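(* The complete $\mathcal{L}_{\log}$-theory $T_{\log}$ is distal.
   Context: Let $\mathcal{L}_{\log}=\{0,+,-,<,\psi,\infty,s,p,\delta_1,\delta_2,\delta_3,\ldots\}$. An asymptotic couple is a pair $(\Gamma,\psi)$ with $\Gamma$ an ordered abelian group and $\psi:\Gamma\setminus\{0\}\to\Gamma$ such that for all nonzero $\alpha,\beta$: (AC1) $\alpha+\beta\neq0\Rightarrow\psi(\alpha+\beta)\ge\min(\psi(\alpha),\psi(\beta))$; (AC2) $\psi(k\alpha)=\psi(\alpha)$ for all nonzero integers $k$; (AC3) $\alpha>0\Rightarrow\alpha+\psi(\alpha)>\psi(\beta)$. It is of $H$-type if moreover $0<\alpha\le\beta\Rightarrow\psi(\alpha)\ge\psi(\beta)$. Put $\psi(0):=\infty$, $\Psi:=\psi(\Gamma\setminus\{0\})$, and $\alpha':=\alpha+\psi(\alpha)$ for $\alpha\ne0$ (this map is strictly increasing for $H$-type couples). The couple has asymptotic integration if every $\gamma\in\Gamma$ equals $\alpha'$ for a (necessarily unique) $\alpha\neq 0$, written $\int\gamma$; the successor function is $s(\gamma):=\psi(\int\gamma)$. The models of $T_{\log}$ are the divisible $H$-asymptotic couples with asymptotic integration such that: $\Psi$ has least element $s(0)$; $s(0)>0$; every element of $\Psi$ has an immediate successor in $\Psi$, namely $s(\alpha)$ for $\alpha\in\Psi$; and $s$ restricts to a bijection $\Psi\to\Psi^{>s(0)}$. The function $p$ is the inverse of this bijection on $\Psi^{>s(0)}$ and $p(\alpha)=\infty$ for all other $\alpha\in\Gamma\cup\{\infty\}$.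 Such a model is construed as an $\mathcal{L}_{\log}$-structure with underlying set $\Gamma_\infty=\Gamma\cup\{\infty\}$, $\Gamma<\infty$, $\delta_n$ interpreted as division by $n$, and $\infty$ as default value (any function applied to an argument involving $\infty$, as well as $\psi(0)$, gives $\infty$). $T_{\log}$ is complete; it is the theory of $(\Gamma_{\log},\psi)$ where $\Gamma_{\log}=\bigoplus_n\mathbb{R}e_n$ ordered lexicographically and $\psi$ sends $(0,\ldots,0,r_n,r_{n+1},\ldots)$ with $r_n\neq0$ to $(1,\ldots,1,0,0,\ldots)$ with $n+1$ ones. A complete theory $T$ with monster model $\mathbb{M}$ is distal if for all infinite linear orders $I_1,I_2$, every set $A\subseteq\mathbb{M}$, every tuple of variables $x$ and every indiscernible sequence $(a_i)_{i\in I}$ from $\mathbb{M}_x$ with $I=I_1+(c)+I_2$ such that $(a_i)_{i\in I_1+I_2}$ is $A$-indiscernible, the whole sequence $(a_i)_{i\in I}$ is $A$-indiscernible. *)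

theory Defs
  imports Main
begin

unbundle cardinal_syntax

section \<open>First-order logic\<close>

text \<open>All elements of \<open>'f\<close> and \<open>'r\<close> are symbols of the language; their arities are recorded
  separately, and terms and formulas are restricted to the well-formed ones by
  \<open>wf_tm\<close> and \<open>wf_fm\<close>.\<close>

record ('f, 'r) language =
  fun_arity :: "'f \<Rightarrow> nat"
  rel_arity :: "'r \<Rightarrow> nat"

datatype 'f tm = Var nat | Fn 'f "'f tm list"

datatype ('f, 'r) fm =
    Falsum
  | Eq "'f tm" "'f tm"
  | Rel 'r "'f tm list"
  | Imp "('f, 'r) fm" "('f, 'r) fm"
  | Forall nat "('f, 'r) fm"

definition Neg :: "('f, 'r) fm \<Rightarrow> ('f, 'r) fm" where
  "Neg \<phi> = Imp \<phi> Falsum"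

definition Or :: "('f, 'r) fm \<Rightarrow> ('f, 'r) fm \<Rightarrow> ('f, 'r) fm" where
  "Or \<phi> \<chi> = Imp (Neg \<phi>) \<chi>"

definition And :: "('f, 'r) fm \<Rightarrow> ('f, 'r) fm \<Rightarrow> ('f, 'r) fm" where
  "And \<phi> \<chi> = Neg (Imp \<phi> (Neg \<chi>))"

fun wf_tm :: "('f, 'r) language \<Rightarrow> 'f tm \<Rightarrow> bool" where
  "wf_tm L (Var v) \<longleftrightarrow> True"
| "wf_tm L (Fn f ts) \<longleftrightarrow> length ts = fun_arity L f \<and> (\<forall>t\<in>set ts. wf_tm L t)"

fun wf_fm :: "('f, 'r) language \<Rightarrow> ('f, 'r) fm \<Rightarrow> bool" where
  "wf_fm L Falsum \<longleftrightarrow> True"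
| "wf_fm L (Eq t u) \<longleftrightarrow> wf_tm L t \<and> wf_tm L u"
| "wf_fm L (Rel r ts) \<longleftrightarrow> length ts = rel_arity L r \<and> (\<forall>t\<in>set ts. wf_tm L t)"
| "wf_fm L (Imp \<phi> \<chi>) \<longleftrightarrow> wf_fm L \<phi> \<and> wf_fm L \<chi>"
| "wf_fm L (Forall v \<phi>) \<longleftrightarrow> wf_fm L \<phi>"

fun vars_tm :: "'f tm \<Rightarrow> nat set" where
  "vars_tm (Var v) = {v}"
| "vars_tm (Fn f ts) = (\<Union>t\<in>set ts. vars_tm t)"

fun free_vars :: "('f, 'r) fm \<Rightarrow> nat set" where
  "free_vars Falsum = {}"
| "free_vars (Eq t u) = vars_tm t \<union> vars_tm u"
| "free_vars (Rel r ts) = (\<Union>t\<in>set ts. vars_tm t)"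
| "free_vars (Imp \<phi> \<chi>) = free_vars \<phi> \<union> free_vars \<chi>"
| "free_vars (Forall v \<phi>) = free_vars \<phi> - {v}"

definition sentence :: "('f, 'r) language \<Rightarrow> ('f, 'r) fm \<Rightarrow> bool" where
  "sentence L \<phi> \<longleftrightarrow> wf_fm L \<phi> \<and> free_vars \<phi> = {}"

record ('f, 'r, 'm) fo_struct =
  carrier :: "'m set"
  fn :: "'f \<Rightarrow> 'm list \<Rightarrow> 'm"
  rel :: "'r \<Rightarrow> 'm list \<Rightarrow> bool"

definition is_structure :: "('f, 'r) language \<Rightarrow> ('f, 'r, 'm) fo_struct \<Rightarrow> bool" where
  "is_structure L M \<longleftrightarrow> carrier M \<noteq> {} \<and>
     (\<forall>f xs. length xs = fun_arity L f \<and> set xs \<subseteq> carrier M \<longrightarrow> fn M f xs \<in> carrier M)"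

fun eval :: "('f, 'r, 'm) fo_struct \<Rightarrow> (nat \<Rightarrow> 'm) \<Rightarrow> 'f tm \<Rightarrow> 'm" where
  "eval M e (Var v) = e v"
| "eval M e (Fn f ts) = fn M f (map (eval M e) ts)"

fun sat :: "('f, 'r, 'm) fo_struct \<Rightarrow> (nat \<Rightarrow> 'm) \<Rightarrow> ('f, 'r) fm \<Rightarrow> bool" where
  "sat M e Falsum \<longleftrightarrow> False"
| "sat M e (Eq t u) \<longleftrightarrow> eval M e t = eval M e u"
| "sat M e (Rel r ts) \<longleftrightarrow> rel M r (map (eval M e) ts)"
| "sat M e (Imp \<phi> \<chi>) \<longleftrightarrow> (sat M e \<phi> \<longrightarrow> sat M e \<chi>)"
| "sat M e (Forall v \<phi>) \<longleftrightarrow> (\<forall>a\<in>carrier M. sat M (e(v := a)) \<phi>)"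

text \<open>\<open>holds M \<phi> xs\<close> means \<open>M \<Turnstile> \<phi>(xs)\<close>, where the variable \<open>v\<close> is assigned the \<open>v\<close>-th entry
  of \<open>xs\<close>. It is only used when the free variables of \<open>\<phi>\<close> are below \<open>length xs\<close>.\<close>

definition holds :: "('f, 'r, 'm) fo_struct \<Rightarrow> ('f, 'r) fm \<Rightarrow> 'm list \<Rightarrow> bool" where
  "holds M \<phi> xs \<longleftrightarrow> sat M (\<lambda>v. xs ! v) \<phi>"

definition formula_in :: "('f, 'r) language \<Rightarrow> nat \<Rightarrow> ('f, 'r) fm \<Rightarrow> bool" where
  "formula_in L n \<phi> \<longleftrightarrow> wf_fm L \<phi> \<and> free_vars \<phi> \<subseteq> {..<n}"

definition model_of ::
    "('f, 'r) language \<Rightarrow> ('f, 'r, 'm) fo_struct \<Rightarrow> ('f, 'r) fm set \<Rightarrow> bool" where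
  "model_of L M T \<longleftrightarrow> is_structure L M \<and> (\<forall>\<phi>\<in>T. holds M \<phi> [])"

text \<open>The type of formulas has cardinality \<open>max \<aleph>\<^sub>0 |L|\<close>, so by Loewenheim-Skolem every
  satisfiable theory has a model whose carrier is a set of elements of this type. Hence
  consistency and consequence may be tested on such models.\<close>

definition consistent :: "('f, 'r) language \<Rightarrow> ('f, 'r) fm set \<Rightarrow> bool" where
  "consistent L T \<longleftrightarrow> (\<exists>M :: ('f, 'r, ('f, 'r) fm) fo_struct. model_of L M T)"

definition entails :: "('f, 'r) language \<Rightarrow> ('f, 'r) fm set \<Rightarrow> ('f, 'r) fm \<Rightarrow> bool" where
  "entails L T \<phi> \<longleftrightarrow>
     (\<forall>M :: ('f, 'r, ('f, 'r) fm) fo_struct. model_of L M T \<longrightarrow> holds M \<phi> [])"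

definition complete_theory :: "('f, 'r) language \<Rightarrow> ('f, 'r) fm set \<Rightarrow> bool" where
  "complete_theory L T \<longleftrightarrow> (\<forall>\<phi>\<in>T. sentence L \<phi>) \<and> consistent L T \<and>
     (\<forall>\<phi>. sentence L \<phi> \<longrightarrow> entails L T \<phi> \<or> entails L T (Neg \<phi>))"


section \<open>Monster models\<close>

text \<open>A pair \<open>(\<phi>, bs)\<close> stands for the formula \<open>\<phi>(x, bs)\<close> in the single variable \<open>x\<close>, numbered 0.\<close>

definition saturated ::
    "('f, 'r) language \<Rightarrow> 'k rel \<Rightarrow> ('f, 'r, 'm) fo_struct \<Rightarrow> bool" where
  "saturated L \<kappa> M \<longleftrightarrow>
     (\<forall>A \<subseteq> carrier M. ( |A| <o \<kappa>) \<longrightarrow>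
       (\<forall>\<Phi>. \<Phi> \<subseteq> {(\<phi>, bs). set bs \<subseteq> A \<and> formula_in L (Suc (length bs)) \<phi>} \<longrightarrow>
          (\<forall>F \<subseteq> \<Phi>. finite F \<longrightarrow> (\<exists>x\<in>carrier M. \<forall>(\<phi>, bs)\<in>F. holds M \<phi> (x # bs))) \<longrightarrow>
          (\<exists>x\<in>carrier M. \<forall>(\<phi>, bs)\<in>\<Phi>. holds M \<phi> (x # bs))))"

definition partial_elementary ::
    "('f, 'r) language \<Rightarrow> ('f, 'r, 'm) fo_struct \<Rightarrow> 'm set \<Rightarrow> ('m \<Rightarrow> 'm) \<Rightarrow> bool" where
  "partial_elementary L M A g \<longleftrightarrow> A \<subseteq> carrier M \<and> g ` A \<subseteq> carrier M \<and>
     (\<forall>\<phi> bs. set bs \<subseteq> A \<and> formula_in L (length bs) \<phi> \<longrightarrow>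
        (holds M \<phi> bs \<longleftrightarrow> holds M \<phi> (map g bs)))"

definition automorphism ::
    "('f, 'r) language \<Rightarrow> ('f, 'r, 'm) fo_struct \<Rightarrow> ('m \<Rightarrow> 'm) \<Rightarrow> bool" where
  "automorphism L M \<sigma> \<longleftrightarrow> bij_betw \<sigma> (carrier M) (carrier M) \<and>
     (\<forall>f xs. set xs \<subseteq> carrier M \<and> length xs = fun_arity L f \<longrightarrow>
        \<sigma> (fn M f xs) = fn M f (map \<sigma> xs)) \<and>
     (\<forall>r xs. set xs \<subseteq> carrier M \<and> length xs = rel_arity L r \<longrightarrow>
        (rel M r xs \<longleftrightarrow> rel M r (map \<sigma> xs)))"

definition strongly_homogeneous ::
    "('f, 'r) language \<Rightarrow> 'k rel \<Rightarrow> ('f, 'r, 'm) fo_struct \<Rightarrow> bool" where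
  "strongly_homogeneous L \<kappa> M \<longleftrightarrow>
     (\<forall>A g. ( |A| <o \<kappa>) \<and> partial_elementary L M A g \<longrightarrow>
        (\<exists>\<sigma>. automorphism L M \<sigma> \<and> (\<forall>a\<in>A. \<sigma> a = g a)))"

text \<open>A monster model is \<open>\<kappa>\<close>-saturated and strongly \<open>\<kappa>\<close>-homogeneous for some \<open>\<kappa> > |L| + \<aleph>\<^sub>0\<close>.
  An infinite \<open>\<kappa>\<close>-saturated structure has at least \<open>\<kappa>\<close> elements, so that \<open>\<kappa>\<close> can be taken on
  the type of the elements of \<open>M\<close>.\<close>

definition monster_model ::
    "('f, 'r) language \<Rightarrow> ('f, 'r) fm set \<Rightarrow> ('f, 'r, 'm) fo_struct \<Rightarrow> bool" where
  "monster_model L T M \<longleftrightarrow> model_of L M T \<and>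
     (\<exists>\<kappa> :: 'm rel. Card_order \<kappa> \<and> ( |UNIV :: ('f, 'r) fm set| <o \<kappa>) \<and>
        saturated L \<kappa> M \<and> strongly_homogeneous L \<kappa> M)"


section \<open>Indiscernible sequences and distality\<close>

definition indiscernible_over ::
    "('f, 'r) language \<Rightarrow> ('f, 'r, 'm) fo_struct \<Rightarrow> 'm set \<Rightarrow> nat \<Rightarrow>
     ('i::linorder) set \<Rightarrow> ('i \<Rightarrow> 'm list) \<Rightarrow> bool" where
  "indiscernible_over L M A n I a \<longleftrightarrow>
     (\<forall>\<phi> bs is js. set bs \<subseteq> A \<and> set is \<subseteq> I \<and> set js \<subseteq> I \<and>
        sorted_wrt (<) is \<and> sorted_wrt (<) js \<and> length is = length js \<and>
        formula_in L (length is * n + length bs) \<phi> \<longrightarrow>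
        (holds M \<phi> (concat (map a is) @ bs) \<longleftrightarrow> holds M \<phi> (concat (map a js) @ bs)))"

text \<open>The index set \<open>I\<^sub>1 + (c) + I\<^sub>2\<close> is taken inside a linearly ordered type \<open>'i\<close>; every such sum of
  linear orders arises in this way. Neither the type of the elements of the monster model nor that of
  the indices can be bound inside the definition, so both are parameters; distality is the
  statement for all \<open>'m\<close> and \<open>'i\<close>.\<close>

definition distal ::
    "('f, 'r) language \<Rightarrow> ('f, 'r) fm set \<Rightarrow> 'm itself \<Rightarrow> ('i::linorder) itself \<Rightarrow> bool" where
  "distal L T (_ :: 'm itself) (_ :: 'i itself) \<longleftrightarrow>
     (\<forall>M :: ('f, 'r, 'm) fo_struct. monster_model L T M \<longrightarrow>
       (\<forall>(I\<^sub>1 :: 'i set) I\<^sub>2 c A n a.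
          infinite I\<^sub>1 \<and> infinite I\<^sub>2 \<and> (\<forall>i\<in>I\<^sub>1. i < c) \<and> (\<forall>i\<in>I\<^sub>2. c < i) \<and>
          A \<subseteq> carrier M \<and>
          (\<forall>i \<in> I\<^sub>1 \<union> {c} \<union> I\<^sub>2. length (a i) = n \<and> set (a i) \<subseteq> carrier M) \<and>
          indiscernible_over L M {} n (I\<^sub>1 \<union> {c} \<union> I\<^sub>2) a \<and>
          indiscernible_over L M A n (I\<^sub>1 \<union> I\<^sub>2) a \<longrightarrow>
          indiscernible_over L M A n (I\<^sub>1 \<union> {c} \<union> I\<^sub>2) a))"


section \<open>Asymptotic couples\<close>

locale ordered_abelian_group =
  fixes G :: "'g set"
    and add :: "'g \<Rightarrow> 'g \<Rightarrow> 'g" (infixl "\<oplus>" 65)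
    and zero :: 'g ("\<zero>")
    and neg :: "'g \<Rightarrow> 'g" ("\<ominus> _" [81] 80)
    and less :: "'g \<Rightarrow> 'g \<Rightarrow> bool" (infix "\<prec>" 50)
  assumes zero_closed: "\<zero> \<in> G"
    and add_closed: "\<lbrakk>x \<in> G; y \<in> G\<rbrakk> \<Longrightarrow> x \<oplus> y \<in> G"
    and neg_closed: "x \<in> G \<Longrightarrow> \<ominus> x \<in> G"
    and add_assoc: "\<lbrakk>x \<in> G; y \<in> G; z \<in> G\<rbrakk> \<Longrightarrow> (x \<oplus> y) \<oplus> z = x \<oplus> (y \<oplus> z)"
    and add_commute: "\<lbrakk>x \<in> G; y \<in> G\<rbrakk> \<Longrightarrow> x \<oplus> y = y \<oplus> x"
    and add_zero: "x \<in> G \<Longrightarrow> x \<oplus> \<zero> = x"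
    and add_neg: "x \<in> G \<Longrightarrow> x \<oplus> \<ominus> x = \<zero>"
    and less_irrefl: "x \<in> G \<Longrightarrow> \<not> x \<prec> x"
    and less_trans: "\<lbrakk>x \<in> G; y \<in> G; z \<in> G; x \<prec> y; y \<prec> z\<rbrakk> \<Longrightarrow> x \<prec> z"
    and less_linear: "\<lbrakk>x \<in> G; y \<in> G\<rbrakk> \<Longrightarrow> x \<prec> y \<or> x = y \<or> y \<prec> x"
    and add_less: "\<lbrakk>x \<in> G; y \<in> G; z \<in> G; x \<prec> y\<rbrakk> \<Longrightarrow> x \<oplus> z \<prec> y \<oplus> z"
begin

definition le (infix "\<preceq>" 50) where
  "x \<preceq> y \<longleftrightarrow> x \<prec> y \<or> x = y"

fun nat_mult :: "nat \<Rightarrow> 'g \<Rightarrow> 'g" where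
  "nat_mult 0 x = \<zero>"
| "nat_mult (Suc n) x = nat_mult n x \<oplus> x"

definition int_mult :: "int \<Rightarrow> 'g \<Rightarrow> 'g" where
  "int_mult k x = (if 0 \<le> k then nat_mult (nat k) x else \<ominus> nat_mult (nat (- k)) x)"

definition nonzero :: "'g set" where
  "nonzero = G - {\<zero>}"

definition divisible :: bool where
  "divisible \<longleftrightarrow> (\<forall>x\<in>G. \<forall>n\<ge>1. \<exists>y\<in>G. nat_mult n y = x)"

end

text \<open>In \<open>AC1\<close> the inequality \<open>\<psi> (\<alpha> \<oplus> \<beta>) \<succeq> min (\<psi> \<alpha>) (\<psi> \<beta>)\<close> is written as a disjunction.
  The value of \<open>\<psi>\<close> at \<open>\<zero>\<close> is irrelevant here.\<close>

locale asymptotic_couple = ordered_abelian_group +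
  fixes \<psi> :: "'a \<Rightarrow> 'a"
  assumes psi_closed: "\<alpha> \<in> nonzero \<Longrightarrow> \<psi> \<alpha> \<in> G"
    and AC1: "\<lbrakk>\<alpha> \<in> nonzero; \<beta> \<in> nonzero; \<alpha> \<oplus> \<beta> \<noteq> \<zero>\<rbrakk> \<Longrightarrow>
                \<psi> \<alpha> \<preceq> \<psi> (\<alpha> \<oplus> \<beta>) \<or> \<psi> \<beta> \<preceq> \<psi> (\<alpha> \<oplus> \<beta>)"
    and AC2: "\<lbrakk>\<alpha> \<in> nonzero; k \<noteq> 0\<rbrakk> \<Longrightarrow> \<psi> (int_mult k \<alpha>) = \<psi> \<alpha>"
    and AC3: "\<lbrakk>\<alpha> \<in> nonzero; \<beta> \<in> nonzero; \<zero> \<prec> \<alpha>\<rbrakk> \<Longrightarrow> \<psi> \<beta> \<prec> \<alpha> \<oplus> \<psi> \<alpha>"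
begin

definition H_type :: bool where
  "H_type \<longleftrightarrow> (\<forall>\<alpha>\<in>G. \<forall>\<beta>\<in>G. \<zero> \<prec> \<alpha> \<and> \<alpha> \<preceq> \<beta> \<longrightarrow> \<psi> \<beta> \<preceq> \<psi> \<alpha>)"

definition Psi :: "'a set" where
  "Psi = \<psi> ` nonzero"

definition deriv :: "'a \<Rightarrow> 'a" where
  "deriv \<alpha> = \<alpha> \<oplus> \<psi> \<alpha>"

definition asymptotic_integration :: bool where
  "asymptotic_integration \<longleftrightarrow> (\<forall>\<gamma>\<in>G. \<exists>\<alpha>\<in>nonzero. deriv \<alpha> = \<gamma>)"

definition integral :: "'a \<Rightarrow> 'a" where
  "integral \<gamma> = (THE \<alpha>. \<alpha> \<in> nonzero \<and> deriv \<alpha> = \<gamma>)"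

definition succ :: "'a \<Rightarrow> 'a" where
  "succ \<gamma> = \<psi> (integral \<gamma>)"

definition Psi_above :: "'a set" where
  "Psi_above = {\<beta> \<in> Psi. succ \<zero> \<prec> \<beta>}"

definition pred :: "'a \<Rightarrow> 'a" where
  "pred = the_inv_into Psi succ"

end

locale log_couple = asymptotic_couple +
  assumes divisible: divisible
    and H_type: H_type
    and asymptotic_integration: asymptotic_integration
    and least_Psi: "succ \<zero> \<in> Psi" "\<beta> \<in> Psi \<Longrightarrow> succ \<zero> \<preceq> \<beta>"
    and succ_zero_pos: "\<zero> \<prec> succ \<zero>"
    and immediate_succ: "\<alpha> \<in> Psi \<Longrightarrow> succ \<alpha> \<in> Psi" "\<alpha> \<in> Psi \<Longrightarrow> \<alpha> \<prec> succ \<alpha>"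
      "\<lbrakk>\<alpha> \<in> Psi; \<beta> \<in> Psi\<rbrakk> \<Longrightarrow> \<not> (\<alpha> \<prec> \<beta> \<and> \<beta> \<prec> succ \<alpha>)"
    and bij_succ: "bij_betw succ Psi Psi_above"


section \<open>The language and theory\<close>

text \<open>\<open>FDelta n\<close> is the symbol \<open>\<delta>\<close> with index \<open>n + 1\<close>, for division by \<open>n + 1\<close>.\<close>

datatype log_fun = FZero | FPlus | FNeg | FPsi | FInf | FSucc | FPred | FDelta nat

datatype log_rel = RLess

fun log_fun_arity :: "log_fun \<Rightarrow> nat" where
  "log_fun_arity FZero = 0"
| "log_fun_arity FInf = 0"
| "log_fun_arity FPlus = 2"
| "log_fun_arity _ = 1"

definition L_log :: "(log_fun, log_rel) language" where
  "L_log = \<lparr>fun_arity = log_fun_arity, rel_arity = (\<lambda>_. 2)\<rparr>"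

type_synonym log_tm = "log_fun tm"
type_synonym log_fm = "(log_fun, log_rel) fm"

abbreviation tZero :: log_tm where "tZero \<equiv> Fn FZero []"
abbreviation tInf :: log_tm where "tInf \<equiv> Fn FInf []"
abbreviation tPlus :: "log_tm \<Rightarrow> log_tm \<Rightarrow> log_tm" (infixl "[+]" 65) where "t [+] u \<equiv> Fn FPlus [t, u]"
abbreviation tNeg :: "log_tm \<Rightarrow> log_tm" where "tNeg t \<equiv> Fn FNeg [t]"
abbreviation tPsi :: "log_tm \<Rightarrow> log_tm" where "tPsi t \<equiv> Fn FPsi [t]"
abbreviation tSucc :: "log_tm \<Rightarrow> log_tm" where "tSucc t \<equiv> Fn FSucc [t]"
abbreviation tPred :: "log_tm \<Rightarrow> log_tm" where "tPred t \<equiv> Fn FPred [t]"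
abbreviation tDelta :: "nat \<Rightarrow> log_tm \<Rightarrow> log_tm" where "tDelta n t \<equiv> Fn (FDelta n) [t]"

abbreviation fEq :: "log_tm \<Rightarrow> log_tm \<Rightarrow> log_fm" (infix "[=]" 50) where "t [=] u \<equiv> Eq t u"
abbreviation fLess :: "log_tm \<Rightarrow> log_tm \<Rightarrow> log_fm" (infix "[<]" 50) where "t [<] u \<equiv> Rel RLess [t, u]"
abbreviation fLe :: "log_tm \<Rightarrow> log_tm \<Rightarrow> log_fm" (infix "[\<le>]" 50) where
  "t [\<le>] u \<equiv> Or (t [<] u) (t [=] u)"
abbreviation fImp :: "log_fm \<Rightarrow> log_fm \<Rightarrow> log_fm" (infixr "[\<longrightarrow>]" 25) where "\<phi> [\<longrightarrow>] \<chi> \<equiv> Imp \<phi> \<chi>"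

fun tMult :: "nat \<Rightarrow> log_tm \<Rightarrow> log_tm" where
  "tMult 0 t = tZero"
| "tMult (Suc n) t = tMult n t [+] t"

definition tIntMult :: "int \<Rightarrow> log_tm \<Rightarrow> log_tm" where
  "tIntMult k t = (if 0 \<le> k then tMult (nat k) t else tNeg (tMult (nat (- k)) t))"

text \<open>Quantifiers relativized to the group \<open>\<Gamma>\<close> and to its nonzero elements.\<close>

definition AllG :: "nat \<Rightarrow> log_fm \<Rightarrow> log_fm" where
  "AllG v \<phi> = Forall v (Neg (Var v [=] tInf) [\<longrightarrow>] \<phi>)"

definition AllN :: "nat \<Rightarrow> log_fm \<Rightarrow> log_fm" where
  "AllN v \<phi> = AllG v (Neg (Var v [=] tZero) [\<longrightarrow>] \<phi>)"

definition ExN :: "nat \<Rightarrow> log_fm \<Rightarrow> log_fm" where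
  "ExN v \<phi> = Neg (AllN v (Neg \<phi>))"

abbreviation X :: log_tm where "X \<equiv> Var 0"
abbreviation Y :: log_tm where "Y \<equiv> Var 1"
abbreviation Z :: log_tm where "Z \<equiv> Var 2"

definition group_axioms :: "log_fm set" where
  "group_axioms = {
     Neg (tZero [=] tInf),
     AllG 0 (AllG 1 (Neg (X [+] Y [=] tInf))),
     AllG 0 (Neg (tNeg X [=] tInf)),
     AllG 0 (AllG 1 (AllG 2 ((X [+] Y) [+] Z [=] X [+] (Y [+] Z)))),
     AllG 0 (AllG 1 (X [+] Y [=] Y [+] X)),
     AllG 0 (X [+] tZero [=] X),
     AllG 0 (X [+] tNeg X [=] tZero),
     AllG 0 (Neg (X [<] X)),
     AllG 0 (AllG 1 (AllG 2 (X [<] Y [\<longrightarrow>] Y [<] Z [\<longrightarrow>] X [<] Z))),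
     AllG 0 (AllG 1 (Or (X [<] Y) (Or (X [=] Y) (Y [<] X)))),
     AllG 0 (AllG 1 (AllG 2 (X [<] Y [\<longrightarrow>] X [+] Z [<] Y [+] Z)))}"

definition infinity_axioms :: "log_fm set" where
  "infinity_axioms = {
     AllG 0 (X [<] tInf),
     Forall 0 (Neg (tInf [<] X)),
     Forall 0 (X [+] tInf [=] tInf),
     Forall 0 (tInf [+] X [=] tInf),
     tNeg tInf [=] tInf,
     tPsi tInf [=] tInf,
     tPsi tZero [=] tInf,
     tSucc tInf [=] tInf,
     tPred tInf [=] tInf} \<union>
     {tDelta n tInf [=] tInf | n. True}"

definition division_axioms :: "log_fm set" where
  "division_axioms =
     {AllG 0 (Neg (tDelta n X [=] tInf)) | n. True} \<union>
     {AllG 0 (tMult (Suc n) (tDelta n X) [=] X) | n. True}"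

definition couple_axioms :: "log_fm set" where
  "couple_axioms = {
     AllN 0 (Neg (tPsi X [=] tInf)),
     AllN 0 (AllN 1 (Neg (X [+] Y [=] tZero) [\<longrightarrow>]
       Or (tPsi X [\<le>] tPsi (X [+] Y)) (tPsi Y [\<le>] tPsi (X [+] Y)))),
     AllN 0 (AllN 1 (tZero [<] X [\<longrightarrow>] tPsi Y [<] X [+] tPsi X)),
     AllG 0 (AllG 1 (tZero [<] X [\<longrightarrow>] X [\<le>] Y [\<longrightarrow>] tPsi Y [\<le>] tPsi X)),
     AllG 0 (ExN 1 (Y [+] tPsi Y [=] X))} \<union>
     {AllN 0 (tPsi (tIntMult k X) [=] tPsi X) | k. k \<noteq> 0}"

text \<open>The first axiom defines \<open>s\<close>. Elements of \<open>\<Psi>\<close> are written as \<open>\<psi>(X)\<close> with nonzero \<open>X\<close>; that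
  \<open>s\<close> takes its values in \<open>\<Psi>\<close> follows from the first axiom and asymptotic integration.\<close>

definition succ_pred_axioms :: "log_fm set" where
  "succ_pred_axioms = {
     AllN 0 (tSucc (X [+] tPsi X) [=] tPsi X),
     AllN 0 (tSucc tZero [\<le>] tPsi X),
     tZero [<] tSucc tZero,
     AllN 0 (tPsi X [<] tSucc (tPsi X)),
     AllN 0 (AllN 1 (Neg (And (tPsi X [<] tPsi Y) (tPsi Y [<] tSucc (tPsi X))))),
     AllN 0 (AllN 1 (tSucc (tPsi X) [=] tSucc (tPsi Y) [\<longrightarrow>] tPsi X [=] tPsi Y)),
     AllN 0 (tSucc tZero [<] tPsi X [\<longrightarrow>] ExN 1 (tSucc (tPsi Y) [=] tPsi X)),
     AllN 0 (tPred (tSucc (tPsi X)) [=] tPsi X),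
     Forall 0 (Neg (ExN 1 (And (tPsi Y [=] X) (tSucc tZero [<] X))) [\<longrightarrow>] tPred X [=] tInf)}"

definition T_log :: "log_fm set" where
  "T_log = group_axioms \<union> infinity_axioms \<union> division_axioms \<union> couple_axioms \<union> succ_pred_axioms"


section \<open>The models of the theory\<close>

text \<open>\<open>log_structure M\<close> says that \<open>M\<close> is the \<open>L_log\<close>-structure construed from a \<open>log_couple\<close>.\<close>

definition log_structure :: "(log_fun, log_rel, 'm) fo_struct \<Rightarrow> bool" where
  "log_structure M \<longleftrightarrow>
     (let infty = fn M FInf [];
          \<Gamma> = carrier M - {infty};
          add = (\<lambda>x y. fn M FPlus [x, y]);
          zero = fn M FZero [];
          neg = (\<lambda>x. fn M FNeg [x]);
          less = (\<lambda>x y. rel M RLess [x, y]);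
          \<psi> = (\<lambda>x. fn M FPsi [x]);
          nmult = ordered_abelian_group.nat_mult add zero;
          s = asymptotic_couple.succ \<Gamma> add zero \<psi>;
          p = asymptotic_couple.pred \<Gamma> add zero \<psi>;
          above = asymptotic_couple.Psi_above \<Gamma> add zero less \<psi>
      in infty \<in> carrier M \<and>
         log_couple \<Gamma> add zero neg less \<psi> \<and>
         (\<forall>x\<in>\<Gamma>. less x infty) \<and> (\<forall>x\<in>carrier M. \<not> less infty x) \<and>
         (\<forall>x\<in>carrier M. add x infty = infty \<and> add infty x = infty) \<and> neg infty = infty \<and>
         \<psi> zero = infty \<and> \<psi> infty = infty \<and>
         (\<forall>n. (\<forall>x\<in>\<Gamma>. fn M (FDelta n) [x] \<in> \<Gamma> \<and> nmult (Suc n) (fn M (FDelta n) [x]) = x) \<and>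
              fn M (FDelta n) [infty] = infty) \<and>
         (\<forall>x\<in>\<Gamma>. fn M FSucc [x] = s x) \<and> fn M FSucc [infty] = infty \<and>
         (\<forall>x\<in>carrier M. fn M FPred [x] = (if x \<in> above then p x else infty)))"

lemma (in asymptotic_couple) deriv_inj:
  assumes a: "\<alpha> \<in> nonzero" and b: "\<beta> \<in> nonzero" and eq: "deriv \<alpha> = deriv \<beta>"
  shows "\<alpha> = \<beta>"
proof -
  have zero_add: "\<zero> \<oplus> x = x" if "x \<in> G" for x
    by (rule trans[OF add_commute[OF zero_closed that] add_zero[OF that]])
  have neg_add: "\<ominus> x \<oplus> x = \<zero>" if "x \<in> G" for x
    by (rule trans[OF add_commute[OF neg_closed[OF that] that] add_neg[OF that]])
  have neg_cancel: "\<ominus> x \<oplus> (x \<oplus> y) = y" if "x \<in> G" "y \<in> G" for x y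
    unfolding add_assoc[OF neg_closed[OF that(1)] that, symmetric] neg_add[OF that(1)]
    by (rule zero_add[OF that(2)])
  have cancel: "y = z" if "x \<in> G" "y \<in> G" "z \<in> G" "x \<oplus> y = x \<oplus> z" for x y z
    using neg_cancel[OF that(1,2)] unfolding that(4) neg_cancel[OF that(1,3)] by (rule sym)
  have psi_neg: "\<psi> (\<ominus> \<gamma>) = \<psi> \<gamma>" if "\<gamma> \<in> nonzero" for \<gamma>
  proof -
    have "int_mult (-1) \<gamma> = \<ominus> (\<zero> \<oplus> \<gamma>)" by (simp add: int_mult_def)
    also have "\<dots> = \<ominus> \<gamma>" using that zero_add by (simp add: nonzero_def)
    finally show ?thesis using AC2[OF that, of "-1"] by simp
  qed
  have main: False if a: "\<alpha> \<in> nonzero" and b: "\<beta> \<in> nonzero" and eq: "deriv \<alpha> = deriv \<beta>"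
    and lt: "\<psi> \<alpha> \<prec> \<psi> \<beta>" for \<alpha> \<beta>
  proof -
    have G: "\<alpha> \<in> G" "\<beta> \<in> G" "\<psi> \<alpha> \<in> G" "\<psi> \<beta> \<in> G" "\<ominus> \<beta> \<in> G" "\<ominus> \<psi> \<alpha> \<in> G"
      using a b psi_closed neg_closed by (auto simp: nonzero_def)
    define \<gamma> where "\<gamma> = \<alpha> \<oplus> \<ominus> \<beta>"
    have gG: "\<gamma> \<in> G" using G add_closed by (simp add: \<gamma>_def)
    have ga: "\<gamma> \<oplus> \<beta> = \<alpha>" unfolding \<gamma>_def
      using add_assoc[OF G(1,5,2)] neg_add G add_zero by simp
    have gp: "\<gamma> \<oplus> \<psi> \<alpha> = \<psi> \<beta>"
    proof (rule cancel[of \<beta>])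
      have "\<beta> \<oplus> (\<gamma> \<oplus> \<psi> \<alpha>) = \<alpha> \<oplus> \<psi> \<alpha>"
        unfolding add_assoc[OF G(2) gG G(3), symmetric] by (subst add_commute[OF G(2) gG]) (simp add: ga)
      then show "\<beta> \<oplus> (\<gamma> \<oplus> \<psi> \<alpha>) = \<beta> \<oplus> \<psi> \<beta>" using eq by (simp add: deriv_def)
    qed (use G gG add_closed in auto)
    have g0: "\<gamma> \<noteq> \<zero>"
      using gp lt G less_irrefl zero_add by auto
    have gN: "\<gamma> \<in> nonzero" using gG g0 by (simp add: nonzero_def)
    have bN: "\<ominus> \<beta> \<in> nonzero"
    proof -
      have "\<ominus> \<beta> \<noteq> \<zero>" using add_neg[OF G(2)] add_zero[OF G(2)] b by (auto simp: nonzero_def)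
      then show ?thesis using G by (simp add: nonzero_def)
    qed
    have gpos: "\<zero> \<prec> \<gamma>"
    proof (rule ccontr)
      assume "\<not> \<zero> \<prec> \<gamma>"
      then have "\<gamma> \<prec> \<zero>" using less_linear[OF zero_closed gG] g0 by auto
      from add_less[OF gG zero_closed G(3) this] have "\<psi> \<beta> \<prec> \<psi> \<alpha>"
        using gp G zero_add by simp
      then show False using lt less_trans[OF G(3,4,3)] less_irrefl[OF G(3)] by blast
    qed
    have "\<psi> \<gamma> \<preceq> \<psi> \<alpha>"
    proof -
      have "\<psi> \<gamma> \<preceq> \<psi> \<alpha> \<or> \<psi> \<beta> \<preceq> \<psi> \<alpha>"
        using AC1[OF gN b] ga a by (auto simp: nonzero_def)
      then show ?thesis using lt less_trans[OF G(3,4,3)] less_irrefl[OF G(3)] by (auto simp: le_def)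
    qed
    moreover have "\<psi> \<alpha> \<preceq> \<psi> \<gamma>"
    proof -
      have "\<psi> \<alpha> \<preceq> \<psi> \<gamma> \<or> \<psi> \<beta> \<preceq> \<psi> \<gamma>"
        using AC1[OF a bN] g0 psi_neg[OF b] by (simp add: \<gamma>_def)
      then show ?thesis using lt less_trans[OF G(3,4) psi_closed[OF gN]] by (auto simp: le_def)
    qed
    ultimately have "\<psi> \<gamma> = \<psi> \<alpha>"
      using less_trans[OF G(3) psi_closed[OF gN] G(3)] less_irrefl[OF G(3)] by (auto simp: le_def)
    then have "\<psi> \<beta> \<prec> \<gamma> \<oplus> \<psi> \<alpha>" using AC3[OF gN b gpos] by simp
    then show False using gp G less_irrefl by simp
  qed
  have G: "\<alpha> \<in> G" "\<beta> \<in> G" "\<psi> \<alpha> \<in> G" "\<psi> \<beta> \<in> G"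
    using a b psi_closed by (auto simp: nonzero_def)
  have "\<psi> \<alpha> = \<psi> \<beta>"
    using main[OF a b eq] main[OF b a eq[symmetric]] less_linear[OF G(3,4)] by auto
  then have "\<alpha> \<oplus> \<psi> \<alpha> = \<beta> \<oplus> \<psi> \<alpha>" using eq by (simp add: deriv_def)
  then have "\<psi> \<alpha> \<oplus> \<alpha> = \<psi> \<alpha> \<oplus> \<beta>"
    unfolding add_commute[OF G(1,3)] add_commute[OF G(2,3)] .
  then show ?thesis using cancel[OF G(3,1,2)] by blast
qed

lemma (in asymptotic_couple) succ_deriv: "\<alpha> \<in> nonzero \<Longrightarrow> succ (deriv \<alpha>) = \<psi> \<alpha>"
proof -
  assume "\<alpha> \<in> nonzero"
  then have "integral (deriv \<alpha>) = \<alpha>" unfolding integral_def by (intro the_equality) (auto intro: deriv_inj)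
  then show ?thesis by (simp add: succ_def)
qed

lemma sentence_T_log: "\<phi> \<in> T_log \<Longrightarrow> sentence L_log \<phi>"
proof -
  have L: "fun_arity L_log = log_fun_arity" "rel_arity L_log = (\<lambda>_. 2)" by (simp_all add: L_log_def)
  have vm: "v \<in> vars_tm (tMult n t) \<Longrightarrow> v \<in> vars_tm t" for n t v
    by (induction n) auto
  have wm: "wf_tm L_log t \<Longrightarrow> wf_tm L_log (tMult n t)" for n t
    by (induction n) (auto simp: L)
  have vi: "v \<in> vars_tm (tIntMult k t) \<Longrightarrow> v \<in> vars_tm t" for k t v
    using vm by (auto simp: tIntMult_def split: if_splits)
  have wi: "wf_tm L_log t \<Longrightarrow> wf_tm L_log (tIntMult k t)" for k t
    using wm by (auto simp: tIntMult_def L)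
  show "\<phi> \<in> T_log \<Longrightarrow> sentence L_log \<phi>"
    unfolding T_log_def group_axioms_def infinity_axioms_def division_axioms_def
      couple_axioms_def succ_pred_axioms_def
    by (auto simp: sentence_def Neg_def Or_def And_def AllG_def AllN_def ExN_def L wm wi
        simp del: tMult.simps dest!: vm vi)
qed

lemma sat_connectives [simp]:
  "sat M e (Neg \<phi>) \<longleftrightarrow> \<not> sat M e \<phi>"
  "sat M e (Or \<phi> \<chi>) \<longleftrightarrow> sat M e \<phi> \<or> sat M e \<chi>"
  "sat M e (And \<phi> \<chi>) \<longleftrightarrow> sat M e \<phi> \<and> sat M e \<chi>"
  by (auto simp: Neg_def Or_def And_def)

lemma sat_relativized [simp]:
  "sat M e (AllG v \<phi>) \<longleftrightarrow> (\<forall>a\<in>carrier M - {fn M FInf []}. sat M (e(v := a)) \<phi>)"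
  "sat M e (AllN v \<phi>) \<longleftrightarrow>
     (\<forall>a\<in>carrier M - {fn M FInf []} - {fn M FZero []}. sat M (e(v := a)) \<phi>)"
  "sat M e (ExN v \<phi>) \<longleftrightarrow>
     (\<exists>a\<in>carrier M - {fn M FInf []} - {fn M FZero []}. sat M (e(v := a)) \<phi>)"
  by (auto simp: AllG_def AllN_def ExN_def)

text \<open>The models of \<open>T_log\<close> are exactly the structures construed from a \<open>log_couple\<close>.\<close>

theorem model_of_T_log_iff:
  assumes M: "is_structure L_log M"
  shows "model_of L_log M T_log \<longleftrightarrow> log_structure M"
proof -
  define infty where "infty = fn M FInf []"
  define \<Gamma> where "\<Gamma> = carrier M - {infty}"
  define add where "add = (\<lambda>x y. fn M FPlus [x, y])"
  define zero where "zero = fn M FZero []"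
  define neg where "neg = (\<lambda>x. fn M FNeg [x])"
  define less where "less = (\<lambda>x y. rel M RLess [x, y])"
  define \<psi> where "\<psi> = (\<lambda>x. fn M FPsi [x])"
  define S where "S = (\<lambda>x. fn M FSucc [x])"
  define P where "P = (\<lambda>x. fn M FPred [x])"
  define D where "D = (\<lambda>n x. fn M (FDelta n) [x])"
  define N where "N = \<Gamma> - {zero}"
  define lq where "lq = (\<lambda>x y. less x y \<or> x = y)"
  define ml where "ml = rec_nat (\<lambda>x. zero) (\<lambda>_ r x. add (r x) x)"
  define im where "im = (\<lambda>k x. if 0 \<le> k then ml (nat k) x else neg (ml (nat (- k)) x))"
  note F = infty_def add_def zero_def neg_def less_def \<psi>_def S_def P_def D_def lq_def
  have cl: "length xs = log_fun_arity f \<Longrightarrow> set xs \<subseteq> carrier M \<Longrightarrow> fn M f xs \<in> carrier M" for f xs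
    using M by (simp add: is_structure_def L_log_def)
  have C: "infty \<in> carrier M" "zero \<in> carrier M"
    "\<And>x y. x \<in> carrier M \<Longrightarrow> y \<in> carrier M \<Longrightarrow> add x y \<in> carrier M"
    "\<And>x. x \<in> carrier M \<Longrightarrow> neg x \<in> carrier M"
    "\<And>x. x \<in> carrier M \<Longrightarrow> \<psi> x \<in> carrier M"
    "\<And>x. x \<in> carrier M \<Longrightarrow> S x \<in> carrier M"
    "\<And>x. x \<in> carrier M \<Longrightarrow> P x \<in> carrier M"
    "\<And>n x. x \<in> carrier M \<Longrightarrow> D n x \<in> carrier M"
    by (auto simp: F intro!: cl)
  have carr: "x \<in> carrier M \<longleftrightarrow> x \<in> \<Gamma> \<or> x = infty" for x
    using C(1) by (auto simp: \<Gamma>_def)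
  have ev_mult: "eval M e (tMult n t) = ml n (eval M e t)" for e n t
    by (induction n) (simp_all add: ml_def add_def zero_def)
  have ev_int: "eval M e (tIntMult k t) = im k (eval M e t)" for e k t
    by (simp add: tIntMult_def im_def ev_mult neg_def)
  define ax1 where "ax1 \<longleftrightarrow> zero \<noteq> infty \<and>
    (\<forall>x\<in>\<Gamma>. \<forall>y\<in>\<Gamma>. add x y \<noteq> infty) \<and> (\<forall>x\<in>\<Gamma>. neg x \<noteq> infty) \<and>
    (\<forall>x\<in>\<Gamma>. \<forall>y\<in>\<Gamma>. \<forall>z\<in>\<Gamma>. add (add x y) z = add x (add y z)) \<and>
    (\<forall>x\<in>\<Gamma>. \<forall>y\<in>\<Gamma>. add x y = add y x) \<and>
    (\<forall>x\<in>\<Gamma>. add x zero = x) \<and> (\<forall>x\<in>\<Gamma>. add x (neg x) = zero) \<and>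
    (\<forall>x\<in>\<Gamma>. \<not> less x x) \<and>
    (\<forall>x\<in>\<Gamma>. \<forall>y\<in>\<Gamma>. \<forall>z\<in>\<Gamma>. less x y \<longrightarrow> less y z \<longrightarrow> less x z) \<and>
    (\<forall>x\<in>\<Gamma>. \<forall>y\<in>\<Gamma>. less x y \<or> x = y \<or> less y x) \<and>
    (\<forall>x\<in>\<Gamma>. \<forall>y\<in>\<Gamma>. \<forall>z\<in>\<Gamma>. less x y \<longrightarrow> less (add x z) (add y z))"
  have 1: "(\<forall>\<phi>\<in>group_axioms. holds M \<phi> []) \<longleftrightarrow> ax1"
    by (simp add: group_axioms_def holds_def ax1_def F \<Gamma>_def)
  define ax2 where "ax2 \<longleftrightarrow> (\<forall>x\<in>\<Gamma>. less x infty) \<and> (\<forall>x\<in>carrier M. \<not> less infty x) \<and>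
    (\<forall>x\<in>carrier M. add x infty = infty) \<and> (\<forall>x\<in>carrier M. add infty x = infty) \<and>
    neg infty = infty \<and> \<psi> infty = infty \<and> \<psi> zero = infty \<and> S infty = infty \<and> P infty = infty \<and>
    (\<forall>n. D n infty = infty)"
  have 2: "(\<forall>\<phi>\<in>infinity_axioms. holds M \<phi> []) \<longleftrightarrow> ax2"
    by (auto simp: infinity_axioms_def holds_def ax2_def F \<Gamma>_def)
  define ax3 where "ax3 \<longleftrightarrow> (\<forall>n. \<forall>x\<in>\<Gamma>. D n x \<noteq> infty) \<and> (\<forall>n. \<forall>x\<in>\<Gamma>. ml (Suc n) (D n x) = x)"
  have 3: "(\<forall>\<phi>\<in>division_axioms. holds M \<phi> []) \<longleftrightarrow> ax3"
  proof -
    have "(\<forall>\<phi>\<in>{AllG 0 (Neg (tDelta n X [=] tInf)) | n. True}. holds M \<phi> []) \<longleftrightarrow>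
        (\<forall>n. holds M (AllG 0 (Neg (tDelta n X [=] tInf))) [])"
      by blast
    moreover have "(\<forall>\<phi>\<in>{AllG 0 (tMult (Suc n) (tDelta n X) [=] X) | n. True}. holds M \<phi> []) \<longleftrightarrow>
        (\<forall>n. holds M (AllG 0 (tMult (Suc n) (tDelta n X) [=] X)) [])"
      by blast
    ultimately show ?thesis unfolding division_axioms_def ball_Un ax3_def
      by (simp add: holds_def F \<Gamma>_def ev_mult del: tMult.simps)
  qed
  define ax4 where "ax4 \<longleftrightarrow> (\<forall>x\<in>N. \<psi> x \<noteq> infty) \<and>
    (\<forall>x\<in>N. \<forall>y\<in>N. add x y \<noteq> zero \<longrightarrow> lq (\<psi> x) (\<psi> (add x y)) \<or> lq (\<psi> y) (\<psi> (add x y))) \<and>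
    (\<forall>x\<in>N. \<forall>y\<in>N. less zero x \<longrightarrow> less (\<psi> y) (add x (\<psi> x))) \<and>
    (\<forall>x\<in>\<Gamma>. \<forall>y\<in>\<Gamma>. less zero x \<longrightarrow> lq x y \<longrightarrow> lq (\<psi> y) (\<psi> x)) \<and>
    (\<forall>x\<in>\<Gamma>. \<exists>y\<in>N. add y (\<psi> y) = x) \<and>
    (\<forall>k. k \<noteq> 0 \<longrightarrow> (\<forall>x\<in>N. \<psi> (im k x) = \<psi> x))"
  have 4: "(\<forall>\<phi>\<in>couple_axioms. holds M \<phi> []) \<longleftrightarrow> ax4"
  proof -
    have "(\<forall>\<phi>\<in>{AllN 0 (tPsi (tIntMult k X) [=] tPsi X) | k. k \<noteq> 0}. holds M \<phi> []) \<longleftrightarrow>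
        (\<forall>k. k \<noteq> 0 \<longrightarrow> holds M (AllN 0 (tPsi (tIntMult k X) [=] tPsi X)) [])"
      by blast
    also have "\<dots> \<longleftrightarrow> (\<forall>k. k \<noteq> 0 \<longrightarrow> (\<forall>x\<in>N. \<psi> (im k x) = \<psi> x))"
      by (simp add: holds_def ev_int N_def \<Gamma>_def \<psi>_def infty_def zero_def)
    finally show ?thesis unfolding couple_axioms_def ball_Un ax4_def
      by (simp add: holds_def F \<Gamma>_def N_def)
  qed
  define ax5 where "ax5 \<longleftrightarrow> (\<forall>x\<in>N. S (add x (\<psi> x)) = \<psi> x) \<and> (\<forall>x\<in>N. lq (S zero) (\<psi> x)) \<and>
    less zero (S zero) \<and> (\<forall>x\<in>N. less (\<psi> x) (S (\<psi> x))) \<and>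
    (\<forall>x\<in>N. \<forall>y\<in>N. \<not> (less (\<psi> x) (\<psi> y) \<and> less (\<psi> y) (S (\<psi> x)))) \<and>
    (\<forall>x\<in>N. \<forall>y\<in>N. S (\<psi> x) = S (\<psi> y) \<longrightarrow> \<psi> x = \<psi> y) \<and>
    (\<forall>x\<in>N. less (S zero) (\<psi> x) \<longrightarrow> (\<exists>y\<in>N. S (\<psi> y) = \<psi> x)) \<and>
    (\<forall>x\<in>N. P (S (\<psi> x)) = \<psi> x) \<and>
    (\<forall>x\<in>carrier M. \<not> (\<exists>y\<in>N. \<psi> y = x \<and> less (S zero) x) \<longrightarrow> P x = infty)"
  have 5: "(\<forall>\<phi>\<in>succ_pred_axioms. holds M \<phi> []) \<longleftrightarrow> ax5"
    by (simp add: succ_pred_axioms_def holds_def ax5_def F \<Gamma>_def N_def)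
  have mod: "model_of L_log M T_log \<longleftrightarrow> ax1 \<and> ax2 \<and> ax3 \<and> ax4 \<and> ax5"
    using M 1 2 3 4 5 by (auto simp: model_of_def T_log_def ball_Un)

  let ?s = "asymptotic_couple.succ \<Gamma> add zero \<psi>"
  let ?p = "asymptotic_couple.pred \<Gamma> add zero \<psi>"
  let ?ab = "asymptotic_couple.Psi_above \<Gamma> add zero less \<psi>"
  have str: "log_structure M \<longleftrightarrow> infty \<in> carrier M \<and> log_couple \<Gamma> add zero neg less \<psi> \<and>
         (\<forall>x\<in>\<Gamma>. less x infty) \<and> (\<forall>x\<in>carrier M. \<not> less infty x) \<and>
         (\<forall>x\<in>carrier M. add x infty = infty \<and> add infty x = infty) \<and> neg infty = infty \<and>
         \<psi> zero = infty \<and> \<psi> infty = infty \<and>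
         (\<forall>n. (\<forall>x\<in>\<Gamma>. D n x \<in> \<Gamma> \<and> ordered_abelian_group.nat_mult add zero (Suc n) (D n x) = x) \<and>
              D n infty = infty) \<and>
         (\<forall>x\<in>\<Gamma>. S x = ?s x) \<and> S infty = infty \<and>
         (\<forall>x\<in>carrier M. P x = (if x \<in> ?ab then ?p x else infty))"
    unfolding log_structure_def Let_def F \<Gamma>_def by (rule refl)
  have ml_eq: "ordered_abelian_group.nat_mult add zero n x = ml n x"
    if "ordered_abelian_group \<Gamma> add zero neg less" for n x
    by (induction n) (simp_all add: ml_def ordered_abelian_group.nat_mult.simps[OF that])
  show ?thesis
  proof
    assume "model_of L_log M T_log"
    then have a1: ax1 and a2: ax2 and a3: ax3 and a4: ax4 and a5: ax5 using mod by auto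
    have zG: "zero \<in> \<Gamma>" using a1 C by (simp add: ax1_def \<Gamma>_def)
    have A: "\<forall>x\<in>\<Gamma>. \<forall>y\<in>\<Gamma>. add x y \<noteq> infty" "\<forall>x\<in>\<Gamma>. neg x \<noteq> infty"
      "\<forall>x\<in>\<Gamma>. \<forall>y\<in>\<Gamma>. \<forall>z\<in>\<Gamma>. add (add x y) z = add x (add y z)"
      "\<forall>x\<in>\<Gamma>. \<forall>y\<in>\<Gamma>. add x y = add y x"
      "\<forall>x\<in>\<Gamma>. add x zero = x" "\<forall>x\<in>\<Gamma>. add x (neg x) = zero"
      "\<forall>x\<in>\<Gamma>. \<not> less x x"
      "\<forall>x\<in>\<Gamma>. \<forall>y\<in>\<Gamma>. \<forall>z\<in>\<Gamma>. less x y \<longrightarrow> less y z \<longrightarrow> less x z"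
      "\<forall>x\<in>\<Gamma>. \<forall>y\<in>\<Gamma>. less x y \<or> x = y \<or> less y x"
      "\<forall>x\<in>\<Gamma>. \<forall>y\<in>\<Gamma>. \<forall>z\<in>\<Gamma>. less x y \<longrightarrow> less (add x z) (add y z)"
      using a1[unfolded ax1_def] by metis+
    interpret ordered_abelian_group \<Gamma> add zero neg less
    proof unfold_locales
      show "add x y \<in> \<Gamma>" if "x \<in> \<Gamma>" "y \<in> \<Gamma>" for x y
        using A(1) that C(3)[of x y] unfolding \<Gamma>_def by blast
      show "neg x \<in> \<Gamma>" if "x \<in> \<Gamma>" for x
        using A(2) that C(4)[of x] unfolding \<Gamma>_def by blast
      show "add x y = add y x" if "x \<in> \<Gamma>" "y \<in> \<Gamma>" for x y using A(4) that by blast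
      show "less x y \<or> x = y \<or> less y x" if "x \<in> \<Gamma>" "y \<in> \<Gamma>" for x y using A(9) that by blast
    qed (fact zG | use A(3) in blast | use A(5) in blast | use A(6) in blast | use A(7) in blast |
        use A(8) in blast | use A(10) in blast)+
    note oag = ordered_abelian_group_axioms
    have N: "nonzero = N" by (simp add: nonzero_def N_def)
    have le: "le = lq" by (simp add: le_def lq_def fun_eq_iff)
    have im: "int_mult k x = im k x" for k x by (simp add: int_mult_def im_def ml_eq[OF oag])
    have NG: "x \<in> N \<Longrightarrow> x \<in> \<Gamma>" for x by (simp add: N_def)
    have B: "\<forall>x\<in>N. \<forall>y\<in>N. add x y \<noteq> zero \<longrightarrow> lq (\<psi> x) (\<psi> (add x y)) \<or> lq (\<psi> y) (\<psi> (add x y))"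
      "\<forall>x\<in>N. \<forall>y\<in>N. less zero x \<longrightarrow> less (\<psi> y) (add x (\<psi> x))"
      "\<forall>x\<in>\<Gamma>. \<forall>y\<in>\<Gamma>. less zero x \<longrightarrow> lq x y \<longrightarrow> lq (\<psi> y) (\<psi> x)"
      "\<forall>x\<in>\<Gamma>. \<exists>y\<in>N. add y (\<psi> y) = x"
      "\<forall>k. k \<noteq> 0 \<longrightarrow> (\<forall>x\<in>N. \<psi> (im k x) = \<psi> x)"
      "\<forall>x\<in>N. \<psi> x \<noteq> infty"
      using a4[unfolded ax4_def] by metis+
    have ND: "x \<in> N \<Longrightarrow> \<psi> x \<in> \<Gamma>" for x
      using B(6) C(5)[of x] unfolding \<Gamma>_def N_def by blast
    interpret asymptotic_couple \<Gamma> add zero neg less \<psi>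
    proof unfold_locales
      show "\<psi> x \<in> \<Gamma>" if "x \<in> nonzero" for x using ND that unfolding N .
      show "le (\<psi> x) (\<psi> (add x y)) \<or> le (\<psi> y) (\<psi> (add x y))"
        if "x \<in> nonzero" "y \<in> nonzero" "add x y \<noteq> zero" for x y using B(1) that unfolding N le by blast
      show "\<psi> (int_mult k x) = \<psi> x" if "x \<in> nonzero" "k \<noteq> 0" for x k
        using B(5) that unfolding N im by blast
      show "less (\<psi> y) (add x (\<psi> x))" if "x \<in> nonzero" "y \<in> nonzero" "less zero x" for x y
        using B(2) that unfolding N by blast
    qed
    have AI: asymptotic_integration
      using B(4) unfolding asymptotic_integration_def N deriv_def .
    have S1: "S (add x (\<psi> x)) = \<psi> x" "lq (S zero) (\<psi> x)" "less (\<psi> x) (S (\<psi> x))"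
      "P (S (\<psi> x)) = \<psi> x" "less (S zero) (\<psi> x) \<Longrightarrow> \<exists>y\<in>N. S (\<psi> y) = \<psi> x" if "x \<in> N" for x
      using a5 that unfolding ax5_def by metis+
    have S2: "\<not> (less (\<psi> x) (\<psi> y) \<and> less (\<psi> y) (S (\<psi> x)))"
      "S (\<psi> x) = S (\<psi> y) \<Longrightarrow> \<psi> x = \<psi> y" if "x \<in> N" "y \<in> N" for x y
      using a5 that unfolding ax5_def by metis+
    have S3: "less zero (S zero)" using a5 unfolding ax5_def by metis
    have S4: "P x = infty" if "x \<in> carrier M" "\<not> (\<exists>y\<in>N. \<psi> y = x \<and> less (S zero) x)" for x
      using a5 that unfolding ax5_def by metis
    have Ss: "S x = succ x" if x: "x \<in> \<Gamma>" for x
    proof -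
      obtain y where y: "y \<in> nonzero" "deriv y = x" using AI x unfolding asymptotic_integration_def by blast
      then have "S x = \<psi> y" using S1(1)[of y] unfolding N deriv_def by simp
      then show ?thesis using succ_deriv[OF y(1)] y(2) by simp
    qed
    have sP: "succ x \<in> Psi" if x: "x \<in> \<Gamma>" for x
    proof -
      obtain y where y: "y \<in> nonzero" "deriv y = x" using AI x unfolding asymptotic_integration_def by blast
      then show ?thesis using succ_deriv[OF y(1)] by (simp add: Psi_def)
    qed
    have Psi: "Psi = \<psi> ` N" by (simp add: Psi_def N)
    have PsiG: "x \<in> Psi \<Longrightarrow> x \<in> \<Gamma>" for x using ND by (auto simp: Psi)
    have S0: "S zero = succ zero" using Ss zG by simp
    have Sp: "S (\<psi> x) = succ (\<psi> x)" if "x \<in> N" for x using Ss ND that by simp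
    have leastP: "lq (succ zero) x" if "x \<in> Psi" for x
      using that S1(2) S0 by (auto simp: Psi)
    have inc: "less x (succ x)" if "x \<in> Psi" for x
      using that S1(3) Sp by (auto simp: Psi)
    have imm: "\<not> (less x y \<and> less y (succ x))" if "x \<in> Psi" "y \<in> Psi" for x y
      using that S2(1) Sp unfolding Psi by (metis imageE)
    have inj: "inj_on succ Psi"
    proof (rule inj_onI)
      fix x y assume "x \<in> Psi" "y \<in> Psi" and eq: "succ x = succ y"
      then obtain x' y' where "x' \<in> N" "y' \<in> N" "x = \<psi> x'" "y = \<psi> y'" by (auto simp: Psi)
      then show "x = y" using S2(2)[of x' y'] Sp eq by simp
    qed
    have im1: "succ x \<in> Psi_above" if "x \<in> Psi" for x
    proof -
      have G: "x \<in> \<Gamma>" "succ x \<in> \<Gamma>" "succ zero \<in> \<Gamma>" using that sP zG PsiG by auto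
      have "less (succ zero) (succ x)"
        using leastP[OF that] inc[OF that] less_trans[OF G(3,1,2)] by (auto simp: lq_def)
      then show ?thesis using sP[OF G(1)] by (simp add: Psi_above_def)
    qed
    have im2: "x \<in> succ ` Psi" if x: "x \<in> Psi_above" for x
    proof -
      obtain z where z: "z \<in> N" "x = \<psi> z" "less (S zero) (\<psi> z)"
        using x S0 unfolding Psi_above_def Psi by auto
      then obtain y where "y \<in> N" "S (\<psi> y) = \<psi> z" using S1(5)[OF z(1)] by blast
      then have "x = succ (\<psi> y)" "\<psi> y \<in> Psi" using z Sp by (auto simp: Psi)
      then show ?thesis by blast
    qed
    have bij: "bij_betw succ Psi Psi_above"
      using inj im1 im2 by (auto simp: bij_betw_def)
    have div: divisible unfolding divisible_def
    proof (intro ballI allI impI)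
      fix x n assume x: "x \<in> \<Gamma>" and n: "(1::nat) \<le> n"
      have "D (n - 1) x \<in> \<Gamma>" using a3 x C(8) unfolding ax3_def by (auto simp: \<Gamma>_def)
      moreover have "ml n (D (n - 1) x) = x" using a3 x n unfolding ax3_def by (cases n) auto
      ultimately show "\<exists>y\<in>\<Gamma>. nat_mult n y = x" using ml_eq[OF oag] by auto
    qed
    have lc: "log_couple \<Gamma> add zero neg less \<psi>"
    proof unfold_locales
      show H_type using B(3) unfolding H_type_def le by blast
      show "less zero (succ zero)" using S3 S0 by simp
    qed (use div AI sP zG leastP PsiG inc imm bij in \<open>auto simp: le\<close>)
    have pred: "P x = (if x \<in> Psi_above then pred x else infty)" if x: "x \<in> carrier M" for x
    proof (cases "x \<in> Psi_above")
      case True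
      then obtain y where y: "y \<in> Psi" "x = succ y" using im2 by auto
      have "pred x = y" using inj y by (simp add: pred_def the_inv_into_f_f)
      moreover have "P x = y" using y S1(4) Sp by (auto simp: Psi)
      ultimately show ?thesis using True by simp
    next
      case False
      then have "\<not> (\<exists>y\<in>N. \<psi> y = x \<and> less (S zero) x)" by (auto simp: Psi_above_def Psi S0)
      then have "P x = infty" using S4 x by blast
      then show ?thesis using False by simp
    qed
    have DG: "D n x \<in> \<Gamma>" if "x \<in> \<Gamma>" for n x
      using a3 that C(8) unfolding ax3_def by (auto simp: \<Gamma>_def)
    have Dm: "nat_mult (Suc n) (D n x) = x" if "x \<in> \<Gamma>" for n x
      using a3 that unfolding ax3_def ml_eq[OF oag] by blast
    show "log_structure M"
      unfolding str
    proof (intro conjI)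
      show "\<forall>n. (\<forall>x\<in>\<Gamma>. D n x \<in> \<Gamma> \<and> nat_mult (Suc n) (D n x) = x) \<and> D n infty = infty"
        using a2 DG Dm unfolding ax2_def by blast
      show "\<forall>x\<in>carrier M. P x = (if x \<in> Psi_above then pred x else infty)" using pred by blast
    qed (use C(1) lc a2 Ss in \<open>simp_all add: ax2_def\<close>)
  next
    assume "log_structure M"
    note s = this[unfolded str]
    interpret log_couple \<Gamma> add zero neg less \<psi> using s by blast
    note oag = ordered_abelian_group_axioms
    have N: "nonzero = N" by (simp add: nonzero_def N_def)
    have le: "le = lq" by (simp add: le_def lq_def fun_eq_iff)
    have im: "int_mult k x = im k x" for k x by (simp add: int_mult_def im_def ml_eq[OF oag])
    have ND: "x \<in> N \<Longrightarrow> \<psi> x \<in> \<Gamma>" for x using psi_closed by (simp add: N)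
    have iG: "x \<in> \<Gamma> \<Longrightarrow> x \<noteq> infty" for x by (simp add: \<Gamma>_def)
    have Psi: "Psi = \<psi> ` N" by (simp add: Psi_def N)
    have NG: "x \<in> N \<Longrightarrow> x \<in> \<Gamma>" for x by (simp add: N_def)
    have Ss: "x \<in> \<Gamma> \<Longrightarrow> S x = succ x" for x using s by blast
    have S0: "S zero = succ zero" using Ss zero_closed by simp
    have inj: "inj_on succ Psi" and img: "succ ` Psi = Psi_above"
      using bij_succ by (auto simp: bij_betw_def)
    have Sp: "S (\<psi> x) = succ (\<psi> x)" "\<psi> x \<in> Psi" if "x \<in> N" for x
      using Ss ND that by (auto simp: Psi)
    have a1: ax1 unfolding ax1_def
    proof (intro conjI)
      show "zero \<noteq> infty" using iG[OF zero_closed] .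
      show "\<forall>x\<in>\<Gamma>. \<forall>y\<in>\<Gamma>. add x y \<noteq> infty" using add_closed iG by blast
      show "\<forall>x\<in>\<Gamma>. neg x \<noteq> infty" using neg_closed iG by blast
      show "\<forall>x\<in>\<Gamma>. \<forall>y\<in>\<Gamma>. \<forall>z\<in>\<Gamma>. add (add x y) z = add x (add y z)" by (intro ballI add_assoc)
      show "\<forall>x\<in>\<Gamma>. \<forall>y\<in>\<Gamma>. add x y = add y x" by (intro ballI add_commute)
      show "\<forall>x\<in>\<Gamma>. add x zero = x" by (intro ballI add_zero)
      show "\<forall>x\<in>\<Gamma>. add x (neg x) = zero" by (intro ballI add_neg)
      show "\<forall>x\<in>\<Gamma>. \<not> less x x" by (intro ballI less_irrefl)
      show "\<forall>x\<in>\<Gamma>. \<forall>y\<in>\<Gamma>. \<forall>z\<in>\<Gamma>. less x y \<longrightarrow> less y z \<longrightarrow> less x z"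
        by (intro ballI impI) (rule less_trans)
      show "\<forall>x\<in>\<Gamma>. \<forall>y\<in>\<Gamma>. less x y \<or> x = y \<or> less y x" by (intro ballI less_linear)
      show "\<forall>x\<in>\<Gamma>. \<forall>y\<in>\<Gamma>. \<forall>z\<in>\<Gamma>. less x y \<longrightarrow> less (add x z) (add y z)"
        by (intro ballI impI add_less)
    qed
    have a2: ax2
    proof -
      have "infty \<notin> Psi_above" using ND iG by (auto simp: Psi_above_def Psi)
      then have "P infty = infty" using s C(1) by simp
      then show ?thesis unfolding ax2_def using s by blast
    qed
    have a3: ax3 unfolding ax3_def using s iG ml_eq[OF oag] by simp
    have a4: ax4 unfolding ax4_def
    proof (intro conjI)
      show "\<forall>x\<in>N. \<psi> x \<noteq> infty" using ND iG by blast
      show "\<forall>x\<in>\<Gamma>. \<forall>y\<in>\<Gamma>. less zero x \<longrightarrow> lq x y \<longrightarrow> lq (\<psi> y) (\<psi> x)"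
        using H_type unfolding H_type_def le by blast
      show "\<forall>x\<in>\<Gamma>. \<exists>y\<in>N. add y (\<psi> y) = x"
        using asymptotic_integration unfolding asymptotic_integration_def N deriv_def by blast
    qed (use AC1 AC2 AC3 in \<open>auto simp: N le im\<close>)
    have a5: ax5 unfolding ax5_def
    proof (intro conjI)
      show "\<forall>x\<in>N. S (add x (\<psi> x)) = \<psi> x"
      proof
        fix x assume x: "x \<in> N"
        then show "S (add x (\<psi> x)) = \<psi> x"
          using Ss[OF add_closed[OF NG[OF x] ND[OF x]]] succ_deriv[of x] unfolding N deriv_def by simp
      qed
      show "\<forall>x\<in>N. lq (S zero) (\<psi> x)" using least_Psi(2) Sp(2) unfolding S0 le by blast
      show "less zero (S zero)" using succ_zero_pos S0 by simp
      show "\<forall>x\<in>N. less (\<psi> x) (S (\<psi> x))" using immediate_succ(2) Sp by simp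
      show "\<forall>x\<in>N. \<forall>y\<in>N. \<not> (less (\<psi> x) (\<psi> y) \<and> less (\<psi> y) (S (\<psi> x)))"
      proof (intro ballI)
        fix x y assume "x \<in> N" "y \<in> N"
        then show "\<not> (less (\<psi> x) (\<psi> y) \<and> less (\<psi> y) (S (\<psi> x)))"
          using immediate_succ(3)[of "\<psi> x" "\<psi> y"] Sp by simp
      qed
      show "\<forall>x\<in>N. \<forall>y\<in>N. S (\<psi> x) = S (\<psi> y) \<longrightarrow> \<psi> x = \<psi> y"
      proof (intro ballI impI)
        fix x y assume "x \<in> N" "y \<in> N" "S (\<psi> x) = S (\<psi> y)"
        then show "\<psi> x = \<psi> y" using inj_onD[OF inj, of "\<psi> x" "\<psi> y"] Sp by simp
      qed
      show "\<forall>x\<in>N. less (S zero) (\<psi> x) \<longrightarrow> (\<exists>y\<in>N. S (\<psi> y) = \<psi> x)"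
      proof (intro ballI impI)
        fix x assume x: "x \<in> N" "less (S zero) (\<psi> x)"
        then have "\<psi> x \<in> succ ` Psi" unfolding img Psi_above_def using Sp S0 by simp
        then show "\<exists>y\<in>N. S (\<psi> y) = \<psi> x" using Sp by (auto simp: Psi)
      qed
      show "\<forall>x\<in>N. P (S (\<psi> x)) = \<psi> x"
      proof
        fix x assume x: "x \<in> N"
        have a: "succ (\<psi> x) \<in> Psi_above" using img Sp x by blast
        then have "succ (\<psi> x) \<in> carrier M" using ND unfolding carr Psi_above_def Psi by auto
        then have "P (succ (\<psi> x)) = pred (succ (\<psi> x))" using s a by simp
        then show "P (S (\<psi> x)) = \<psi> x" using Sp[OF x] inj by (simp add: pred_def the_inv_into_f_f)
      qed
      show "\<forall>x\<in>carrier M. \<not> (\<exists>y\<in>N. \<psi> y = x \<and> less (S zero) x) \<longrightarrow> P x = infty"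
      proof (intro ballI impI)
        fix x assume x: "x \<in> carrier M" "\<not> (\<exists>y\<in>N. \<psi> y = x \<and> less (S zero) x)"
        then have "x \<notin> Psi_above" by (auto simp: Psi_above_def Psi S0)
        then show "P x = infty" using s x(1) by simp
      qed
    qed
    show "model_of L_log M T_log" using mod a1 a2 a3 a4 a5 by blast
  qed
qed

end

theory Submission
  imports Defs "HOL-Computational_Algebra.Polynomial" "HOL-Library.Countable_Set"
begin

text \<open>Countably saturated models have quantifier elimination by a back-and-forth argument: a partial isomorphism
  is extended first on \<open>\<Psi>\<close>, then on the group, where the cut of a new element \<open>b\<close> and the values \<open>\<psi> (b \<ominus> h)\<close> determine
  its type. Completeness follows by comparing the substructures generated by \<open>\<zero>\<close> in ultrapowers of two models,
  and consistency from a lexicographically ordered group of polynomials.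

  By quantifier elimination only atomic formulas matter for distality, and parameters may be added one at a time.
  Let \<open>b\<close> be the new parameter. Replacing \<open>c\<close> by the index \<open>0\<close> of a long sequence of integers, every term has values
  \<open>\<alpha> i \<oplus> \<beta>\<close> along the sequence, with \<open>\<alpha>\<close> not involving \<open>b\<close> (hence indiscernible including the index \<open>0\<close>) and \<open>\<beta>\<close>
  constant. So \<open>\<alpha>\<close> is monotone, and the sign of \<open>\<alpha> i \<oplus> \<beta>\<close> at \<open>0\<close> is the common sign at \<open>-1\<close> and \<open>1\<close>.\<close>

section \<open>Models of \<open>T_log\<close>\<close>

text \<open>A single element \<open>b\<close> cannot simply be adjoined to a substructure:
  \<open>\<psi> (b \<ominus> h)\<close> may be new for infinitely many \<open>h\<close>, and each
  new value brings its successors and predecessors. The countable substructure to be reached is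
  therefore fixed in advance. Its part in \<Psi> is mapped while only the order, \<open>\<s>\<close>
  and \<open>\<p>\<close> matter, and the group part is filled in once every value of \<psi> that
  can occur is in place. An element \<open>\<omega>\<close> above these values satisfies
  \<open>\<s> x = \<psi> (x \<ominus> \<omega>)\<close>, so that the group extension has to respect
  only addition, the order and \<psi>. In the distality argument the constant \<beta> disappears
  from differences, and \<psi> and \<open>\<s>\<close> of
  \<open>\<alpha> i \<oplus> \<beta>\<close>, unless constant, become \<psi> of a difference with a
  fixed outer index. Each such step uses up indices at both ends; hence the long sequence, whose
  length depends only on the two terms compared. Consistency refers to models on the type of
  formulas, which is countable here; this is why the model has rational coordinates.\<close>

abbreviation Plus :: "(log_fun, log_rel, 'm) fo_struct \<Rightarrow> 'm \<Rightarrow> 'm \<Rightarrow> 'm" (infixl "\<oplus>\<index>" 65) where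
  "x \<oplus>\<^bsub>M\<^esub> y \<equiv> fn M FPlus [x, y]"
abbreviation Minus :: "(log_fun, log_rel, 'm) fo_struct \<Rightarrow> 'm \<Rightarrow> 'm" ("\<ominus>\<index> _" [81] 80) where
  "\<ominus>\<^bsub>M\<^esub> x \<equiv> fn M FNeg [x]"
abbreviation Sub :: "(log_fun, log_rel, 'm) fo_struct \<Rightarrow> 'm \<Rightarrow> 'm \<Rightarrow> 'm" ("(_ \<ominus>\<index> _)" [65, 66] 65) where
  "x \<ominus>\<^bsub>M\<^esub> y \<equiv> x \<oplus>\<^bsub>M\<^esub> (\<ominus>\<^bsub>M\<^esub> y)"
abbreviation Zer :: "(log_fun, log_rel, 'm) fo_struct \<Rightarrow> 'm" ("\<zero>\<index>") where
  "\<zero>\<^bsub>M\<^esub> \<equiv> fn M FZero []"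
abbreviation Infty :: "(log_fun, log_rel, 'm) fo_struct \<Rightarrow> 'm" ("\<infinity>\<index>") where
  "\<infinity>\<^bsub>M\<^esub> \<equiv> fn M FInf []"
abbreviation Less :: "(log_fun, log_rel, 'm) fo_struct \<Rightarrow> 'm \<Rightarrow> 'm \<Rightarrow> bool" (infix "\<prec>\<index>" 50) where
  "x \<prec>\<^bsub>M\<^esub> y \<equiv> rel M RLess [x, y]"
abbreviation LessEq :: "(log_fun, log_rel, 'm) fo_struct \<Rightarrow> 'm \<Rightarrow> 'm \<Rightarrow> bool" (infix "\<preceq>\<index>" 50) where
  "x \<preceq>\<^bsub>M\<^esub> y \<equiv> x \<prec>\<^bsub>M\<^esub> y \<or> x = y"
abbreviation Psi :: "(log_fun, log_rel, 'm) fo_struct \<Rightarrow> 'm \<Rightarrow> 'm" ("\<psi>\<index>") where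
  "\<psi>\<^bsub>M\<^esub> x \<equiv> fn M FPsi [x]"
abbreviation Succ :: "(log_fun, log_rel, 'm) fo_struct \<Rightarrow> 'm \<Rightarrow> 'm" ("\<s>\<index>") where
  "\<s>\<^bsub>M\<^esub> x \<equiv> fn M FSucc [x]"
abbreviation Pred :: "(log_fun, log_rel, 'm) fo_struct \<Rightarrow> 'm \<Rightarrow> 'm" ("\<p>\<index>") where
  "\<p>\<^bsub>M\<^esub> x \<equiv> fn M FPred [x]"
abbreviation Delta :: "(log_fun, log_rel, 'm) fo_struct \<Rightarrow> nat \<Rightarrow> 'm \<Rightarrow> 'm" ("\<delta>\<index>") where
  "\<delta>\<^bsub>M\<^esub> n x \<equiv> fn M (FDelta n) [x]"
definition Gam :: "(log_fun, log_rel, 'm) fo_struct \<Rightarrow> 'm set" ("\<Gamma>\<index>") where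
  "\<Gamma>\<^bsub>M\<^esub> = carrier M - {\<infinity>\<^bsub>M\<^esub>}"
definition Psis :: "(log_fun, log_rel, 'm) fo_struct \<Rightarrow> 'm set" ("\<Psi>\<index>") where
  "\<Psi>\<^bsub>M\<^esub> = (\<lambda>x. \<psi>\<^bsub>M\<^esub> x) ` (\<Gamma>\<^bsub>M\<^esub> - {\<zero>\<^bsub>M\<^esub>})"

locale log_model =
  fixes M :: "(log_fun, log_rel, 'm) fo_struct" (structure)
  assumes log_structure: "log_structure M"
begin

sublocale c: log_couple \<Gamma> "\<lambda>x y. x \<oplus> y" \<zero> "\<lambda>x. \<ominus> x" "\<lambda>x y. x \<prec> y" "\<lambda>x. \<psi> x"
  using log_structure unfolding log_structure_def Let_def Gam_def by blast

lemma carrier: "x \<in> carrier M \<longleftrightarrow> x \<in> \<Gamma> \<or> x = \<infinity>"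
  using log_structure unfolding log_structure_def Let_def Gam_def by blast

lemma infty_notin [simp]: "\<infinity> \<notin> \<Gamma>" by (simp add: Gam_def)

lemma Gam_carrier [simp, intro]: "x \<in> \<Gamma> \<Longrightarrow> x \<in> carrier M" by (simp add: carrier)

lemma infty_rules [simp]:
  "x \<in> \<Gamma> \<Longrightarrow> x \<prec> \<infinity>" "x \<in> carrier M \<Longrightarrow> \<not> \<infinity> \<prec> x"
  "x \<in> carrier M \<Longrightarrow> x \<oplus> \<infinity> = \<infinity>" "x \<in> carrier M \<Longrightarrow> \<infinity> \<oplus> x = \<infinity>" "\<ominus> \<infinity> = \<infinity>"
  "\<psi> \<zero> = \<infinity>" "\<psi> \<infinity> = \<infinity>" "\<s> \<infinity> = \<infinity>" "\<delta> n \<infinity> = \<infinity>"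
  using log_structure unfolding log_structure_def Let_def Gam_def by blast+

lemma Psi_eq: "c.Psi = \<Psi>"
  by (simp add: c.Psi_def Psis_def c.nonzero_def)

lemma closed [simp, intro]:
  "\<zero> \<in> \<Gamma>" "x \<in> \<Gamma> \<Longrightarrow> y \<in> \<Gamma> \<Longrightarrow> x \<oplus> y \<in> \<Gamma>" "x \<in> \<Gamma> \<Longrightarrow> \<ominus> x \<in> \<Gamma>"
  "x \<in> \<Gamma> \<Longrightarrow> \<delta> n x \<in> \<Gamma>"
  using c.zero_closed c.add_closed c.neg_closed log_structure
  unfolding log_structure_def Let_def Gam_def by auto

lemma not_infty [simp]: "x \<in> \<Gamma> \<Longrightarrow> x \<noteq> \<infinity>" by auto

lemma add_zero [simp]: "x \<in> \<Gamma> \<Longrightarrow> x \<oplus> \<zero> = x" using c.add_zero .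
lemma zero_add [simp]: "x \<in> \<Gamma> \<Longrightarrow> \<zero> \<oplus> x = x" using c.add_zero c.add_commute by fastforce
lemma add_neg [simp]: "x \<in> \<Gamma> \<Longrightarrow> x \<ominus> x = \<zero>" using c.add_neg .
lemma neg_add [simp]: "x \<in> \<Gamma> \<Longrightarrow> \<ominus> x \<oplus> x = \<zero>"
  using c.add_neg c.add_commute[of "\<ominus> x" x] by simp

lemma a_lcomm: "x \<in> \<Gamma> \<Longrightarrow> y \<in> \<Gamma> \<Longrightarrow> z \<in> \<Gamma> \<Longrightarrow> x \<oplus> (y \<oplus> z) = y \<oplus> (x \<oplus> z)"
  by (metis c.add_assoc c.add_commute)

lemmas a_ac = c.add_assoc c.add_commute a_lcomm

lemma cancel [simp]:
  "x \<in> \<Gamma> \<Longrightarrow> y \<in> \<Gamma> \<Longrightarrow> x \<oplus> (\<ominus> x \<oplus> y) = y"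
  "x \<in> \<Gamma> \<Longrightarrow> y \<in> \<Gamma> \<Longrightarrow> \<ominus> x \<oplus> (x \<oplus> y) = y"
  by (simp_all flip: c.add_assoc)

lemma add_left_cancel [simp]:
  "x \<in> \<Gamma> \<Longrightarrow> y \<in> \<Gamma> \<Longrightarrow> z \<in> \<Gamma> \<Longrightarrow> x \<oplus> y = x \<oplus> z \<longleftrightarrow> y = z"
  by (metis cancel(2))
lemma add_right_cancel [simp]:
  "x \<in> \<Gamma> \<Longrightarrow> y \<in> \<Gamma> \<Longrightarrow> z \<in> \<Gamma> \<Longrightarrow> y \<oplus> x = z \<oplus> x \<longleftrightarrow> y = z"
  by (metis c.add_commute add_left_cancel)

lemma neg_neg [simp]: "x \<in> \<Gamma> \<Longrightarrow> \<ominus> (\<ominus> x) = x"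
  by (metis add_left_cancel add_neg neg_add closed(3))
lemma neg_zero [simp]: "\<ominus> \<zero> = \<zero>"
  by (metis add_zero closed(1,3) neg_add)
lemma neg_plus: "x \<in> \<Gamma> \<Longrightarrow> y \<in> \<Gamma> \<Longrightarrow> \<ominus> (x \<oplus> y) = \<ominus> x \<oplus> \<ominus> y"
  by (rule add_left_cancel[THEN iffD1, of "x \<oplus> y"]) (simp_all add: a_ac)

text \<open>Sorting the summands with \<open>ag\<close> may leave an element and its negative one or
  two places apart; these rules cancel them there. Together with \<open>cancel\<close> they make
  \<open>simp\<close> prove the group identities below.\<close>

lemma cancel2 [simp]:
  assumes "x \<in> \<Gamma>" "y \<in> \<Gamma>" "z \<in> \<Gamma>" "w \<in> \<Gamma>"
  shows "x \<oplus> (y \<oplus> (\<ominus> x \<oplus> z)) = y \<oplus> z" "\<ominus> x \<oplus> (y \<oplus> (x \<oplus> z)) = y \<oplus> z"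
    "x \<oplus> (y \<oplus> \<ominus> x) = y" "\<ominus> x \<oplus> (y \<oplus> x) = y"
    "x \<oplus> (y \<oplus> (z \<oplus> \<ominus> x)) = y \<oplus> z" "\<ominus> x \<oplus> (y \<oplus> (z \<oplus> x)) = y \<oplus> z"
    "x \<oplus> (y \<oplus> (z \<oplus> (\<ominus> x \<oplus> w))) = y \<oplus> (z \<oplus> w)"
    "\<ominus> x \<oplus> (y \<oplus> (z \<oplus> (x \<oplus> w))) = y \<oplus> (z \<oplus> w)"
proof -
  have c: "\<And>u. u \<in> \<Gamma> \<Longrightarrow> x \<oplus> (y \<oplus> u) = y \<oplus> (x \<oplus> u)" "\<And>u. u \<in> \<Gamma> \<Longrightarrow> x \<oplus> (z \<oplus> u) = z \<oplus> (x \<oplus> u)"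
   "\<And>u. u \<in> \<Gamma> \<Longrightarrow> \<ominus> x \<oplus> (y \<oplus> u) = y \<oplus> (\<ominus> x \<oplus> u)" "\<And>u. u \<in> \<Gamma> \<Longrightarrow> \<ominus> x \<oplus> (z \<oplus> u) = z \<oplus> (\<ominus> x \<oplus> u)"
   using assms a_lcomm by simp_all
  show "x \<oplus> (y \<oplus> (\<ominus> x \<oplus> z)) = y \<oplus> z" "\<ominus> x \<oplus> (y \<oplus> (x \<oplus> z)) = y \<oplus> z"
    "x \<oplus> (y \<oplus> \<ominus> x) = y" "\<ominus> x \<oplus> (y \<oplus> x) = y"
    "x \<oplus> (y \<oplus> (z \<oplus> \<ominus> x)) = y \<oplus> z" "\<ominus> x \<oplus> (y \<oplus> (z \<oplus> x)) = y \<oplus> z"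
    "x \<oplus> (y \<oplus> (z \<oplus> (\<ominus> x \<oplus> w))) = y \<oplus> (z \<oplus> w)"
    "\<ominus> x \<oplus> (y \<oplus> (z \<oplus> (x \<oplus> w))) = y \<oplus> (z \<oplus> w)"
    using assms by (simp_all add: c)
qed

lemmas ag = a_ac neg_plus

end

section \<open>The order of the group and integer multiples\<close>

context log_model
begin

lemma less_irrefl [simp]: "x \<in> carrier M \<Longrightarrow> \<not> x \<prec> x"
  using c.less_irrefl by (auto simp: carrier)

lemma less_trans:
  "x \<prec> y \<Longrightarrow> y \<prec> z \<Longrightarrow> x \<in> carrier M \<Longrightarrow> y \<in> carrier M \<Longrightarrow> z \<in> carrier M \<Longrightarrow> x \<prec> z"
  using c.less_trans[of x y z] infty_rules(2)[of y] infty_rules(2)[of z] infty_rules(1)[of x]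
  unfolding carrier by blast

lemma less_linear: "x \<in> carrier M \<Longrightarrow> y \<in> carrier M \<Longrightarrow> x \<prec> y \<or> x = y \<or> y \<prec> x"
  using c.less_linear[of x y] by (auto simp: carrier)

lemma less_asym: "x \<prec> y \<Longrightarrow> x \<in> carrier M \<Longrightarrow> y \<in> carrier M \<Longrightarrow> \<not> y \<prec> x"
  using less_trans[of x y x] less_irrefl[of x] by blast

lemma le_less_trans:
  "x \<preceq> y \<Longrightarrow> y \<prec> z \<Longrightarrow> x \<in> carrier M \<Longrightarrow> y \<in> carrier M \<Longrightarrow> z \<in> carrier M \<Longrightarrow> x \<prec> z"
  using less_trans[of x y z] by blast

lemma less_le_trans:
  "x \<prec> y \<Longrightarrow> y \<preceq> z \<Longrightarrow> x \<in> carrier M \<Longrightarrow> y \<in> carrier M \<Longrightarrow> z \<in> carrier M \<Longrightarrow> x \<prec> z"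
  using less_trans[of x y z] by blast

lemma le_trans:
  "x \<preceq> y \<Longrightarrow> y \<preceq> z \<Longrightarrow> x \<in> carrier M \<Longrightarrow> y \<in> carrier M \<Longrightarrow> z \<in> carrier M \<Longrightarrow> x \<preceq> z"
  using less_trans[of x y z] by blast

lemma le_antisym: "x \<preceq> y \<Longrightarrow> y \<preceq> x \<Longrightarrow> x \<in> carrier M \<Longrightarrow> y \<in> carrier M \<Longrightarrow> x = y"
  using less_asym[of x y] by blast

lemma add_less_cancel [simp]:
  assumes "x \<in> \<Gamma>" "y \<in> \<Gamma>" "z \<in> \<Gamma>"
  shows "x \<oplus> z \<prec> y \<oplus> z \<longleftrightarrow> x \<prec> y" "z \<oplus> x \<prec> z \<oplus> y \<longleftrightarrow> x \<prec> y"
proof -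
  have "x \<prec> y \<Longrightarrow> x \<oplus> z \<prec> y \<oplus> z" using c.add_less assms by simp
  moreover have "x \<oplus> z \<prec> y \<oplus> z \<Longrightarrow> x \<prec> y"
    using c.add_less[of "x \<oplus> z" "y \<oplus> z" "\<ominus> z"] assms by (simp add: ag)
  ultimately show "x \<oplus> z \<prec> y \<oplus> z \<longleftrightarrow> x \<prec> y" by blast
  then show "z \<oplus> x \<prec> z \<oplus> y \<longleftrightarrow> x \<prec> y" using assms c.add_commute by metis
qed

lemma neg_eq_zero [simp]: "x \<in> \<Gamma> \<Longrightarrow> \<ominus> x = \<zero> \<longleftrightarrow> x = \<zero>"
  by (metis neg_neg neg_zero)

lemma sub_eq_zero [simp]: "x \<in> \<Gamma> \<Longrightarrow> y \<in> \<Gamma> \<Longrightarrow> x \<ominus> y = \<zero> \<longleftrightarrow> x = y"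
  by (metis add_neg add_right_cancel closed(3))

lemma neg_eq [simp]: "x \<in> \<Gamma> \<Longrightarrow> y \<in> \<Gamma> \<Longrightarrow> \<ominus> x = \<ominus> y \<longleftrightarrow> x = y"
  by (metis neg_neg)

lemma sub_pos: "x \<in> \<Gamma> \<Longrightarrow> y \<in> \<Gamma> \<Longrightarrow> \<zero> \<prec> y \<ominus> x \<longleftrightarrow> x \<prec> y"
  using add_less_cancel(1)[of \<zero> "y \<ominus> x" x] by (simp add: ag)

lemma sub_neg: "x \<in> \<Gamma> \<Longrightarrow> y \<in> \<Gamma> \<Longrightarrow> y \<ominus> x \<prec> \<zero> \<longleftrightarrow> y \<prec> x"
  using add_less_cancel(1)[of "y \<ominus> x" \<zero> x] by (simp add: ag)

lemma neg_pos [simp]: "x \<in> \<Gamma> \<Longrightarrow> \<zero> \<prec> \<ominus> x \<longleftrightarrow> x \<prec> \<zero>"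
  using add_less_cancel(1)[of \<zero> "\<ominus> x" x] by simp

lemma neg_neg_iff [simp]: "x \<in> \<Gamma> \<Longrightarrow> \<ominus> x \<prec> \<zero> \<longleftrightarrow> \<zero> \<prec> x"
  using add_less_cancel(1)[of "\<ominus> x" \<zero> x] by simp

lemma neg_less [simp]: "x \<in> \<Gamma> \<Longrightarrow> y \<in> \<Gamma> \<Longrightarrow> \<ominus> x \<prec> \<ominus> y \<longleftrightarrow> y \<prec> x"
  using sub_pos[of y x] sub_pos[of "\<ominus> x" "\<ominus> y"] by (simp add: ag)

lemma add_pos: "\<zero> \<prec> x \<Longrightarrow> \<zero> \<preceq> y \<Longrightarrow> x \<in> \<Gamma> \<Longrightarrow> y \<in> \<Gamma> \<Longrightarrow> \<zero> \<prec> x \<oplus> y"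
proof -
  assume a: "\<zero> \<prec> x" "\<zero> \<preceq> y" "x \<in> \<Gamma>" "y \<in> \<Gamma>"
  then have "\<zero> \<oplus> \<zero> \<prec> x \<oplus> \<zero>" "x \<oplus> \<zero> \<preceq> x \<oplus> y" using add_less_cancel(2)[of \<zero> y x] by auto
  then show ?thesis using a less_le_trans[of \<zero> x "x \<oplus> y"] by (simp add: carrier)
qed

fun nmul :: "nat \<Rightarrow> 'm \<Rightarrow> 'm" where
  "nmul 0 x = \<zero>"
| "nmul (Suc n) x = nmul n x \<oplus> x"

definition mul :: "int \<Rightarrow> 'm \<Rightarrow> 'm" where
  "mul k x = (if 0 \<le> k then nmul (nat k) x else \<ominus> nmul (nat (- k)) x)"

lemma nmul_eq: "c.nat_mult n x = nmul n x"
  by (induction n) auto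

lemma mul_eq: "c.int_mult k x = mul k x"
  by (simp add: c.int_mult_def mul_def nmul_eq)

lemma nmul_closed [simp, intro]: "x \<in> \<Gamma> \<Longrightarrow> nmul n x \<in> \<Gamma>"
  by (induction n) auto

lemma mul_closed [simp, intro]: "x \<in> \<Gamma> \<Longrightarrow> mul n x \<in> \<Gamma>"
  by (simp add: mul_def)

lemma mul_simps [simp]: "mul 0 x = \<zero>" "x \<in> \<Gamma> \<Longrightarrow> mul 1 x = x" "x \<in> \<Gamma> \<Longrightarrow> mul (-1) x = \<ominus> x"
  by (simp_all add: mul_def)

lemma mul_Suc: assumes x: "x \<in> \<Gamma>" shows "mul (k + 1) x = mul k x \<oplus> x"
proof -
  consider "k \<ge> 0" | "k = -1" | "k < -1" by linarith
  then show ?thesis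
  proof cases
    case 1
    then show ?thesis using x by (simp add: mul_def nat_add_distrib)
  next
    case 2 then show ?thesis using x by simp
  next
    case 3
    then have "nat (- k) = Suc (nat (- (k + 1)))" by simp
    then show ?thesis using 3 x by (simp add: mul_def ag)
  qed
qed

lemma mul_pred: assumes x: "x \<in> \<Gamma>" shows "mul (k - 1) x = mul k x \<ominus> x"
  using mul_Suc[OF x, of "k - 1"] x by (simp add: ag)

lemma mul_add: assumes x: "x \<in> \<Gamma>" shows "mul (a + b) x = mul a x \<oplus> mul b x"
proof (induction b rule: int_induct[where k = 0])
  case base show ?case using x by simp
next
  case (step1 i)
  have "mul (a + (i + 1)) x = mul (a + i) x \<oplus> x" using mul_Suc[OF x, of "a + i"] by (simp add: add.assoc)
  then show ?case using x step1 by (simp add: mul_Suc ag)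
next
  case (step2 i)
  have "mul (a + (i - 1)) x = mul (a + i) x \<ominus> x" using mul_pred[OF x, of "a + i"] by (simp add: algebra_simps)
  then show ?case using x step2 by (simp add: mul_pred ag)
qed

lemma mul_neg: assumes x: "x \<in> \<Gamma>" shows "mul (- a) x = \<ominus> mul a x"
  using x by (auto simp: mul_def)

lemma mul_plus: assumes x: "x \<in> \<Gamma>" "y \<in> \<Gamma>" shows "mul a (x \<oplus> y) = mul a x \<oplus> mul a y"
proof (induction a rule: int_induct[where k = 0])
  case base show ?case by simp
next
  case (step1 i) then show ?case using x by (simp add: mul_Suc ag)
next
  case (step2 i) then show ?case using x by (simp add: mul_pred ag)
qed

lemma mul_zero [simp]: "mul a \<zero> = \<zero>"
proof (induction a rule: int_induct[where k = 0])
  case base show ?case by simp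
next
  case (step1 i) then show ?case by (simp add: mul_Suc)
next
  case (step2 i) then show ?case by (simp add: mul_pred)
qed

lemma mul_minus: assumes x: "x \<in> \<Gamma>" shows "mul a (\<ominus> x) = \<ominus> mul a x"
  using mul_plus[of x "\<ominus> x" a] x by (metis add_left_cancel add_neg closed(3) mul_closed mul_zero)

lemma mul_mult: assumes x: "x \<in> \<Gamma>" shows "mul (a * b) x = mul a (mul b x)"
proof (induction a rule: int_induct[where k = 0])
  case base show ?case by simp
next
  case (step1 i)
  have "(i + 1) * b = i * b + b" by algebra
  then show ?case using step1 x by (simp add: mul_add mul_Suc)
next
  case (step2 i)
  have "mul ((i - 1) * b) x = mul (i * b + - b) x" by (simp add: algebra_simps)
  also have "\<dots> = mul (i * b) x \<ominus> mul b x" using x by (simp only: mul_add mul_neg)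
  finally show ?case using step2 x by (simp add: mul_pred)
qed

lemma mul_pos: assumes x: "x \<in> \<Gamma>" and pos: "\<zero> \<prec> x" and k: "k \<ge> 1" shows "\<zero> \<prec> mul k x"
  using k
proof (induction k rule: int_ge_induct)
  case base then show ?case using x pos by simp
next
  case (step i) then show ?case using x pos by (simp add: mul_Suc add_pos)
qed

lemma mul_less_iff: assumes x: "x \<in> \<Gamma>" and k: "k \<ge> 1"
  shows "\<zero> \<prec> mul k x \<longleftrightarrow> \<zero> \<prec> x" "mul k x \<prec> \<zero> \<longleftrightarrow> x \<prec> \<zero>" "mul k x = \<zero> \<longleftrightarrow> x = \<zero>"
proof -
  have n: "mul k x \<prec> \<zero>" if "x \<prec> \<zero>"
    using mul_pos[of "\<ominus> x" k] that x k by (simp add: mul_minus)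
  have p: "\<zero> \<prec> mul k x" if "\<zero> \<prec> x" using mul_pos[OF x that k] .
  have z: "mul k x = \<zero>" if "x = \<zero>" using that by simp
  have c: "x \<in> carrier M" "mul k x \<in> carrier M" "\<zero> \<in> carrier M" using x by (simp_all add: Gam_carrier)
  consider "x \<prec> \<zero>" | "x = \<zero>" | "\<zero> \<prec> x" using less_linear[OF c(1,3)] by blast
  then have "(\<zero> \<prec> mul k x \<longleftrightarrow> \<zero> \<prec> x) \<and> (mul k x \<prec> \<zero> \<longleftrightarrow> x \<prec> \<zero>) \<and> (mul k x = \<zero> \<longleftrightarrow> x = \<zero>)"
  proof cases
    case 1 then show ?thesis using n less_asym[OF _ c(1,3)] less_asym[OF _ c(2,3)] less_irrefl[OF c(3)] by metis
  next
    case 2 then show ?thesis using z less_irrefl[OF c(3)] by simp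
  next
    case 3 then show ?thesis using p less_asym[OF _ c(3,1)] less_asym[OF _ c(3,2)] less_irrefl[OF c(3)] by metis
  qed
  then show "\<zero> \<prec> mul k x \<longleftrightarrow> \<zero> \<prec> x" "mul k x \<prec> \<zero> \<longleftrightarrow> x \<prec> \<zero>" "mul k x = \<zero> \<longleftrightarrow> x = \<zero>"
    by blast+
qed

lemma mul_eq_zero [simp]: assumes x: "x \<in> \<Gamma>" shows "mul k x = \<zero> \<longleftrightarrow> k = 0 \<or> x = \<zero>"
  using mul_less_iff(3)[OF x, of k] mul_less_iff(3)[OF x, of "- k"] x by (cases "k > 0"; cases "k = 0") (auto simp: mul_neg)

lemma mul_cancel: assumes "x \<in> \<Gamma>" "y \<in> \<Gamma>" "k \<noteq> 0" shows "mul k x = mul k y \<longleftrightarrow> x = y"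
proof -
  have "mul k x \<ominus> mul k y = mul k (x \<ominus> y)" using assms by (simp add: mul_plus mul_minus)
  then have "mul k x = mul k y \<longleftrightarrow> mul k (x \<ominus> y) = \<zero>" using assms sub_eq_zero[of "mul k x" "mul k y"] by simp
  then show ?thesis using assms by simp
qed

lemma mul_delta [simp]: "x \<in> \<Gamma> \<Longrightarrow> mul (1 + int n) (\<delta> n x) = x"
proof -
  assume "x \<in> \<Gamma>"
  then have "c.nat_mult (Suc n) (\<delta> n x) = x"
    using log_structure unfolding log_structure_def Let_def Gam_def by blast
  then show ?thesis by (simp add: mul_def nat_add_distrib nmul_eq)
qed

lemma divisible: assumes "x \<in> \<Gamma>" "k \<noteq> 0" shows "\<exists>y\<in>\<Gamma>. mul k y = x"
proof (cases "k > 0")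
  case True
  then have "1 + int (nat (k - 1)) = k" by simp
  then show ?thesis using mul_delta[OF assms(1), of "nat (k - 1)"] assms by (metis closed(4))
next
  case False
  then have "1 + int (nat (- k - 1)) = - k" using assms by simp
  then have "mul k (\<ominus> \<delta> (nat (- k - 1)) x) = x"
    using mul_delta[OF assms(1), of "nat (- k - 1)"] assms by (simp add: mul_minus mul_neg)
  then show ?thesis using assms by (metis closed(3,4))
qed

end

section \<open>\<psi> as a valuation, the successor function and the set \<Psi>\<close>

context log_model
begin

lemma psi_closed [simp, intro]: "x \<in> carrier M \<Longrightarrow> \<psi> x \<in> carrier M"
  using c.psi_closed[of x] infty_rules(6,7) carrier[of x] carrier[of "\<infinity>"] by (cases "x = \<zero>") (auto simp: c.nonzero_def)

lemma psi_eq_infty [simp]: "x \<in> \<Gamma> \<Longrightarrow> \<psi> x = \<infinity> \<longleftrightarrow> x = \<zero>"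
  using c.psi_closed[of x] infty_notin by (cases "x = \<zero>") (auto simp: c.nonzero_def)

lemma psi_Gam [simp, intro]: "x \<in> \<Gamma> \<Longrightarrow> x \<noteq> \<zero> \<Longrightarrow> \<psi> x \<in> \<Gamma>"
  using c.psi_closed[of x] by (auto simp: c.nonzero_def)

lemma psi_Psi [simp, intro]: "x \<in> \<Gamma> \<Longrightarrow> x \<noteq> \<zero> \<Longrightarrow> \<psi> x \<in> \<Psi>"
  by (auto simp: Psis_def)

lemma psi_mul: "x \<in> \<Gamma> \<Longrightarrow> k \<noteq> 0 \<Longrightarrow> \<psi> (mul k x) = \<psi> x"
  using c.AC2[of x k] by (cases "x = \<zero>") (auto simp: c.nonzero_def mul_eq)

lemma psi_neg [simp]: "x \<in> \<Gamma> \<Longrightarrow> \<psi> (\<ominus> x) = \<psi> x"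
  using psi_mul[of x "-1"] by simp

text \<open>The convention \<open>\<psi> \<zero> = \<infinity>\<close> makes the ultrametric
  inequality hold without the exceptions of \<open>AC1\<close>.\<close>

lemma psi_add: assumes "x \<in> \<Gamma>" "y \<in> \<Gamma>" shows "\<psi> x \<preceq> \<psi> (x \<oplus> y) \<or> \<psi> y \<preceq> \<psi> (x \<oplus> y)"
proof (cases "x = \<zero> \<or> y = \<zero> \<or> x \<oplus> y = \<zero>")
  case True
  then show ?thesis using assms by fastforce
next
  case False
  then show ?thesis using c.AC1[of x y] assms by (auto simp: c.nonzero_def c.le_def)
qed

lemma psi_sub_swap: "x \<in> \<Gamma> \<Longrightarrow> y \<in> \<Gamma> \<Longrightarrow> \<psi> (x \<ominus> y) = \<psi> (y \<ominus> x)"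
  using psi_neg[of "x \<ominus> y"] by (simp add: ag)

text \<open>The standard valuation argument: the inequality that \<open>psi_add\<close> does not
  give at once comes from applying it to \<open>x = (x \<oplus> y) \<ominus> y\<close>.\<close>

lemma psi_add_eq: assumes "x \<in> \<Gamma>" "y \<in> \<Gamma>" "\<psi> x \<prec> \<psi> y" shows "\<psi> (x \<oplus> y) = \<psi> x"
proof -
  have c: "\<psi> x \<in> carrier M" "\<psi> y \<in> carrier M" "\<psi> (x \<oplus> y) \<in> carrier M" using assms by (auto simp: Gam_carrier)
  have "\<psi> x \<preceq> \<psi> (x \<oplus> y)" using psi_add[OF assms(1,2)] assms(3) c less_le_trans[of "\<psi> x" "\<psi> y" "\<psi> (x \<oplus> y)"] by blast
  moreover have "\<psi> (x \<oplus> y) \<preceq> \<psi> x"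
    using psi_add[of "x \<oplus> y" "\<ominus> y"] assms c by (auto simp: ag less_asym)
  ultimately show ?thesis using c le_antisym by blast
qed

lemma psi_add_eq': assumes "x \<in> \<Gamma>" "y \<in> \<Gamma>" "\<psi> y \<prec> \<psi> x" shows "\<psi> (x \<oplus> y) = \<psi> y"
  using psi_add_eq[of y x] assms by (simp add: ag)

lemma psi_sub_eq: assumes "x \<in> \<Gamma>" "y \<in> \<Gamma>" "\<psi> x \<prec> \<psi> y" shows "\<psi> (x \<ominus> y) = \<psi> x"
  using psi_add_eq[of x "\<ominus> y"] assms by simp

lemma psi_sub_eq': assumes "x \<in> \<Gamma>" "y \<in> \<Gamma>" "\<psi> y \<prec> \<psi> x" shows "\<psi> (x \<ominus> y) = \<psi> y"
  using psi_add_eq'[of x "\<ominus> y"] assms by simp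

lemma psi_antimono: assumes "x \<in> \<Gamma>" "y \<in> \<Gamma>" "\<zero> \<preceq> x" "x \<preceq> y" shows "\<psi> y \<preceq> \<psi> x"
proof (cases "x = \<zero>")
  case True
  then show ?thesis using assms by (cases "y = \<zero>") auto
next
  case False
  then show ?thesis using c.H_type assms unfolding c.H_type_def c.le_def by auto
qed

lemma psi_mono: assumes "x \<in> \<Gamma>" "y \<in> \<Gamma>" "y \<preceq> \<zero>" "x \<preceq> y" shows "\<psi> x \<preceq> \<psi> y"
  using psi_antimono[of "\<ominus> y" "\<ominus> x"] assms by auto

text \<open>By H-type a smaller value of \<psi> means a larger absolute value, so \<open>y\<close>
  is small compared with \<open>x\<close>.\<close>

lemma psi_less_imp: assumes "x \<in> \<Gamma>" "y \<in> \<Gamma>" "\<psi> x \<prec> \<psi> y" "\<zero> \<prec> x" shows "y \<prec> x" "\<ominus> x \<prec> y"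
proof -
  have "\<not> x \<preceq> y" "\<not> y \<preceq> \<ominus> x"
    using psi_antimono[of x y] psi_mono[of y "\<ominus> x"] assms less_asym[of "\<psi> x" "\<psi> y"]
    by (auto simp: Gam_carrier)
  then show "y \<prec> x" "\<ominus> x \<prec> y" using assms less_linear[of x y] less_linear[of y "\<ominus> x"] by auto
qed

text \<open>The summand with the smaller value dominates the other one in absolute value, hence
  decides the sign of the sum.\<close>

lemma add_sign: assumes "x \<in> \<Gamma>" "y \<in> \<Gamma>" "\<psi> x \<prec> \<psi> y"
  shows "\<zero> \<prec> x \<oplus> y \<longleftrightarrow> \<zero> \<prec> x" "x \<oplus> y \<noteq> \<zero>" "\<zero> \<prec> y \<oplus> x \<longleftrightarrow> \<zero> \<prec> x" "y \<oplus> x \<noteq> \<zero>"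
proof -
  have x0: "x \<noteq> \<zero>" using assms by auto
  show nz: "x \<oplus> y \<noteq> \<zero>" using psi_add_eq[OF assms] assms x0 psi_eq_infty[of x] infty_rules(6) by metis
  have pos: "\<zero> \<prec> u \<oplus> v" if "u \<in> \<Gamma>" "v \<in> \<Gamma>" "\<psi> u \<prec> \<psi> v" "\<zero> \<prec> u" for u v
    using psi_less_imp(2)[OF that] sub_pos[of "\<ominus> u" v] that by (simp add: ag)
  show p: "\<zero> \<prec> x \<oplus> y \<longleftrightarrow> \<zero> \<prec> x"
  proof
    assume a: "\<zero> \<prec> x \<oplus> y"
    show "\<zero> \<prec> x"
    proof (rule ccontr)
      assume "\<not> \<zero> \<prec> x"
      then have "\<zero> \<prec> \<ominus> x" using x0 less_linear[of x \<zero>] assms by (auto simp: Gam_carrier)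
      then have "\<zero> \<prec> \<ominus> x \<ominus> y" using pos[of "\<ominus> x" "\<ominus> y"] assms by simp
      then have "x \<oplus> y \<prec> \<zero>" using neg_pos[of "x \<oplus> y"] assms by (simp add: ag)
      then show False using a less_asym[of "x \<oplus> y" \<zero>] assms by (simp add: Gam_carrier)
    qed
  qed (use pos assms in blast)
  show "\<zero> \<prec> y \<oplus> x \<longleftrightarrow> \<zero> \<prec> x" "y \<oplus> x \<noteq> \<zero>" using p nz assms c.add_commute[of x y] by simp_all
qed

text \<open>Nonnegative summands cannot cancel: from \<open>x \<preceq> x \<oplus> y\<close> the
  value of the sum is at most \<open>\<psi> x\<close>, even when both values are equal.\<close>

lemma psi_add_pos: assumes "x \<in> \<Gamma>" "y \<in> \<Gamma>" "\<zero> \<preceq> x" "\<zero> \<preceq> y" "\<psi> x \<preceq> \<psi> y"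
  shows "\<psi> (x \<oplus> y) = \<psi> x"
proof -
  have "x \<preceq> x \<oplus> y" using assms add_less_cancel(2)[of \<zero> y x] by auto
  then have "\<psi> (x \<oplus> y) \<preceq> \<psi> x" using psi_antimono[of x "x \<oplus> y"] assms by auto
  moreover have "\<psi> x \<preceq> \<psi> (x \<oplus> y)" using psi_add[OF assms(1,2)] assms le_trans[of "\<psi> x" "\<psi> y" "\<psi> (x \<oplus> y)"] by auto
  ultimately show ?thesis using le_antisym[of "\<psi> (x \<oplus> y)" "\<psi> x"] assms by simp
qed

lemma psi_add_pos': assumes "x \<in> \<Gamma>" "y \<in> \<Gamma>" "\<zero> \<preceq> x" "\<zero> \<preceq> y" "\<psi> y \<preceq> \<psi> x"
  shows "\<psi> (x \<oplus> y) = \<psi> y"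
  using psi_add_pos[of y x] c.add_commute assms by metis

lemma Psi_Gam: "w \<in> \<Psi> \<Longrightarrow> w \<in> \<Gamma>" by (auto simp: Psis_def)

lemma Psi_carrier: "w \<in> \<Psi> \<Longrightarrow> w \<in> carrier M" by (simp add: Psi_Gam Gam_carrier)

lemma Psi_pos: "w \<in> \<Psi> \<Longrightarrow> \<exists>u\<in>\<Gamma>. \<zero> \<prec> u \<and> \<psi> u = w"
proof -
  assume "w \<in> \<Psi>"
  then obtain u where u: "u \<in> \<Gamma>" "u \<noteq> \<zero>" "\<psi> u = w" by (auto simp: Psis_def)
  show ?thesis
  proof (cases "\<zero> \<prec> u")
    case True then show ?thesis using u by blast
  next
    case False
    then have "\<zero> \<prec> \<ominus> u" using u less_linear[of u \<zero>] by (auto simp: Gam_carrier)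
    then show ?thesis using u by (intro bexI[of _ "\<ominus> u"]) auto
  qed
qed

lemma succ_eq: "x \<in> \<Gamma> \<Longrightarrow> \<s> x = c.succ x"
  using log_structure unfolding log_structure_def Let_def Gam_def by blast

lemma succ_add_psi: "x \<in> \<Gamma> \<Longrightarrow> x \<noteq> \<zero> \<Longrightarrow> \<s> (x \<oplus> \<psi> x) = \<psi> x"
  using c.succ_deriv[of x] succ_eq[of "x \<oplus> \<psi> x"] by (simp add: c.nonzero_def c.deriv_def)

text \<open>If \<open>\<alpha> = x \<ominus> w\<close> has value \<open>w\<close>, then
  \<open>\<alpha> \<oplus> \<psi> \<alpha> = x\<close>, so \<alpha> is the integral of
  \<open>x\<close>. Together with \<open>psi_sub_succ\<close> this characterizes
  \<open>\<s> x\<close> as the only \<open>w\<close> with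
  \<open>\<psi> (x \<ominus> w) = w\<close>.\<close>

lemma succ_unique: "x \<in> \<Gamma> \<Longrightarrow> w \<in> \<Gamma> \<Longrightarrow> \<psi> (x \<ominus> w) = w \<Longrightarrow> \<s> x = w"
  using succ_add_psi[of "x \<ominus> w"] by (cases "x = w") (auto simp: ag)

lemma int_ex: "x \<in> \<Gamma> \<Longrightarrow> \<exists>y\<in>\<Gamma>. y \<noteq> \<zero> \<and> y \<oplus> \<psi> y = x"
  using c.asymptotic_integration unfolding c.asymptotic_integration_def c.nonzero_def c.deriv_def by blast

lemma succ_Psi [simp, intro]: "x \<in> \<Gamma> \<Longrightarrow> \<s> x \<in> \<Psi>"
  using int_ex succ_add_psi psi_Psi by metis

lemma succ_Gam [simp, intro]: "x \<in> \<Gamma> \<Longrightarrow> \<s> x \<in> \<Gamma>"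
  using succ_Psi Psi_Gam by blast

lemma psi_sub_succ: "x \<in> \<Gamma> \<Longrightarrow> \<psi> (x \<ominus> \<s> x) = \<s> x"
  using int_ex[of x] succ_add_psi by (auto simp: ag)

lemma Psi_min: "w \<in> \<Psi> \<Longrightarrow> \<s> \<zero> \<preceq> w" "\<s> \<zero> \<in> \<Psi>" "\<zero> \<prec> \<s> \<zero>"
  using c.least_Psi c.succ_zero_pos by (simp_all add: Psi_eq c.le_def succ_eq)

lemma Psi_succ_less: "w \<in> \<Psi> \<Longrightarrow> w \<prec> \<s> w"
  using c.immediate_succ(2)[of w] by (simp add: Psi_eq succ_eq Psi_Gam)

lemma Psi_succ_le: "w \<in> \<Psi> \<Longrightarrow> v \<in> \<Psi> \<Longrightarrow> w \<prec> v \<Longrightarrow> \<s> w \<preceq> v"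
  using c.immediate_succ(3)[of w v] less_linear[of v "\<s> w"] succ_Gam[of w] by (auto simp: Psi_eq succ_eq Psi_Gam Psi_carrier)

lemma Psi_succ_inj: "w \<in> \<Psi> \<Longrightarrow> v \<in> \<Psi> \<Longrightarrow> \<s> w = \<s> v \<Longrightarrow> w = v"
  using c.bij_succ by (simp add: bij_betw_def inj_on_def Psi_eq succ_eq Psi_Gam)

lemma Psi_succ_mono: "w \<in> \<Psi> \<Longrightarrow> v \<in> \<Psi> \<Longrightarrow> \<s> w \<prec> \<s> v \<longleftrightarrow> w \<prec> v"
proof -
  have *: "\<s> w \<prec> \<s> v" if "w \<in> \<Psi>" "v \<in> \<Psi>" "w \<prec> v" for w v
    using that Psi_succ_le[OF that] Psi_succ_less[OF that(2)] le_less_trans by (auto simp: Psi_carrier Psi_Gam)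
  assume "w \<in> \<Psi>" "v \<in> \<Psi>"
  then show ?thesis using *[of w v] *[of v w] less_linear[of w v] less_asym[of "\<s> w" "\<s> v"] less_irrefl
    by (auto simp: Psi_carrier Psi_Gam)
qed

lemma Psi_above_eq: "c.Psi_above = {w \<in> \<Psi>. \<s> \<zero> \<prec> w}"
  by (simp add: c.Psi_above_def Psi_eq succ_eq)

lemma pred_eq: "x \<in> carrier M \<Longrightarrow> \<p> x = (if x \<in> c.Psi_above then c.pred x else \<infinity>)"
  using log_structure unfolding log_structure_def Let_def Gam_def by blast

lemma pred_succ [simp]: assumes "w \<in> \<Psi>" shows "\<p> (\<s> w) = w"
proof -
  have "\<s> w \<in> c.Psi_above" "inj_on c.succ c.Psi" using c.bij_succ assms by (auto simp: bij_betw_def Psi_eq succ_eq Psi_Gam)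
  then show ?thesis using assms pred_eq[of "\<s> w"]
      succ_Gam[OF Psi_Gam[OF assms]]
    by (simp add: Psi_Gam c.pred_def succ_eq the_inv_into_f_f Psi_eq)
qed

lemma Psi_pred_ex: "w \<in> \<Psi> \<Longrightarrow> w \<noteq> \<s> \<zero> \<Longrightarrow> \<exists>v\<in>\<Psi>. w = \<s> v"
proof -
  assume w: "w \<in> \<Psi>" "w \<noteq> \<s> \<zero>"
  then have "w \<in> c.Psi_above" using Psi_min(1)[of w] by (auto simp: Psi_above_eq)
  then show ?thesis using c.bij_succ w by (auto simp: bij_betw_def Psi_eq succ_eq Psi_Gam)
qed

lemma pred_infty: "x \<in> carrier M \<Longrightarrow> \<not> (x \<in> \<Psi> \<and> x \<noteq> \<s> \<zero>) \<Longrightarrow> \<p> x = \<infinity>"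
  by (simp add: pred_eq Psi_above_eq) (metis Psi_carrier Psi_min(2) less_irrefl)

lemma pred_Psi: assumes "w \<in> \<Psi>" "w \<noteq> \<s> \<zero>" shows "\<p> w \<in> \<Psi>" "\<s> (\<p> w) = w"
  using Psi_pred_ex[OF assms] by auto

lemma succ_notmin: "w \<in> \<Psi> \<Longrightarrow> \<s> w \<noteq> \<s> \<zero>"
  using Psi_succ_less[of w] Psi_min(1)[of w] less_asym[of w "\<s> w"] less_irrefl[of w] by (auto simp: Psi_carrier Psi_Gam)

lemma pred_carrier [simp, intro]: "x \<in> carrier M \<Longrightarrow> \<p> x \<in> carrier M"
  using pred_infty[of x] pred_Psi[of x] Psi_carrier carrier by metis

text \<open>Upper bound: \<open>w \<ominus> v\<close> is at least \<open>\<s> v \<ominus> v\<close>,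
  which has value \<open>\<s> v\<close>. Lower bound: \<open>AC3\<close> gives a value above
  \<open>v\<close>, and the next element of \<Psi> after \<open>v\<close> is
  \<open>\<s> v\<close>.\<close>

lemma psi_Psi_sub: assumes "v \<in> \<Psi>" "w \<in> \<Psi>" "v \<prec> w" shows "\<psi> (w \<ominus> v) = \<s> v"
proof -
  have G: "v \<in> \<Gamma>" "w \<in> \<Gamma>" "v \<in> carrier M" "w \<in> carrier M" "\<s> w \<in> \<Gamma>" using assms by (auto simp: Psi_Gam Psi_carrier)
  have vw: "\<s> v \<prec> \<s> w" using Psi_succ_mono[OF assms(1,2)] assms by simp
  have sv: "\<s> v \<preceq> w" using Psi_succ_le assms by blast
  show ?thesis
  proof (cases "w = \<s> v")
    case True
    then show ?thesis using psi_sub_succ[OF G(1)] psi_sub_swap[of w v] G by simp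
  next
    case False
    then have "\<s> v \<prec> w" using sv by blast
    have pos: "\<zero> \<prec> w \<ominus> v" using sub_pos G assms by simp
    have pos': "\<zero> \<preceq> \<s> v \<ominus> v" "\<s> v \<ominus> v \<preceq> w \<ominus> v"
      using sub_pos Psi_succ_less[OF assms(1)] G sv add_less_cancel(1)[of "\<s> v" w "\<ominus> v"] by auto
    have le: "\<psi> (w \<ominus> v) \<preceq> \<s> v"
      using psi_antimono[OF _ _ pos'] G psi_sub_succ[of v] psi_sub_swap[of "\<s> v" v] by simp
    have vw': "w \<noteq> v" using G assms(3) by auto
    \<comment> \<open>\<open>AC3\<close> for the positive element \<open>w \<ominus> v\<close>,
      tested against some \<open>u\<close> with value \<open>w\<close>.\<close>
    have "w \<prec> (w \<ominus> v) \<oplus> \<psi> (w \<ominus> v)"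
    proof -
      obtain u where "u \<in> \<Gamma>" "u \<noteq> \<zero>" "\<psi> u = w" using assms(2) by (auto simp: Psis_def)
      then show ?thesis using c.AC3[of "w \<ominus> v" u] pos G vw' by (auto simp: c.nonzero_def)
    qed
    then have "v \<prec> \<psi> (w \<ominus> v)"
      using add_less_cancel(1)[of v "\<psi> (w \<ominus> v)" "w \<ominus> v"] G vw' by (simp add: ag)
    then have "\<s> v \<preceq> \<psi> (w \<ominus> v)" using Psi_succ_le[OF assms(1)] G assms psi_Psi[of "w \<ominus> v"] by (metis less_irrefl sub_eq_zero closed(2,3))
    then show ?thesis using le less_asym G by (auto simp: Psi_carrier)
  qed
qed

lemma psi_Psi_sub': "v \<in> \<Psi> \<Longrightarrow> w \<in> \<Psi> \<Longrightarrow> v \<prec> w \<Longrightarrow> \<psi> (v \<ominus> w) = \<s> v"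
  using psi_Psi_sub psi_sub_swap[of v w] by (simp add: Psi_Gam)

text \<open>In \<open>x \<ominus> w = (x \<ominus> \<s> x) \<oplus> (\<s> x \<ominus> w)\<close> the
  summands have the values \<open>\<s> x\<close> and \<open>\<s> w\<close>, both above
  \<open>w\<close>.\<close>

lemma psi_sub_succ_gt: assumes "x \<in> \<Gamma>" "w \<in> \<Psi>" "w \<prec> \<s> x" shows "w \<prec> \<psi> (x \<ominus> w)"
proof -
  have G: "w \<in> \<Gamma>" using assms by (simp add: Psi_Gam)
  have *: "\<psi> (x \<ominus> \<s> x) \<preceq> \<psi> (x \<ominus> w) \<or> \<psi> (\<s> x \<ominus> w) \<preceq> \<psi> (x \<ominus> w)"
    using psi_add[of "x \<ominus> \<s> x" "\<s> x \<ominus> w"] assms G by (simp add: ag)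
  have "\<psi> (x \<ominus> \<s> x) = \<s> x" "\<psi> (\<s> x \<ominus> w) = \<s> w"
    using assms psi_sub_succ psi_Psi_sub by simp_all
  then show ?thesis using * assms Psi_succ_less[of w] G less_le_trans[of w "\<s> x" "\<psi> (x \<ominus> w)"]
      less_le_trans[of w "\<s> w" "\<psi> (x \<ominus> w)"] by auto
qed

text \<open>In \<open>x \<ominus> y = (\<s> y \<ominus> y) \<oplus> (x \<ominus> \<s> y)\<close> the
  first summand has value \<open>\<s> y\<close> and dominates. This and \<open>psi_less_psi\<close>
  have the same shape, which later allows \<psi> and \<open>\<s>\<close> to be treated by one
  argument.\<close>

lemma succ_less_psi: assumes "x \<in> \<Gamma>" "y \<in> \<Gamma>" "\<s> y \<prec> \<s> x"
  shows "\<psi> (x \<ominus> y) = \<s> y" "y \<prec> x \<longleftrightarrow> y \<prec> \<s> y"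
proof -
  define u v where "u = \<s> y \<ominus> y" and "v = x \<ominus> \<s> y"
  have uv: "u \<in> \<Gamma>" "v \<in> \<Gamma>" "u \<oplus> v = x \<ominus> y" "\<psi> u = \<s> y" "\<s> y \<prec> \<psi> v"
    using assms psi_sub_succ[of y] psi_sub_swap[of y "\<s> y"] psi_sub_succ_gt[of x "\<s> y"]
    by (auto simp: u_def v_def ag)
  then show "\<psi> (x \<ominus> y) = \<s> y" using psi_add_eq[of u v] by simp
  have "\<zero> \<prec> u \<oplus> v \<longleftrightarrow> \<zero> \<prec> u" using add_sign(1)[of u v] uv by simp
  then show "y \<prec> x \<longleftrightarrow> y \<prec> \<s> y" using uv assms by (simp add: u_def sub_pos)
qed

lemma psi_less_psi: assumes "x \<in> \<Gamma>" "y \<in> \<Gamma>" "\<psi> y \<prec> \<psi> x"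
  shows "\<psi> (x \<ominus> y) = \<psi> y" "y \<prec> x \<longleftrightarrow> y \<prec> \<zero>"
  using psi_sub_eq'[of x y] add_sign(1)[of "\<ominus> y" x] assms sub_pos[of y x] by (simp_all add: ag)

text \<open>An element \<open>w\<close> of \<Psi> above \<open>\<s> x\<close> makes
  \<open>\<s> x\<close> visible as a value of \<psi>: in \<open>w \<ominus> x = (\<s> x \<ominus> x)
  \<oplus> (w \<ominus> \<s> x)\<close> the first summand dominates.\<close>

lemma psi_sub_top: assumes "x \<in> \<Gamma>" "w \<in> \<Psi>" "\<s> x \<prec> w"
  shows "\<psi> (x \<ominus> w) = \<s> x" "x \<prec> w \<longleftrightarrow> x \<prec> \<s> x" "x \<noteq> w"
proof -
  define u v where "u = \<s> x \<ominus> x" and "v = w \<ominus> \<s> x"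
  have uv: "u \<in> \<Gamma>" "v \<in> \<Gamma>" "u \<oplus> v = w \<ominus> x" "\<psi> u = \<s> x" "\<psi> u \<prec> \<psi> v"
    using assms psi_sub_succ[of x] psi_sub_swap[of x "\<s> x"] psi_Psi_sub[of "\<s> x" w] Psi_succ_less[of "\<s> x"]
    by (auto simp: u_def v_def ag Psi_Gam)
  show "\<psi> (x \<ominus> w) = \<s> x" using psi_add_eq[of u v] uv psi_sub_swap[of x w] assms by (simp add: Psi_Gam)
  show "x \<prec> w \<longleftrightarrow> x \<prec> \<s> x"
    using add_sign(1)[of u v] uv assms sub_pos[of x w] sub_pos[of x "\<s> x"] by (simp add: u_def Psi_Gam)
  show "x \<noteq> w" using Psi_succ_less[of w] less_asym[of w "\<s> w"] assms by (auto simp: Psi_Gam)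
qed

text \<open>The converse reading of \<open>psi_sub_top\<close>: with
  \<open>y = \<psi> (x \<ominus> w)\<close>, replacing \<open>w\<close> by \<open>y\<close> adds
  \<open>w \<ominus> y\<close>, of value \<open>\<s> y\<close>, and does not change the value
  \<open>y\<close>; then \<open>succ_unique\<close> applies.\<close>

lemma succ_eq_psi_top: assumes "x \<in> \<Gamma>" "w \<in> \<Psi>" "\<psi> (x \<ominus> w) \<prec> w" shows "\<s> x = \<psi> (x \<ominus> w)"
proof -
  define y where "y = \<psi> (x \<ominus> w)"
  have "x \<noteq> w" using assms by (auto simp: Psi_Gam)
  then have y: "y \<in> \<Psi>" "y \<in> \<Gamma>" "w \<in> \<Gamma>" using assms by (simp_all add: y_def Psi_Gam)
  then have "y \<prec> \<psi> (w \<ominus> y)" using psi_Psi_sub[of y w] Psi_succ_less[of y] assms by (simp add: y_def)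
  then have "\<psi> ((x \<ominus> w) \<oplus> (w \<ominus> y)) = y" using psi_add_eq[of "x \<ominus> w" "w \<ominus> y"] assms y by (simp add: y_def)
  then have "\<psi> (x \<ominus> y) = y" using assms y by (simp add: ag)
  then show ?thesis using succ_unique[of x y] assms y by (simp add: y_def)
qed

text \<open>Membership in \<Psi> becomes an equation between terms, so it can occur in types and is
  decided by atomic formulas.\<close>

lemma Psi_iff: "x \<in> \<Gamma> \<Longrightarrow> x \<in> \<Psi> \<longleftrightarrow> \<p> (\<s> x) = x"
  using pred_succ[of x] pred_Psi(1)[of "\<s> x"] pred_infty[of "\<s> x"] succ_Gam[of x] infty_notin
  by (metis Gam_carrier)

end

section \<open>Partial isomorphisms of ordered groups\<close>

locale two_models = log_model M + N: log_model N
  for M :: "(log_fun, log_rel, 'm) fo_struct" (structure) and N :: "(log_fun, log_rel, 'n) fo_struct"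
begin

text \<open>Pure subgroups of \<open>\<Gamma> \<times> \<Gamma>\<^bsub>N\<^esub>\<close> that are graphs of order isomorphisms inducing \<open>T\<close> on the values of \<open>\<psi>\<close>.\<close>

definition good :: "('m \<times> 'n) set \<Rightarrow> ('m \<times> 'n) set \<Rightarrow> bool" where
  "good T R \<longleftrightarrow> R \<subseteq> \<Gamma> \<times> \<Gamma>\<^bsub>N\<^esub> \<and> (\<zero>, \<zero>\<^bsub>N\<^esub>) \<in> R \<and>
     (\<forall>x x' y y'. (x, x') \<in> R \<longrightarrow> (y, y') \<in> R \<longrightarrow> (x \<oplus> y, x' \<oplus>\<^bsub>N\<^esub> y') \<in> R) \<and>
     (\<forall>x x'. (x, x') \<in> R \<longrightarrow> (\<ominus> x, \<ominus>\<^bsub>N\<^esub> x') \<in> R) \<and>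
     (\<forall>x\<in>\<Gamma>. \<forall>x'\<in>\<Gamma>\<^bsub>N\<^esub>. \<forall>k\<ge>1. (mul k x, N.mul k x') \<in> R \<longrightarrow> (x, x') \<in> R) \<and>
     (\<forall>x x'. (x, x') \<in> R \<longrightarrow> (\<zero> \<prec> x \<longleftrightarrow> \<zero>\<^bsub>N\<^esub> \<prec>\<^bsub>N\<^esub> x') \<and> (x \<noteq> \<zero> \<longrightarrow> (\<psi> x, \<psi>\<^bsub>N\<^esub> x') \<in> T))"

lemma goodD:
  assumes "good T R" "(x, x') \<in> R"
  shows "x \<in> \<Gamma>" "x' \<in> \<Gamma>\<^bsub>N\<^esub>" "(\<ominus> x, \<ominus>\<^bsub>N\<^esub> x') \<in> R" "\<zero> \<prec> x \<longleftrightarrow> \<zero>\<^bsub>N\<^esub> \<prec>\<^bsub>N\<^esub> x'"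
    "x \<prec> \<zero> \<longleftrightarrow> x' \<prec>\<^bsub>N\<^esub> \<zero>\<^bsub>N\<^esub>" "x = \<zero> \<longleftrightarrow> x' = \<zero>\<^bsub>N\<^esub>" "x \<noteq> \<zero> \<Longrightarrow> (\<psi> x, \<psi>\<^bsub>N\<^esub> x') \<in> T"
    "(y, y') \<in> R \<Longrightarrow> (x \<oplus> y, x' \<oplus>\<^bsub>N\<^esub> y') \<in> R"
    "(y, y') \<in> R \<Longrightarrow> (x \<ominus> y, x' \<ominus>\<^bsub>N\<^esub> y') \<in> R"
proof -
  show m: "x \<in> \<Gamma>" "x' \<in> \<Gamma>\<^bsub>N\<^esub>" "(\<ominus> x, \<ominus>\<^bsub>N\<^esub> x') \<in> R" "\<zero> \<prec> x \<longleftrightarrow> \<zero>\<^bsub>N\<^esub> \<prec>\<^bsub>N\<^esub> x'"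
    and "x \<noteq> \<zero> \<Longrightarrow> (\<psi> x, \<psi>\<^bsub>N\<^esub> x') \<in> T"
    using assms unfolding good_def by auto
  show n: "x \<prec> \<zero> \<longleftrightarrow> x' \<prec>\<^bsub>N\<^esub> \<zero>\<^bsub>N\<^esub>"
    using assms m unfolding good_def by (metis neg_pos N.neg_pos)
  show "x = \<zero> \<longleftrightarrow> x' = \<zero>\<^bsub>N\<^esub>"
    using m n less_linear[of x \<zero>] N.less_linear[of x' "\<zero>\<^bsub>N\<^esub>"] by auto
  show "(y, y') \<in> R \<Longrightarrow> (x \<oplus> y, x' \<oplus>\<^bsub>N\<^esub> y') \<in> R" "(y, y') \<in> R \<Longrightarrow> (x \<ominus> y, x' \<ominus>\<^bsub>N\<^esub> y') \<in> R"
    using assms unfolding good_def by blast+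
qed

lemma good_pure:
  assumes g: "good T R" and "x \<in> \<Gamma>" "x' \<in> \<Gamma>\<^bsub>N\<^esub>" "k \<noteq> 0" "(mul k x, N.mul k x') \<in> R"
  shows "(x, x') \<in> R"
proof (cases "k > 0")
  case True
  then have "k \<ge> 1" by simp
  then show ?thesis using assms unfolding good_def by blast
next
  case False
  then have "(mul (- k) x, N.mul (- k) x') \<in> R" "- k \<ge> 1"
    using goodD(3)[OF g assms(5)] assms by (auto simp: mul_neg N.mul_neg)
  then show ?thesis using assms unfolding good_def by blast
qed

lemma good_order:
  assumes "good T R" "(x, x') \<in> R" "(y, y') \<in> R"
  shows "x \<prec> y \<longleftrightarrow> x' \<prec>\<^bsub>N\<^esub> y'" "x = y \<longleftrightarrow> x' = y'" "x \<noteq> y \<Longrightarrow> (\<psi> (x \<ominus> y), \<psi>\<^bsub>N\<^esub> (x' \<ominus>\<^bsub>N\<^esub> y')) \<in> T"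
proof -
  note m = goodD(1,2)[OF assms(1,2)] goodD(1,2)[OF assms(1,3)]
  note d = goodD(9)[OF assms(1,3,2)] goodD(9)[OF assms(1,2,3)]
  show "x \<prec> y \<longleftrightarrow> x' \<prec>\<^bsub>N\<^esub> y'" using goodD(4)[OF assms(1) d(1)] m by (simp add: sub_pos N.sub_pos)
  show "x = y \<longleftrightarrow> x' = y'" using goodD(6)[OF assms(1) d(2)] m by simp
  show "x \<noteq> y \<Longrightarrow> (\<psi> (x \<ominus> y), \<psi>\<^bsub>N\<^esub> (x' \<ominus>\<^bsub>N\<^esub> y')) \<in> T" using goodD(7)[OF assms(1) d(2)] m by simp
qed

lemma good_mul: "good T R \<Longrightarrow> (x, x') \<in> R \<Longrightarrow> (mul k x, N.mul k x') \<in> R"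
proof (induction k rule: int_induct[where k = 0])
  case base then show ?case unfolding good_def by simp
next
  case (step1 i)
  then show ?case using goodD(1,2)[OF step1(3,4)] goodD(8)[OF step1(3) step1(2)[OF step1(3,4)] step1(4)]
    by (simp add: mul_Suc N.mul_Suc)
next
  case (step2 i)
  then show ?case using goodD(1,2)[OF step2(3,4)] goodD(9)[OF step2(3) step2(2)[OF step2(3,4)] step2(4)]
    by (simp add: mul_pred N.mul_pred)
qed

text \<open>The pure subgroup generated by \<open>R\<close> and \<open>(b, b')\<close>: divisible
  groups have rational multiples, expressed here by clearing the denominator
  \<open>k\<close>.\<close>

definition span :: "('m \<times> 'n) set \<Rightarrow> 'm \<Rightarrow> 'n \<Rightarrow> ('m \<times> 'n) set" where
  "span R b b' = {(x, x'). x \<in> \<Gamma> \<and> x' \<in> \<Gamma>\<^bsub>N\<^esub> \<and> (\<exists>k m h h'. k \<ge> 1 \<and> (h, h') \<in> R \<and>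
     mul k x = h \<oplus> mul m b \<and> N.mul k x' = h' \<oplus>\<^bsub>N\<^esub> N.mul m b')}"

lemma spanI: "x \<in> \<Gamma> \<Longrightarrow> x' \<in> \<Gamma>\<^bsub>N\<^esub> \<Longrightarrow> k \<ge> 1 \<Longrightarrow> (h, h') \<in> R \<Longrightarrow> mul k x = h \<oplus> mul m b \<Longrightarrow>
    N.mul k x' = h' \<oplus>\<^bsub>N\<^esub> N.mul m b' \<Longrightarrow> (x, x') \<in> span R b b'"
  unfolding span_def by blast

text \<open>By divisibility and purity, \<open>h\<close> can be absorbed into the multiple of
  \<open>b\<close>. Every new element is thus a nonzero rational multiple of some
  \<open>b \<ominus> h\<close> and inherits its value, and its sign up to the sign of
  \<open>m\<close>.\<close>

lemma span_normal_form:
  assumes g: "good T R" and b: "b \<in> \<Gamma>" "b' \<in> \<Gamma>\<^bsub>N\<^esub>" and x: "(x, x') \<in> span R b b'" and n: "(x, x') \<notin> R"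
  obtains k m h h' where "k \<ge> 1" "m \<noteq> 0" "(h, h') \<in> R" "mul k x = mul m (b \<ominus> h)"
    "N.mul k x' = N.mul m (b' \<ominus>\<^bsub>N\<^esub> h')"
proof -
  from x obtain k m h h' where x': "x \<in> \<Gamma>" "x' \<in> \<Gamma>\<^bsub>N\<^esub>" and *: "k \<ge> 1" "(h, h') \<in> R"
     "mul k x = h \<oplus> mul m b" "N.mul k x' = h' \<oplus>\<^bsub>N\<^esub> N.mul m b'" unfolding span_def by blast
  note h = goodD(1-3)[OF g *(2)]
  have m: "m \<noteq> 0"
  proof
    assume "m = 0"
    then show False using good_pure[OF g x', of k] n * h by simp
  qed
  \<comment> \<open>Solving \<open>mul m l = \<ominus> h\<close> turns
    \<open>h \<oplus> mul m b\<close> into \<open>mul m (b \<ominus> l)\<close>; purity puts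
    \<open>(l, l')\<close> into \<open>R\<close>.\<close>
  obtain l l' where l: "l \<in> \<Gamma>" "mul m l = \<ominus> h" "l' \<in> \<Gamma>\<^bsub>N\<^esub>" "N.mul m l' = \<ominus>\<^bsub>N\<^esub> h'"
    using divisible[of "\<ominus> h" m] N.divisible[of "\<ominus>\<^bsub>N\<^esub> h'" m] h m by auto
  have "(l, l') \<in> R" using good_pure[OF g l(1,3) m] l h by simp
  moreover have "mul k x = mul m (b \<ominus> l)" "N.mul k x' = N.mul m (b' \<ominus>\<^bsub>N\<^esub> l')"
    using * l h b by (simp_all add: mul_plus mul_minus N.mul_plus N.mul_minus ag N.ag)
  ultimately show ?thesis using that *(1) m by blast
qed

lemma span_mono: "good T R \<Longrightarrow> R \<subseteq> span R b b'"
proof (rule subrelI)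
  fix x x' assume g: "good T R" and x: "(x, x') \<in> R"
  then show "(x, x') \<in> span R b b'" using goodD(1,2)[OF g x]
    by (intro spanI[where k = 1 and m = 0 and h = x and h' = x']) auto
qed

lemma span_gen: assumes g: "good T R" and b: "b \<in> \<Gamma>" "b' \<in> \<Gamma>\<^bsub>N\<^esub>" shows "(b, b') \<in> span R b b'"
  using g b by (intro spanI[where k = 1 and m = 1 and h = "\<zero>" and h' = "\<zero>\<^bsub>N\<^esub>"]) (auto simp: good_def)

text \<open>By the normal form, signs and values of all new elements are controlled by those of the
  differences \<open>b \<ominus> h\<close>, so it is enough that \<open>b\<close> and
  \<open>b'\<close> agree in their cuts and in these values.\<close>

lemma span_good:
  assumes g: "good T R" and b: "b \<in> \<Gamma>" "b' \<in> \<Gamma>\<^bsub>N\<^esub>"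
    and bR: "\<And>h h'. (h, h') \<in> R \<Longrightarrow> h \<noteq> b \<and> h' \<noteq> b' \<and> (h \<prec> b \<longleftrightarrow> h' \<prec>\<^bsub>N\<^esub> b') \<and>
       (\<psi> (b \<ominus> h), \<psi>\<^bsub>N\<^esub> (b' \<ominus>\<^bsub>N\<^esub> h')) \<in> T"
  shows "good T (span R b b')"
  unfolding good_def
proof (intro conjI allI impI ballI)
  show "span R b b' \<subseteq> \<Gamma> \<times> \<Gamma>\<^bsub>N\<^esub>" by (auto simp: span_def)
  show "(\<zero>, \<zero>\<^bsub>N\<^esub>) \<in> span R b b'" using span_mono[OF g] g unfolding good_def by blast
  fix x x' assume x: "(x, x') \<in> span R b b'"
  then obtain k m h h' where x': "x \<in> \<Gamma>" "x' \<in> \<Gamma>\<^bsub>N\<^esub>" and *: "k \<ge> 1" "(h, h') \<in> R"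
     "mul k x = h \<oplus> mul m b" "N.mul k x' = h' \<oplus>\<^bsub>N\<^esub> N.mul m b'" unfolding span_def by blast
  note h = goodD(1-3)[OF g *(2)]
  show "(\<ominus> x, \<ominus>\<^bsub>N\<^esub> x') \<in> span R b b'"
    using *(1) h b x'
    by (intro spanI[where k = k and m = "- m" and h = "\<ominus> h" and h' = "\<ominus>\<^bsub>N\<^esub> h'"])
      (simp_all add: mul_minus N.mul_minus *(3,4) mul_neg N.mul_neg ag N.ag)
  show "(x \<oplus> y, x' \<oplus>\<^bsub>N\<^esub> y') \<in> span R b b'" if y: "(y, y') \<in> span R b b'" for y y'
  proof -
    from y obtain k1 m1 g1 g1' where y': "y \<in> \<Gamma>" "y' \<in> \<Gamma>\<^bsub>N\<^esub>" and **: "k1 \<ge> 1" "(g1, g1') \<in> R"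
     "mul k1 y = g1 \<oplus> mul m1 b" "N.mul k1 y' = g1' \<oplus>\<^bsub>N\<^esub> N.mul m1 b'" unfolding span_def by blast
    note h1 = goodD(1-3)[OF g **(2)]
    let ?h = "mul k1 h \<oplus> mul k g1" and ?h' = "N.mul k1 h' \<oplus>\<^bsub>N\<^esub> N.mul k g1'"
    have "k * k1 \<ge> 1" using *(1) **(1) mult_mono[of 1 k 1 k1] by simp
    moreover have "(?h, ?h') \<in> R" using good_mul[OF g] *(2) **(2) goodD(8)[OF g] by blast
    moreover have "mul (k * k1) (x \<oplus> y) = ?h \<oplus> mul (k1 * m + k * m1) b"
    proof -
      have "mul (k * k1) (x \<oplus> y) = mul k1 (mul k x) \<oplus> mul k (mul k1 y)"
        using x' y' by (simp add: mul_plus mul_mult mult.commute flip: mul_mult)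
      then show ?thesis using h h1 b unfolding * ** by (simp add: mul_plus mul_add mul_mult ag)
    qed
    moreover have "N.mul (k * k1) (x' \<oplus>\<^bsub>N\<^esub> y') = ?h' \<oplus>\<^bsub>N\<^esub> N.mul (k1 * m + k * m1) b'"
    proof -
      have "N.mul (k * k1) (x' \<oplus>\<^bsub>N\<^esub> y') = N.mul k1 (N.mul k x') \<oplus>\<^bsub>N\<^esub> N.mul k (N.mul k1 y')"
        using x' y' by (simp add: N.mul_plus N.mul_mult mult.commute flip: N.mul_mult)
      then show ?thesis using h h1 b unfolding * ** by (simp add: N.mul_plus N.mul_add N.mul_mult N.ag)
    qed
    ultimately show ?thesis unfolding span_def using x' y' by blast
  qed
  show "\<zero> \<prec> x \<longleftrightarrow> \<zero>\<^bsub>N\<^esub> \<prec>\<^bsub>N\<^esub> x'" "x \<noteq> \<zero> \<Longrightarrow> (\<psi> x, \<psi>\<^bsub>N\<^esub> x') \<in> T"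
  proof -
    have "(\<zero> \<prec> x \<longleftrightarrow> \<zero>\<^bsub>N\<^esub> \<prec>\<^bsub>N\<^esub> x') \<and> (x \<noteq> \<zero> \<longrightarrow> (\<psi> x, \<psi>\<^bsub>N\<^esub> x') \<in> T)"
    proof (cases "(x, x') \<in> R")
      case True then show ?thesis using goodD[OF g] by blast
    next
      case False
      obtain k m h h' where **: "k \<ge> 1" "m \<noteq> 0" "(h, h') \<in> R" "mul k x = mul m (b \<ominus> h)"
        "N.mul k x' = N.mul m (b' \<ominus>\<^bsub>N\<^esub> h')" using span_normal_form[OF g b x False] by blast
      note h = goodD(1-3)[OF g **(3)]
      have "\<psi> x = \<psi> (b \<ominus> h)" "\<psi>\<^bsub>N\<^esub> x' = \<psi>\<^bsub>N\<^esub> (b' \<ominus>\<^bsub>N\<^esub> h')"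
        using psi_mul[of x k] psi_mul[of "b \<ominus> h" m] N.psi_mul[of x' k] N.psi_mul[of "b' \<ominus>\<^bsub>N\<^esub> h'" m] ** x' b h by auto
      moreover have "\<zero> \<prec> x \<longleftrightarrow> \<zero> \<prec> mul m (b \<ominus> h)" "\<zero>\<^bsub>N\<^esub> \<prec>\<^bsub>N\<^esub> x' \<longleftrightarrow> \<zero>\<^bsub>N\<^esub> \<prec>\<^bsub>N\<^esub> N.mul m (b' \<ominus>\<^bsub>N\<^esub> h')"
        using mul_less_iff(1)[of x k] N.mul_less_iff(1)[of x' k] ** x' by auto
      moreover have "\<zero> \<prec> mul m (b \<ominus> h) \<longleftrightarrow> \<zero>\<^bsub>N\<^esub> \<prec>\<^bsub>N\<^esub> N.mul m (b' \<ominus>\<^bsub>N\<^esub> h')"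
      proof (cases "m > 0")
        case True
        then show ?thesis using mul_less_iff(1)[of "b \<ominus> h" m] N.mul_less_iff(1)[of "b' \<ominus>\<^bsub>N\<^esub> h'" m]
          bR[OF **(3)] h b by (simp add: sub_pos N.sub_pos)
      next
        case False
        have "b \<prec> h \<longleftrightarrow> b' \<prec>\<^bsub>N\<^esub> h'" using bR[OF **(3)] h b less_linear[of b h] N.less_linear[of b' h']
          less_asym[of b h] N.less_asym[of b' h'] by auto
        then show ?thesis using mul_less_iff(2)[of "b \<ominus> h" "- m"] N.mul_less_iff(2)[of "b' \<ominus>\<^bsub>N\<^esub> h'" "- m"]
          False **(2) h b by (simp add: sub_neg N.sub_neg mul_neg N.mul_neg)
      qed
      ultimately show ?thesis using bR[OF **(3)] by simp
    qed
    then show "\<zero> \<prec> x \<longleftrightarrow> \<zero>\<^bsub>N\<^esub> \<prec>\<^bsub>N\<^esub> x'" "x \<noteq> \<zero> \<Longrightarrow> (\<psi> x, \<psi>\<^bsub>N\<^esub> x') \<in> T" by blast+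
  qed
next
  fix x x' and k :: int assume x: "x \<in> \<Gamma>" "x' \<in> \<Gamma>\<^bsub>N\<^esub>" "1 \<le> k" "(mul k x, N.mul k x') \<in> span R b b'"
  then obtain l m h h' where *: "l \<ge> 1" "(h, h') \<in> R" "mul l (mul k x) = h \<oplus> mul m b"
    "N.mul l (N.mul k x') = h' \<oplus>\<^bsub>N\<^esub> N.mul m b'" unfolding span_def by blast
  moreover have "l * k \<ge> 1" using *(1) x(3) mult_mono[of 1 l 1 k] by simp
  moreover have "mul (l * k) x = mul l (mul k x)" "N.mul (l * k) x' = N.mul l (N.mul k x')"
    using x by (simp_all add: mul_mult N.mul_mult)
  ultimately show "(x, x') \<in> span R b b'" unfolding span_def using x by auto
qed

end

section \<open>Countable saturation\<close>

text \<open>Zorn's lemma takes the place of an enumeration of \<open>A\<close>. Only relations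
  containing \<open>R0\<close> compete, so that the extension step may rely on what
  \<open>R0\<close> already provides.\<close>

lemma extend_relation:
  assumes P0: "P R0"
    and chain: "\<And>C. C \<noteq> {} \<Longrightarrow> subset.chain {R. P R \<and> R0 \<subseteq> R} C \<Longrightarrow> P (\<Union>C)"
    and ext: "\<And>R x. P R \<Longrightarrow> R0 \<subseteq> R \<Longrightarrow> x \<in> A \<Longrightarrow> x \<notin> Domain R \<Longrightarrow> \<exists>R'. P R' \<and> R \<subseteq> R' \<and> x \<in> Domain R'"
  shows "\<exists>R. P R \<and> R0 \<subseteq> R \<and> A \<subseteq> Domain R"
proof -
  have "\<exists>R\<in>{R. P R \<and> R0 \<subseteq> R}. \<forall>S\<in>{R. P R \<and> R0 \<subseteq> R}. R \<subseteq> S \<longrightarrow> S = R"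
  proof (rule subset_Zorn_nonempty)
    fix C assume C: "C \<noteq> {}" "subset.chain {R. P R \<and> R0 \<subseteq> R} C"
    then obtain S where "S \<in> C" "R0 \<subseteq> S" unfolding subset.chain_def by auto
    then have "R0 \<subseteq> \<Union>C" by auto
    then show "\<Union>C \<in> {R. P R \<and> R0 \<subseteq> R}" using chain[OF C] by blast
  qed (use P0 in auto)
  then obtain R where R: "P R" "R0 \<subseteq> R" and max: "\<forall>S. P S \<and> R0 \<subseteq> S \<and> R \<subseteq> S \<longrightarrow> S = R" by auto
  have "A \<subseteq> Domain R"
  proof
    fix x assume "x \<in> A"
    show "x \<in> Domain R"
    proof (rule ccontr)
      assume "x \<notin> Domain R"
      then obtain R' where R': "P R'" "R \<subseteq> R'" "x \<in> Domain R'" using ext[OF R \<open>x \<in> A\<close>] by blast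
      then have "R' = R" using max R by auto
      then show False using R' \<open>x \<notin> Domain R\<close> by simp
    qed
  qed
  then show ?thesis using R by blast
qed

lemma chain_Union2:
  assumes "subset.chain A C" "x \<in> \<Union>C" "y \<in> \<Union>C"
  shows "\<exists>R\<in>C. x \<in> R \<and> y \<in> R"
  using assms unfolding subset.chain_def subset_chain_def by blast

text \<open>Countably many formulas suffice for the back-and-forth because the language is
  countable. In this form the property holds both for monster models and for ultrapowers along
  suitable ultrafilters on the natural numbers.\<close>

definition countably_saturated :: "('f, 'r) language \<Rightarrow> ('f, 'r, 'm) fo_struct \<Rightarrow> bool" where
  "countably_saturated L M \<longleftrightarrow>
     (\<forall>\<Phi>. countable \<Phi> \<and> \<Phi> \<subseteq> {(\<phi>, bs). set bs \<subseteq> carrier M \<and> formula_in L (Suc (length bs)) \<phi>} \<longrightarrow>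
        (\<forall>F \<subseteq> \<Phi>. finite F \<longrightarrow> (\<exists>x\<in>carrier M. \<forall>(\<phi>, bs)\<in>F. holds M \<phi> (x # bs))) \<longrightarrow>
        (\<exists>x\<in>carrier M. \<forall>(\<phi>, bs)\<in>\<Phi>. holds M \<phi> (x # bs)))"

lemma countably_saturatedD:
  assumes "countably_saturated L M" "countable \<Phi>"
    "\<And>\<phi> bs. (\<phi>, bs) \<in> \<Phi> \<Longrightarrow> set bs \<subseteq> carrier M \<and> formula_in L (Suc (length bs)) \<phi>"
    "\<And>F. F \<subseteq> \<Phi> \<Longrightarrow> finite F \<Longrightarrow> \<exists>x\<in>carrier M. \<forall>(\<phi>, bs)\<in>F. holds M \<phi> (x # bs)"
  shows "\<exists>x\<in>carrier M. \<forall>(\<phi>, bs)\<in>\<Phi>. holds M \<phi> (x # bs)"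
proof -
  have "\<Phi> \<subseteq> {(\<phi>, bs). set bs \<subseteq> carrier M \<and> formula_in L (Suc (length bs)) \<phi>}" using assms(3) by auto
  then show ?thesis using assms unfolding countably_saturated_def by blast
qed

lemma L_log_simps [simp]: "fun_arity L_log = log_fun_arity" "rel_arity L_log r = 2"
  by (simp_all add: L_log_def)

context log_model
begin

lemma finite_max: assumes "finite A" "A \<noteq> {}" "A \<subseteq> carrier M" shows "\<exists>m\<in>A. \<forall>a\<in>A. a \<preceq> m"
  using assms
proof (induction A rule: finite_ne_induct)
  case (insert x F)
  then obtain m where m: "m \<in> F" "\<forall>a\<in>F. a \<preceq> m" by auto
  have c: "x \<in> carrier M" "m \<in> carrier M" "F \<subseteq> carrier M" using insert m by auto
  show ?case
  proof (cases "x \<preceq> m")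
    case True then show ?thesis using m by blast
  next
    case False
    then have mx: "m \<prec> x" using c less_linear[of x m] by blast
    have "a \<preceq> x" if "a \<in> F" for a
      using le_less_trans[of a m x] m that c mx by blast
    then show ?thesis by blast
  qed
qed auto

lemma finite_min: assumes "finite A" "A \<noteq> {}" "A \<subseteq> carrier M" shows "\<exists>m\<in>A. \<forall>a\<in>A. m \<preceq> a"
  using assms
proof (induction A rule: finite_ne_induct)
  case (insert x F)
  then obtain m where m: "m \<in> F" "\<forall>a\<in>F. m \<preceq> a" by auto
  have c: "x \<in> carrier M" "m \<in> carrier M" "F \<subseteq> carrier M" using insert m by auto
  show ?case
  proof (cases "m \<preceq> x")
    case True then show ?thesis using m by blast
  next
    case False
    then have mx: "x \<prec> m" using c less_linear[of x m] by blast
    have "x \<preceq> a" if "a \<in> F" for a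
      using less_le_trans[of x m a] m that c mx by blast
    then show ?thesis by blast
  qed
qed auto

text \<open>Finitely many of the conditions are met by \<open>\<s> m\<close>, where \<open>m\<close>
  is the largest element of \<open>A\<close> involved: it lies above \<open>m\<close>, and below
  \<open>B\<close> by assumption. With \<open>B\<close> empty this yields elements of \<Psi> above
  any nonempty countable subset of \<Psi>.\<close>

lemma saturated_Psi_cut:
  assumes sat: "countably_saturated L_log M" and A: "countable A" "A \<subseteq> \<Psi>" "A \<noteq> {}" and B: "countable B" "B \<subseteq> \<Psi>"
    and AB: "\<And>a b. a \<in> A \<Longrightarrow> b \<in> B \<Longrightarrow> \<s> a \<prec> b"
  shows "\<exists>z\<in>\<Psi>. (\<forall>a\<in>A. a \<prec> z) \<and> (\<forall>b\<in>B. z \<prec> b)"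
proof -
  \<comment> \<open>\<open>Psi_iff\<close> as a formula; the value \<open>\<infinity>\<close> also
    solves the equation and has to be excluded.\<close>
  define P :: log_fm where "P = And (tPred (tSucc X) [=] X) (Neg (X [=] tInf))"
  define \<Phi> where "\<Phi> = {(P, [])} \<union> (\<lambda>a. (Y [<] X, [a])) ` A \<union> (\<lambda>b. (X [<] Y, [b])) ` B"
  have c: "A \<subseteq> carrier M" "B \<subseteq> carrier M" using A B Psi_carrier by auto
  have P: "holds M P [z] \<longleftrightarrow> z \<in> \<Psi>" if "z \<in> carrier M" for z
    using that Psi_iff[of z] Psi_Gam[of z] carrier[of z] by (auto simp: P_def holds_def)
  have "\<exists>x\<in>carrier M. \<forall>(\<phi>, bs)\<in>\<Phi>. holds M \<phi> (x # bs)"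
  proof (rule countably_saturatedD[OF sat])
    show "countable \<Phi>" using A B by (simp add: \<Phi>_def)
    show "set bs \<subseteq> carrier M \<and> formula_in L_log (Suc (length bs)) \<phi>" if "(\<phi>, bs) \<in> \<Phi>" for \<phi> bs
      using that c by (auto simp: \<Phi>_def P_def formula_in_def And_def Neg_def)
    fix F assume F: "F \<subseteq> \<Phi>" "finite F"
    obtain a0 where a0: "a0 \<in> A" using A by blast
    \<comment> \<open>The element \<open>a0\<close> keeps the set nonempty when \<open>F\<close>
      contains no condition from \<open>A\<close>.\<close>
    define A0 where "A0 = insert a0 {a \<in> A. (Y [<] X, [a]) \<in> F}"
    have "finite {a \<in> A. (Y [<] X, [a]) \<in> F}"
      by (rule finite_subset[OF _ finite_vimageI[OF F(2), of "\<lambda>a. (Y [<] X, [a])"]]) (auto simp: inj_on_def)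
    then obtain m where m: "m \<in> A0" "\<forall>a\<in>A0. a \<preceq> m" using finite_max[of A0] c a0 by (auto simp: A0_def)
    have mA: "m \<in> A" "m \<in> \<Psi>" "m \<in> \<Gamma>" using m A a0 Psi_Gam by (auto simp: A0_def)
    have "holds M \<phi> (\<s> m # bs)" if "(\<phi>, bs) \<in> F" for \<phi> bs
    proof -
      have "(\<phi>, bs) \<in> \<Phi>" using F that by blast
      then consider "\<phi> = P" "bs = []" | a where "a \<in> A" "\<phi> = (Y [<] X)" "bs = [a]"
        | b where "b \<in> B" "\<phi> = (X [<] Y)" "bs = [b]" unfolding \<Phi>_def by blast
      then show ?thesis
      proof cases
        case 1 then show ?thesis using P mA by simp
      next
        case 2
        then have "a \<preceq> m" using m that by (auto simp: A0_def)
        then have "a \<prec> \<s> m" using Psi_succ_less[of m] mA le_less_trans[of a m "\<s> m"] 2 c by auto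
        then show ?thesis using 2 by (simp add: holds_def)
      next
        case 3 then show ?thesis using AB mA by (simp add: holds_def)
      qed
    qed
    then show "\<exists>x\<in>carrier M. \<forall>(\<phi>, bs)\<in>F. holds M \<phi> (x # bs)"
      using mA by (intro bexI[of _ "\<s> m"]) auto
  qed
  then obtain z where z: "z \<in> carrier M" "\<And>\<phi> bs. (\<phi>, bs) \<in> \<Phi> \<Longrightarrow> holds M \<phi> (z # bs)" by blast
  have "holds M P [z]" "\<And>a. a \<in> A \<Longrightarrow> holds M (Y [<] X) [z, a]" "\<And>b. b \<in> B \<Longrightarrow> holds M (X [<] Y) [z, b]"
    using z(2) by (simp_all add: \<Phi>_def)
  then show ?thesis using P[OF z(1)] by (auto simp: holds_def)
qed

text \<open>A triple \<open>(h, w, c)\<close> prescribes the value of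
  \<open>\<psi> (z \<ominus> h)\<close> and, by the truth value \<open>c\<close>, the side of
  \<open>h\<close> on which \<open>z\<close> lies. These data turn out to determine how
  \<open>z\<close> extends a partial isomorphism.\<close>

lemma saturated_psi_type:
  assumes sat: "countably_saturated L_log M" and Q: "countable Q" "Q \<noteq> {}"
    and QM: "\<And>h w c. (h, w, c) \<in> Q \<Longrightarrow> h \<in> \<Gamma> \<and> w \<in> \<Gamma>"
    and fin: "\<And>F. F \<subseteq> Q \<Longrightarrow> finite F \<Longrightarrow> F \<noteq> {} \<Longrightarrow> \<exists>z\<in>\<Gamma>. \<forall>(h, w, c)\<in>F. \<psi> (z \<ominus> h) = w \<and> (h \<prec> z \<longleftrightarrow> c)"
  shows "\<exists>z\<in>\<Gamma>. \<forall>(h, w, c)\<in>Q. \<psi> (z \<ominus> h) = w \<and> (h \<prec> z \<longleftrightarrow> c)"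
proof -
  define \<chi> :: "bool \<Rightarrow> log_fm" where "\<chi> = (\<lambda>c. And (tPsi (X [+] tNeg Y) [=] Z) (if c then Y [<] X else Neg (Y [<] X)))"
  define f where "f = (\<lambda>(h :: 'm, w :: 'm, c). (\<chi> c, [h, w]))"
  have h: "holds M (\<chi> c) [z, h, w] \<longleftrightarrow> \<psi> (z \<ominus> h) = w \<and> (h \<prec> z \<longleftrightarrow> c)" for z h w c
    by (auto simp: \<chi>_def holds_def)
  have inj: "inj f" by (auto simp: inj_on_def f_def \<chi>_def And_def Neg_def split: if_splits)
  have "\<exists>x\<in>carrier M. \<forall>(\<phi>, bs)\<in>f ` Q. holds M \<phi> (x # bs)"
  proof (rule countably_saturatedD[OF sat])
    show "countable (f ` Q)" using Q by simp
    show "set bs \<subseteq> carrier M \<and> formula_in L_log (Suc (length bs)) \<phi>" if "(\<phi>, bs) \<in> f ` Q" for \<phi> bs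
    proof -
      from that obtain h w c where "(h, w, c) \<in> Q" "(\<phi>, bs) = f (h, w, c)" by auto
      then show ?thesis using QM[of h w c] by (auto simp: f_def \<chi>_def formula_in_def And_def Neg_def)
    qed
    fix F assume F: "F \<subseteq> f ` Q" "finite F"
    then obtain G where G: "finite G" "G \<subseteq> Q" "F = f ` G" using finite_subset_image by metis
    obtain q where q: "q \<in> Q" using Q by blast
    obtain z where z: "z \<in> \<Gamma>" "\<forall>(h, w, c)\<in>insert q G. \<psi> (z \<ominus> h) = w \<and> (h \<prec> z \<longleftrightarrow> c)"
      using fin[of "insert q G"] G q by auto
    then show "\<exists>x\<in>carrier M. \<forall>(\<phi>, bs)\<in>F. holds M \<phi> (x # bs)"
      using h unfolding G(3) by (intro bexI[of _ z]) (auto simp: f_def)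
  qed
  then obtain z where z: "z \<in> carrier M" and *: "\<forall>(\<phi>, bs)\<in>f ` Q. holds M \<phi> (z # bs)" by blast
  have z2: "\<psi> (z \<ominus> h) = w \<and> (h \<prec> z \<longleftrightarrow> c)" if "(h, w, c) \<in> Q" for h w c
  proof -
    have "(\<chi> c, [h, w]) \<in> f ` Q" using that by (force simp: f_def)
    then have "holds M (\<chi> c) [z, h, w]" using * by blast
    then show ?thesis by (simp only: h)
  qed
  obtain h w c where q: "(h, w, c) \<in> Q" using Q by auto
  \<comment> \<open>A single triple rules out \<open>\<infinity>\<close>, since
    \<open>\<psi> (\<infinity> \<ominus> h) = \<infinity>\<close> while the prescribed
    \<open>w\<close> is in \<Gamma>.\<close>
  have "z \<noteq> \<infinity>" using z2[OF q] QM[OF q] by auto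
  then show ?thesis using z z2 carrier[of z] by (intro bexI[of _ z]) auto
qed

end

section \<open>Isomorphisms between parts of \<open>\<Psi>\<close>\<close>

context log_model
begin

text \<open>The elements of \<open>\<Psi>\<close> at finite distance from \<open>w\<close>, indexed by the integers.\<close>

definition shift :: "int \<Rightarrow> 'm \<Rightarrow> 'm" where
  "shift k w = (if 0 \<le> k then ((\<lambda>x. \<s> x) ^^ nat k) w else ((\<lambda>x. \<p> x) ^^ nat (- k)) w)"

lemma infty_eq_psi [simp]: "x \<in> \<Gamma> \<Longrightarrow> \<infinity> = \<psi> x \<longleftrightarrow> x = \<zero>"
  using psi_eq_infty by metis

lemma shift_simps: "shift 0 w = w" "0 \<le> k \<Longrightarrow> shift (k + 1) w = \<s> (shift k w)"
    "k \<le> 0 \<Longrightarrow> shift (k - 1) w = \<p> (shift k w)"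
proof -
  show "shift 0 w = w" by (simp add: shift_def)
  show "0 \<le> k \<Longrightarrow> shift (k + 1) w = \<s> (shift k w)"
    by (simp add: shift_def nat_add_distrib)
  assume k: "k \<le> 0"
  then have "nat (1 - k) = Suc (nat (- k))" by simp
  then show "shift (k - 1) w = \<p> (shift k w)" using k by (cases "k = 0") (simp_all add: shift_def)
qed

text \<open>On the negative side the orbit is built by \<open>\<p>\<close>. As it stays in \<Psi>
  and avoids the least element, each application of \<open>\<p>\<close> is undone by
  \<open>\<s>\<close>.\<close>

lemma shift_Suc:
  assumes "\<And>k. shift k w \<in> \<Psi> \<and> shift k w \<noteq> \<s> \<zero>"
  shows "shift (k + 1) w = \<s> (shift k w)"
proof (cases "0 \<le> k")
  case True then show ?thesis by (rule shift_simps(2))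
next
  case False
  then have "shift k w = \<p> (shift (k + 1) w)" using shift_simps(3)[of "k + 1" w] by simp
  then show ?thesis using pred_Psi(2)[of "shift (k + 1) w"] assms by metis
qed

lemma shift_less:
  assumes "\<And>k. shift k w \<in> \<Psi> \<and> shift k w \<noteq> \<s> \<zero>"
  shows "shift i w \<prec> shift j w \<longleftrightarrow> i < j"
proof -
  have 1: "shift i w \<prec> shift j w" if "i + 1 \<le> j" for i j
    using that
  proof (induction j rule: int_ge_induct)
    case base
    show ?case unfolding shift_Suc[OF assms] using assms[of i] Psi_succ_less by blast
  next
    case (step j)
    have "shift j w \<prec> shift (j + 1) w" unfolding shift_Suc[OF assms] using assms[of j] Psi_succ_less by blast
    then show ?case using step less_trans[of "shift i w" "shift j w" "shift (j + 1) w"] assms Psi_carrier by blast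
  qed
  have c: "shift k w \<in> carrier M" for k using assms Psi_carrier by blast
  show ?thesis
    using 1[of i j] 1[of j i] less_asym[OF _ c c, of i j] less_irrefl[OF c, of i] by (cases i j rule: linorder_cases) auto
qed

end

context two_models
begin

definition Psi_iso :: "('m \<times> 'n) set \<Rightarrow> bool" where
  "Psi_iso T \<longleftrightarrow> T \<subseteq> \<Psi> \<times> \<Psi>\<^bsub>N\<^esub> \<and> (\<s> \<zero>, \<s>\<^bsub>N\<^esub> \<zero>\<^bsub>N\<^esub>) \<in> T \<and>
     (\<forall>x x' y y'. (x, x') \<in> T \<longrightarrow> (y, y') \<in> T \<longrightarrow> (x \<prec> y \<longleftrightarrow> x' \<prec>\<^bsub>N\<^esub> y')) \<and>
     (\<forall>x x'. (x, x') \<in> T \<longrightarrow> (\<s> x, \<s>\<^bsub>N\<^esub> x') \<in> T \<and> (x \<noteq> \<s> \<zero> \<longrightarrow> (\<p> x, \<p>\<^bsub>N\<^esub> x') \<in> T))"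

lemma Psi_isoD:
  assumes "Psi_iso T" "(x, x') \<in> T"
  shows "x \<in> \<Psi>" "x' \<in> \<Psi>\<^bsub>N\<^esub>" "x \<in> \<Gamma>" "x' \<in> \<Gamma>\<^bsub>N\<^esub>" "(\<s> x, \<s>\<^bsub>N\<^esub> x') \<in> T" "x \<noteq> \<s> \<zero> \<Longrightarrow> (\<p> x, \<p>\<^bsub>N\<^esub> x') \<in> T"
    "(y, y') \<in> T \<Longrightarrow> x \<prec> y \<longleftrightarrow> x' \<prec>\<^bsub>N\<^esub> y'" "(y, y') \<in> T \<Longrightarrow> x = y \<longleftrightarrow> x' = y'"
    "x = \<s> \<zero> \<longleftrightarrow> x' = \<s>\<^bsub>N\<^esub> \<zero>\<^bsub>N\<^esub>"
proof -
  show x: "x \<in> \<Psi>" "x' \<in> \<Psi>\<^bsub>N\<^esub>" "(\<s> x, \<s>\<^bsub>N\<^esub> x') \<in> T" "x \<noteq> \<s> \<zero> \<Longrightarrow> (\<p> x, \<p>\<^bsub>N\<^esub> x') \<in> T"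
    using assms unfolding Psi_iso_def by auto
  show "x \<in> \<Gamma>" "x' \<in> \<Gamma>\<^bsub>N\<^esub>" using x Psi_Gam N.Psi_Gam by auto
  show *: "x \<prec> y \<longleftrightarrow> x' \<prec>\<^bsub>N\<^esub> y'" if "(y, y') \<in> T" for y y' using assms that unfolding Psi_iso_def by blast
  show **: "x = y \<longleftrightarrow> x' = y'" if y: "(y, y') \<in> T" for y y'
  proof -
    have "y \<prec> x \<longleftrightarrow> y' \<prec>\<^bsub>N\<^esub> x'" "y \<in> \<Psi>" "y' \<in> \<Psi>\<^bsub>N\<^esub>" using assms y unfolding Psi_iso_def by blast+
    then show ?thesis using *[OF y] less_linear[of x y] N.less_linear[of x' y'] x less_irrefl N.less_irrefl Psi_carrier N.Psi_carrier
      by metis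
  qed
  show "x = \<s> \<zero> \<longleftrightarrow> x' = \<s>\<^bsub>N\<^esub> \<zero>\<^bsub>N\<^esub>" using ** assms(1) unfolding Psi_iso_def by blast
qed

definition same_cut :: "('m \<times> 'n) set \<Rightarrow> 'm \<Rightarrow> 'n \<Rightarrow> bool" where
  "same_cut T w w' \<longleftrightarrow> w \<in> \<Psi> \<and> w' \<in> \<Psi>\<^bsub>N\<^esub> \<and>
     (\<forall>y y'. (y, y') \<in> T \<longrightarrow> w \<noteq> y \<and> w' \<noteq> y' \<and> (w \<prec> y \<longleftrightarrow> w' \<prec>\<^bsub>N\<^esub> y') \<and> (y \<prec> w \<longleftrightarrow> y' \<prec>\<^bsub>N\<^esub> w'))"

lemma same_cutI:
  assumes "w \<in> \<Psi>" "w' \<in> \<Psi>\<^bsub>N\<^esub>" "Psi_iso T"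
    "\<And>y y'. (y, y') \<in> T \<Longrightarrow> w \<noteq> y \<and> w' \<noteq> y' \<and> (w \<prec> y \<longleftrightarrow> w' \<prec>\<^bsub>N\<^esub> y')"
  shows "same_cut T w w'"
  unfolding same_cut_def
proof (intro conjI allI impI)
  fix y y' assume y: "(y, y') \<in> T"
  have c: "w \<in> carrier M" "y \<in> carrier M" "w' \<in> carrier N" "y' \<in> carrier N"
    using assms(1,2) Psi_isoD(1,2)[OF assms(3) y] Psi_carrier N.Psi_carrier by auto
  show "y \<prec> w \<longleftrightarrow> y' \<prec>\<^bsub>N\<^esub> w'"
    using assms(4)[OF y] less_linear[OF c(1,2)] N.less_linear[OF c(3,4)] less_asym[of w y] N.less_asym[of w' y'] c by blast
qed (use assms in blast)+

text \<open>Since \<open>T\<close> is closed under \<open>\<p>\<close>, the successor of a new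
  element is new; and since nothing of \<Psi> lies between \<open>w\<close> and
  \<open>\<s> w\<close>, it fills the same cut.\<close>

lemma same_cut_succ: assumes T: "Psi_iso T" and c: "same_cut T w w'" shows "same_cut T (\<s> w) (\<s>\<^bsub>N\<^esub> w')"
proof (rule same_cutI[OF _ _ T])
  have w: "w \<in> \<Psi>" "w' \<in> \<Psi>\<^bsub>N\<^esub>" using c by (auto simp: same_cut_def)
  then show "\<s> w \<in> \<Psi>" "\<s>\<^bsub>N\<^esub> w' \<in> \<Psi>\<^bsub>N\<^esub>" by (auto simp: Psi_Gam N.Psi_Gam)
  fix y y' assume y: "(y, y') \<in> T"
  note t = Psi_isoD[OF T y]
  have 1: "\<s> w \<noteq> y"
  proof
    assume e: "\<s> w = y"
    then have "(w, \<p>\<^bsub>N\<^esub> y') \<in> T" using t(6) w succ_notmin by auto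
    then show False using c by (auto simp: same_cut_def)
  qed
  have 2: "\<s>\<^bsub>N\<^esub> w' \<noteq> y'"
  proof
    assume e: "\<s>\<^bsub>N\<^esub> w' = y'"
    then have "(\<p> y, w') \<in> T" using t(6,9) w N.succ_notmin by auto
    then show False using c by (auto simp: same_cut_def)
  qed
  have "\<s> w \<prec> y \<longleftrightarrow> w \<prec> y"
    using 1 Psi_succ_le[of w y] Psi_succ_less[of w] less_trans[of w "\<s> w" y] w t(1) Psi_carrier succ_Psi Psi_Gam by blast
  moreover have "\<s>\<^bsub>N\<^esub> w' \<prec>\<^bsub>N\<^esub> y' \<longleftrightarrow> w' \<prec>\<^bsub>N\<^esub> y'"
    using 2 N.Psi_succ_le[of w' y'] N.Psi_succ_less[of w'] N.less_trans[of w' "\<s>\<^bsub>N\<^esub> w'" y'] w t(2) N.Psi_carrier N.succ_Psi N.Psi_Gam by blast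
  ultimately show "\<s> w \<noteq> y \<and> \<s>\<^bsub>N\<^esub> w' \<noteq> y' \<and> (\<s> w \<prec> y \<longleftrightarrow> \<s>\<^bsub>N\<^esub> w' \<prec>\<^bsub>N\<^esub> y')"
    using 1 2 c y by (auto simp: same_cut_def)
qed

lemma same_cut_notmin: assumes T: "Psi_iso T" and c: "same_cut T w w'" shows "w \<noteq> \<s> \<zero>" "w' \<noteq> \<s>\<^bsub>N\<^esub> \<zero>\<^bsub>N\<^esub>"
  using T c unfolding Psi_iso_def same_cut_def by blast+

lemma same_cut_pred: assumes T: "Psi_iso T" and c: "same_cut T w w'" shows "same_cut T (\<p> w) (\<p>\<^bsub>N\<^esub> w')"
proof (rule same_cutI[OF _ _ T])
  have w: "w \<in> \<Psi>" "w' \<in> \<Psi>\<^bsub>N\<^esub>" using c by (auto simp: same_cut_def)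
  show p: "\<p> w \<in> \<Psi>" "\<p>\<^bsub>N\<^esub> w' \<in> \<Psi>\<^bsub>N\<^esub>" using pred_Psi(1)[of w] N.pred_Psi(1)[of w'] w same_cut_notmin[OF T c] by auto
  have s: "\<s> (\<p> w) = w" "\<s>\<^bsub>N\<^esub> (\<p>\<^bsub>N\<^esub> w') = w'" using pred_Psi(2)[of w] N.pred_Psi(2)[of w'] w same_cut_notmin[OF T c] by auto
  fix y y' assume y: "(y, y') \<in> T"
  note t = Psi_isoD[OF T y]
  have "\<p> w \<prec> y \<longleftrightarrow> w \<prec> \<s> y" "\<p>\<^bsub>N\<^esub> w' \<prec>\<^bsub>N\<^esub> y' \<longleftrightarrow> w' \<prec>\<^bsub>N\<^esub> \<s>\<^bsub>N\<^esub> y'"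
    using Psi_succ_mono[OF p(1) t(1)] N.Psi_succ_mono[OF p(2) t(2)] s by simp_all
  moreover have *: "w \<noteq> \<s> y \<and> w' \<noteq> \<s>\<^bsub>N\<^esub> y' \<and> (w \<prec> \<s> y \<longleftrightarrow> w' \<prec>\<^bsub>N\<^esub> \<s>\<^bsub>N\<^esub> y')"
    using c t(5) unfolding same_cut_def by blast
  ultimately show "\<p> w \<noteq> y \<and> \<p>\<^bsub>N\<^esub> w' \<noteq> y' \<and> (\<p> w \<prec> y \<longleftrightarrow> \<p>\<^bsub>N\<^esub> w' \<prec>\<^bsub>N\<^esub> y')"
    using s *  by metis
qed

lemma same_cut_shift: assumes T: "Psi_iso T" and c: "same_cut T w w'" shows "same_cut T (shift k w) (N.shift k w')"
proof (induction k rule: int_induct[where k = 0])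
  case base then show ?case using c by (simp add: shift_simps N.shift_simps)
next
  case (step1 i) then show ?case using same_cut_succ[OF T] by (simp add: shift_simps N.shift_simps)
next
  case (step2 i) then show ?case using same_cut_pred[OF T] by (simp add: shift_simps N.shift_simps)
qed

text \<open>The whole orbit of \<open>w\<close> under \<open>\<s>\<close> and \<open>\<p>\<close>
  lies in one cut of \<open>T\<close> and is ordered like the integers on both sides, so it can be
  added at once.\<close>

lemma Psi_iso_step:
  assumes T: "Psi_iso T" and c: "same_cut T w w'"
  shows "Psi_iso (T \<union> range (\<lambda>k. (shift k w, N.shift k w')))"
proof -
  note sc = same_cut_shift[OF T c]
  have s: "shift k w \<in> \<Psi> \<and> shift k w \<noteq> \<s> \<zero>" "N.shift k w' \<in> \<Psi>\<^bsub>N\<^esub> \<and> N.shift k w' \<noteq> \<s>\<^bsub>N\<^esub> \<zero>\<^bsub>N\<^esub>" for k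
    using sc[of k] same_cut_notmin[OF T sc[of k]] by (auto simp: same_cut_def)
  have S: "\<s> (shift k w) = shift (k + 1) w" "\<s>\<^bsub>N\<^esub> (N.shift k w') = N.shift (k + 1) w'"
     "\<p> (shift k w) = shift (k - 1) w" "\<p>\<^bsub>N\<^esub> (N.shift k w') = N.shift (k - 1) w'" for k
    using shift_Suc[of w k] N.shift_Suc[of w' k] shift_Suc[of w "k - 1"] N.shift_Suc[of w' "k - 1"] s pred_succ N.pred_succ by auto
  show ?thesis
    unfolding Psi_iso_def
  proof (intro conjI allI impI)
    show "T \<union> range (\<lambda>k. (shift k w, N.shift k w')) \<subseteq> \<Psi> \<times> \<Psi>\<^bsub>N\<^esub>" using T s by (auto simp: Psi_iso_def)
    show "(\<s> \<zero>, \<s>\<^bsub>N\<^esub> \<zero>\<^bsub>N\<^esub>) \<in> T \<union> range (\<lambda>k. (shift k w, N.shift k w'))" using T by (auto simp: Psi_iso_def)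
    fix x x' assume x: "(x, x') \<in> T \<union> range (\<lambda>k. (shift k w, N.shift k w'))"
    show "(\<s> x, \<s>\<^bsub>N\<^esub> x') \<in> T \<union> range (\<lambda>k. (shift k w, N.shift k w'))"
      using x Psi_isoD(5)[OF T, of x x'] S by auto
    show "(\<p> x, \<p>\<^bsub>N\<^esub> x') \<in> T \<union> range (\<lambda>k. (shift k w, N.shift k w'))" if "x \<noteq> \<s> \<zero>"
      using x Psi_isoD(6)[OF T, of x x'] that S by auto
    fix y y' assume y: "(y, y') \<in> T \<union> range (\<lambda>k. (shift k w, N.shift k w'))"
    show "x \<prec> y \<longleftrightarrow> x' \<prec>\<^bsub>N\<^esub> y'"
      using x y Psi_isoD(7)[OF T] sc s shift_less[OF s(1)] N.shift_less[OF s(2)] unfolding same_cut_def by auto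
  qed
qed

lemma Psi_iso_chain:
  assumes C: "C \<noteq> {}" "subset.chain A C" and T: "\<And>T. T \<in> C \<Longrightarrow> Psi_iso T"
  shows "Psi_iso (\<Union>C)"
  unfolding Psi_iso_def
proof (intro conjI allI impI)
  show "\<Union>C \<subseteq> \<Psi> \<times> \<Psi>\<^bsub>N\<^esub>" using T by (force simp: Psi_iso_def)
  show "(\<s> \<zero>, \<s>\<^bsub>N\<^esub> \<zero>\<^bsub>N\<^esub>) \<in> \<Union>C" using T C(1) by (auto simp: Psi_iso_def)
  fix x x' assume x: "(x, x') \<in> \<Union>C"
  then show "(\<s> x, \<s>\<^bsub>N\<^esub> x') \<in> \<Union>C" "x \<noteq> \<s> \<zero> \<Longrightarrow> (\<p> x, \<p>\<^bsub>N\<^esub> x') \<in> \<Union>C" using Psi_isoD(5,6)[OF T] by blast+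
  fix y y' assume y: "(y, y') \<in> \<Union>C"
  obtain R where "R \<in> C" "(x, x') \<in> R" "(y, y') \<in> R" using chain_Union2[OF C(2) x y] by blast
  then show "x \<prec> y \<longleftrightarrow> x' \<prec>\<^bsub>N\<^esub> y'" using Psi_isoD(7)[OF T] by blast
qed

lemma Psi_iso_countable:
  assumes T: "Psi_iso T" and W: "countable W" "Domain T \<subseteq> W" shows "countable T"
proof (rule countable_image_inj_on)
  show "countable (fst ` T)" using W countable_subset[of "fst ` T" W] by (auto simp: Domain_fst)
  show "inj_on fst T" using Psi_isoD(8)[OF T] by (auto simp: inj_on_def)
qed

text \<open>An orbit is added at each step. Its image is found by saturation in the countable cut
  given by the image of \<open>T\<close>; discreteness of \<Psi> makes that cut finitely
  satisfiable.\<close>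

lemma Psi_iso_extend:
  assumes N: "countably_saturated L_log N" and T0: "Psi_iso T0" "Domain T0 \<subseteq> W"
    and W: "countable W" "W \<subseteq> \<Psi>" "\<And>w. w \<in> W \<Longrightarrow> \<s> w \<in> W" "\<And>w. w \<in> W \<Longrightarrow> w \<noteq> \<s> \<zero> \<Longrightarrow> \<p> w \<in> W"
  shows "\<exists>T. Psi_iso T \<and> T0 \<subseteq> T \<and> Domain T = W"
proof -
  define P where "P = (\<lambda>T. Psi_iso T \<and> Domain T \<subseteq> W)"
  have "\<exists>T. P T \<and> T0 \<subseteq> T \<and> W \<subseteq> Domain T"
  proof (rule extend_relation)
    show "P T0" using T0 by (simp add: P_def)
    fix C assume C: "C \<noteq> {}" "subset.chain {R. P R \<and> T0 \<subseteq> R} C"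
    then have *: "\<And>T. T \<in> C \<Longrightarrow> P T" unfolding subset.chain_def by auto
    then show "P (\<Union>C)" using Psi_iso_chain[OF C] unfolding P_def by blast
  next
    fix T w assume PT: "P T" and w: "w \<in> W" "w \<notin> Domain T"
    then have T: "Psi_iso T" "Domain T \<subseteq> W" by (auto simp: P_def)
    have wP: "w \<in> \<Psi>" using w W by auto
    define A where "A = {y'. \<exists>y. (y, y') \<in> T \<and> y \<prec> w}"
    define B where "B = {y'. \<exists>y. (y, y') \<in> T \<and> w \<prec> y}"
    have cT: "countable (snd ` T)" using Psi_iso_countable[OF T(1) W(1) T(2)] by simp
    have sub: "A \<subseteq> snd ` T" "B \<subseteq> snd ` T" by (force simp: A_def B_def)+
    have "\<exists>z\<in>\<Psi>\<^bsub>N\<^esub>. (\<forall>a\<in>A. a \<prec>\<^bsub>N\<^esub> z) \<and> (\<forall>b\<in>B. z \<prec>\<^bsub>N\<^esub> b)"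
    proof (rule N.saturated_Psi_cut[OF N])
      show "countable A" "countable B" using cT sub countable_subset by blast+
      show "A \<subseteq> \<Psi>\<^bsub>N\<^esub>" "B \<subseteq> \<Psi>\<^bsub>N\<^esub>" using Psi_isoD(2)[OF T(1)] by (auto simp: A_def B_def)
      have "(\<s> \<zero>, \<s>\<^bsub>N\<^esub> \<zero>\<^bsub>N\<^esub>) \<in> T" using T unfolding Psi_iso_def by blast
      moreover from this have "\<s> \<zero> \<prec> w" using Psi_min(1)[OF wP] w by auto
      ultimately show "A \<noteq> {}" by (auto simp: A_def)
      fix a b assume "a \<in> A" "b \<in> B"
      then obtain x y where xy: "(x, a) \<in> T" "x \<prec> w" "(y, b) \<in> T" "w \<prec> y" by (auto simp: A_def B_def)
      have xP: "x \<in> \<Psi>" "y \<in> \<Psi>" using Psi_isoD(1)[OF T(1)] xy by auto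
      \<comment> \<open>As \<open>w\<close> lies strictly between \<open>x\<close> and
        \<open>y\<close>, so \<open>\<s> x \<preceq> w \<prec> y\<close>; this strict gap is
        expressed by \<open>\<s>\<close> and carries over to the images.\<close>
      have "\<s> x \<prec> y" using Psi_succ_le[OF xP(1) wP xy(2)] xy(4) le_less_trans[of "\<s> x" w y] xP wP
        by (simp add: Psi_carrier Psi_Gam)
      then show "\<s>\<^bsub>N\<^esub> a \<prec>\<^bsub>N\<^esub> b" using Psi_isoD(7)[OF T(1) Psi_isoD(5)[OF T(1) xy(1)] xy(3)] by blast
    qed
    then obtain w' where w': "w' \<in> \<Psi>\<^bsub>N\<^esub>" "\<And>a. a \<in> A \<Longrightarrow> a \<prec>\<^bsub>N\<^esub> w'" "\<And>b. b \<in> B \<Longrightarrow> w' \<prec>\<^bsub>N\<^esub> b" by blast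
    have cut: "same_cut T w w'"
    proof (rule same_cutI[OF wP w'(1) T(1)])
      fix y y' assume y: "(y, y') \<in> T"
      have wy: "w \<noteq> y" using w(2) y by auto
      have c: "w \<in> carrier M" "y \<in> carrier M" "w' \<in> carrier N" "y' \<in> carrier N"
        using wP w'(1) Psi_isoD(1,2)[OF T(1) y] Psi_carrier N.Psi_carrier by auto
      consider "w \<prec> y" | "y \<prec> w" using less_linear[OF c(1,2)] wy by blast
      then show "w \<noteq> y \<and> w' \<noteq> y' \<and> (w \<prec> y \<longleftrightarrow> w' \<prec>\<^bsub>N\<^esub> y')"
      proof cases
        case 1
        then have "w' \<prec>\<^bsub>N\<^esub> y'" using w'(3) y by (auto simp: B_def)
        then show ?thesis using 1 wy c N.less_irrefl by blast
      next
        case 2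
        then have "y' \<prec>\<^bsub>N\<^esub> w'" using w'(2) y by (auto simp: A_def)
        then show ?thesis using 2 wy c N.less_irrefl N.less_asym less_asym by blast
      qed
    qed
    define T' where "T' = T \<union> range (\<lambda>k. (shift k w, N.shift k w'))"
    have "shift k w \<in> W" for k
    proof (induction k rule: int_induct[where k = 0])
      case base then show ?case using w by (simp add: shift_simps)
    next
      case (step1 i) then show ?case using W by (simp add: shift_simps)
    next
      case (step2 i)
      then show ?case using W same_cut_notmin(1)[OF T(1) same_cut_shift[OF T(1) cut]] by (simp add: shift_simps)
    qed
    then have "P T'" using Psi_iso_step[OF T(1) cut] T(2) by (auto simp: P_def T'_def)
    moreover have "(shift 0 w, N.shift 0 w') \<in> T'" by (auto simp: T'_def)
    then have "w \<in> Domain T'" by (auto simp: shift_simps)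
    ultimately show "\<exists>R'. P R' \<and> T \<subseteq> R' \<and> w \<in> Domain R'" by (auto simp: T'_def)
  qed
  then show ?thesis unfolding P_def by blast
qed

end

section \<open>Realizing cuts\<close>

context two_models
begin

lemma good_chain:
  assumes C: "C \<noteq> {}" "subset.chain A C" and R: "\<And>R. R \<in> C \<Longrightarrow> good T R"
  shows "good T (\<Union>C)"
  unfolding good_def
proof (intro conjI allI impI ballI)
  show "\<Union>C \<subseteq> \<Gamma> \<times> \<Gamma>\<^bsub>N\<^esub>" using goodD(1,2)[OF R] by (force simp: good_def)
  show "(\<zero>, \<zero>\<^bsub>N\<^esub>) \<in> \<Union>C" using R C(1) by (auto simp: good_def)
  fix x x' assume x: "(x, x') \<in> \<Union>C"
  then show "(\<ominus> x, \<ominus>\<^bsub>N\<^esub> x') \<in> \<Union>C" "\<zero> \<prec> x \<longleftrightarrow> \<zero>\<^bsub>N\<^esub> \<prec>\<^bsub>N\<^esub> x'" "x \<noteq> \<zero> \<Longrightarrow> (\<psi> x, \<psi>\<^bsub>N\<^esub> x') \<in> T"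
    using goodD(3,4,7)[OF R] by blast+
  fix y y' assume y: "(y, y') \<in> \<Union>C"
  obtain S where "S \<in> C" "(x, x') \<in> S" "(y, y') \<in> S" using chain_Union2[OF C(2) x y] by blast
  then show "(x \<oplus> y, x' \<oplus>\<^bsub>N\<^esub> y') \<in> \<Union>C" using goodD(8)[OF R] by blast
next
  fix x x' and k :: int assume x: "x \<in> \<Gamma>" "x' \<in> \<Gamma>\<^bsub>N\<^esub>" "1 \<le> k" "(mul k x, N.mul k x') \<in> \<Union>C"
  then obtain S where "S \<in> C" "(mul k x, N.mul k x') \<in> S" by blast
  then show "(x, x') \<in> \<Union>C" using good_pure[OF R x(1,2), of S k] x(3) by auto
qed

lemma good_mono: "good T R \<Longrightarrow> T \<subseteq> T' \<Longrightarrow> good T' R"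
  unfolding good_def by (elim conjE, intro conjI) (assumption+, blast)

lemma good_countable:
  assumes R: "good T R" and D: "countable D" "Domain R \<subseteq> D" shows "countable R"
proof (rule countable_image_inj_on)
  show "countable (fst ` R)" using D countable_subset[of "fst ` R" D] by (auto simp: Domain_fst)
  show "inj_on fst R" using good_order(2)[OF R] by (auto simp: inj_on_def)
qed

text \<open>For nonnegative summands the value of the sum is the smaller of the two values, and
  \<open>T\<close> preserves which one that is. It will be used with
  \<open>y = b \<ominus> a\<close> and \<open>x = a \<ominus> h\<close> for \<open>a\<close> the
  element next to \<open>b\<close>.\<close>

lemma add_pos_step:
  assumes T: "Psi_iso T" and R: "good T R" and x: "(x, x') \<in> R" "\<zero> \<preceq> x"
    and y: "y \<in> \<Gamma>" "\<zero> \<prec> y" "u \<in> \<Gamma>\<^bsub>N\<^esub>" "\<zero>\<^bsub>N\<^esub> \<prec>\<^bsub>N\<^esub> u" "(\<psi> y, \<psi>\<^bsub>N\<^esub> u) \<in> T"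
  shows "(\<psi> (y \<oplus> x), \<psi>\<^bsub>N\<^esub> (u \<oplus>\<^bsub>N\<^esub> x')) \<in> T" "\<zero>\<^bsub>N\<^esub> \<prec>\<^bsub>N\<^esub> u \<oplus>\<^bsub>N\<^esub> x'"
proof -
  note d = goodD[OF R x(1)]
  have x': "\<zero>\<^bsub>N\<^esub> \<preceq>\<^bsub>N\<^esub> x'" using d(4,6) x by auto
  show "\<zero>\<^bsub>N\<^esub> \<prec>\<^bsub>N\<^esub> u \<oplus>\<^bsub>N\<^esub> x'" using N.add_pos[OF y(4) x' y(3) d(2)] .
  show "(\<psi> (y \<oplus> x), \<psi>\<^bsub>N\<^esub> (u \<oplus>\<^bsub>N\<^esub> x')) \<in> T"
  proof (cases "x = \<zero>")
    case True
    then show ?thesis using d(6) y by simp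
  next
    case False
    have t: "(\<psi> x, \<psi>\<^bsub>N\<^esub> x') \<in> T" using d False by blast
    note c = Psi_isoD(7)[OF T y(5) t] Psi_isoD(8)[OF T y(5) t] Psi_isoD(7)[OF T t y(5)]
    show ?thesis
    proof (cases "\<psi> y \<preceq> \<psi> x")
      case True
      then show ?thesis using psi_add_pos[of y x] N.psi_add_pos[of u x'] c x x' y d by auto
    next
      case False
      then have "\<psi> x \<prec> \<psi> y" using less_linear[of "\<psi> x" "\<psi> y"] d y by auto
      then show ?thesis using psi_add_pos'[of y x] N.psi_add_pos'[of u x'] c x x' y d t by auto
    qed
  qed
qed

text \<open>Here \<open>a\<close> is the best approximation of \<open>b\<close>, from below. Any
  positive \<open>u\<close> with the value corresponding to \<open>\<psi> (b \<ominus> a)\<close>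
  serves: \<open>a' \<oplus> u\<close> lies correctly above the images of smaller elements because
  nothing cancels, and correctly below those of larger ones because their distance from
  \<open>a'\<close> dominates \<open>u\<close>.\<close>

lemma one_sided_approx:
  assumes T: "Psi_iso T" and R: "good T R" and G: "G \<subseteq> R" and b: "b \<in> \<Gamma>" "b \<notin> Domain R"
    and a: "(a, a') \<in> R" "a \<prec> b" "\<psi> (b \<ominus> a) \<in> Domain T"
    and lo: "\<And>h h'. (h, h') \<in> G \<Longrightarrow> h \<prec> b \<Longrightarrow> h \<preceq> a"
    and hi: "\<And>h h'. (h, h') \<in> G \<Longrightarrow> b \<prec> h \<Longrightarrow> \<psi> (h \<ominus> b) \<prec> \<psi> (b \<ominus> a)"
  shows "\<exists>z\<in>\<Gamma>\<^bsub>N\<^esub>. \<forall>(h, h')\<in>G. (\<psi> (b \<ominus> h), \<psi>\<^bsub>N\<^esub> (z \<ominus>\<^bsub>N\<^esub> h')) \<in> T \<and> (h' \<prec>\<^bsub>N\<^esub> z \<longleftrightarrow> h \<prec> b)"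
proof -
  obtain w' where w': "(\<psi> (b \<ominus> a), w') \<in> T" using a by blast
  obtain u where u: "u \<in> \<Gamma>\<^bsub>N\<^esub>" "\<zero>\<^bsub>N\<^esub> \<prec>\<^bsub>N\<^esub> u" "\<psi>\<^bsub>N\<^esub> u = w'" using N.Psi_pos Psi_isoD(2)[OF T w'] by blast
  note d = goodD(1,2)[OF R a(1)]
  have y: "b \<ominus> a \<in> \<Gamma>" "\<zero> \<prec> b \<ominus> a" "(\<psi> (b \<ominus> a), \<psi>\<^bsub>N\<^esub> u) \<in> T" using a b d w' u by (auto simp: sub_pos)
  define z where "z = a' \<oplus>\<^bsub>N\<^esub> u"
  have z: "z \<in> \<Gamma>\<^bsub>N\<^esub>" using d u by (simp add: z_def)
  have "(\<psi> (b \<ominus> h), \<psi>\<^bsub>N\<^esub> (z \<ominus>\<^bsub>N\<^esub> h')) \<in> T \<and> (h' \<prec>\<^bsub>N\<^esub> z \<longleftrightarrow> h \<prec> b)" if h: "(h, h') \<in> G" for h h'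
  proof -
    have hR: "(h, h') \<in> R" using h G by blast
    note e = goodD(1,2)[OF R hR]
    consider "h \<prec> b" | "b \<prec> h" using less_linear[of h b] b e hR by auto
    then show ?thesis
    proof cases
      case 1
      have x: "(a \<ominus> h, a' \<ominus>\<^bsub>N\<^esub> h') \<in> R" "\<zero> \<preceq> a \<ominus> h"
        using goodD(9)[OF R a(1) hR] lo[OF h 1] d e by (auto simp: sub_pos)
      have eq: "(b \<ominus> a) \<oplus> (a \<ominus> h) = b \<ominus> h" "u \<oplus>\<^bsub>N\<^esub> (a' \<ominus>\<^bsub>N\<^esub> h') = z \<ominus>\<^bsub>N\<^esub> h'"
        using d e b u by (simp_all add: z_def ag N.ag)
      show ?thesis using add_pos_step[OF T R x y(1,2) u(1,2) y(3)] 1 e z unfolding eq by (simp add: N.sub_pos)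
    next
      case 2
      have x: "(h \<ominus> a, h' \<ominus>\<^bsub>N\<^esub> a') \<in> R" using goodD(9)[OF R hR a(1)] .
      have "\<psi> (h \<ominus> a) = \<psi> (h \<ominus> b)"
        using psi_add_eq[of "h \<ominus> b" "b \<ominus> a"] hi[OF h 2] d e b by (simp add: ag)
      then have lt: "\<psi> (h \<ominus> a) \<prec> \<psi> (b \<ominus> a)" using hi[OF h 2] by simp
      have "h \<noteq> a" using 2 a less_asym[of a b] d b by auto
      then have t: "(\<psi> (h \<ominus> a), \<psi>\<^bsub>N\<^esub> (h' \<ominus>\<^bsub>N\<^esub> a')) \<in> T" using goodD(7)[OF R x] d e by simp
      have lt': "\<psi>\<^bsub>N\<^esub> (h' \<ominus>\<^bsub>N\<^esub> a') \<prec>\<^bsub>N\<^esub> \<psi>\<^bsub>N\<^esub> u" using Psi_isoD(7)[OF T t y(3)] lt by simp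
      have "a \<prec> h" using less_trans[OF a(2) 2] d e b by simp
      then have pos: "\<zero>\<^bsub>N\<^esub> \<prec>\<^bsub>N\<^esub> h' \<ominus>\<^bsub>N\<^esub> a'" using good_order(1)[OF R a(1) hR] d e by (simp add: N.sub_pos)
      have "\<zero>\<^bsub>N\<^esub> \<prec>\<^bsub>N\<^esub> (h' \<ominus>\<^bsub>N\<^esub> a') \<ominus>\<^bsub>N\<^esub> u" "\<psi>\<^bsub>N\<^esub> ((h' \<ominus>\<^bsub>N\<^esub> a') \<ominus>\<^bsub>N\<^esub> u) = \<psi>\<^bsub>N\<^esub> (h' \<ominus>\<^bsub>N\<^esub> a')"
        using N.add_sign(1)[of "h' \<ominus>\<^bsub>N\<^esub> a'" "\<ominus>\<^bsub>N\<^esub> u"] N.psi_sub_eq[of "h' \<ominus>\<^bsub>N\<^esub> a'" u] d e u pos lt' by simp_all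
      moreover have "(h' \<ominus>\<^bsub>N\<^esub> a') \<ominus>\<^bsub>N\<^esub> u = h' \<ominus>\<^bsub>N\<^esub> z" using d e u by (simp add: z_def N.ag)
      ultimately have "z \<prec>\<^bsub>N\<^esub> h'" "\<psi>\<^bsub>N\<^esub> (z \<ominus>\<^bsub>N\<^esub> h') = \<psi>\<^bsub>N\<^esub> (h' \<ominus>\<^bsub>N\<^esub> a')"
        using z e N.psi_sub_swap[of z h'] by (simp_all add: N.sub_pos)
      moreover have "\<psi> (b \<ominus> h) = \<psi> (h \<ominus> a)" using \<open>\<psi> (h \<ominus> a) = \<psi> (h \<ominus> b)\<close> psi_sub_swap[of b h] e b by simp
      ultimately show ?thesis using t 2 less_asym[of b h] N.less_asym[of z h'] b e z by auto
    qed
  qed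
  then show ?thesis using z by blast
qed

text \<open>The mirror image, obtained by applying the previous lemma to \<open>\<ominus> b\<close>
  and the negated pairs of \<open>G\<close>.\<close>

lemma one_sided_approx':
  assumes T: "Psi_iso T" and R: "good T R" and G: "G \<subseteq> R" and b: "b \<in> \<Gamma>" "b \<notin> Domain R"
    and a: "(a, a') \<in> R" "b \<prec> a" "\<psi> (a \<ominus> b) \<in> Domain T"
    and lo: "\<And>h h'. (h, h') \<in> G \<Longrightarrow> b \<prec> h \<Longrightarrow> a \<preceq> h"
    and hi: "\<And>h h'. (h, h') \<in> G \<Longrightarrow> h \<prec> b \<Longrightarrow> \<psi> (b \<ominus> h) \<prec> \<psi> (a \<ominus> b)"
  shows "\<exists>z\<in>\<Gamma>\<^bsub>N\<^esub>. \<forall>(h, h')\<in>G. (\<psi> (b \<ominus> h), \<psi>\<^bsub>N\<^esub> (z \<ominus>\<^bsub>N\<^esub> h')) \<in> T \<and> (h' \<prec>\<^bsub>N\<^esub> z \<longleftrightarrow> h \<prec> b)"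
proof -
  define G' where "G' = (\<lambda>(h, h'). (\<ominus> h, \<ominus>\<^bsub>N\<^esub> h')) ` G"
  have GG: "(h, h') \<in> G \<Longrightarrow> h \<in> \<Gamma> \<and> h' \<in> \<Gamma>\<^bsub>N\<^esub>" for h h' using G goodD(1,2)[OF R] by blast
  have aa: "a \<in> \<Gamma>" "a' \<in> \<Gamma>\<^bsub>N\<^esub>" using goodD(1,2)[OF R a(1)] by auto
  have nb: "\<ominus> b \<notin> Domain R"
  proof
    assume "\<ominus> b \<in> Domain R"
    then obtain x' where "(\<ominus> b, x') \<in> R" by blast
    then have "(\<ominus> (\<ominus> b), \<ominus>\<^bsub>N\<^esub> x') \<in> R" using goodD(3)[OF R] by blast
    then show False using b by auto
  qed
  have "\<exists>z\<in>\<Gamma>\<^bsub>N\<^esub>. \<forall>(h, h')\<in>G'. (\<psi> (\<ominus> b \<ominus> h), \<psi>\<^bsub>N\<^esub> (z \<ominus>\<^bsub>N\<^esub> h')) \<in> T \<and> (h' \<prec>\<^bsub>N\<^esub> z \<longleftrightarrow> h \<prec> \<ominus> b)"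
  proof (rule one_sided_approx[OF T R _ _ nb goodD(3)[OF R a(1)]])
    show "G' \<subseteq> R" using G goodD(3)[OF R] by (auto simp: G'_def)
    show "\<ominus> b \<in> \<Gamma>" "\<ominus> a \<prec> \<ominus> b" using b a aa by auto
    show "\<psi> (\<ominus> b \<ominus> \<ominus> a) \<in> Domain T" using a b aa by (simp add: ag)
    fix h h' assume "(h, h') \<in> G'"
    then obtain g g' where g: "(g, g') \<in> G" "h = \<ominus> g" "h' = \<ominus>\<^bsub>N\<^esub> g'" by (auto simp: G'_def)
    show "h \<preceq> \<ominus> a" if "h \<prec> \<ominus> b" using lo[OF g(1)] that g GG[OF g(1)] b aa by auto
    show "\<psi> (h \<ominus> \<ominus> b) \<prec> \<psi> (\<ominus> b \<ominus> \<ominus> a)" if "\<ominus> b \<prec> h"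
      using hi[OF g(1)] that g GG[OF g(1)] b aa by (simp add: ag)
  qed
  then obtain z where z: "z \<in> \<Gamma>\<^bsub>N\<^esub>"
     and zG': "\<forall>(h, h')\<in>G'. (\<psi> (\<ominus> b \<ominus> h), \<psi>\<^bsub>N\<^esub> (z \<ominus>\<^bsub>N\<^esub> h')) \<in> T \<and> (h' \<prec>\<^bsub>N\<^esub> z \<longleftrightarrow> h \<prec> \<ominus> b)" by blast
  have zG: "(\<psi> (\<ominus> b \<ominus> \<ominus> h), \<psi>\<^bsub>N\<^esub> (z \<ominus>\<^bsub>N\<^esub> \<ominus>\<^bsub>N\<^esub> h')) \<in> T" "\<ominus>\<^bsub>N\<^esub> h' \<prec>\<^bsub>N\<^esub> z \<longleftrightarrow> \<ominus> h \<prec> \<ominus> b" if "(h, h') \<in> G" for h h'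
  proof -
    have "(\<ominus> h, \<ominus>\<^bsub>N\<^esub> h') \<in> G'" using that by (force simp: G'_def)
    then show "(\<psi> (\<ominus> b \<ominus> \<ominus> h), \<psi>\<^bsub>N\<^esub> (z \<ominus>\<^bsub>N\<^esub> \<ominus>\<^bsub>N\<^esub> h')) \<in> T" "\<ominus>\<^bsub>N\<^esub> h' \<prec>\<^bsub>N\<^esub> z \<longleftrightarrow> \<ominus> h \<prec> \<ominus> b"
      using zG' by blast+
  qed
  have "(\<psi> (b \<ominus> h), \<psi>\<^bsub>N\<^esub> (\<ominus>\<^bsub>N\<^esub> z \<ominus>\<^bsub>N\<^esub> h')) \<in> T \<and> (h' \<prec>\<^bsub>N\<^esub> \<ominus>\<^bsub>N\<^esub> z \<longleftrightarrow> h \<prec> b)" if h: "(h, h') \<in> G" for h h'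
  proof -
    have m: "h \<in> \<Gamma>" "h' \<in> \<Gamma>\<^bsub>N\<^esub>" using GG h by auto
    have "\<psi> (b \<ominus> h) = \<psi> (\<ominus> b \<ominus> \<ominus> h)" using psi_neg[of "b \<ominus> h"] m b by (simp add: ag)
    moreover have "\<psi>\<^bsub>N\<^esub> (\<ominus>\<^bsub>N\<^esub> z \<ominus>\<^bsub>N\<^esub> h') = \<psi>\<^bsub>N\<^esub> (z \<ominus>\<^bsub>N\<^esub> \<ominus>\<^bsub>N\<^esub> h')" using N.psi_neg[of "z \<oplus>\<^bsub>N\<^esub> h'"] m z by (simp add: N.ag)
    moreover have "h \<prec> b \<longleftrightarrow> h' \<prec>\<^bsub>N\<^esub> \<ominus>\<^bsub>N\<^esub> z"
    proof -
      have "h \<prec> b \<longleftrightarrow> \<not> (\<ominus> h \<prec> \<ominus> b)"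
        using m b less_linear[of h b] less_asym[of h b] G h by auto
      moreover have "\<ominus>\<^bsub>N\<^esub> h' \<noteq> z" using zG(1)[OF h] m Psi_isoD(4)[OF T] N.not_infty by force
      then have "h' \<prec>\<^bsub>N\<^esub> \<ominus>\<^bsub>N\<^esub> z \<longleftrightarrow> \<not> (\<ominus>\<^bsub>N\<^esub> h' \<prec>\<^bsub>N\<^esub> z)"
        using m z N.less_linear[of "\<ominus>\<^bsub>N\<^esub> h'" z] N.less_asym[of "\<ominus>\<^bsub>N\<^esub> h'" z] N.neg_less[of "\<ominus>\<^bsub>N\<^esub> z" h'] by auto
      ultimately show ?thesis using zG(2)[OF h] by simp
    qed
    ultimately show ?thesis using zG(1)[OF h] by simp
  qed
  then show ?thesis using z by (intro bexI[of _ "\<ominus>\<^bsub>N\<^esub> z"]) auto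
qed

text \<open>Used when the nearest elements \<open>a \<prec> b \<prec> d\<close> are equally far from \<open>b\<close> in the sense of \<open>\<psi>\<close>: the midpoint of
  \<open>a'\<close> and \<open>d'\<close> is then as far from both of them.\<close>

lemma midpoint_approx:
  assumes T: "Psi_iso T" and R: "good T R" and G: "G \<subseteq> R" and b: "b \<in> \<Gamma>" "b \<notin> Domain R"
    and a: "(a, a') \<in> R" "a \<prec> b" and d: "(d, d') \<in> R" "b \<prec> d" and ad: "\<psi> (b \<ominus> a) = \<psi> (d \<ominus> b)"
    and lo: "\<And>h h'. (h, h') \<in> G \<Longrightarrow> h \<prec> b \<Longrightarrow> h \<preceq> a"
    and hi: "\<And>h h'. (h, h') \<in> G \<Longrightarrow> b \<prec> h \<Longrightarrow> d \<preceq> h"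
  shows "\<exists>z\<in>\<Gamma>\<^bsub>N\<^esub>. \<forall>(h, h')\<in>G. (\<psi> (b \<ominus> h), \<psi>\<^bsub>N\<^esub> (z \<ominus>\<^bsub>N\<^esub> h')) \<in> T \<and> (h' \<prec>\<^bsub>N\<^esub> z \<longleftrightarrow> h \<prec> b)"
proof -
  note m = goodD(1,2)[OF R a(1)] goodD(1,2)[OF R d(1)]
  obtain u where u: "u \<in> \<Gamma>\<^bsub>N\<^esub>" "N.mul 2 u = d' \<ominus>\<^bsub>N\<^esub> a'" using N.divisible[of "d' \<ominus>\<^bsub>N\<^esub> a'" 2] m by auto
  have "a \<prec> d" using less_trans[OF a(2) d(2)] m b by simp
  then have "a' \<prec>\<^bsub>N\<^esub> d'" "a \<noteq> d" using good_order(1)[OF R a(1) d(1)] m less_irrefl by auto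
  then have u0: "\<zero>\<^bsub>N\<^esub> \<prec>\<^bsub>N\<^esub> u" using N.mul_less_iff(1)[of u 2] u m by (simp add: N.sub_pos)
  have uu: "u \<oplus>\<^bsub>N\<^esub> u = d' \<ominus>\<^bsub>N\<^esub> a'" using u N.mul_Suc[of u 1] by simp
  \<comment> \<open>The positive distances \<open>b \<ominus> a\<close> and
    \<open>d \<ominus> b\<close> have equal value, which their sum keeps; halving
    \<open>d' \<ominus> a'\<close> does not change its value either. Hence \<open>u\<close> has the
    value wanted on both sides.\<close>
  have "\<psi> (d \<ominus> a) = \<psi> (b \<ominus> a)"
    using psi_add_pos[of "b \<ominus> a" "d \<ominus> b"] ad m b a d by (simp add: ag sub_pos)
  moreover have "(\<psi> (d \<ominus> a), \<psi>\<^bsub>N\<^esub> (d' \<ominus>\<^bsub>N\<^esub> a')) \<in> T" using goodD(7)[OF R goodD(9)[OF R d(1) a(1)]] m \<open>a \<noteq> d\<close> by simp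
  moreover have "\<psi>\<^bsub>N\<^esub> (d' \<ominus>\<^bsub>N\<^esub> a') = \<psi>\<^bsub>N\<^esub> u" using N.psi_mul[of u 2] u by simp
  ultimately have y: "(\<psi> (b \<ominus> a), \<psi>\<^bsub>N\<^esub> u) \<in> T" "(\<psi> (d \<ominus> b), \<psi>\<^bsub>N\<^esub> u) \<in> T" using ad by simp_all
  define z where "z = a' \<oplus>\<^bsub>N\<^esub> u"
  have z: "z \<in> \<Gamma>\<^bsub>N\<^esub>" using m u by (simp add: z_def)
  have zd: "z = d' \<ominus>\<^bsub>N\<^esub> u"
  proof -
    have "d' = a' \<oplus>\<^bsub>N\<^esub> (u \<oplus>\<^bsub>N\<^esub> u)" unfolding uu using m by (simp add: N.ag)
    then show ?thesis using m u by (simp add: z_def N.ag)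
  qed
  have "(\<psi> (b \<ominus> h), \<psi>\<^bsub>N\<^esub> (z \<ominus>\<^bsub>N\<^esub> h')) \<in> T \<and> (h' \<prec>\<^bsub>N\<^esub> z \<longleftrightarrow> h \<prec> b)" if h: "(h, h') \<in> G" for h h'
  proof -
    have hR: "(h, h') \<in> R" using h G by blast
    note e = goodD(1,2)[OF R hR]
    consider "h \<prec> b" | "b \<prec> h" using less_linear[of h b] b e hR by auto
    then show ?thesis
    proof cases
      case 1
      have x: "(a \<ominus> h, a' \<ominus>\<^bsub>N\<^esub> h') \<in> R" "\<zero> \<preceq> a \<ominus> h"
        using goodD(9)[OF R a(1) hR] lo[OF h 1] m e by (auto simp: sub_pos)
      have eq: "(b \<ominus> a) \<oplus> (a \<ominus> h) = b \<ominus> h" "u \<oplus>\<^bsub>N\<^esub> (a' \<ominus>\<^bsub>N\<^esub> h') = z \<ominus>\<^bsub>N\<^esub> h'"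
        using m e b u by (simp_all add: z_def ag N.ag)
      have "b \<ominus> a \<in> \<Gamma>" "\<zero> \<prec> b \<ominus> a" using m b a by (auto simp: sub_pos)
      from add_pos_step[OF T R x this u(1) u0 y(1)] show ?thesis using 1 e z unfolding eq by (simp add: N.sub_pos)
    next
      case 2
      have x: "(h \<ominus> d, h' \<ominus>\<^bsub>N\<^esub> d') \<in> R" "\<zero> \<preceq> h \<ominus> d"
        using goodD(9)[OF R hR d(1)] hi[OF h 2] m e by (auto simp: sub_pos)
      have eq: "(d \<ominus> b) \<oplus> (h \<ominus> d) = h \<ominus> b" "u \<oplus>\<^bsub>N\<^esub> (h' \<ominus>\<^bsub>N\<^esub> d') = h' \<ominus>\<^bsub>N\<^esub> z"
        using m e b u by (simp_all add: zd ag N.ag)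
      have "d \<ominus> b \<in> \<Gamma>" "\<zero> \<prec> d \<ominus> b" using m b d by (auto simp: sub_pos)
      from add_pos_step[OF T R x this u(1) u0 y(2)]
      have "(\<psi> (b \<ominus> h), \<psi>\<^bsub>N\<^esub> (z \<ominus>\<^bsub>N\<^esub> h')) \<in> T" "z \<prec>\<^bsub>N\<^esub> h'" using e z b psi_sub_swap[of b h] N.psi_sub_swap[of z h']
        unfolding eq by (simp_all add: N.sub_pos)
      then show ?thesis using 2 less_asym[of b h] N.less_asym[of z h'] e z b by auto
    qed
  qed
  then show ?thesis using z by blast
qed

text \<open>Let \<open>a\<close> and \<open>d\<close> be the neighbours of \<open>b\<close> in the
  finite set. A larger value of \<psi> means a smaller distance, so with different values one
  neighbour is decisively closer and a one-sided approximation from there works; with equal values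
  the midpoint is taken.\<close>

lemma finite_approx:
  assumes T: "Psi_iso T" and R: "good T R" and G: "G \<subseteq> R" "finite G" "G \<noteq> {}" and b: "b \<in> \<Gamma>" "b \<notin> Domain R"
    and bT: "\<And>h h'. (h, h') \<in> R \<Longrightarrow> \<psi> (b \<ominus> h) \<in> Domain T"
  shows "\<exists>z\<in>\<Gamma>\<^bsub>N\<^esub>. \<forall>(h, h')\<in>G. (\<psi> (b \<ominus> h), \<psi>\<^bsub>N\<^esub> (z \<ominus>\<^bsub>N\<^esub> h')) \<in> T \<and> (h' \<prec>\<^bsub>N\<^esub> z \<longleftrightarrow> h \<prec> b)"
proof -
  have hG: "h \<in> \<Gamma>" "h' \<in> \<Gamma>\<^bsub>N\<^esub>" "h \<noteq> b" if "(h, h') \<in> R" for h h' using goodD(1,2)[OF R that] that b by auto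
  define Lo where "Lo = {h. h \<in> Domain G \<and> h \<prec> b}"
  define Up where "Up = {h. h \<in> Domain G \<and> b \<prec> h}"
  have fin: "finite Lo" "finite Up" using G(2) by (auto simp: Lo_def Up_def Domain_fst)
  have sub: "Lo \<subseteq> carrier M" "Up \<subseteq> carrier M" using hG G(1) by (auto simp: Lo_def Up_def)
  have bT': "\<psi> (h \<ominus> b) \<in> Domain T" if "(h, h') \<in> R" for h h'
    using bT[OF that] psi_sub_swap[of b h] hG[OF that] b by simp
  have emp: "Lo \<noteq> {} \<or> Up \<noteq> {}"
  proof -
    obtain h h' where "(h, h') \<in> G" using G(3) by auto
    then have "h \<in> Lo \<or> h \<in> Up" using hG[of h h'] G(1) less_linear[of h b] b by (auto simp: Lo_def Up_def)
    then show ?thesis by blast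
  qed
  have lo: "\<exists>a a'. (a, a') \<in> G \<and> a \<prec> b \<and> (\<forall>h h'. (h, h') \<in> G \<longrightarrow> h \<prec> b \<longrightarrow> h \<preceq> a)" if "Lo \<noteq> {}"
    using finite_max[OF fin(1) that sub(1)] unfolding Lo_def by blast
  have up: "\<exists>a a'. (a, a') \<in> G \<and> b \<prec> a \<and> (\<forall>h h'. (h, h') \<in> G \<longrightarrow> b \<prec> h \<longrightarrow> a \<preceq> h)" if "Up \<noteq> {}"
    using finite_min[OF fin(2) that sub(2)] unfolding Up_def by blast
  consider "Up = {}" | "Lo = {}" | "Up \<noteq> {}" "Lo \<noteq> {}" by blast
  then show ?thesis
  proof cases
    case 1
    then obtain a a' where a: "(a, a') \<in> G" "a \<prec> b" "\<And>h h'. (h, h') \<in> G \<Longrightarrow> h \<prec> b \<Longrightarrow> h \<preceq> a" using lo emp by blast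
    show ?thesis
      by (rule one_sided_approx[OF T R G(1) b _ a(2)]) (use a G(1) 1 bT in \<open>auto simp: Up_def\<close>)
  next
    case 2
    then obtain a a' where a: "(a, a') \<in> G" "b \<prec> a" "\<And>h h'. (h, h') \<in> G \<Longrightarrow> b \<prec> h \<Longrightarrow> a \<preceq> h" using up emp by blast
    show ?thesis
      by (rule one_sided_approx'[OF T R G(1) b _ a(2)]) (use a G(1) 2 bT' in \<open>auto simp: Lo_def\<close>)
  next
    case 3
    then obtain a a' where a: "(a, a') \<in> G" "a \<prec> b" "\<And>h h'. (h, h') \<in> G \<Longrightarrow> h \<prec> b \<Longrightarrow> h \<preceq> a" using lo by blast
    obtain d d' where d: "(d, d') \<in> G" "b \<prec> d" "\<And>h h'. (h, h') \<in> G \<Longrightarrow> b \<prec> h \<Longrightarrow> d \<preceq> h" using up 3 by blast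
    have aR: "(a, a') \<in> R" "(d, d') \<in> R" using a d G by auto
    note m = hG[OF aR(1)] hG[OF aR(2)]
    have lo': "\<psi> (b \<ominus> h) \<preceq> \<psi> (b \<ominus> a)" if "(h, h') \<in> G" "h \<prec> b" for h h'
    proof -
      have h: "h \<in> \<Gamma>" "h \<preceq> a" using hG[of h h'] G(1) that a(3)[OF that] by auto
      then have "b \<ominus> a \<preceq> b \<ominus> h" using add_less_cancel(2)[of "\<ominus> a" "\<ominus> h" b] m b by auto
      then show ?thesis using psi_antimono[of "b \<ominus> a" "b \<ominus> h"] h m b a by (simp add: sub_pos)
    qed
    have up': "\<psi> (h \<ominus> b) \<preceq> \<psi> (d \<ominus> b)" if "(h, h') \<in> G" "b \<prec> h" for h h'
    proof -
      have h: "h \<in> \<Gamma>" "d \<preceq> h" using hG[of h h'] G(1) that d(3)[OF that] by auto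
      then have "d \<ominus> b \<preceq> h \<ominus> b" using add_less_cancel(1)[of d h "\<ominus> b"] m b by auto
      then show ?thesis using psi_antimono[of "d \<ominus> b" "h \<ominus> b"] h m b d by (simp add: sub_pos)
    qed
    have c: "\<psi> (b \<ominus> a) \<in> carrier M" "\<psi> (d \<ominus> b) \<in> carrier M" using m b by auto
    consider "\<psi> (b \<ominus> a) = \<psi> (d \<ominus> b)" | "\<psi> (d \<ominus> b) \<prec> \<psi> (b \<ominus> a)" | "\<psi> (b \<ominus> a) \<prec> \<psi> (d \<ominus> b)"
      using less_linear[OF c] by blast
    then show ?thesis
    proof cases
      case 1
      show ?thesis by (rule midpoint_approx[OF T R G(1) b aR(1) a(2) aR(2) d(2) 1 a(3) d(3)])
    next
      case 2
      show ?thesis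
      proof (rule one_sided_approx[OF T R G(1) b aR(1) a(2) bT[OF aR(1)] a(3)])
        fix h h' assume h: "(h, h') \<in> G" "b \<prec> h"
        show "\<psi> (h \<ominus> b) \<prec> \<psi> (b \<ominus> a)"
          using le_less_trans[OF up'[OF h] 2] c hG[of h h'] h G(1) b by auto
      qed
    next
      case 3
      show ?thesis
      proof (rule one_sided_approx'[OF T R G(1) b aR(2) d(2) bT'[OF aR(2)] d(3)])
        fix h h' assume h: "(h, h') \<in> G" "h \<prec> b"
        show "\<psi> (b \<ominus> h) \<prec> \<psi> (d \<ominus> b)"
          using le_less_trans[OF lo'[OF h] 3] c hG[of h h'] h G(1) b by auto
      qed
    qed
  qed
qed

text \<open>Finite approximations and saturation give \<open>b'\<close>. That all values
  \<open>\<psi> (b \<ominus> h)\<close> are already in the domain of \<open>T\<close> is what allows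
  their images to be prescribed.\<close>

lemma realize_type:
  assumes N: "countably_saturated L_log N" and T: "Psi_iso T" and R: "good T R" "countable R"
    and b: "b \<in> \<Gamma>" "b \<notin> Domain R"
    and bT: "\<And>h h'. (h, h') \<in> R \<Longrightarrow> \<psi> (b \<ominus> h) \<in> Domain T"
  shows "\<exists>b'\<in>\<Gamma>\<^bsub>N\<^esub>. good T (span R b b')"
proof -
  define t where "t = (\<lambda>w. SOME w'. (w, w') \<in> T)"
  have t: "(w, t w) \<in> T" if "w \<in> Domain T" for w
    unfolding t_def using that someI_ex[of "\<lambda>w'. (w, w') \<in> T"] by blast
  have t': "(w, w') \<in> T \<longleftrightarrow> w' = t w" if "w \<in> Domain T" for w w'
    using t[OF that] Psi_isoD(8)[OF T t[OF that], of w w'] by auto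
  define f where "f = (\<lambda>(h, h' :: 'n). (h', t (\<psi> (b \<ominus> h)), h \<prec> b))"
  have "\<exists>z\<in>\<Gamma>\<^bsub>N\<^esub>. \<forall>(h, w, c)\<in>f ` R. \<psi>\<^bsub>N\<^esub> (z \<ominus>\<^bsub>N\<^esub> h) = w \<and> (h \<prec>\<^bsub>N\<^esub> z \<longleftrightarrow> c)"
  proof (rule N.saturated_psi_type[OF N])
    show "countable (f ` R)" "f ` R \<noteq> {}" using R by (auto simp: good_def)
    show "h \<in> \<Gamma>\<^bsub>N\<^esub> \<and> w \<in> \<Gamma>\<^bsub>N\<^esub>" if "(h, w, c) \<in> f ` R" for h w c
    proof -
      from that obtain g where g: "(g, h) \<in> R" "w = t (\<psi> (b \<ominus> g))" by (auto simp: f_def)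
      then show ?thesis using Psi_isoD(4)[OF T t[OF bT[OF g(1)]]] goodD(2)[OF R(1) g(1)] by simp
    qed
    fix F assume F: "F \<subseteq> f ` R" "finite F" "F \<noteq> {}"
    then obtain G where G: "finite G" "G \<subseteq> R" "F = f ` G" using finite_subset_image by metis
    have "G \<noteq> {}" using F G by auto
    then have "\<exists>z\<in>\<Gamma>\<^bsub>N\<^esub>. \<forall>(h, h')\<in>G. (\<psi> (b \<ominus> h), \<psi>\<^bsub>N\<^esub> (z \<ominus>\<^bsub>N\<^esub> h')) \<in> T \<and> (h' \<prec>\<^bsub>N\<^esub> z \<longleftrightarrow> h \<prec> b)"
      by (rule finite_approx[OF T R(1) G(2,1) _ b]) (rule bT)
    then obtain z where z: "z \<in> \<Gamma>\<^bsub>N\<^esub>"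
      "\<forall>(h, h')\<in>G. (\<psi> (b \<ominus> h), \<psi>\<^bsub>N\<^esub> (z \<ominus>\<^bsub>N\<^esub> h')) \<in> T \<and> (h' \<prec>\<^bsub>N\<^esub> z \<longleftrightarrow> h \<prec> b)" by blast
    have "\<psi>\<^bsub>N\<^esub> (z \<ominus>\<^bsub>N\<^esub> h) = w \<and> (h \<prec>\<^bsub>N\<^esub> z \<longleftrightarrow> c)" if "(h, w, c) \<in> F" for h w c
    proof -
      from that obtain g where g: "(g, h) \<in> G" "w = t (\<psi> (b \<ominus> g))" "c = (g \<prec> b)" unfolding G(3) f_def by auto
      have "(g, h) \<in> R" using g(1) G(2) by blast
      moreover have "(\<psi> (b \<ominus> g), \<psi>\<^bsub>N\<^esub> (z \<ominus>\<^bsub>N\<^esub> h)) \<in> T \<and> (h \<prec>\<^bsub>N\<^esub> z \<longleftrightarrow> g \<prec> b)" using z(2) g(1) by blast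
      ultimately show ?thesis using t'[OF bT[of g h]] g by simp
    qed
    then show "\<exists>z\<in>\<Gamma>\<^bsub>N\<^esub>. \<forall>(h, w, c)\<in>F. \<psi>\<^bsub>N\<^esub> (z \<ominus>\<^bsub>N\<^esub> h) = w \<and> (h \<prec>\<^bsub>N\<^esub> z \<longleftrightarrow> c)"
      using z(1) by blast
  qed
  then obtain z where z: "z \<in> \<Gamma>\<^bsub>N\<^esub>" and zR: "\<forall>q\<in>f ` R. case q of (h, w, c) \<Rightarrow> \<psi>\<^bsub>N\<^esub> (z \<ominus>\<^bsub>N\<^esub> h) = w \<and> (h \<prec>\<^bsub>N\<^esub> z \<longleftrightarrow> c)"
    by blast
  have "good T (span R b z)"
  proof (rule span_good[OF R(1) b(1) z])
    fix h h' assume h: "(h, h') \<in> R"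
    then have "f (h, h') \<in> f ` R" by blast
    then have *: "\<psi>\<^bsub>N\<^esub> (z \<ominus>\<^bsub>N\<^esub> h') = t (\<psi> (b \<ominus> h))" "h' \<prec>\<^bsub>N\<^esub> z \<longleftrightarrow> h \<prec> b"
      using bspec[OF zR, of "f (h, h')"] by (simp_all add: f_def)
    then have **: "(\<psi> (b \<ominus> h), \<psi>\<^bsub>N\<^esub> (z \<ominus>\<^bsub>N\<^esub> h')) \<in> T" using t[OF bT[OF h]] by simp
    \<comment> \<open>Equality would make the value \<open>\<infinity>\<close>, whereas
      \<open>T\<close> consists of values in the groups.\<close>
    then have "h' \<noteq> z" using Psi_isoD(4)[OF T **] z by auto
    then show "h \<noteq> b \<and> h' \<noteq> z \<and> (h \<prec> b \<longleftrightarrow> h' \<prec>\<^bsub>N\<^esub> z) \<and> (\<psi> (b \<ominus> h), \<psi>\<^bsub>N\<^esub> (z \<ominus>\<^bsub>N\<^esub> h')) \<in> T"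
      using * ** h b by auto
  qed
  then show ?thesis using z by blast
qed

end

section \<open>Extending partial isomorphisms\<close>

context log_model
begin

text \<open>These are the substructures without \<open>\<infinity>\<close>; the guards on \<psi> and
  \<open>\<p>\<close> skip the arguments where the result is \<open>\<infinity>\<close>.\<close>

definition closed_set :: "'m set \<Rightarrow> bool" where
  "closed_set E \<longleftrightarrow> E \<subseteq> \<Gamma> \<and> \<zero> \<in> E \<and> (\<forall>x\<in>E. \<forall>y\<in>E. x \<oplus> y \<in> E) \<and>
     (\<forall>x\<in>E. \<ominus> x \<in> E \<and> \<s> x \<in> E \<and> (\<forall>n. \<delta> n x \<in> E) \<and> (x \<noteq> \<zero> \<longrightarrow> \<psi> x \<in> E) \<and>
        (x \<in> \<Psi> \<and> x \<noteq> \<s> \<zero> \<longrightarrow> \<p> x \<in> E))"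

lemma closed_setD:
  assumes "closed_set E"
  shows "E \<subseteq> \<Gamma>" "\<zero> \<in> E" "x \<in> E \<Longrightarrow> y \<in> E \<Longrightarrow> x \<oplus> y \<in> E" "x \<in> E \<Longrightarrow> \<ominus> x \<in> E" "x \<in> E \<Longrightarrow> \<s> x \<in> E"
    "x \<in> E \<Longrightarrow> \<delta> n x \<in> E" "x \<in> E \<Longrightarrow> x \<noteq> \<zero> \<Longrightarrow> \<psi> x \<in> E" "x \<in> E \<Longrightarrow> x \<in> \<Psi> \<Longrightarrow> x \<noteq> \<s> \<zero> \<Longrightarrow> \<p> x \<in> E"
  using assms unfolding closed_set_def by auto

lemma closed_set_mul: assumes E: "closed_set E" and x: "x \<in> E" shows "mul k x \<in> E"
proof -
  have xG: "x \<in> \<Gamma>" using closed_setD(1)[OF E] x by blast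
  show ?thesis
  proof (induction k rule: int_induct[where k = 0])
    case base then show ?case using closed_setD(2)[OF E] by simp
  next
    case (step1 i) then show ?case using closed_setD(3)[OF E] x xG by (simp add: mul_Suc)
  next
    case (step2 i) then show ?case using closed_setD(3,4)[OF E] x xG by (simp add: mul_pred)
  qed
qed

lemma closed_set_divisible: assumes E: "closed_set E" and x: "x \<in> E" and k: "k \<noteq> 0" shows "\<exists>y\<in>E. mul k y = x"
proof -
  have xG: "x \<in> \<Gamma>" using closed_setD(1)[OF E] x by blast
  obtain n where n: "k = 1 + int n \<or> k = - (1 + int n)"
  proof (cases "k > 0")
    case True
    then show ?thesis using that[of "nat (k - 1)"] by simp
  next
    case False
    then show ?thesis using that[of "nat (- k - 1)"] k by simp
  qed
  have d: "\<delta> n x \<in> \<Gamma>" "\<delta> n x \<in> E" "\<ominus> \<delta> n x \<in> E" using xG closed_setD(4,6)[OF E] x by auto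
  show ?thesis
  proof (cases "k = 1 + int n")
    case True
    then show ?thesis using mul_delta[OF xG, of n] d by blast
  next
    case False
    then have "mul k (\<ominus> \<delta> n x) = mul (1 + int n) (\<delta> n x)" using n d xG mul_neg[OF d(1), of "1 + int n"]
      by (simp add: mul_minus)
    then show ?thesis using mul_delta[OF xG, of n] d by auto
  qed
qed

definition adjoin :: "'m set \<Rightarrow> 'm \<Rightarrow> 'm set" where
  "adjoin E w = {x \<in> \<Gamma>. \<exists>k m h. k \<ge> 1 \<and> h \<in> E \<and> mul k x = h \<oplus> mul m w}"

lemma adjoinI: "x \<in> \<Gamma> \<Longrightarrow> k \<ge> 1 \<Longrightarrow> h \<in> E \<Longrightarrow> mul k x = h \<oplus> mul m w \<Longrightarrow> x \<in> adjoin E w"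
  unfolding adjoin_def by blast

lemma adjoin_mono: assumes "closed_set E" "w \<in> \<Gamma>" shows "E \<subseteq> adjoin E w" "w \<in> adjoin E w"
proof
  fix x assume "x \<in> E"
  then show "x \<in> adjoin E w" using closed_setD(1)[OF assms(1)] assms(2)
    by (intro adjoinI[where k = 1 and h = x and m = 0]) auto
next
  show "w \<in> adjoin E w" using closed_setD(1,2)[OF assms(1)] assms(2)
    by (intro adjoinI[where k = 1 and h = "\<zero>" and m = 1]) auto
qed

lemma adjoin_add:
  assumes E: "closed_set E" and w: "w \<in> \<Gamma>" and x: "x \<in> adjoin E w" and y: "y \<in> adjoin E w"
  shows "x \<oplus> y \<in> adjoin E w"
proof -
  obtain k m h where x: "x \<in> \<Gamma>" "k \<ge> 1" "h \<in> E" "mul k x = h \<oplus> mul m w" using x unfolding adjoin_def by blast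
  obtain k1 m1 h1 where y: "y \<in> \<Gamma>" "k1 \<ge> 1" "h1 \<in> E" "mul k1 y = h1 \<oplus> mul m1 w" using y unfolding adjoin_def by blast
  have h: "h \<in> \<Gamma>" "h1 \<in> \<Gamma>" using closed_setD(1)[OF E] x y by auto
  show ?thesis
  proof (rule adjoinI)
    show "x \<oplus> y \<in> \<Gamma>" using x y by simp
    show "k * k1 \<ge> 1" using x(2) y(2) mult_mono[of 1 k 1 k1] by simp
    show "mul k1 h \<oplus> mul k h1 \<in> E" using closed_set_mul[OF E] closed_setD(3)[OF E] x y by blast
    have "mul (k * k1) (x \<oplus> y) = mul k1 (mul k x) \<oplus> mul k (mul k1 y)"
      using x(1) y(1) by (simp add: mul_plus mul_mult mult.commute flip: mul_mult)
    then show "mul (k * k1) (x \<oplus> y) = mul k1 h \<oplus> mul k h1 \<oplus> mul (k1 * m + k * m1) w"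
      using h w unfolding x y by (simp add: mul_plus mul_add mul_mult ag)
  qed
qed

lemma adjoin_mul_iff:
  assumes E: "closed_set E" and w: "w \<in> \<Gamma>" and x: "x \<in> \<Gamma>" and k: "k \<noteq> 0"
  shows "mul k x \<in> adjoin E w \<longleftrightarrow> x \<in> adjoin E w"
proof
  assume "mul k x \<in> adjoin E w"
  then obtain l m h where l: "l \<ge> 1" "h \<in> E" "mul l (mul k x) = h \<oplus> mul m w" unfolding adjoin_def by blast
  have h: "h \<in> \<Gamma>" using l closed_setD(1)[OF E] by auto
  show "x \<in> adjoin E w"
  proof (cases "k > 0")
    case True
    then have "l * k \<ge> 1" using l mult_mono[of 1 l 1 k] by simp
    then show ?thesis using adjoinI[OF x, of "l * k" h E m] l x by (simp add: mul_mult)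
  next
    case False
    then have "l * (- k) \<ge> 1" using l k mult_mono[of 1 l 1 "- k"] by linarith
    moreover have "mul (l * (- k)) x = \<ominus> h \<oplus> mul (- m) w" using l x h w mul_neg[OF x, of "l * k"]
      by (simp add: mul_mult mul_neg ag)
    ultimately show ?thesis using adjoinI[OF x, of "l * (- k)" "\<ominus> h" E "- m"] l closed_setD(4)[OF E] by simp
  qed
next
  assume "x \<in> adjoin E w"
  then obtain l m h where l: "l \<ge> 1" "h \<in> E" "mul l x = h \<oplus> mul m w" unfolding adjoin_def by blast
  have h: "h \<in> \<Gamma>" using l closed_setD(1)[OF E] by auto
  have "mul l (mul k x) = mul k (mul l x)" using x by (simp add: mult.commute flip: mul_mult)
  also have "\<dots> = mul k h \<oplus> mul (k * m) w" using l h w by (simp add: mul_plus mul_mult)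
  finally show "mul k x \<in> adjoin E w" using adjoinI[of "mul k x" l "mul k h"] x l closed_set_mul[OF E] by blast
qed

lemma adjoin_sub:
  assumes E: "closed_set E" and w: "w \<in> \<Gamma>" and x: "x \<in> adjoin E w" and y: "y \<in> adjoin E w"
  shows "x \<ominus> y \<in> adjoin E w"
proof -
  have "y \<in> \<Gamma>" using y by (simp add: adjoin_def)
  then have "\<ominus> y \<in> adjoin E w" using adjoin_mul_iff[OF E w, of y "-1"] y by simp
  then show ?thesis using adjoin_add[OF E w x] by blast
qed

text \<open>Adjoining an element \<open>w\<close> above all of \<Psi> in \<open>E\<close> creates no
  new values: up to a rational multiple a new element is \<open>w \<ominus> l\<close> with
  \<open>l\<close> in \<open>E\<close>, and \<open>\<psi> (w \<ominus> l) = \<s> l\<close>.\<close>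

lemma adjoin_psi:
  assumes E: "closed_set E" and w: "w \<in> \<Psi>" "\<And>v. v \<in> E \<Longrightarrow> v \<in> \<Psi> \<Longrightarrow> v \<prec> w" and x: "x \<in> adjoin E w" "x \<noteq> \<zero>"
  shows "\<psi> x \<in> E" "\<psi> x \<in> \<Psi>"
proof -
  obtain k m h where k: "x \<in> \<Gamma>" "k \<ge> 1" "h \<in> E" "mul k x = h \<oplus> mul m w" using x unfolding adjoin_def by blast
  have h: "h \<in> \<Gamma>" using closed_setD(1)[OF E] k by auto
  have wG: "w \<in> \<Gamma>" using w Psi_Gam by blast
  have px: "\<psi> (mul k x) = \<psi> x" using psi_mul[of x k] k(1,2) by simp
  show "\<psi> x \<in> \<Psi>" using k x by auto
  show "\<psi> x \<in> E"
  proof (cases "m = 0")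
    case True
    then have "mul k x = h" using k h by simp
    then have "\<psi> x = \<psi> h" "h \<noteq> \<zero>" using px k(1,2) x by auto
    then show ?thesis using closed_setD(7)[OF E k(3)] by simp
  next
    case False
    obtain l where l: "l \<in> E" "mul m l = \<ominus> h" using closed_set_divisible[OF E closed_setD(4)[OF E k(3)] False] by blast
    have lG: "l \<in> \<Gamma>" using closed_setD(1)[OF E] l by auto
    have "\<s> l \<prec> w" using w(2) closed_setD(5)[OF E l(1)] lG by blast
    then have "\<psi> (w \<ominus> l) = \<s> l" using psi_sub_top(1)[OF lG w(1)] psi_sub_swap[of w l] lG wG by simp
    moreover have "mul k x = mul m (w \<ominus> l)" using k l h lG wG by (simp add: mul_plus mul_minus ag)
    then have "\<psi> x = \<psi> (w \<ominus> l)" using px psi_mul[of "w \<ominus> l" m] lG wG False by simp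
    ultimately show ?thesis using closed_setD(5)[OF E l(1)] by simp
  qed
qed

text \<open>The group is torsion-free, so an element is determined by the triple
  \<open>(k, m, h)\<close> of its equation.\<close>

lemma adjoin_countable: assumes "countable E" shows "countable (adjoin E w)"
proof -
  let ?f = "\<lambda>(k, m, h). THE x. x \<in> \<Gamma> \<and> mul k x = h \<oplus> mul m w"
  have "adjoin E w \<subseteq> ?f ` (UNIV \<times> UNIV \<times> E)"
  proof
    fix x assume "x \<in> adjoin E w"
    then obtain k m h where k: "x \<in> \<Gamma>" "k \<ge> 1" "h \<in> E" "mul k x = h \<oplus> mul m w" unfolding adjoin_def by blast
    have "?f (k, m, h) = x" using k mul_cancel[of _ x k] by (auto intro!: the_equality)
    then have "x = ?f (k, m, h)" by simp
    then show "x \<in> ?f ` (UNIV \<times> UNIV \<times> E)" by (rule image_eqI) (use k(3) in simp)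
  qed
  moreover have "countable ((UNIV :: (int) set) \<times> (UNIV :: int set) \<times> E)" using assms by (intro countable_SIGMA) auto
  ultimately show ?thesis by (meson countable_image countable_subset)
qed

text \<open>Write \<open>w \<ominus> h = (w \<ominus> v) \<oplus> (v \<ominus> h)\<close>, where the
  first summand is negative with value \<open>\<s> w\<close>. Whichever summand has the smaller
  value decides; nothing is claimed when the values are equal.\<close>

lemma Psi_top_compare:
  assumes "w \<in> \<Psi>" "v \<in> \<Psi>" "w \<prec> v" "h \<in> \<Gamma>"
  shows "\<psi> (h \<ominus> v) \<prec> \<s> w \<Longrightarrow> \<psi> (w \<ominus> h) = \<psi> (h \<ominus> v) \<and> (h \<prec> w \<longleftrightarrow> h \<prec> v)"
    "\<s> w \<prec> \<psi> (h \<ominus> v) \<Longrightarrow> \<psi> (w \<ominus> h) = \<s> w \<and> \<not> h \<prec> w"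
proof -
  have G: "w \<in> \<Gamma>" "v \<in> \<Gamma>" using assms Psi_Gam by auto
  define x y where "x = w \<ominus> v" and "y = v \<ominus> h"
  have xy: "x \<in> \<Gamma>" "y \<in> \<Gamma>" "x \<oplus> y = w \<ominus> h" "\<psi> x = \<s> w" "\<psi> y = \<psi> (h \<ominus> v)"
    using G assms psi_Psi_sub' psi_sub_swap[of v h] by (auto simp: x_def y_def ag)
  have s: "\<zero> \<prec> y \<longleftrightarrow> h \<prec> v" "\<not> \<zero> \<prec> x" "\<zero> \<prec> x \<oplus> y \<longleftrightarrow> h \<prec> w"
    unfolding xy(3) using G assms sub_pos less_asym[of w v] by (auto simp: x_def y_def)
  show "\<psi> (h \<ominus> v) \<prec> \<s> w \<Longrightarrow> \<psi> (w \<ominus> h) = \<psi> (h \<ominus> v) \<and> (h \<prec> w \<longleftrightarrow> h \<prec> v)"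
    using psi_add_eq'[of x y] add_sign(3)[of y x] xy s by simp
  show "\<s> w \<prec> \<psi> (h \<ominus> v) \<Longrightarrow> \<psi> (w \<ominus> h) = \<s> w \<and> \<not> h \<prec> w"
    using psi_add_eq[of x y] add_sign(1)[of x y] xy s by simp
qed

end

section \<open>Extending an isomorphism to a given countable substructure\<close>

context two_models
begin

text \<open>Graphs of isomorphisms between substructures with \<open>\<infinity>\<close> removed.\<close>

definition log_iso :: "('m \<times> 'n) set \<Rightarrow> bool" where
  "log_iso R \<longleftrightarrow> R \<subseteq> \<Gamma> \<times> \<Gamma>\<^bsub>N\<^esub> \<and> (\<zero>, \<zero>\<^bsub>N\<^esub>) \<in> R \<and>
     (\<forall>x x' y y'. (x, x') \<in> R \<longrightarrow> (y, y') \<in> R \<longrightarrow>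
        (x \<oplus> y, x' \<oplus>\<^bsub>N\<^esub> y') \<in> R \<and> (x \<prec> y \<longleftrightarrow> x' \<prec>\<^bsub>N\<^esub> y') \<and> (x = y \<longleftrightarrow> x' = y')) \<and>
     (\<forall>x x'. (x, x') \<in> R \<longrightarrow> (\<ominus> x, \<ominus>\<^bsub>N\<^esub> x') \<in> R \<and> (\<s> x, \<s>\<^bsub>N\<^esub> x') \<in> R \<and> (\<forall>n. (\<delta> n x, \<delta>\<^bsub>N\<^esub> n x') \<in> R) \<and>
        (x \<noteq> \<zero> \<longrightarrow> (\<psi> x, \<psi>\<^bsub>N\<^esub> x') \<in> R) \<and> (x \<in> \<Psi> \<and> x \<noteq> \<s> \<zero> \<longleftrightarrow> x' \<in> \<Psi>\<^bsub>N\<^esub> \<and> x' \<noteq> \<s>\<^bsub>N\<^esub> \<zero>\<^bsub>N\<^esub>) \<and>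
        (x \<in> \<Psi> \<and> x \<noteq> \<s> \<zero> \<longrightarrow> (\<p> x, \<p>\<^bsub>N\<^esub> x') \<in> R))"

text \<open>First \<open>T0\<close> is extended to the elements of \<open>\<Psi>\<close> in \<open>E\<close>, then an element \<open>\<omega>\<close> of \<open>\<Psi>\<close> above all of these is
  adjoined. For \<open>w \<in> \<Psi>\<close> below \<open>\<omega>\<close>, the order of \<open>h\<close> and \<open>w\<close> and the value \<open>\<psi> (w \<ominus> h)\<close> are determined by
  \<open>\<psi> (h \<ominus> \<omega>)\<close> unless this is \<open>\<s> w\<close>; the invariant \<open>inv\<close> excludes that case as long as \<open>w\<close> is not in the
  domain.\<close>

lemma extension:
  assumes satM: "countably_saturated L_log M" and satN: "countably_saturated L_log N"
    and E: "closed_set E" "countable E"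
    and T0: "Psi_iso T0" "Domain T0 \<subseteq> E" and R0: "good T0 R0" "Domain R0 \<subseteq> E"
    and sR0: "\<And>x x'. (x, x') \<in> R0 \<Longrightarrow> (\<s> x, \<s>\<^bsub>N\<^esub> x') \<in> T0 \<and> (x \<prec> \<s> x \<longleftrightarrow> x' \<prec>\<^bsub>N\<^esub> \<s>\<^bsub>N\<^esub> x')"
    and iR0: "\<And>x x' w w'. (x, x') \<in> R0 \<Longrightarrow> (w, w') \<in> T0 \<Longrightarrow> x \<noteq> \<zero> \<and> \<psi> x = \<s> w \<or> \<s> x = \<s> w \<Longrightarrow> (w, w') \<in> R0"
  shows "\<exists>R. R0 \<subseteq> R \<and> Domain R = E \<and> log_iso R"
proof -
  define W where "W = E \<inter> \<Psi>"
  have EG: "x \<in> E \<Longrightarrow> x \<in> \<Gamma>" for x using closed_setD(1)[OF E(1)] by blast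
  have W: "countable W" "W \<subseteq> \<Psi>" "\<And>w. w \<in> W \<Longrightarrow> \<s> w \<in> W" "\<And>w. w \<in> W \<Longrightarrow> w \<noteq> \<s> \<zero> \<Longrightarrow> \<p> w \<in> W" "\<s> \<zero> \<in> W"
    using E(2) closed_setD(2,5,8)[OF E(1)] EG pred_Psi(1) by (auto simp: W_def)
  have T0W: "Domain T0 \<subseteq> W" using T0(2) Psi_isoD(1)[OF T0(1)] by (auto simp: W_def)
  obtain T where T: "Psi_iso T" "T0 \<subseteq> T" "Domain T = W" using Psi_iso_extend[OF satN T0(1) T0W W(1-4)] by blast
  note TD = Psi_isoD[OF T(1)]
  have cT: "countable (snd ` T)" using Psi_iso_countable[OF T(1) W(1)] T(3) by simp
  \<comment> \<open>The upper half of the cut is empty, so that only elements of \<open>W\<close>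
    have to be exceeded.\<close>
  obtain \<omega> where \<omega>: "\<omega> \<in> \<Psi>" "\<And>w. w \<in> W \<Longrightarrow> w \<prec> \<omega>"
    using saturated_Psi_cut[OF satM W(1,2), of "{}"] W(5) by auto
  have "snd ` T \<subseteq> \<Psi>\<^bsub>N\<^esub>" "snd ` T \<noteq> {}" using TD(2) T(1) unfolding Psi_iso_def by auto
  then obtain \<omega>' where \<omega>': "\<omega>' \<in> \<Psi>\<^bsub>N\<^esub>" "\<And>w w'. (w, w') \<in> T \<Longrightarrow> w' \<prec>\<^bsub>N\<^esub> \<omega>'"
    using N.saturated_Psi_cut[OF satN cT, of "{}"] by force
  have \<omega>G: "\<omega> \<in> \<Gamma>" "\<omega>' \<in> \<Gamma>\<^bsub>N\<^esub>" using \<omega>(1) \<omega>'(1) Psi_Gam N.Psi_Gam by auto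
  have \<omega>E: "\<omega> \<notin> E" using \<omega>(2)[of \<omega>] \<omega>(1) \<omega>G less_irrefl[of \<omega>] by (auto simp: W_def)
  \<comment> \<open>All relations built from here on have their domain inside \<open>D\<close>. By
    \<open>adjoin_psi\<close> the values on \<open>D\<close> lie in \<open>W\<close>, so
    \<open>T\<close> already knows their images.\<close>
  define D where "D = adjoin E \<omega>"
  have D: "countable D" "E \<subseteq> D" "\<omega> \<in> D" "\<And>x y. x \<in> D \<Longrightarrow> y \<in> D \<Longrightarrow> x \<oplus> y \<in> D" "\<And>x y. x \<in> D \<Longrightarrow> y \<in> D \<Longrightarrow> x \<ominus> y \<in> D"
    "\<And>x k. x \<in> \<Gamma> \<Longrightarrow> k \<noteq> 0 \<Longrightarrow> mul k x \<in> D \<longleftrightarrow> x \<in> D" "D \<subseteq> \<Gamma>"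
    using adjoin_countable[OF E(2)] adjoin_mono[OF E(1) \<omega>G(1)] adjoin_add[OF E(1) \<omega>G(1)] adjoin_sub[OF E(1) \<omega>G(1)]
      adjoin_mul_iff[OF E(1) \<omega>G(1)] by (auto simp: D_def adjoin_def)
  have D\<psi>: "\<psi> x \<in> W" if "x \<in> D" "x \<noteq> \<zero>" for x
    using adjoin_psi[OF E(1) \<omega>(1) _ that[unfolded D_def]] \<omega>(2) by (auto simp: W_def)
  have Dspan: "Domain (span R b b') \<subseteq> D" if R: "good T R" "Domain R \<subseteq> D" and b: "b \<in> D" for R b b'
  proof
    fix x assume "x \<in> Domain (span R b b')"
    then obtain k m h h' where x: "x \<in> \<Gamma>" "k \<ge> 1" "(h, h') \<in> R" "mul k x = h \<oplus> mul m b" unfolding span_def by blast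
    have "mul m b \<in> D"
    proof (cases "m = 0")
      case True then show ?thesis using D(2) closed_setD(2)[OF E(1)] by auto
    qed (use D(6)[of b m] b D(7) in auto)
    then have "mul k x \<in> D" using D(4)[of h "mul m b"] R(2) x by auto
    then show "x \<in> D" using D(6)[of x k] x by simp
  qed

  define inv where "inv = (\<lambda>R. \<forall>x x' w w'. (x, x') \<in> R \<longrightarrow> x \<noteq> \<zero> \<longrightarrow> (w, w') \<in> T \<longrightarrow> \<psi> x = \<s> w \<longrightarrow> (w, w') \<in> R)"
  define R1 where "R1 = span R0 \<omega> \<omega>'"
  have gR0: "good T R0" using good_mono[OF R0(1) T(2)] .
  \<comment> \<open>The cut of \<open>\<omega>\<close> over \<open>R0\<close> and the values of its
    differences are expressed by \<open>\<s> h\<close>; hence the assumption \<open>sR0\<close> is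
    exactly what the extension by \<open>(\<omega>, \<omega>')\<close> needs.\<close>
  have *: "\<psi> (\<omega> \<ominus> h) = \<s> h" "\<psi>\<^bsub>N\<^esub> (\<omega>' \<ominus>\<^bsub>N\<^esub> h') = \<s>\<^bsub>N\<^esub> h'" "h \<noteq> \<omega>" "h' \<noteq> \<omega>'" "h \<prec> \<omega> \<longleftrightarrow> h' \<prec>\<^bsub>N\<^esub> \<omega>'"
      "(\<s> h, \<s>\<^bsub>N\<^esub> h') \<in> T" if h: "(h, h') \<in> R0" for h h'
  proof -
    note d = goodD(1,2)[OF gR0 h]
    show t: "(\<s> h, \<s>\<^bsub>N\<^esub> h') \<in> T" using sR0[OF h] T(2) by blast
    have lt: "\<s> h \<prec> \<omega>" "\<s>\<^bsub>N\<^esub> h' \<prec>\<^bsub>N\<^esub> \<omega>'" using \<omega>(2) \<omega>'(2)[OF t] t T(3) by auto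
    show "\<psi> (\<omega> \<ominus> h) = \<s> h" "\<psi>\<^bsub>N\<^esub> (\<omega>' \<ominus>\<^bsub>N\<^esub> h') = \<s>\<^bsub>N\<^esub> h'" "h \<noteq> \<omega>" "h' \<noteq> \<omega>'" "h \<prec> \<omega> \<longleftrightarrow> h' \<prec>\<^bsub>N\<^esub> \<omega>'"
      using psi_sub_top[OF d(1) \<omega>(1) lt(1)] N.psi_sub_top[OF d(2) \<omega>'(1) lt(2)] sR0[OF h]
        psi_sub_swap[OF \<omega>G(1) d(1)] N.psi_sub_swap[OF \<omega>G(2) d(2)] by auto
  qed
  have gR1: "good T R1" unfolding R1_def
    by (rule span_good[OF gR0 \<omega>G]) (use * in auto)
  have R1: "R0 \<subseteq> R1" "(\<omega>, \<omega>') \<in> R1" unfolding R1_def using span_mono[OF gR0] span_gen[OF gR0 \<omega>G] by auto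
  have DR1: "Domain R1 \<subseteq> D" unfolding R1_def using Dspan[OF gR0] R0(2) D by blast
  \<comment> \<open>\<open>T0\<close> is closed under \<open>\<p>\<close>, and so contains
    \<open>w\<close> as soon as it contains \<open>\<s> w\<close>. This brings values occurring over
    \<open>R0\<close> into the scope of \<open>iR0\<close>.\<close>
  have T0T: "(w, w') \<in> T0" if w: "(w, w') \<in> T" and sw: "\<s> w \<in> Domain T0" for w w'
  proof -
    obtain v' where v': "(\<s> w, v') \<in> T0" using sw by blast
    have "w \<in> \<Psi>" using TD(1)[OF w] .
    then have "(w, \<p>\<^bsub>N\<^esub> v') \<in> T0" using Psi_isoD(6)[OF T0(1) v'] succ_notmin by simp
    moreover from this have "w' = \<p>\<^bsub>N\<^esub> v'" using TD(8)[OF w] T(2) by blast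
    ultimately show ?thesis by simp
  qed
  have inv1: "inv R1" unfolding inv_def
  proof (intro allI impI)
    fix x x' w w' assume x: "(x, x') \<in> R1" "x \<noteq> \<zero>" and w: "(w, w') \<in> T" "\<psi> x = \<s> w"
    show "(w, w') \<in> R1"
    proof (cases "(x, x') \<in> R0")
      case True
      then have "(\<psi> x, \<psi>\<^bsub>N\<^esub> x') \<in> T0" using goodD(7)[OF R0(1)] x by blast
      then have "(w, w') \<in> T0" using T0T[OF w(1)] w(2) by auto
      then show ?thesis using iR0[OF True, of w w'] x w R1 by auto
    next
      case False
      obtain k m h h' where k: "k \<ge> 1" "m \<noteq> 0" "(h, h') \<in> R0" "mul k x = mul m (\<omega> \<ominus> h)"
        by (rule span_normal_form[OF gR0 \<omega>G x(1)[unfolded R1_def] False])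
      have xG: "x \<in> \<Gamma>" "h \<in> \<Gamma>" using goodD(1)[OF gR1 x(1)] goodD(1)[OF gR0 k(3)] by auto
      have "\<psi> x = \<psi> (mul k x)" using psi_mul[OF xG(1), of k] k(1) by simp
      also have "\<dots> = \<s> h" unfolding k(4) using psi_mul[of "\<omega> \<ominus> h" m] xG \<omega>G k(2) *(1)[OF k(3)] by simp
      finally have e: "\<psi> x = \<s> h" .
      then have "(w, w') \<in> T0" using T0T[OF w(1)] w(2) sR0[OF k(3)] by auto
      then show ?thesis using iR0[OF k(3), of w w'] e w(2) R1 by auto
    qed
  qed

  define P where "P = (\<lambda>R. good T R \<and> Domain R \<subseteq> D)"
  define P1 where "P1 = (\<lambda>R. P R \<and> inv R)"
  have chainP: "P (\<Union>C)" if "C \<noteq> {}" "subset.chain A C" "\<And>R. R \<in> C \<Longrightarrow> P R" for C and A :: "('m \<times> 'n) set set"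
    using good_chain[OF that(1,2)] that(3) unfolding P_def by blast
  have "\<exists>R. P1 R \<and> R1 \<subseteq> R \<and> W \<subseteq> Domain R"
  proof (rule extend_relation)
    show "P1 R1" using gR1 DR1 inv1 by (simp add: P1_def P_def)
    fix C assume C: "C \<noteq> {}" "subset.chain {R. P1 R \<and> R1 \<subseteq> R} C"
    then have "\<And>R. R \<in> C \<Longrightarrow> P1 R" unfolding subset.chain_def by auto
    then have "P (\<Union>C)" and "\<And>R. R \<in> C \<Longrightarrow> inv R" using chainP[OF C] unfolding P1_def by blast+
    then show "P1 (\<Union>C)" unfolding P1_def inv_def by (meson UnionE UnionI)
  next
    fix R w assume "P1 R" and RR: "R1 \<subseteq> R" and w: "w \<in> W" "w \<notin> Domain R"
    then have R: "good T R" "Domain R \<subseteq> D" "inv R" by (auto simp: P1_def P_def)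
    obtain w' where w': "(w, w') \<in> T" using T(3) w by blast
    have wP: "w \<in> \<Psi>" "w' \<in> \<Psi>\<^bsub>N\<^esub>" "w \<in> \<Gamma>" "w' \<in> \<Gamma>\<^bsub>N\<^esub>" using TD(1-4)[OF w'] by auto
    have w\<omega>: "w \<prec> \<omega>" "w' \<prec>\<^bsub>N\<^esub> \<omega>'" using \<omega>(2) w \<omega>'(2)[OF w'] by auto
    have sw: "(\<s> w, \<s>\<^bsub>N\<^esub> w') \<in> T" using TD(5)[OF w'] .
    have \<omega>R: "(\<omega>, \<omega>') \<in> R" using RR R1 by auto
    \<comment> \<open>The last disjunction is there for the invariant: each value
      \<open>\<psi> (w \<ominus> h)\<close> is either \<open>\<s> w\<close> or one that already
      occurs as \<open>\<psi> (h \<ominus> \<omega>)\<close>.\<close>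
    have key: "h \<noteq> w \<and> (h \<prec> w \<longleftrightarrow> h' \<prec>\<^bsub>N\<^esub> w') \<and> (\<psi> (w \<ominus> h), \<psi>\<^bsub>N\<^esub> (w' \<ominus>\<^bsub>N\<^esub> h')) \<in> T \<and>
        (\<psi> (w \<ominus> h) = \<s> w \<or> (h \<noteq> \<omega> \<and> \<psi> (w \<ominus> h) = \<psi> (h \<ominus> \<omega>)))" if h: "(h, h') \<in> R" for h h'
    proof (cases "h = \<omega>")
      case True
      then have "h' = \<omega>'" using good_order(2)[OF R(1) h \<omega>R] by simp
      then show ?thesis using True psi_Psi_sub'[OF wP(1) \<omega>(1) w\<omega>(1)] N.psi_Psi_sub'[OF wP(2) \<omega>'(1) w\<omega>(2)] sw w\<omega> \<omega>G wP
          less_asym[OF w\<omega>(1)] N.less_asym[OF w\<omega>(2)] by auto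
    next
      case False
      note d = goodD(1,2)[OF R(1) h]
      have y: "(\<psi> (h \<ominus> \<omega>), \<psi>\<^bsub>N\<^esub> (h' \<ominus>\<^bsub>N\<^esub> \<omega>')) \<in> T" using good_order(3)[OF R(1) h \<omega>R False] .
      have o: "h \<prec> \<omega> \<longleftrightarrow> h' \<prec>\<^bsub>N\<^esub> \<omega>'" using good_order(1)[OF R(1) h \<omega>R] .
      have "\<psi> (h \<ominus> \<omega>) \<noteq> \<s> w"
      proof
        assume "\<psi> (h \<ominus> \<omega>) = \<s> w"
        then have "(w, w') \<in> R" using R(3) goodD(9)[OF R(1) h \<omega>R] False d \<omega>G w' sub_eq_zero unfolding inv_def by blast
        then show False using w by blast
      qed
      then consider "\<psi> (h \<ominus> \<omega>) \<prec> \<s> w" | "\<s> w \<prec> \<psi> (h \<ominus> \<omega>)"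
        using less_linear[of "\<psi> (h \<ominus> \<omega>)" "\<s> w"] d \<omega>G wP by auto
      then show ?thesis
      proof cases
        case 1
        then have "\<psi>\<^bsub>N\<^esub> (h' \<ominus>\<^bsub>N\<^esub> \<omega>') \<prec>\<^bsub>N\<^esub> \<s>\<^bsub>N\<^esub> w'" using TD(7)[OF y sw] by simp
        then show ?thesis using Psi_top_compare(1)[OF wP(1) \<omega>(1) w\<omega>(1) d(1) 1] N.Psi_top_compare(1)[OF wP(2) \<omega>'(1) w\<omega>(2) d(2)]
            o y False w h by auto
      next
        case 2
        then have "\<s>\<^bsub>N\<^esub> w' \<prec>\<^bsub>N\<^esub> \<psi>\<^bsub>N\<^esub> (h' \<ominus>\<^bsub>N\<^esub> \<omega>')" using TD(7)[OF sw y] by simp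
        then show ?thesis using Psi_top_compare(2)[OF wP(1) \<omega>(1) w\<omega>(1) d(1) 2] N.Psi_top_compare(2)[OF wP(2) \<omega>'(1) w\<omega>(2) d(2)]
            sw w h by auto
      qed
    qed
    have "good T (span R w w')"
    proof (rule span_good[OF R(1) wP(3,4)])
      fix h h' assume h: "(h, h') \<in> R"
      have "h' \<noteq> w'" using key[OF h] TD(4) wP(4) by force
      then show "h \<noteq> w \<and> h' \<noteq> w' \<and> (h \<prec> w \<longleftrightarrow> h' \<prec>\<^bsub>N\<^esub> w') \<and> (\<psi> (w \<ominus> h), \<psi>\<^bsub>N\<^esub> (w' \<ominus>\<^bsub>N\<^esub> h')) \<in> T" using key[OF h] by blast
    qed
    moreover have "Domain (span R w w') \<subseteq> D" using Dspan[OF R(1,2)] w D(2) by (auto simp: W_def)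
    moreover have "inv (span R w w')" unfolding inv_def
    proof (intro allI impI)
      fix x x' v v' assume x: "(x, x') \<in> span R w w'" "x \<noteq> \<zero>" and v: "(v, v') \<in> T" "\<psi> x = \<s> v"
      note sm = span_mono[OF R(1), of w w']
      show "(v, v') \<in> span R w w'"
      proof (cases "(x, x') \<in> R")
        case True
        then have "(v, v') \<in> R" using R(3) x v unfolding inv_def by blast
        then show ?thesis using sm by blast
      next
        case False
        obtain k m h h' where k: "k \<ge> 1" "m \<noteq> 0" "(h, h') \<in> R" "mul k x = mul m (w \<ominus> h)"
          by (rule span_normal_form[OF R(1) wP(3,4) x(1) False])
        have xG: "x \<in> \<Gamma>" "h \<in> \<Gamma>" using x(1) goodD(1)[OF R(1) k(3)] by (auto simp: span_def)
        have "\<psi> x = \<psi> (mul k x)" using psi_mul[OF xG(1), of k] k(1) by simp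
        also have "\<dots> = \<psi> (w \<ominus> h)" unfolding k(4) using psi_mul[of "w \<ominus> h" m] xG wP k(2) by simp
        finally have e: "\<psi> (w \<ominus> h) = \<s> v" using v by simp
        consider "\<psi> (w \<ominus> h) = \<s> w" | "h \<noteq> \<omega>" "\<psi> (w \<ominus> h) = \<psi> (h \<ominus> \<omega>)" using key[OF k(3)] by blast
        then show ?thesis
        proof cases
          case 1
          then have "v = w" using e Psi_succ_inj[of v w] TD(1)[OF v(1)] wP by simp
          then have "v' = w'" using TD(8)[OF v(1) w'] by simp
          then show ?thesis using \<open>v = w\<close> span_gen[OF R(1) wP(3,4)] by simp
        next
          case 2
          have "(v, v') \<in> R" using R(3) goodD(9)[OF R(1) k(3) \<omega>R] 2 xG \<omega>G v e sub_eq_zero unfolding inv_def by metis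
          then show ?thesis using sm by blast
        qed
      qed
    qed
    ultimately show "\<exists>R'. P1 R' \<and> R \<subseteq> R' \<and> w \<in> Domain R'"
      using span_mono[OF R(1), of w w'] span_gen[OF R(1) wP(3,4)] unfolding P1_def P_def by blast
  qed
  then obtain R2 where "P1 R2" and R12: "R1 \<subseteq> R2" and WR2: "W \<subseteq> Domain R2" by blast
  then have R2: "good T R2" "Domain R2 \<subseteq> D" "inv R2" by (auto simp: P1_def P_def)
  \<comment> \<open>So far each \<open>w\<close> in \<open>W\<close> merely has some image. The
    invariant, applied to \<open>w \<ominus> \<omega>\<close> of value \<open>\<s> w\<close>, shows
    that the image is the one prescribed by \<open>T\<close>.\<close>
  have TR2: "T \<subseteq> R2"
  proof (rule subrelI)
    fix w w' assume w: "(w, w') \<in> T"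
    then obtain x' where x': "(w, x') \<in> R2" using WR2 T(3) by blast
    have w\<omega>: "w \<prec> \<omega>" "w \<in> \<Psi>" "w \<in> \<Gamma>" using \<omega>(2) w T(3) TD(1,3)[OF w] by auto
    have "(w \<ominus> \<omega>, x' \<ominus>\<^bsub>N\<^esub> \<omega>') \<in> R2" using goodD(9)[OF R2(1) x'] R1 R12 by blast
    moreover have "\<psi> (w \<ominus> \<omega>) = \<s> w" "w \<ominus> \<omega> \<noteq> \<zero>" using psi_Psi_sub'[OF w\<omega>(2) \<omega>(1) w\<omega>(1)] w\<omega> \<omega>G less_irrefl by auto
    ultimately show "(w, w') \<in> R2" using R2(3) w unfolding inv_def by blast
  qed
  have "\<exists>R. P R \<and> R2 \<subseteq> R \<and> E \<subseteq> Domain R"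
  proof (rule extend_relation)
    show "P R2" using R2 by (simp add: P_def)
    fix C assume C: "C \<noteq> {}" "subset.chain {R. P R \<and> R2 \<subseteq> R} C"
    then have "\<And>R. R \<in> C \<Longrightarrow> P R" unfolding subset.chain_def by auto
    then show "P (\<Union>C)" using chainP[OF C] by blast
  next
    fix R b assume "P R" "R2 \<subseteq> R" and b: "b \<in> E" "b \<notin> Domain R"
    then have R: "good T R" "Domain R \<subseteq> D" by (auto simp: P_def)
    have "\<exists>b'\<in>\<Gamma>\<^bsub>N\<^esub>. good T (span R b b')"
    proof (rule realize_type[OF satN T(1) R(1) good_countable[OF R(1) D(1) R(2)] EG[OF b(1)] b(2)])
      fix h h' assume h: "(h, h') \<in> R"
      then have "b \<ominus> h \<in> D" "b \<noteq> h" "h \<in> \<Gamma>" using D(5)[of b h] R(2) b D(2) goodD(1)[OF R(1) h] by auto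
      \<comment> \<open>The difference stays in \<open>D\<close>, whose nonzero elements have values
        in \<open>W = Domain T\<close>.\<close>
      then show "\<psi> (b \<ominus> h) \<in> Domain T" using D\<psi>[of "b \<ominus> h"] EG[OF b(1)] T(3) by simp
    qed
    then obtain b' where b': "b' \<in> \<Gamma>\<^bsub>N\<^esub>" "good T (span R b b')" by blast
    then show "\<exists>R'. P R' \<and> R \<subseteq> R' \<and> b \<in> Domain R'"
      using span_mono[OF R(1), of b b'] span_gen[OF R(1) EG[OF b(1)] b'(1)] Dspan[OF R, of b b'] b(1) D(2) unfolding P_def by blast
  qed
  then obtain R3 where "P R3" and R23: "R2 \<subseteq> R3" and ER3: "E \<subseteq> Domain R3" by blast
  then have R3: "good T R3" by (auto simp: P_def)
  have \<omega>R3: "(\<omega>, \<omega>') \<in> R3" using R1 R12 R23 by blast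
  have TR3: "(w, w') \<in> R3" if "(w, w') \<in> T" for w w' using that TR2 R23 by blast
  \<comment> \<open>The auxiliary element \<open>\<omega>\<close> and everything else outside
    \<open>E\<close> are discarded.\<close>
  define R where "R = {(x, x') \<in> R3. x \<in> E}"
  have RT: "(w, w') \<in> R" if "(w, w') \<in> T" for w w' using TR3[OF that] T(3) that by (auto simp: R_def W_def)
  \<comment> \<open>This is where \<open>\<omega>\<close> pays off: \<open>\<s> x\<close> is
    \<open>\<psi> (x \<ominus> \<omega>)\<close>, and likewise in the other model, so preserving
    \<psi> gives preservation of \<open>\<s>\<close>.\<close>
  have succR: "(\<s> x, \<s>\<^bsub>N\<^esub> x') \<in> T" if "(x, x') \<in> R" for x x'
  proof -
    have x: "(x, x') \<in> R3" "x \<in> E" using that by (auto simp: R_def)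
    note d = goodD(1,2)[OF R3 x(1)]
    have sx: "\<s> x \<in> W" using closed_setD(5)[OF E(1) x(2)] d by (auto simp: W_def)
    have "\<psi> (x \<ominus> \<omega>) = \<s> x" "x \<noteq> \<omega>" using psi_sub_top(1,3)[OF d(1) \<omega>(1) \<omega>(2)[OF sx]] by auto
    then have t: "(\<s> x, \<psi>\<^bsub>N\<^esub> (x' \<ominus>\<^bsub>N\<^esub> \<omega>')) \<in> T" using good_order(3)[OF R3 x(1) \<omega>R3] by simp
    then show ?thesis using N.succ_eq_psi_top[OF d(2) \<omega>'(1) \<omega>'(2)[OF t]] by simp
  qed
  \<comment> \<open>If only the image is known to be in \<Psi>, then applying \<open>\<p>\<close> to
    its successor gives a pair of \<open>T\<close> with the same second component; injectivity of
    \<open>R3\<close> identifies it.\<close>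
  have PsiR: "(x, x') \<in> T" if x: "(x, x') \<in> R" "x \<in> \<Psi> \<or> x' \<in> \<Psi>\<^bsub>N\<^esub>" for x x'
  proof -
    have x3: "(x, x') \<in> R3" "x \<in> E" using x by (auto simp: R_def)
    from x(2) show ?thesis
    proof
      assume "x \<in> \<Psi>"
      then obtain w' where w': "(x, w') \<in> T" using x3 T(3) by (auto simp: W_def)
      then show ?thesis using good_order(2)[OF R3 TR3[OF w'] x3(1)] by simp
    next
      assume xN: "x' \<in> \<Psi>\<^bsub>N\<^esub>"
      have s: "(\<s> x, \<s>\<^bsub>N\<^esub> x') \<in> T" using succR[OF x(1)] .
      have "\<s> x \<noteq> \<s> \<zero>" using TD(9)[OF s] N.succ_notmin[OF xN] by simp
      then have t: "(\<p> (\<s> x), x') \<in> T" using TD(6)[OF s] xN by simp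
      then show ?thesis using good_order(2)[OF R3 TR3[OF t] x3(1)] by simp
    qed
  qed
  have "log_iso R" unfolding log_iso_def
  proof (intro conjI allI impI)
    have RD: "(x, x') \<in> R3" "x \<in> E" if "(x, x') \<in> R" for x x' using that by (auto simp: R_def)
    show "R \<subseteq> \<Gamma> \<times> \<Gamma>\<^bsub>N\<^esub>" using goodD(1,2)[OF R3] by (auto simp: R_def)
    show "(\<zero>, \<zero>\<^bsub>N\<^esub>) \<in> R" using R3 closed_setD(2)[OF E(1)] by (auto simp: R_def good_def)
    fix x x' assume x: "(x, x') \<in> R"
    note d = goodD(1,2)[OF R3 RD(1)[OF x]]
    show "(\<ominus> x, \<ominus>\<^bsub>N\<^esub> x') \<in> R" using goodD(3)[OF R3 RD(1)[OF x]] closed_setD(4)[OF E(1) RD(2)[OF x]] by (simp add: R_def)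
    show "(\<s> x, \<s>\<^bsub>N\<^esub> x') \<in> R" using RT succR[OF x] by blast
    show "(\<delta> n x, \<delta>\<^bsub>N\<^esub> n x') \<in> R" for n
      using good_pure[OF R3, of "\<delta> n x" "\<delta>\<^bsub>N\<^esub> n x'" "1 + int n"] d RD[OF x] closed_setD(6)[OF E(1) RD(2)[OF x]] by (simp add: R_def)
    show "(\<psi> x, \<psi>\<^bsub>N\<^esub> x') \<in> R" if "x \<noteq> \<zero>" using RT goodD(7)[OF R3 RD(1)[OF x] that] by blast
    show "x \<in> \<Psi>\<^bsub>M\<^esub> \<and> x \<noteq> \<s> \<zero> \<longleftrightarrow> x' \<in> \<Psi>\<^bsub>N\<^esub> \<and> x' \<noteq> \<s>\<^bsub>N\<^esub> \<zero>\<^bsub>N\<^esub>"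
      using PsiR[OF x] TD(1,2,9) by blast
    show "(\<p> x, \<p>\<^bsub>N\<^esub> x') \<in> R" if "x \<in> \<Psi> \<and> x \<noteq> \<s> \<zero>" using RT TD(6) PsiR[OF x] that by blast
    fix y y' assume y: "(y, y') \<in> R"
    show "(x \<oplus> y, x' \<oplus>\<^bsub>N\<^esub> y') \<in> R" using goodD(8)[OF R3 RD(1)[OF x] RD(1)[OF y]] closed_setD(3)[OF E(1) RD(2)[OF x] RD(2)[OF y]] by (simp add: R_def)
    show "x \<prec> y \<longleftrightarrow> x' \<prec>\<^bsub>N\<^esub> y'" "x = y \<longleftrightarrow> x' = y'" using good_order(1,2)[OF R3 RD(1)[OF x] RD(1)[OF y]] by auto
  qed
  moreover have "R0 \<subseteq> R" using R0(2) R1 R12 R23 by (auto simp: R_def)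
  moreover have "Domain R = E" using ER3 by (auto simp: R_def)
  ultimately show ?thesis by blast
qed

end

section \<open>Quantifier elimination\<close>

instance tm :: (countable) countable by countable_datatype
instance log_fun :: countable by countable_datatype

fun tsubst :: "(nat \<Rightarrow> 'f tm) \<Rightarrow> 'f tm \<Rightarrow> 'f tm" where
  "tsubst \<sigma> (Var v) = \<sigma> v"
| "tsubst \<sigma> (Fn f ts) = Fn f (map (tsubst \<sigma>) ts)"

lemma eval_tsubst: "eval M e (tsubst \<sigma> t) = eval M (\<lambda>v. eval M e (\<sigma> v)) t"
  by (induction t) (auto simp: comp_def cong: map_cong)

lemma wf_tsubst: "wf_tm L t \<Longrightarrow> (\<And>v. v \<in> vars_tm t \<Longrightarrow> wf_tm L (\<sigma> v)) \<Longrightarrow> wf_tm L (tsubst \<sigma> t)"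
  by (induction t) auto

lemma vars_tsubst: "vars_tm (tsubst \<sigma> t) = (\<Union>v\<in>vars_tm t. vars_tm (\<sigma> v))"
  by (induction t) auto

lemma eval_cong: "(\<And>v. v \<in> vars_tm t \<Longrightarrow> e v = e' v) \<Longrightarrow> eval M e t = eval M e' t"
proof (induction t)
  case (Fn f ts)
  then have "map (eval M e) ts = map (eval M e') ts" by (intro map_cong) auto
  then show ?case by (simp only: eval.simps)
qed auto

lemma sat_cong: "(\<And>v. v \<in> free_vars \<phi> \<Longrightarrow> e v = e' v) \<Longrightarrow> sat M e \<phi> \<longleftrightarrow> sat M e' \<phi>"
proof (induction \<phi> arbitrary: e e')
  case (Eq t u)
  have "eval M e t = eval M e' t" "eval M e u = eval M e' u" by (rule eval_cong; use Eq in simp)+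
  then show ?case by simp
next
  case (Rel r ts)
  then have "map (eval M e) ts = map (eval M e') ts" by (intro map_cong eval_cong) auto
  then show ?case by (simp only: sat.simps)
next
  case (Imp \<phi> \<chi>)
  have "sat M e \<phi> \<longleftrightarrow> sat M e' \<phi>" by (rule Imp.IH(1)) (use Imp.prems in auto)
  moreover have "sat M e \<chi> \<longleftrightarrow> sat M e' \<chi>" by (rule Imp.IH(2)) (use Imp.prems in auto)
  ultimately show ?case by simp
next
  case (Forall v \<phi>)
  have "sat M (e(v := a)) \<phi> \<longleftrightarrow> sat M (e'(v := a)) \<phi>" for a
    using Forall.prems by (intro Forall.IH) auto
  then show ?case by simp
qed simp

lemma log_tm_induct [consumes 1, case_names Var Zero Inf Plus Neg Psi Succ Pred Delta]:
  assumes "wf_tm L_log t" "\<And>v. P (Var v)" "P tZero" "P tInf"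
    "\<And>t u. wf_tm L_log t \<Longrightarrow> wf_tm L_log u \<Longrightarrow> P t \<Longrightarrow> P u \<Longrightarrow> P (t [+] u)"
    "\<And>t. wf_tm L_log t \<Longrightarrow> P t \<Longrightarrow> P (tNeg t)"
    "\<And>t. wf_tm L_log t \<Longrightarrow> P t \<Longrightarrow> P (tPsi t)"
    "\<And>t. wf_tm L_log t \<Longrightarrow> P t \<Longrightarrow> P (tSucc t)"
    "\<And>t. wf_tm L_log t \<Longrightarrow> P t \<Longrightarrow> P (tPred t)"
    "\<And>n t. wf_tm L_log t \<Longrightarrow> P t \<Longrightarrow> P (tDelta n t)"
  shows "P t"
  using assms(1)
proof (induction t)
  case (Var v) then show ?case using assms(2) by simp
next
  case (Fn f ts)
  then have l: "length ts = log_fun_arity f" and w: "\<And>t. t \<in> set ts \<Longrightarrow> wf_tm L_log t" and P: "\<And>t. t \<in> set ts \<Longrightarrow> P t" by auto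
  consider "ts = []" | t where "ts = [t]" | t u where "ts = [t, u]"
    using l by (cases f) (auto simp: length_Suc_conv numeral_2_eq_2)
  then show ?case
  proof cases
    case 1 then show ?thesis using l assms(3,4) by (cases f) auto
  next
    case (2 t)
    then have "wf_tm L_log t" "P t" using w P by auto
    then show ?thesis using 2 l assms(6-10) by (cases f) auto
  next
    case (3 t u)
    then have "wf_tm L_log t" "P t" "wf_tm L_log u" "P u" using w P by auto
    then show ?thesis using 3 l assms(5) by (cases f) auto
  qed
qed

context log_model
begin

lemma plus_closed [simp, intro]: "x \<in> carrier M \<Longrightarrow> y \<in> carrier M \<Longrightarrow> x \<oplus> y \<in> carrier M"
  by (cases "x = \<infinity> \<or> y = \<infinity>") (auto simp: carrier)

lemma unary_closed [simp, intro]: "x \<in> carrier M \<Longrightarrow> \<ominus> x \<in> carrier M" "x \<in> carrier M \<Longrightarrow> \<s> x \<in> carrier M"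
  "x \<in> carrier M \<Longrightarrow> \<delta> n x \<in> carrier M" "\<infinity> \<in> carrier M" "\<zero> \<in> carrier M"
  by (cases "x = \<infinity>"; auto simp: carrier)+

lemma eval_closed: assumes "wf_tm L_log t" "\<And>v. e v \<in> carrier M" shows "eval M e t \<in> carrier M"
  using assms(1) by (induction t rule: log_tm_induct) (use assms(2) in auto)

lemma pred_eq_infty: "x \<in> carrier M \<Longrightarrow> \<p> x = \<infinity> \<longleftrightarrow> \<not> (x \<in> \<Psi> \<and> x \<noteq> \<s> \<zero>)"
  using pred_infty[of x] pred_Psi(1)[of x] Psi_Gam infty_notin by metis

lemma closed_set_terms:
  assumes e: "\<And>v. e v \<in> carrier M"
  shows "closed_set {x \<in> \<Gamma>. \<exists>t. wf_tm L_log t \<and> x = eval M e t}" (is "closed_set ?E")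
proof -
  have I: "wf_tm L_log t \<Longrightarrow> eval M e t \<in> \<Gamma> \<Longrightarrow> eval M e t \<in> ?E" for t by blast
  have u: "fn M f [x] \<in> ?E" if x: "x \<in> ?E" and f: "log_fun_arity f = 1" "fn M f [x] \<in> \<Gamma>" for f x
  proof -
    from x obtain t where t: "wf_tm L_log t" "x = eval M e t" by blast
    then show ?thesis using I[of "Fn f [t]"] f by simp
  qed
  have b: "x \<oplus> y \<in> ?E" if xy: "x \<in> ?E" "y \<in> ?E" for x y
  proof -
    from xy obtain t u where "wf_tm L_log t" "x = eval M e t" "wf_tm L_log u" "y = eval M e u" by blast
    moreover have "x \<oplus> y \<in> \<Gamma>" using xy by auto
    ultimately show ?thesis using I[of "t [+] u"] by simp
  qed
  show ?thesis unfolding closed_set_def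
  proof (intro conjI ballI allI impI)
    show "\<zero> \<in> ?E" using I[of tZero] by simp
    fix x assume x: "x \<in> ?E"
    then have xG: "x \<in> \<Gamma>" by simp
    show "\<ominus> x \<in> ?E" "\<s> x \<in> ?E" "\<delta> n x \<in> ?E" for n
      by (rule u[OF x]; use xG in simp)+
    show "\<psi> x \<in> ?E" if "x \<noteq> \<zero>" by (rule u[OF x]) (use xG that in simp_all)
    show "\<p> x \<in> ?E" if "x \<in> \<Psi> \<and> x \<noteq> \<s> \<zero>" by (rule u[OF x]) (use pred_Psi(1)[of x] Psi_Gam that in simp_all)
  qed (use b in auto)
qed

end

definition atomic_equiv ::
    "(log_fun, log_rel, 'm) fo_struct \<Rightarrow> (log_fun, log_rel, 'n) fo_struct \<Rightarrow> (nat \<Rightarrow> 'm) \<Rightarrow> (nat \<Rightarrow> 'n) \<Rightarrow> bool" where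
  "atomic_equiv M N e e' \<longleftrightarrow> (\<forall>t u. wf_tm L_log t \<longrightarrow> wf_tm L_log u \<longrightarrow>
     (eval M e t = eval M e u \<longleftrightarrow> eval N e' t = eval N e' u) \<and>
     (eval M e t \<prec>\<^bsub>M\<^esub> eval M e u \<longleftrightarrow> eval N e' t \<prec>\<^bsub>N\<^esub> eval N e' u))"

lemma atomic_equiv_sym: "atomic_equiv M N e e' \<Longrightarrow> atomic_equiv N M e' e"
  unfolding atomic_equiv_def by blast

section \<open>Atomic equivalence of assignments and isomorphisms of generated substructures\<close>

context two_models
begin

lemma log_isoD:
  assumes "log_iso R" "(x, x') \<in> R"
  shows "x \<in> \<Gamma>" "x' \<in> \<Gamma>\<^bsub>N\<^esub>" "(y, y') \<in> R \<Longrightarrow> (x \<oplus> y, x' \<oplus>\<^bsub>N\<^esub> y') \<in> R" "(y, y') \<in> R \<Longrightarrow> x \<prec> y \<longleftrightarrow> x' \<prec>\<^bsub>N\<^esub> y'"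
   "(y, y') \<in> R \<Longrightarrow> x = y \<longleftrightarrow> x' = y'" "(\<ominus> x, \<ominus>\<^bsub>N\<^esub> x') \<in> R" "(\<s> x, \<s>\<^bsub>N\<^esub> x') \<in> R" "(\<delta> n x, \<delta>\<^bsub>N\<^esub> n x') \<in> R"
   "x \<noteq> \<zero> \<Longrightarrow> (\<psi> x, \<psi>\<^bsub>N\<^esub> x') \<in> R" "x \<in> \<Psi> \<and> x \<noteq> \<s> \<zero> \<longleftrightarrow> x' \<in> \<Psi>\<^bsub>N\<^esub> \<and> x' \<noteq> \<s>\<^bsub>N\<^esub> \<zero>\<^bsub>N\<^esub>"
   "x \<in> \<Psi> \<and> x \<noteq> \<s> \<zero> \<Longrightarrow> (\<p> x, \<p>\<^bsub>N\<^esub> x') \<in> R" "x = \<zero> \<longleftrightarrow> x' = \<zero>\<^bsub>N\<^esub>"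
proof -
  have 1: "R \<subseteq> \<Gamma> \<times> \<Gamma>\<^bsub>N\<^esub>" "(\<zero>, \<zero>\<^bsub>N\<^esub>) \<in> R"
    and 2: "\<forall>x x' y y'. (x, x') \<in> R \<longrightarrow> (y, y') \<in> R \<longrightarrow>
        (x \<oplus> y, x' \<oplus>\<^bsub>N\<^esub> y') \<in> R \<and> (x \<prec> y \<longleftrightarrow> x' \<prec>\<^bsub>N\<^esub> y') \<and> (x = y \<longleftrightarrow> x' = y')"
    and 3: "\<forall>x x'. (x, x') \<in> R \<longrightarrow> (\<ominus> x, \<ominus>\<^bsub>N\<^esub> x') \<in> R \<and> (\<s> x, \<s>\<^bsub>N\<^esub> x') \<in> R \<and> (\<forall>n. (\<delta> n x, \<delta>\<^bsub>N\<^esub> n x') \<in> R) \<and>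
        (x \<noteq> \<zero> \<longrightarrow> (\<psi> x, \<psi>\<^bsub>N\<^esub> x') \<in> R) \<and> (x \<in> \<Psi> \<and> x \<noteq> \<s> \<zero> \<longleftrightarrow> x' \<in> \<Psi>\<^bsub>N\<^esub> \<and> x' \<noteq> \<s>\<^bsub>N\<^esub> \<zero>\<^bsub>N\<^esub>) \<and>
        (x \<in> \<Psi> \<and> x \<noteq> \<s> \<zero> \<longrightarrow> (\<p> x, \<p>\<^bsub>N\<^esub> x') \<in> R)"
    using assms(1)[unfolded log_iso_def, THEN conjunct1] assms(1)[unfolded log_iso_def, THEN conjunct2, THEN conjunct1]
      assms(1)[unfolded log_iso_def, THEN conjunct2, THEN conjunct2, THEN conjunct1]
      assms(1)[unfolded log_iso_def, THEN conjunct2, THEN conjunct2, THEN conjunct2] by this+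
  note r = 2[rule_format, OF assms(2)] and u = 3[rule_format, OF assms(2)]
  show "x \<in> \<Gamma>" "x' \<in> \<Gamma>\<^bsub>N\<^esub>" using 1 assms(2) by auto
  show "(y, y') \<in> R \<Longrightarrow> (x \<oplus> y, x' \<oplus>\<^bsub>N\<^esub> y') \<in> R" "(y, y') \<in> R \<Longrightarrow> x \<prec> y \<longleftrightarrow> x' \<prec>\<^bsub>N\<^esub> y'"
    "(y, y') \<in> R \<Longrightarrow> x = y \<longleftrightarrow> x' = y'" "x = \<zero> \<longleftrightarrow> x' = \<zero>\<^bsub>N\<^esub>" using r 1(2) by simp_all
  show "(\<ominus> x, \<ominus>\<^bsub>N\<^esub> x') \<in> R" "(\<s> x, \<s>\<^bsub>N\<^esub> x') \<in> R" "(\<delta> n x, \<delta>\<^bsub>N\<^esub> n x') \<in> R"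
   "x \<noteq> \<zero> \<Longrightarrow> (\<psi> x, \<psi>\<^bsub>N\<^esub> x') \<in> R" "x \<in> \<Psi> \<and> x \<noteq> \<s> \<zero> \<longleftrightarrow> x' \<in> \<Psi>\<^bsub>N\<^esub> \<and> x' \<noteq> \<s>\<^bsub>N\<^esub> \<zero>\<^bsub>N\<^esub>"
   "x \<in> \<Psi> \<and> x \<noteq> \<s> \<zero> \<Longrightarrow> (\<p> x, \<p>\<^bsub>N\<^esub> x') \<in> R" using u by blast+
qed

text \<open>Adding the pair of infinities turns the partial operations back into the default-valued
  ones. The two delicate cases are \<psi> at \<open>\<zero>\<close> and \<open>\<p>\<close> outside
  its proper domain, where both sides become infinite together.\<close>

lemma log_iso_eval:
  assumes R: "log_iso R" and e: "\<And>v. (e v, e' v) \<in> insert (\<infinity>, \<infinity>\<^bsub>N\<^esub>) R" and t: "wf_tm L_log t"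
  shows "(eval M e t, eval N e' t) \<in> insert (\<infinity>, \<infinity>\<^bsub>N\<^esub>) R"
proof -
  note d = log_isoD[OF R]
  show ?thesis
    using t
  proof (induction t rule: log_tm_induct)
    case (Var v) then show ?case using e by simp
  next
    case Zero then show ?case using R by (simp add: log_iso_def)
  next
    case Inf then show ?case by simp
  next
    case (Plus t u) then show ?case using d(1-3) by auto
  next
    case (Neg t) then show ?case using d(6) by auto
  next
    case (Psi t)
    show ?case
    proof (cases "eval M e t = \<zero>")
      case True
      then have "eval N e' t = \<zero>\<^bsub>N\<^esub>" using Psi d(12)[of "eval M e t" "eval N e' t"] by auto
      then show ?thesis using True by simp
    next
      case False then show ?thesis using Psi d(9) by auto
    qed
  next
    case (Succ t) then show ?case using d(7) by auto
  next
    case (Pred t)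
    show ?case
    proof (cases "eval M e t \<in> \<Psi> \<and> eval M e t \<noteq> \<s> \<zero>")
      case True
      then have "(eval M e t, eval N e' t) \<in> R" using Pred Psi_Gam[of "\<infinity>"] by auto
      then show ?thesis using d(11) True by simp
    next
      case False
      have c: "eval M e t \<in> carrier M" "eval N e' t \<in> carrier N" using Pred.IH d(1,2) by auto
      have "\<not> (eval N e' t \<in> \<Psi>\<^bsub>N\<^esub> \<and> eval N e' t \<noteq> \<s>\<^bsub>N\<^esub> \<zero>\<^bsub>N\<^esub>)"
        using Pred.IH False d(10) N.Psi_Gam[of "\<infinity>\<^bsub>N\<^esub>"] by auto
      then show ?thesis using pred_infty[OF c(1) False] N.pred_infty[OF c(2)] by simp
    qed
  next
    case (Delta n t) then show ?case using d(8) by auto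
  qed
qed

lemma log_iso_atomic_equiv:
  assumes R: "log_iso R" and e: "\<And>v. (e v, e' v) \<in> insert (\<infinity>, \<infinity>\<^bsub>N\<^esub>) R"
  shows "atomic_equiv M N e e'"
  unfolding atomic_equiv_def
proof (intro allI impI)
  fix t u assume tu: "wf_tm L_log t" "wf_tm L_log u"
  note d = log_isoD[OF R]
  have "(eval M e t, eval N e' t) \<in> insert (\<infinity>, \<infinity>\<^bsub>N\<^esub>) R" "(eval M e u, eval N e' u) \<in> insert (\<infinity>, \<infinity>\<^bsub>N\<^esub>) R"
    using log_iso_eval[OF R, of e e'] e tu by blast+
  moreover have "(x = y \<longleftrightarrow> x' = y') \<and> (x \<prec> y \<longleftrightarrow> x' \<prec>\<^bsub>N\<^esub> y')"
    if xy: "(x, x') \<in> insert (\<infinity>, \<infinity>\<^bsub>N\<^esub>) R" "(y, y') \<in> insert (\<infinity>, \<infinity>\<^bsub>N\<^esub>) R" for x x' y y'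
  proof -
    consider "(x, x') \<in> R" "(y, y') \<in> R" | "x = \<infinity>" "x' = \<infinity>\<^bsub>N\<^esub>" "(y, y') \<in> R" | "y = \<infinity>" "y' = \<infinity>\<^bsub>N\<^esub>" "(x, x') \<in> R"
      | "x = \<infinity>" "x' = \<infinity>\<^bsub>N\<^esub>" "y = \<infinity>" "y' = \<infinity>\<^bsub>N\<^esub>" using xy by auto
    then show ?thesis
    proof cases
      case 1 then show ?thesis using d(4,5)[OF 1] by blast
    next
      case 2 then show ?thesis using d(1,2)[OF 2(3)] by auto
    next
      case 3 then show ?thesis using d(1,2)[OF 3(3)] by auto
    next
      case 4 then show ?thesis by simp
    qed
  qed
  ultimately show "(eval M e t = eval M e u \<longleftrightarrow> eval N e' t = eval N e' u) \<and>
     (eval M e t \<prec> eval M e u \<longleftrightarrow> eval N e' t \<prec>\<^bsub>N\<^esub> eval N e' u)" by blast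
qed

lemma atomic_equiv_log_iso:
  assumes ae: "atomic_equiv M N e e'" and e: "\<And>v. e v \<in> carrier M" "\<And>v. e' v \<in> carrier N"
  shows "log_iso {(eval M e t, eval N e' t) | t. wf_tm L_log t \<and> eval M e t \<in> \<Gamma>}" (is "log_iso ?R")
proof -
  have eq: "eval M e t = eval M e u \<longleftrightarrow> eval N e' t = eval N e' u"
    "eval M e t \<prec> eval M e u \<longleftrightarrow> eval N e' t \<prec>\<^bsub>N\<^esub> eval N e' u" if "wf_tm L_log t" "wf_tm L_log u" for t u
    using ae that unfolding atomic_equiv_def by auto
  have G: "eval M e t \<in> \<Gamma> \<longleftrightarrow> eval N e' t \<in> \<Gamma>\<^bsub>N\<^esub>" if "wf_tm L_log t" for t
    using eq(1)[OF that, of tInf] eval_closed[OF that, of e] N.eval_closed[OF that, of e'] e carrier[of "eval M e t"] N.carrier[of "eval N e' t"] by auto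
  have I: "(eval M e t, eval N e' t) \<in> ?R" if "wf_tm L_log t" "eval M e t \<in> \<Gamma>" for t using that by blast
  have E: "\<exists>t. x = eval M e t \<and> x' = eval N e' t \<and> wf_tm L_log t \<and> x \<in> \<Gamma> \<and> x' \<in> \<Gamma>\<^bsub>N\<^esub>" if "(x, x') \<in> ?R" for x x'
    using that G by blast
  have u: "(fn M f [x], fn N f [x']) \<in> ?R" if x: "(x, x') \<in> ?R" and f: "log_fun_arity f = 1" "fn M f [x] \<in> \<Gamma>" for f x x'
  proof -
    obtain t where "x = eval M e t" "x' = eval N e' t" "wf_tm L_log t" using E[OF x] by blast
    then show ?thesis using I[of "Fn f [t]"] f by simp
  qed
  show ?thesis unfolding log_iso_def
  proof (intro conjI allI impI)
    show "?R \<subseteq> \<Gamma> \<times> \<Gamma>\<^bsub>N\<^esub>" using E by blast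
    show "(\<zero>, \<zero>\<^bsub>N\<^esub>) \<in> ?R" using I[of tZero] by simp
    fix x x' assume x: "(x, x') \<in> ?R"
    then obtain t where t: "x = eval M e t" "x' = eval N e' t" "wf_tm L_log t" "x \<in> \<Gamma>" "x' \<in> \<Gamma>\<^bsub>N\<^esub>" using E by blast
    show "(\<ominus> x, \<ominus>\<^bsub>N\<^esub> x') \<in> ?R" by (rule u[OF x]) (use t(4) in simp_all)
    show "(\<s> x, \<s>\<^bsub>N\<^esub> x') \<in> ?R" by (rule u[OF x]) (use t(4) in simp_all)
    show "(\<delta> n x, \<delta>\<^bsub>N\<^esub> n x') \<in> ?R" for n by (rule u[OF x]) (use t(4) in simp_all)
    show "(\<psi> x, \<psi>\<^bsub>N\<^esub> x') \<in> ?R" if "x \<noteq> \<zero>" by (rule u[OF x]) (use t(4) that in simp_all)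
    show "x \<in> \<Psi> \<and> x \<noteq> \<s> \<zero> \<longleftrightarrow> x' \<in> \<Psi>\<^bsub>N\<^esub> \<and> x' \<noteq> \<s>\<^bsub>N\<^esub> \<zero>\<^bsub>N\<^esub>"
    proof -
      \<comment> \<open>The proper domain of \<open>\<p>\<close> is recognized by an atomic
        formula.\<close>
      have "\<p> x = \<infinity> \<longleftrightarrow> \<p>\<^bsub>N\<^esub> x' = \<infinity>\<^bsub>N\<^esub>" using eq(1)[of "tPred t" tInf] t by simp
      then show ?thesis using pred_eq_infty[of x] N.pred_eq_infty[of x'] t(4,5) by blast
    qed
    show "(\<p> x, \<p>\<^bsub>N\<^esub> x') \<in> ?R" if "x \<in> \<Psi> \<and> x \<noteq> \<s> \<zero>"
      by (rule u[OF x]) (use that pred_Psi(1)[of x] Psi_Gam in simp_all)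
    fix y y' assume "(y, y') \<in> ?R"
    then obtain u where u: "y = eval M e u" "y' = eval N e' u" "wf_tm L_log u" "y \<in> \<Gamma>" "y' \<in> \<Gamma>\<^bsub>N\<^esub>" using E by blast
    show "(x \<oplus> y, x' \<oplus>\<^bsub>N\<^esub> y') \<in> ?R" using I[of "t [+] u"] t u by simp
    show "x \<prec> y \<longleftrightarrow> x' \<prec>\<^bsub>N\<^esub> y'" "x = y \<longleftrightarrow> x' = y'" using eq[OF t(3) u(3)] t u by simp_all
  qed
qed

text \<open>Here \<open>R0\<close> is already a full isomorphism, so \<open>T0\<close> can be its
  part in \<Psi>. All required successors then belong to \<open>T0\<close>, and the invariant of the
  extension holds at the start because \<open>T0\<close> is contained in \<open>R0\<close>.\<close>

lemma log_iso_extension: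
  assumes sat: "countably_saturated L_log M" "countably_saturated L_log N" and E: "closed_set E" "countable E"
    and R0: "log_iso R0" "Domain R0 \<subseteq> E"
  shows "\<exists>R. R0 \<subseteq> R \<and> Domain R = E \<and> log_iso R"
proof -
  note d = log_isoD[OF R0(1)]
  define T0 where "T0 = {(x, x') \<in> R0. x \<in> \<Psi>}"
  \<comment> \<open>\<open>log_iso\<close> speaks only of \<Psi> without its least element.
    Membership in all of \<Psi> follows by passing to \<open>\<s> x\<close>, which is not least, and
    recovering \<open>x\<close> by \<open>\<p>\<close>.\<close>
  have Psi: "x \<in> \<Psi> \<longleftrightarrow> x' \<in> \<Psi>\<^bsub>N\<^esub>" if "(x, x') \<in> R0" for x x'
  proof -
    note sx = d(7)[OF that]
    show ?thesis
    proof
      assume x: "x \<in> \<Psi>"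
      then have s: "\<s> x \<in> \<Psi> \<and> \<s> x \<noteq> \<s> \<zero>" using succ_notmin d(1)[OF that] by blast
      then have "\<p>\<^bsub>N\<^esub> (\<s>\<^bsub>N\<^esub> x') = x'" using d(5)[OF d(11)[OF sx s] that] x by simp
      then show "x' \<in> \<Psi>\<^bsub>N\<^esub>" using N.Psi_iff d(2)[OF that] by blast
    next
      assume x: "x' \<in> \<Psi>\<^bsub>N\<^esub>"
      then have "\<s>\<^bsub>N\<^esub> x' \<in> \<Psi>\<^bsub>N\<^esub> \<and> \<s>\<^bsub>N\<^esub> x' \<noteq> \<s>\<^bsub>N\<^esub> \<zero>\<^bsub>N\<^esub>" using N.succ_notmin d(2)[OF that] by blast
      then have "\<s> x \<in> \<Psi> \<and> \<s> x \<noteq> \<s> \<zero>" using d(10)[OF sx] by blast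
      then have "\<p> (\<s> x) = x" using d(5)[OF d(11)[OF sx] that] x by simp
      then show "x \<in> \<Psi>" using Psi_iff d(1)[OF that] by blast
    qed
  qed
  have T0: "Psi_iso T0" unfolding Psi_iso_def
  proof (intro conjI allI impI)
    show "T0 \<subseteq> \<Psi> \<times> \<Psi>\<^bsub>N\<^esub>" using Psi by (auto simp: T0_def)
    have "(\<zero>, \<zero>\<^bsub>N\<^esub>) \<in> R0" using R0(1) by (simp add: log_iso_def)
    then show "(\<s> \<zero>, \<s>\<^bsub>N\<^esub> \<zero>\<^bsub>N\<^esub>) \<in> T0" using d(7) by (simp add: T0_def)
    fix x x' assume x: "(x, x') \<in> T0"
    then have x': "(x, x') \<in> R0" "x \<in> \<Psi>" by (auto simp: T0_def)
    show "(\<s> x, \<s>\<^bsub>N\<^esub> x') \<in> T0" using x' d(1,7) by (simp add: T0_def)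
    show "(\<p> x, \<p>\<^bsub>N\<^esub> x') \<in> T0" if "x \<noteq> \<s> \<zero>" using x' that d(11) pred_Psi(1) by (simp add: T0_def)
    fix y y' assume "(y, y') \<in> T0"
    then show "x \<prec> y \<longleftrightarrow> x' \<prec>\<^bsub>N\<^esub> y'" using d(4)[OF x'(1)] by (simp add: T0_def)
  qed
  have "good T0 R0" unfolding good_def
  proof (intro conjI allI impI ballI)
    show "R0 \<subseteq> \<Gamma> \<times> \<Gamma>\<^bsub>N\<^esub>" "(\<zero>, \<zero>\<^bsub>N\<^esub>) \<in> R0" using R0(1) by (auto simp: log_iso_def)
    fix x x' assume x: "(x, x') \<in> R0"
    show "(\<ominus> x, \<ominus>\<^bsub>N\<^esub> x') \<in> R0" using d(6)[OF x] .
    show "\<zero> \<prec> x \<longleftrightarrow> \<zero>\<^bsub>N\<^esub> \<prec>\<^bsub>N\<^esub> x'" using d(4)[OF \<open>(\<zero>, \<zero>\<^bsub>N\<^esub>) \<in> R0\<close> x] .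
    show "(\<psi> x, \<psi>\<^bsub>N\<^esub> x') \<in> T0" if "x \<noteq> \<zero>" using d(9)[OF x that] d(1)[OF x] that by (simp add: T0_def)
    show "(x \<oplus> y, x' \<oplus>\<^bsub>N\<^esub> y') \<in> R0" if "(y, y') \<in> R0" for y y' using d(3)[OF x that] .
  next
    fix x x' and k :: int assume x: "x \<in> \<Gamma>" "x' \<in> \<Gamma>\<^bsub>N\<^esub>" and k: "1 \<le> k" and m: "(mul k x, N.mul k x') \<in> R0"
    define n where "n = nat (k - 1)"
    have n: "1 + int n = k" using k by (simp add: n_def)
    have "mul k (\<delta> n (mul k x)) = mul k x" "N.mul k (\<delta>\<^bsub>N\<^esub> n (N.mul k x')) = N.mul k x'"
      using mul_delta[of "mul k x" n] N.mul_delta[of "N.mul k x'" n] x n by auto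
    then have "\<delta> n (mul k x) = x" "\<delta>\<^bsub>N\<^esub> n (N.mul k x') = x'" using mul_cancel[of _ x k] N.mul_cancel[of _ x' k] x k by auto
    then show "(x, x') \<in> R0" using d(8)[OF m, of n] by simp
  qed
  note g = this
  show ?thesis
  proof (rule extension[OF sat E T0 _ g R0(2)])
    show "Domain T0 \<subseteq> E" using R0(2) by (auto simp: T0_def)
    fix x x' assume x: "(x, x') \<in> R0"
    show "(\<s> x, \<s>\<^bsub>N\<^esub> x') \<in> T0 \<and> (x \<prec> \<s> x \<longleftrightarrow> x' \<prec>\<^bsub>N\<^esub> \<s>\<^bsub>N\<^esub> x')"
      using d(7)[OF x] d(4)[OF x d(7)[OF x]] d(1)[OF x] by (simp add: T0_def)
    show "(w, w') \<in> R0" if "(w, w') \<in> T0" for w w' using that by (simp add: T0_def)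
  qed
qed

text \<open>The domain is extended to everything generated by the values of \<open>e\<close>
  together with \<open>a\<close>. This is countable, as there are only countably many terms, even
  though infinitely many variables are assigned.\<close>

lemma back_and_forth:
  assumes sat: "countably_saturated L_log M" "countably_saturated L_log N"
    and ae: "atomic_equiv M N e e'" and e: "\<And>v. e v \<in> carrier M" "\<And>v. e' v \<in> carrier N" and a: "a \<in> carrier M"
  shows "\<exists>a'\<in>carrier N. atomic_equiv M N (e(v := a)) (e'(v := a'))"
proof -
  let ?R0 = "{(eval M e t, eval N e' t) | t. wf_tm L_log t \<and> eval M e t \<in> \<Gamma>}"
  \<comment> \<open>The new element gets variable 0 and the old assignment is shifted, so that no
    value of \<open>e\<close> is overwritten.\<close>
  define e2 where "e2 = case_nat a e"
  define E where "E = {x \<in> \<Gamma>. \<exists>t. wf_tm L_log t \<and> x = eval M e2 t}"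
  have e2: "e2 v \<in> carrier M" for v using a e by (cases v) (auto simp: e2_def)
  have "E \<subseteq> eval M e2 ` UNIV" by (auto simp: E_def)
  then have cE: "countable E" by (rule countable_subset) simp
  have "Domain ?R0 \<subseteq> E"
  proof
    fix x assume "x \<in> Domain ?R0"
    then obtain t where t: "wf_tm L_log t" "x = eval M e t" "x \<in> \<Gamma>" by blast
    have "x = eval M e2 (tsubst (\<lambda>v. Var (Suc v)) t)" using t by (simp add: eval_tsubst e2_def)
    moreover have "wf_tm L_log (tsubst (\<lambda>v. Var (Suc v)) t)" using t by (intro wf_tsubst) auto
    ultimately show "x \<in> E" using t unfolding E_def by blast
  qed
  then obtain R where R: "?R0 \<subseteq> R" "Domain R = E" "log_iso R"
    using log_iso_extension[OF sat closed_set_terms[of e2, OF e2, folded E_def] cE atomic_equiv_log_iso[OF ae e]] by blast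
  have eR: "(e w, e' w) \<in> insert (\<infinity>, \<infinity>\<^bsub>N\<^esub>) R" for w
  proof (cases "e w = \<infinity>")
    case True
    have "e w = \<infinity> \<longleftrightarrow> e' w = \<infinity>\<^bsub>N\<^esub>" using ae[unfolded atomic_equiv_def, rule_format, of "Var w" tInf] by simp
    then show ?thesis using True by simp
  next
    case False
    then have "e w \<in> \<Gamma>" using e(1)[of w] carrier[of "e w"] by blast
    then have "(e w, e' w) \<in> ?R0" by (intro CollectI exI[of _ "Var w"]) simp
    then show ?thesis using R by blast
  qed
  obtain a' where a': "(a, a') \<in> insert (\<infinity>, \<infinity>\<^bsub>N\<^esub>) R"
  proof (cases "a = \<infinity>")
    case False
    then have "a \<in> \<Gamma>" using a carrier[of a] by blast
    then have "a \<in> E" unfolding E_def by (intro CollectI conjI exI[of _ "Var 0"]) (simp_all add: e2_def)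
    then show ?thesis using R(2) that by blast
  qed (use that in blast)
  have "a' \<in> carrier N" using a' log_isoD(2)[OF R(3)] by auto
  moreover have "atomic_equiv M N (e(v := a)) (e'(v := a'))"
    by (rule log_iso_atomic_equiv[OF R(3)]) (use a' eR in auto)
  ultimately show ?thesis by blast
qed

end

text \<open>Formulated as preservation of all formulas between two possibly different models: used
  with one model for indiscernibility and with two for completeness. Only the quantifier needs an
  argument, once in each direction.\<close>

theorem quantifier_elimination:
  assumes M: "log_structure M" "countably_saturated L_log M" and N: "log_structure N" "countably_saturated L_log N"
    and "atomic_equiv M N e e'" "\<And>v. e v \<in> carrier M" "\<And>v. e' v \<in> carrier N" "wf_fm L_log \<phi>"
  shows "sat M e \<phi> \<longleftrightarrow> sat N e' \<phi>"
proof -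
  interpret MN: two_models M N using M N by unfold_locales
  interpret NM: two_models N M by unfold_locales
  show ?thesis using assms(5-)
  proof (induction \<phi> arbitrary: e e')
    case (Eq t u)
    then show ?case unfolding atomic_equiv_def by simp
  next
    case (Rel r ts)
    then obtain t u where "ts = [t, u]" by (auto simp: length_Suc_conv numeral_2_eq_2)
    then show ?case using Rel by (cases r) (auto simp: atomic_equiv_def)
  next
    case (Imp \<phi> \<chi>)
    then show ?case using Imp.IH(1)[of e e'] Imp.IH(2)[of e e'] by simp
  next
    case (Forall v \<phi>)
    note e = Forall.prems
    have 1: "\<exists>a'\<in>carrier N. sat M (e(v := a)) \<phi> \<longleftrightarrow> sat N (e'(v := a')) \<phi>" if a: "a \<in> carrier M" for a
    proof -
      obtain a' where a': "a' \<in> carrier N" "atomic_equiv M N (e(v := a)) (e'(v := a'))"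
        using MN.back_and_forth[OF M(2) N(2) e(1-3) a] by blast
      have "sat M (e(v := a)) \<phi> \<longleftrightarrow> sat N (e'(v := a')) \<phi>"
        by (rule Forall.IH[OF a'(2)]) (use e a a'(1) in auto)
      then show ?thesis using a'(1) by blast
    qed
    have 2: "\<exists>a\<in>carrier M. sat M (e(v := a)) \<phi> \<longleftrightarrow> sat N (e'(v := a')) \<phi>" if a': "a' \<in> carrier N" for a'
    proof -
      obtain a where a: "a \<in> carrier M" "atomic_equiv N M (e'(v := a')) (e(v := a))"
        using NM.back_and_forth[OF N(2) M(2) atomic_equiv_sym[OF e(1)] e(3,2) a'] by blast
      have "sat M (e(v := a)) \<phi> \<longleftrightarrow> sat N (e'(v := a')) \<phi>"
        by (rule Forall.IH[OF atomic_equiv_sym[OF a(2)]]) (use e a' a(1) in auto)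
      then show ?thesis using a(1) by blast
    qed
    show ?case using 1 2 by auto
  qed simp
qed

section \<open>Sequences indiscernible for atomic formulas\<close>

text \<open>Indiscernibility with respect to atomic formulas of a set of sequences, each variable being
  assigned the value of a sequence at an index; constant sequences play the role of parameters.\<close>

definition indisc :: "(log_fun, log_rel, 'm) fo_struct \<Rightarrow> ('i::linorder) set \<Rightarrow> ('i \<Rightarrow> 'm) set \<Rightarrow> bool" where
  "indisc M J S \<longleftrightarrow> (\<forall>t u s \<iota> \<kappa>. wf_tm L_log t \<and> wf_tm L_log u \<and>
     (\<forall>v\<in>vars_tm t \<union> vars_tm u. s v \<in> S \<and> \<iota> v \<in> J \<and> \<kappa> v \<in> J) \<and>
     (\<forall>v\<in>vars_tm t \<union> vars_tm u. \<forall>w\<in>vars_tm t \<union> vars_tm u. \<iota> v < \<iota> w \<longleftrightarrow> \<kappa> v < \<kappa> w) \<longrightarrow>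
     (eval M (\<lambda>v. s v (\<iota> v)) t = eval M (\<lambda>v. s v (\<iota> v)) u \<longleftrightarrow> eval M (\<lambda>v. s v (\<kappa> v)) t = eval M (\<lambda>v. s v (\<kappa> v)) u) \<and>
     (eval M (\<lambda>v. s v (\<iota> v)) t \<prec>\<^bsub>M\<^esub> eval M (\<lambda>v. s v (\<iota> v)) u \<longleftrightarrow> eval M (\<lambda>v. s v (\<kappa> v)) t \<prec>\<^bsub>M\<^esub> eval M (\<lambda>v. s v (\<kappa> v)) u))"

lemma indiscD:
  assumes "indisc M J S" "wf_tm L_log t" "wf_tm L_log u"
    "\<And>v. v \<in> vars_tm t \<union> vars_tm u \<Longrightarrow> s v \<in> S \<and> \<iota> v \<in> J \<and> \<kappa> v \<in> J"
    "\<And>v w. v \<in> vars_tm t \<union> vars_tm u \<Longrightarrow> w \<in> vars_tm t \<union> vars_tm u \<Longrightarrow> \<iota> v < \<iota> w \<longleftrightarrow> \<kappa> v < \<kappa> w"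
  shows "eval M (\<lambda>v. s v (\<iota> v)) t = eval M (\<lambda>v. s v (\<iota> v)) u \<longleftrightarrow> eval M (\<lambda>v. s v (\<kappa> v)) t = eval M (\<lambda>v. s v (\<kappa> v)) u"
    "eval M (\<lambda>v. s v (\<iota> v)) t \<prec>\<^bsub>M\<^esub> eval M (\<lambda>v. s v (\<iota> v)) u \<longleftrightarrow> eval M (\<lambda>v. s v (\<kappa> v)) t \<prec>\<^bsub>M\<^esub> eval M (\<lambda>v. s v (\<kappa> v)) u"
  using assms(1)[unfolded indisc_def, rule_format, of t u s \<iota> \<kappa>] assms(2-) by blast+

lemma indiscI:
  assumes "\<And>t u s \<iota> \<kappa>. wf_tm L_log t \<Longrightarrow> wf_tm L_log u \<Longrightarrow>
    (\<And>v. v \<in> vars_tm t \<union> vars_tm u \<Longrightarrow> s v \<in> S \<and> \<iota> v \<in> J \<and> \<kappa> v \<in> J) \<Longrightarrow>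
    (\<And>v w. v \<in> vars_tm t \<union> vars_tm u \<Longrightarrow> w \<in> vars_tm t \<union> vars_tm u \<Longrightarrow> \<iota> v < \<iota> w \<longleftrightarrow> \<kappa> v < \<kappa> w) \<Longrightarrow>
    (eval M (\<lambda>v. s v (\<iota> v)) t = eval M (\<lambda>v. s v (\<iota> v)) u \<longleftrightarrow> eval M (\<lambda>v. s v (\<kappa> v)) t = eval M (\<lambda>v. s v (\<kappa> v)) u) \<and>
     (eval M (\<lambda>v. s v (\<iota> v)) t \<prec>\<^bsub>M\<^esub> eval M (\<lambda>v. s v (\<iota> v)) u \<longleftrightarrow> eval M (\<lambda>v. s v (\<kappa> v)) t \<prec>\<^bsub>M\<^esub> eval M (\<lambda>v. s v (\<kappa> v)) u)"
  shows "indisc M J S"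
  unfolding indisc_def
proof (intro allI impI, elim conjE)
  fix t u s \<iota> \<kappa>
  assume a: "wf_tm L_log t" "wf_tm L_log u" "\<forall>v\<in>vars_tm t \<union> vars_tm u. s v \<in> S \<and> \<iota> v \<in> J \<and> \<kappa> v \<in> J"
     "\<forall>v\<in>vars_tm t \<union> vars_tm u. \<forall>w\<in>vars_tm t \<union> vars_tm u. \<iota> v < \<iota> w \<longleftrightarrow> \<kappa> v < \<kappa> w"
  show "(eval M (\<lambda>v. s v (\<iota> v)) t = eval M (\<lambda>v. s v (\<iota> v)) u \<longleftrightarrow> eval M (\<lambda>v. s v (\<kappa> v)) t = eval M (\<lambda>v. s v (\<kappa> v)) u) \<and>
     (eval M (\<lambda>v. s v (\<iota> v)) t \<prec>\<^bsub>M\<^esub> eval M (\<lambda>v. s v (\<iota> v)) u \<longleftrightarrow> eval M (\<lambda>v. s v (\<kappa> v)) t \<prec>\<^bsub>M\<^esub> eval M (\<lambda>v. s v (\<kappa> v)) u)"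
    by (rule assms) (use a in blast)+
qed

lemma indisc_mono: "indisc M J S \<Longrightarrow> J' \<subseteq> J \<Longrightarrow> S' \<subseteq> S \<Longrightarrow> indisc M J' S'"
proof (rule indiscI)
  assume S: "indisc M J S" "J' \<subseteq> J" "S' \<subseteq> S"
  fix t u s and \<iota> \<kappa> :: "nat \<Rightarrow> 'b"
  assume a: "wf_tm L_log t" "wf_tm L_log u" "\<And>v. v \<in> vars_tm t \<union> vars_tm u \<Longrightarrow> s v \<in> S' \<and> \<iota> v \<in> J' \<and> \<kappa> v \<in> J'"
    "\<And>v w. v \<in> vars_tm t \<union> vars_tm u \<Longrightarrow> w \<in> vars_tm t \<union> vars_tm u \<Longrightarrow> \<iota> v < \<iota> w \<longleftrightarrow> \<kappa> v < \<kappa> w"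
  have b: "s v \<in> S \<and> \<iota> v \<in> J \<and> \<kappa> v \<in> J" if "v \<in> vars_tm t \<union> vars_tm u" for v using a(3)[OF that] S by blast
  show "(eval M (\<lambda>v. s v (\<iota> v)) t = eval M (\<lambda>v. s v (\<iota> v)) u \<longleftrightarrow> eval M (\<lambda>v. s v (\<kappa> v)) t = eval M (\<lambda>v. s v (\<kappa> v)) u) \<and>
     (eval M (\<lambda>v. s v (\<iota> v)) t \<prec>\<^bsub>M\<^esub> eval M (\<lambda>v. s v (\<iota> v)) u \<longleftrightarrow> eval M (\<lambda>v. s v (\<kappa> v)) t \<prec>\<^bsub>M\<^esub> eval M (\<lambda>v. s v (\<kappa> v)) u)"
    using indiscD[OF S(1) a(1,2), of s \<iota> \<kappa>, OF b a(4)] by blast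
qed

lemma indisc2:
  assumes "indisc M J S" "x \<in> S" "y \<in> S" "i \<in> J" "j \<in> J" "i' \<in> J" "j' \<in> J" "i < j \<longleftrightarrow> i' < j'" "j < i \<longleftrightarrow> j' < i'"
  shows "x i = y j \<longleftrightarrow> x i' = y j'" "x i \<prec>\<^bsub>M\<^esub> y j \<longleftrightarrow> x i' \<prec>\<^bsub>M\<^esub> y j'"
  using indiscD[OF assms(1), of "Var 0" "Var 1" "\<lambda>v. if v = 0 then x else y" "\<lambda>v. if v = 0 then i else j" "\<lambda>v. if v = 0 then i' else j'"]
    assms(2-) by (auto split: if_splits)

lemma indisc_infty:
  assumes "indisc M J S" "x \<in> S" "i \<in> J" "i' \<in> J"
  shows "x i = \<infinity>\<^bsub>M\<^esub> \<longleftrightarrow> x i' = \<infinity>\<^bsub>M\<^esub>"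
  using indiscD(1)[OF assms(1), of "Var 0" tInf "\<lambda>v. x" "\<lambda>v. i" "\<lambda>v. i'"] assms(2-) by auto

text \<open>Increasing and decreasing triples are both allowed, because the values may grow in
  either direction along the sequence.\<close>

lemma indisc_psi_triple:
  assumes J: "indisc M J S" "x \<in> S" and i: "{i, j, k} \<subseteq> J" "{i', j', k'} \<subseteq> J"
    and o: "i < j \<and> j < k \<and> i' < j' \<and> j' < k' \<or> k < j \<and> j < i \<and> k' < j' \<and> j' < i'"
  shows "\<psi>\<^bsub>M\<^esub> (x j \<ominus>\<^bsub>M\<^esub> x i) \<prec>\<^bsub>M\<^esub> \<psi>\<^bsub>M\<^esub> (x k \<ominus>\<^bsub>M\<^esub> x j) \<longleftrightarrow> \<psi>\<^bsub>M\<^esub> (x j' \<ominus>\<^bsub>M\<^esub> x i') \<prec>\<^bsub>M\<^esub> \<psi>\<^bsub>M\<^esub> (x k' \<ominus>\<^bsub>M\<^esub> x j')"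
proof -
  define \<iota> where "\<iota> = (\<lambda>v::nat. if v = 0 then i else if v = 1 then j else k)"
  define \<kappa> where "\<kappa> = (\<lambda>v::nat. if v = 0 then i' else if v = 1 then j' else k')"
  let ?t = "tPsi (Var 1 [+] tNeg (Var 0))" and ?u = "tPsi (Var 2 [+] tNeg (Var 1))"
  have V: "vars_tm ?t \<union> vars_tm ?u = {0, 1, 2}" by auto
  have "eval M (\<lambda>v. x (\<iota> v)) ?t \<prec>\<^bsub>M\<^esub> eval M (\<lambda>v. x (\<iota> v)) ?u \<longleftrightarrow> eval M (\<lambda>v. x (\<kappa> v)) ?t \<prec>\<^bsub>M\<^esub> eval M (\<lambda>v. x (\<kappa> v)) ?u"
  proof (rule indiscD(2)[OF J(1)])
    show "x \<in> S \<and> \<iota> v \<in> J \<and> \<kappa> v \<in> J" if "v \<in> vars_tm ?t \<union> vars_tm ?u" for v using that i J(2) by (auto simp: \<iota>_def \<kappa>_def)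
    show "\<iota> v < \<iota> w \<longleftrightarrow> \<kappa> v < \<kappa> w" if "v \<in> vars_tm ?t \<union> vars_tm ?u" "w \<in> vars_tm ?t \<union> vars_tm ?u" for v w
      using that o unfolding V by (auto simp: \<iota>_def \<kappa>_def)
  qed auto
  then show ?thesis by (simp add: \<iota>_def \<kappa>_def)
qed

text \<open>The sequences obtained by terms from sequences in \<open>S\<close>, which may also be evaluated at the
  fixed indices of absolute value in \<open>(N - k, N]\<close>.\<close>

definition Cl :: "(log_fun, log_rel, 'm) fo_struct \<Rightarrow> (int \<Rightarrow> 'm) set \<Rightarrow> int \<Rightarrow> int \<Rightarrow> (int \<Rightarrow> 'm) set" where
  "Cl M S N k = {\<alpha>. \<exists>t s \<tau>. wf_tm L_log t \<and>
     (\<forall>v\<in>vars_tm t. s v \<in> S \<and> (\<forall>l. \<tau> v = Some l \<longrightarrow> N - k < \<bar>l\<bar> \<and> \<bar>l\<bar> \<le> N)) \<and>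
     \<alpha> = (\<lambda>i. eval M (\<lambda>v. s v (case \<tau> v of None \<Rightarrow> i | Some l \<Rightarrow> l)) t)}"

lemma Cl_base: "x \<in> S \<Longrightarrow> x \<in> Cl M S N k"
  unfolding Cl_def by (intro CollectI exI[of _ "Var 0"] exI[of _ "\<lambda>_. x"] exI[of _ "\<lambda>_. None"]) auto

lemma Cl_choose:
  assumes "\<alpha> ` V \<subseteq> Cl M S N k"
  shows "\<exists>T s \<tau>. \<forall>v\<in>V. wf_tm L_log (T v) \<and> (\<forall>w\<in>vars_tm (T v). s v w \<in> S \<and>
      (\<forall>l. \<tau> v w = Some l \<longrightarrow> N - k < \<bar>l\<bar> \<and> \<bar>l\<bar> \<le> N)) \<and>
      (\<forall>i. \<alpha> v i = eval M (\<lambda>w. s v w (case \<tau> v w of None \<Rightarrow> i | Some l \<Rightarrow> l)) (T v))"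
proof -
  have "\<forall>v\<in>V. \<exists>q. wf_tm L_log (fst q) \<and> (\<forall>w\<in>vars_tm (fst q). fst (snd q) w \<in> S \<and>
      (\<forall>l. snd (snd q) w = Some l \<longrightarrow> N - k < \<bar>l\<bar> \<and> \<bar>l\<bar> \<le> N)) \<and>
      \<alpha> v = (\<lambda>i. eval M (\<lambda>w. fst (snd q) w (case snd (snd q) w of None \<Rightarrow> i | Some l \<Rightarrow> l)) (fst q))"
  proof
    fix v assume "v \<in> V"
    then have "\<alpha> v \<in> Cl M S N k" using assms by blast
    then obtain t s \<tau> where "wf_tm L_log t" "\<forall>w\<in>vars_tm t. s w \<in> S \<and> (\<forall>l. \<tau> w = Some l \<longrightarrow> N - k < \<bar>l\<bar> \<and> \<bar>l\<bar> \<le> N)"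
      "\<alpha> v = (\<lambda>i. eval M (\<lambda>w. s w (case \<tau> w of None \<Rightarrow> i | Some l \<Rightarrow> l)) t)" unfolding Cl_def by blast
    then show "\<exists>q. wf_tm L_log (fst q) \<and> (\<forall>w\<in>vars_tm (fst q). fst (snd q) w \<in> S \<and>
      (\<forall>l. snd (snd q) w = Some l \<longrightarrow> N - k < \<bar>l\<bar> \<and> \<bar>l\<bar> \<le> N)) \<and>
      \<alpha> v = (\<lambda>i. eval M (\<lambda>w. fst (snd q) w (case snd (snd q) w of None \<Rightarrow> i | Some l \<Rightarrow> l)) (fst q))"
      by (intro exI[of _ "(t, s, \<tau>)"]) auto
  qed
  from bchoice[OF this] obtain q where q: "\<forall>v\<in>V. wf_tm L_log (fst (q v)) \<and> (\<forall>w\<in>vars_tm (fst (q v)). fst (snd (q v)) w \<in> S \<and>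
      (\<forall>l. snd (snd (q v)) w = Some l \<longrightarrow> N - k < \<bar>l\<bar> \<and> \<bar>l\<bar> \<le> N)) \<and>
      \<alpha> v = (\<lambda>i. eval M (\<lambda>w. fst (snd (q v)) w (case snd (snd (q v)) w of None \<Rightarrow> i | Some l \<Rightarrow> l)) (fst (q v)))"
    by blast
  show ?thesis
    by (rule exI[of _ "\<lambda>v. fst (q v)"], rule exI[of _ "\<lambda>v. fst (snd (q v))"], rule exI[of _ "\<lambda>v. snd (snd (q v))"])
      (use q in auto)
qed

text \<open>The same variable may occur in \<open>T v\<close> and in \<open>T w\<close> with
  different meanings; numbering by pairs keeps these copies apart.\<close>

lemma eval_tsubst_encode:
  assumes "\<And>v w. v \<in> vars_tm t \<Longrightarrow> w \<in> vars_tm (T v) \<Longrightarrow> e (prod_encode (v, w)) = f v w"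
  shows "eval M e (tsubst (\<lambda>v. tsubst (\<lambda>w. Var (prod_encode (v, w))) (T v)) t) = eval M (\<lambda>v. eval M (f v) (T v)) t"
  unfolding eval_tsubst using assms by (intro eval_cong) (auto intro!: eval_cong)

lemma Cl_term:
  assumes t: "wf_tm L_log t" and k: "k \<le> k'"
    and a: "\<And>v. v \<in> vars_tm t \<Longrightarrow> \<alpha> v \<in> Cl M S N k" "\<And>v l. v \<in> vars_tm t \<Longrightarrow> \<tau>' v = Some l \<Longrightarrow> N - k' < \<bar>l\<bar> \<and> \<bar>l\<bar> \<le> N"
  shows "(\<lambda>i. eval M (\<lambda>v. \<alpha> v (case \<tau>' v of None \<Rightarrow> i | Some l \<Rightarrow> l)) t) \<in> Cl M S N k'"
proof -
  have sub: "\<alpha> ` vars_tm t \<subseteq> Cl M S N k" using a(1) by blast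
  obtain T s \<tau> where T0: "\<forall>v\<in>vars_tm t. wf_tm L_log (T v) \<and> (\<forall>w\<in>vars_tm (T v). s v w \<in> S \<and>
      (\<forall>l. \<tau> v w = Some l \<longrightarrow> N - k < \<bar>l\<bar> \<and> \<bar>l\<bar> \<le> N)) \<and>
      (\<forall>i. \<alpha> v i = eval M (\<lambda>w. s v w (case \<tau> v w of None \<Rightarrow> i | Some l \<Rightarrow> l)) (T v))"
    using Cl_choose[OF sub] by blast
  have T: "\<And>v. v \<in> vars_tm t \<Longrightarrow> wf_tm L_log (T v)"
    "\<And>v w. v \<in> vars_tm t \<Longrightarrow> w \<in> vars_tm (T v) \<Longrightarrow> s v w \<in> S"
    "\<And>v w l. v \<in> vars_tm t \<Longrightarrow> w \<in> vars_tm (T v) \<Longrightarrow> \<tau> v w = Some l \<Longrightarrow> N - k < \<bar>l\<bar> \<and> \<bar>l\<bar> \<le> N"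
    "\<And>v i. v \<in> vars_tm t \<Longrightarrow> \<alpha> v i = eval M (\<lambda>w. s v w (case \<tau> v w of None \<Rightarrow> i | Some l \<Rightarrow> l)) (T v)"
    using T0 by blast+
  define t' where "t' = tsubst (\<lambda>v. tsubst (\<lambda>w. Var (prod_encode (v, w))) (T v)) t"
  define s' where "s' = (\<lambda>x. case prod_decode x of (v, w) \<Rightarrow> s v w)"
  define \<tau>'' where "\<tau>'' = (\<lambda>x. case prod_decode x of (v, w) \<Rightarrow> (case \<tau> v w of None \<Rightarrow> \<tau>' v | Some l \<Rightarrow> Some l))"
  have "wf_tm L_log t'" unfolding t'_def by (intro wf_tsubst t T) auto
  moreover have "s' x \<in> S \<and> (\<forall>l. \<tau>'' x = Some l \<longrightarrow> N - k' < \<bar>l\<bar> \<and> \<bar>l\<bar> \<le> N)" if "x \<in> vars_tm t'" for x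
  proof -
    have "\<exists>v w. x = prod_encode (v, w) \<and> v \<in> vars_tm t \<and> w \<in> vars_tm (T v)"
      using that by (auto simp: t'_def vars_tsubst)
    then obtain v w where x: "x = prod_encode (v, w)" "v \<in> vars_tm t" "w \<in> vars_tm (T v)" by blast
    have "s' x = s v w" "\<tau>'' x = (case \<tau> v w of None \<Rightarrow> \<tau>' v | Some l \<Rightarrow> Some l)"
      by (simp_all add: s'_def \<tau>''_def x(1))
    then show ?thesis using T(2)[OF x(2,3)] T(3)[OF x(2,3)] a(2)[OF x(2)] k by (cases "\<tau> v w") auto
  qed
  moreover have "eval M (\<lambda>v. \<alpha> v (case \<tau>' v of None \<Rightarrow> i | Some l \<Rightarrow> l)) t = eval M (\<lambda>x. s' x (case \<tau>'' x of None \<Rightarrow> i | Some l \<Rightarrow> l)) t'" for i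
  proof -
    have "eval M (\<lambda>x. s' x (case \<tau>'' x of None \<Rightarrow> i | Some l \<Rightarrow> l)) t' =
       eval M (\<lambda>v. eval M (\<lambda>w. s v w (case \<tau> v w of None \<Rightarrow> (case \<tau>' v of None \<Rightarrow> i | Some l \<Rightarrow> l) | Some l \<Rightarrow> l)) (T v)) t"
      unfolding t'_def by (rule eval_tsubst_encode) (auto simp: s'_def \<tau>''_def split: option.splits)
    also have "\<dots> = eval M (\<lambda>v. \<alpha> v (case \<tau>' v of None \<Rightarrow> i | Some l \<Rightarrow> l)) t"
      by (rule eval_cong) (simp add: T(4))
    finally show ?thesis by simp
  qed
  ultimately show ?thesis unfolding Cl_def by (intro CollectI exI[of _ t'] exI[of _ s'] exI[of _ \<tau>'']) auto
qed

lemma Cl_op: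
  assumes "wf_tm L_log t" "\<And>v. v \<in> vars_tm t \<Longrightarrow> \<alpha> v \<in> Cl M S N k"
  shows "(\<lambda>i. eval M (\<lambda>v. \<alpha> v i) t) \<in> Cl M S N k"
  using Cl_term[OF assms(1) order_refl assms(2), where \<tau>' = "\<lambda>_. None"] by simp

lemma Cl_mono: "k \<le> k' \<Longrightarrow> Cl M S N k \<subseteq> Cl M S N k'"
proof
  fix x assume "k \<le> k'" "x \<in> Cl M S N k"
  then show "x \<in> Cl M S N k'" using Cl_term[of "Var 0" k k' "\<lambda>_. x" M S N "\<lambda>_. None"] by simp
qed

text \<open>Freezing a generated sequence at an outer index gives a constant that is still counted
  as generated by \<open>S\<close>.\<close>

lemma Cl_fix: "x \<in> Cl M S N k \<Longrightarrow> k \<le> k' \<Longrightarrow> N - k' < \<bar>l\<bar> \<Longrightarrow> \<bar>l\<bar> \<le> N \<Longrightarrow> (\<lambda>_. x l) \<in> Cl M S N k'"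
proof -
  assume a: "x \<in> Cl M S N k" "k \<le> k'" "N - k' < \<bar>l\<bar>" "\<bar>l\<bar> \<le> N"
  have "(\<lambda>i. eval M (\<lambda>v. x (case Some l of None \<Rightarrow> i | Some l \<Rightarrow> l)) (Var 0)) \<in> Cl M S N k'"
    by (rule Cl_term[of _ k]) (use a in auto)
  then show ?thesis by simp
qed

lemma Cl_subset: "S \<subseteq> S' \<Longrightarrow> Cl M S N k \<subseteq> Cl M S' N k"
  unfolding Cl_def by blast

text \<open>The fixed indices have absolute value above \<open>N - k\<close>, the free ones at most
  \<open>N - k\<close>. Moving the free ones therefore never changes their order relative to fixed
  ones, and a fixed index is never \<open>0\<close>.\<close>

lemma Cl_indisc:
  assumes S: "indisc M J S" and J: "J \<subseteq> {-N..N}" "{-N..N} - {0} \<subseteq> J" and k: "0 \<le> k" "k \<le> N"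
  shows "indisc M (J \<inter> {-(N-k)..N-k}) (Cl M S N k)"
proof (rule indiscI)
  fix t u :: log_tm and \<alpha> :: "nat \<Rightarrow> int \<Rightarrow> 'a" and \<iota> \<kappa> :: "nat \<Rightarrow> int"
  assume wf: "wf_tm L_log t" "wf_tm L_log u"
    and a: "\<And>v. v \<in> vars_tm t \<union> vars_tm u \<Longrightarrow> \<alpha> v \<in> Cl M S N k \<and> \<iota> v \<in> J \<inter> {-(N-k)..N-k} \<and> \<kappa> v \<in> J \<inter> {-(N-k)..N-k}"
    and o: "\<And>v w. v \<in> vars_tm t \<union> vars_tm u \<Longrightarrow> w \<in> vars_tm t \<union> vars_tm u \<Longrightarrow> \<iota> v < \<iota> w \<longleftrightarrow> \<kappa> v < \<kappa> w"
  let ?V = "vars_tm t \<union> vars_tm u"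
  have sub: "\<alpha> ` ?V \<subseteq> Cl M S N k" using a by blast
  obtain T s \<tau> where T0: "\<forall>v\<in>?V. wf_tm L_log (T v) \<and> (\<forall>w\<in>vars_tm (T v). s v w \<in> S \<and>
      (\<forall>l. \<tau> v w = Some l \<longrightarrow> N - k < \<bar>l\<bar> \<and> \<bar>l\<bar> \<le> N)) \<and>
      (\<forall>i. \<alpha> v i = eval M (\<lambda>w. s v w (case \<tau> v w of None \<Rightarrow> i | Some l \<Rightarrow> l)) (T v))"
    using Cl_choose[OF sub] by blast
  have T: "\<And>v. v \<in> ?V \<Longrightarrow> wf_tm L_log (T v)"
    "\<And>v w. v \<in> ?V \<Longrightarrow> w \<in> vars_tm (T v) \<Longrightarrow> s v w \<in> S"
    "\<And>v w l. v \<in> ?V \<Longrightarrow> w \<in> vars_tm (T v) \<Longrightarrow> \<tau> v w = Some l \<Longrightarrow> N - k < \<bar>l\<bar> \<and> \<bar>l\<bar> \<le> N"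
    "\<And>v i. v \<in> ?V \<Longrightarrow> \<alpha> v i = eval M (\<lambda>w. s v w (case \<tau> v w of None \<Rightarrow> i | Some l \<Rightarrow> l)) (T v)"
    using T0 by blast+
  define F where "F = tsubst (\<lambda>v. tsubst (\<lambda>w. Var (prod_encode (v, w))) (T v))"
  define s' where "s' = (\<lambda>x. case prod_decode x of (v, w) \<Rightarrow> s v w)"
  define g where "g = (\<lambda>(\<iota> :: nat \<Rightarrow> int) x. case prod_decode x of (v, w) \<Rightarrow> (case \<tau> v w of None \<Rightarrow> \<iota> v | Some l \<Rightarrow> l))"
  have ev: "eval M (\<lambda>x. s' x (g \<iota> x)) (F r) = eval M (\<lambda>v. \<alpha> v (\<iota> v)) r" if "vars_tm r \<subseteq> ?V" for r \<iota>
  proof -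
    have "eval M (\<lambda>x. s' x (g \<iota> x)) (F r) = eval M (\<lambda>v. eval M (\<lambda>w. s v w (case \<tau> v w of None \<Rightarrow> \<iota> v | Some l \<Rightarrow> l)) (T v)) r"
      unfolding F_def by (rule eval_tsubst_encode) (auto simp: s'_def g_def)
    also have "\<dots> = eval M (\<lambda>v. \<alpha> v (\<iota> v)) r" using that T(4) by (intro eval_cong) (simp add: subset_eq)
    finally show ?thesis .
  qed
  have wfF: "wf_tm L_log (F t)" "wf_tm L_log (F u)" unfolding F_def by (intro wf_tsubst wf T; simp)+
  have vF: "\<exists>v w. x = prod_encode (v, w) \<and> v \<in> ?V \<and> w \<in> vars_tm (T v)" if "x \<in> vars_tm (F t) \<union> vars_tm (F u)" for x
    using that by (auto simp: F_def vars_tsubst)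
  have g1: "s' x \<in> S \<and> g \<iota> x \<in> J \<and> g \<kappa> x \<in> J" if x: "x \<in> vars_tm (F t) \<union> vars_tm (F u)" for x
  proof -
    obtain v w where x: "x = prod_encode (v, w)" "v \<in> ?V" "w \<in> vars_tm (T v)" using vF[OF x] by blast
    show ?thesis
    proof (cases "\<tau> v w")
      case None
      then show ?thesis using x T(2)[OF x(2,3)] a[OF x(2)] by (simp add: s'_def g_def)
    next
      case (Some l)
      then have "N - k < \<bar>l\<bar>" "\<bar>l\<bar> \<le> N" using T(3)[OF x(2,3)] by auto
      then have "l \<in> {-N..N} - {0}" using k by auto
      then have "l \<in> J" using J(2) by blast
      then show ?thesis using Some x T(2)[OF x(2,3)] by (simp add: s'_def g_def)
    qed
  qed
  have g2: "g \<iota> x < g \<iota> y \<longleftrightarrow> g \<kappa> x < g \<kappa> y"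
    if x: "x \<in> vars_tm (F t) \<union> vars_tm (F u)" and y: "y \<in> vars_tm (F t) \<union> vars_tm (F u)" for x y
  proof -
    obtain v w where x: "x = prod_encode (v, w)" "v \<in> ?V" "w \<in> vars_tm (T v)" using vF[OF x] by blast
    obtain v1 w1 where y: "y = prod_encode (v1, w1)" "v1 \<in> ?V" "w1 \<in> vars_tm (T v1)" using vF[OF y] by blast
    have r: "\<bar>\<iota> v\<bar> \<le> N - k" "\<bar>\<kappa> v\<bar> \<le> N - k" "\<bar>\<iota> v1\<bar> \<le> N - k" "\<bar>\<kappa> v1\<bar> \<le> N - k" using a[OF x(2)] a[OF y(2)] by auto
    show ?thesis
    proof (cases "\<tau> v w"; cases "\<tau> v1 w1")
      assume "\<tau> v w = None" "\<tau> v1 w1 = None"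
      then show ?thesis using o[OF x(2) y(2)] x y by (simp add: g_def)
    next
      fix l assume l: "\<tau> v w = None" "\<tau> v1 w1 = Some l"
      then have "N - k < \<bar>l\<bar>" using T(3)[OF y(2,3)] by blast
      then have "\<iota> v < l \<longleftrightarrow> \<kappa> v < l" using r by linarith
      then show ?thesis using l x y by (simp add: g_def)
    next
      fix l assume l: "\<tau> v w = Some l" "\<tau> v1 w1 = None"
      then have "N - k < \<bar>l\<bar>" using T(3)[OF x(2,3)] by blast
      then have "l < \<iota> v1 \<longleftrightarrow> l < \<kappa> v1" using r by linarith
      then show ?thesis using l x y by (simp add: g_def)
    next
      fix l l' assume l: "\<tau> v w = Some l" "\<tau> v1 w1 = Some l'"
      then show ?thesis using x y by (simp add: g_def)
    qed
  qed
  show "(eval M (\<lambda>v. \<alpha> v (\<iota> v)) t = eval M (\<lambda>v. \<alpha> v (\<iota> v)) u \<longleftrightarrow> eval M (\<lambda>v. \<alpha> v (\<kappa> v)) t = eval M (\<lambda>v. \<alpha> v (\<kappa> v)) u) \<and>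
     (eval M (\<lambda>v. \<alpha> v (\<iota> v)) t \<prec>\<^bsub>M\<^esub> eval M (\<lambda>v. \<alpha> v (\<iota> v)) u \<longleftrightarrow> eval M (\<lambda>v. \<alpha> v (\<kappa> v)) t \<prec>\<^bsub>M\<^esub> eval M (\<lambda>v. \<alpha> v (\<kappa> v)) u)"
    using indiscD[OF S wfF, of s' "g \<iota>" "g \<kappa>", OF g1 g2] ev[of t] ev[of u] by simp
qed

section \<open>Values of terms along an indiscernible sequence\<close>

lemma Cl_unary: "x \<in> Cl M S N k \<Longrightarrow> log_fun_arity f = 1 \<Longrightarrow> (\<lambda>i. fn M f [x i]) \<in> Cl M S N k"
  using Cl_op[of "Fn f [Var 0]" "\<lambda>_. x"] by simp

lemma Cl_plus:
  assumes "x \<in> Cl M S N k" "y \<in> Cl M S N k" shows "(\<lambda>i. x i \<oplus>\<^bsub>M\<^esub> y i) \<in> Cl M S N k"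
proof -
  have "(\<lambda>i. eval M (\<lambda>v. (if v = 0 then x else y) i) (Var 0 [+] Var 1)) \<in> Cl M S N k"
    by (rule Cl_op) (use assms in auto)
  then show ?thesis by simp
qed

lemma Cl_const: "log_fun_arity f = 0 \<Longrightarrow> (\<lambda>_. fn M f []) \<in> Cl M S N k"
  using Cl_op[of "Fn f []" "\<lambda>_. undefined" M S N k] by simp

context log_model
begin

text \<open>As \<open>x\<close> and \<open>z\<close> differ but compare equally with
  \<open>d\<close>, neither equals \<open>d\<close> and both lie on the same side of it; so does
  everything between them.\<close>

lemma between_compare:
  assumes c: "x \<in> carrier M" "y \<in> carrier M" "z \<in> carrier M" "d \<in> carrier M" and o: "x \<prec> y \<and> y \<prec> z \<or> z \<prec> y \<and> y \<prec> x"
    and e: "x = d \<longleftrightarrow> z = d" "x \<prec> d \<longleftrightarrow> z \<prec> d"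
  shows "(y = d \<longleftrightarrow> z = d) \<and> (y \<prec> d \<longleftrightarrow> z \<prec> d)"
proof -
  have xz: "x \<noteq> z" using o less_asym[of x y] c by blast
  then have nz: "z \<noteq> d" "x \<noteq> d" using e by auto
  consider "z \<prec> d" "x \<prec> d" | "d \<prec> z" "d \<prec> x" using less_linear[OF c(3,4)] less_linear[OF c(1,4)] nz e by blast
  then show ?thesis
  proof cases
    case 1
    then have "y \<prec> d" using o less_trans[of y z d] less_trans[of y x d] c by blast
    then show ?thesis using 1 less_irrefl[of d] c by auto
  next
    case 2
    then have "d \<prec> y" using o less_trans[of d z y] less_trans[of d x y] c by blast
    then show ?thesis using 2 less_asym[of d y] less_asym[of d z] less_irrefl[of d] nz c by auto
  qed
qed

end

locale linearization = log_model M for M :: "(log_fun, log_rel, 'm) fo_struct" (structure) +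
  fixes S :: "(int \<Rightarrow> 'm) set" and b :: 'm and N :: int
  assumes S_carrier: "\<And>s i. s \<in> S \<Longrightarrow> s i \<in> carrier M" and b_carrier: "b \<in> carrier M"
    and indisc_S: "indisc M {-N..N} S" and indisc_b: "indisc M ({-N..N} - {0}) (insert (\<lambda>_. b) S)"
begin

abbreviation A :: "int \<Rightarrow> (int \<Rightarrow> 'm) set" where "A k \<equiv> Cl M S N k"
abbreviation C :: "int \<Rightarrow> (int \<Rightarrow> 'm) set" where "C k \<equiv> Cl M (insert (\<lambda>_. b) S) N k"
abbreviation J :: "int \<Rightarrow> int set" where "J k \<equiv> {-(N-k)..N-k}"

lemma AC: "x \<in> A k \<Longrightarrow> x \<in> C k"
  using Cl_subset[of S "insert (\<lambda>_. b) S"] by blast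

lemma C_carrier: assumes "x \<in> C k" shows "x i \<in> carrier M"
proof -
  obtain t s \<tau> where t: "wf_tm L_log t" "\<forall>v\<in>vars_tm t. s v \<in> insert (\<lambda>_. b) S"
    "x = (\<lambda>i. eval M (\<lambda>v. s v (case \<tau> v of None \<Rightarrow> i | Some l \<Rightarrow> l)) t)" using assms unfolding Cl_def by blast
  let ?e = "\<lambda>v. if v \<in> vars_tm t then s v (case \<tau> v of None \<Rightarrow> i | Some l \<Rightarrow> l) else \<zero>"
  have "x i = eval M ?e t" unfolding t(3) by (rule eval_cong) simp
  moreover have "eval M ?e t \<in> carrier M"
    by (rule eval_closed[OF t(1)]) (use t(2) S_carrier b_carrier in auto)
  ultimately show ?thesis by simp
qed

lemma A_carrier: "x \<in> A k \<Longrightarrow> x i \<in> carrier M"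
  using C_carrier AC by blast

lemma indisc_A: "0 \<le> k \<Longrightarrow> k \<le> N \<Longrightarrow> indisc M (J k) (A k)"
  using Cl_indisc[OF indisc_S, of N k] by (simp add: Int_absorb1)

lemma indisc_C: assumes "0 \<le> k" "k \<le> N" shows "indisc M (J k - {0}) (C k)"
proof -
  have "({-N..N} - {0}) \<inter> J k = J k - {0}" using assms by auto
  then show ?thesis using Cl_indisc[OF indisc_b, of N k] assms by simp
qed

text \<open>A term in \<open>b\<close> and the sequences of \<open>S\<close> takes values \<open>\<alpha> i \<oplus> \<beta>\<close> with \<open>\<alpha>\<close> free of \<open>b\<close> and \<open>\<beta>\<close> constant (or is
  \<open>\<infinity>\<close>), and \<open>\<psi>\<close>, \<open>\<s>\<close> and \<open>\<p>\<close> turn such a sequence into one that is constant or free of \<open>b\<close>. Each step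
  sacrifices indices at both ends, which then serve as fixed indices.\<close>

definition lin :: "int \<Rightarrow> (int \<Rightarrow> 'm) \<Rightarrow> bool" where
  "lin k y \<longleftrightarrow> (\<forall>i\<in>J k. y i = \<infinity>) \<or>
     (\<exists>\<alpha>\<in>A k. \<exists>\<beta>\<in>\<Gamma>. (\<lambda>_. \<beta>) \<in> C k \<and> (\<forall>i\<in>J k. \<alpha> i \<in> \<Gamma> \<and> y i = \<alpha> i \<oplus> \<beta>))"

definition pure :: "int \<Rightarrow> (int \<Rightarrow> 'm) \<Rightarrow> bool" where
  "pure k y \<longleftrightarrow> (\<exists>e. (\<lambda>_. e) \<in> C k \<and> (\<forall>i\<in>J k. y i = e)) \<or> (\<exists>\<epsilon>\<in>A k. \<forall>i\<in>J k. y i = \<epsilon> i)"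

lemma lin_infty: "(\<And>i. i \<in> J k \<Longrightarrow> y i = \<infinity>) \<Longrightarrow> lin k y"
  unfolding lin_def by blast

lemma linI: "\<alpha> \<in> A k \<Longrightarrow> \<beta> \<in> \<Gamma> \<Longrightarrow> (\<lambda>_. \<beta>) \<in> C k \<Longrightarrow> (\<And>i. i \<in> J k \<Longrightarrow> \<alpha> i \<in> \<Gamma> \<and> y i = \<alpha> i \<oplus> \<beta>) \<Longrightarrow> lin k y"
  unfolding lin_def by blast

lemma linE:
  assumes "lin k y"
  obtains "\<And>i. i \<in> J k \<Longrightarrow> y i = \<infinity>"
  | \<alpha> \<beta> where "\<alpha> \<in> A k" "\<beta> \<in> \<Gamma>" "(\<lambda>_. \<beta>) \<in> C k" "\<And>i. i \<in> J k \<Longrightarrow> \<alpha> i \<in> \<Gamma>" "\<And>i. i \<in> J k \<Longrightarrow> y i = \<alpha> i \<oplus> \<beta>"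
  using assms unfolding lin_def by blast

lemma lin_mono: assumes "lin k y" "k \<le> k'" shows "lin k' y"
  using assms(1)
proof (cases rule: linE)
  case 1 then show ?thesis using assms(2) by (intro lin_infty) auto
next
  case (2 \<alpha> \<beta>)
  have "\<alpha> \<in> A k'" "(\<lambda>_. \<beta>) \<in> C k'" using Cl_mono[OF assms(2)] 2 by blast+
  then show ?thesis using assms(2) 2 by (intro linI[of \<alpha> k' \<beta>]) auto
qed

text \<open>Take \<alpha> to be zero or \<beta> to be zero. A sequence free of \<open>b\<close> that
  is infinite at one index is infinite at all of them.\<close>

lemma pure_lin: assumes k: "0 \<le> k" "k \<le> N" and y: "pure k y" shows "lin k y"
  using y unfolding pure_def
proof (elim disjE exE conjE bexE)
  fix e assume e: "(\<lambda>_. e) \<in> C k" "\<forall>i\<in>J k. y i = e"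
  show ?thesis
  proof (cases "e = \<infinity>")
    case True then show ?thesis using e by (intro lin_infty) auto
  next
    case False
    then have eG: "e \<in> \<Gamma>" using C_carrier[OF e(1)] carrier[of e] by blast
    show ?thesis using e eG Cl_const[of FZero M S N k] by (intro linI[of "\<lambda>_. \<zero>" k e]) auto
  qed
next
  fix \<epsilon> assume e: "\<epsilon> \<in> A k" "\<forall>i\<in>J k. y i = \<epsilon> i"
  have 0: "0 \<in> J k" using k by simp
  show ?thesis
  proof (cases "\<epsilon> 0 = \<infinity>")
    case True then show ?thesis using e indisc_infty[OF indisc_A[OF k] e(1) 0] by (intro lin_infty) auto
  next
    case False
    then have "\<epsilon> i \<in> \<Gamma>" if "i \<in> J k" for i
      using indisc_infty[OF indisc_A[OF k] e(1) 0 that] A_carrier[OF e(1), of i] carrier[of "\<epsilon> i"] by blast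
    then show ?thesis using e Cl_const[of FZero M _ N k] by (intro linI[of \<epsilon> k \<zero>]) auto
  qed
qed

lemma pure_unary: assumes "pure k y" "log_fun_arity f = 1" shows "pure k (\<lambda>i. fn M f [y i])"
  using assms(1) unfolding pure_def
proof (elim disjE exE conjE bexE)
  fix e assume "(\<lambda>_. e) \<in> C k" "\<forall>i\<in>J k. y i = e"
  then show "(\<exists>e. (\<lambda>_. e) \<in> C k \<and> (\<forall>i\<in>J k. fn M f [y i] = e)) \<or> (\<exists>\<epsilon>\<in>A k. \<forall>i\<in>J k. fn M f [y i] = \<epsilon> i)"
    using Cl_unary[OF _ assms(2), of "\<lambda>_. e"] by (intro disjI1 exI[of _ "fn M f [e]"]) auto
next
  fix \<epsilon> assume "\<epsilon> \<in> A k" "\<forall>i\<in>J k. y i = \<epsilon> i"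
  then show "(\<exists>e. (\<lambda>_. e) \<in> C k \<and> (\<forall>i\<in>J k. fn M f [y i] = e)) \<or> (\<exists>\<epsilon>\<in>A k. \<forall>i\<in>J k. fn M f [y i] = \<epsilon> i)"
    using Cl_unary[OF _ assms(2), of \<epsilon>] by (intro disjI2 bexI[of _ "\<lambda>i. fn M f [\<epsilon> i]"]) auto
qed

lemma lin_neg: assumes "lin k y" shows "lin k (\<lambda>i. \<ominus> y i)"
  using assms
proof (cases rule: linE)
  case 1 then show ?thesis by (intro lin_infty) auto
next
  case (2 \<alpha> \<beta>)
  then show ?thesis using Cl_unary[of \<alpha> _ _ _ _ FNeg] Cl_unary[of "\<lambda>_. \<beta>" _ _ _ _ FNeg]
    by (intro linI[of "\<lambda>i. \<ominus> \<alpha> i" k "\<ominus> \<beta>"]) (auto simp: ag)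
qed

lemma delta_add: assumes "x \<in> \<Gamma>" "y \<in> \<Gamma>" shows "\<delta> n (x \<oplus> y) = \<delta> n x \<oplus> \<delta> n y"
proof (rule mul_cancel[THEN iffD1])
  show "mul (1 + int n) (\<delta> n (x \<oplus> y)) = mul (1 + int n) (\<delta> n x \<oplus> \<delta> n y)"
    using assms by (simp add: mul_plus)
qed (use assms in auto)

lemma lin_delta: assumes "lin k y" shows "lin k (\<lambda>i. \<delta> n (y i))"
  using assms
proof (cases rule: linE)
  case 1 then show ?thesis by (intro lin_infty) auto
next
  case (2 \<alpha> \<beta>)
  then show ?thesis using Cl_unary[of \<alpha> _ _ _ _ "FDelta n"] Cl_unary[of "\<lambda>_. \<beta>" _ _ _ _ "FDelta n"]
    by (intro linI[of "\<lambda>i. \<delta> n (\<alpha> i)" k "\<delta> n \<beta>"]) (auto simp: delta_add)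
qed

lemma lin_carrier: assumes "lin k y" "i \<in> J k" shows "y i \<in> carrier M"
  using assms by (cases rule: linE) auto

lemma lin_plus: assumes y: "lin k y" and z: "lin k z" shows "lin k (\<lambda>i. y i \<oplus> z i)"
  using y
proof (cases rule: linE)
  case 1 then show ?thesis using lin_carrier[OF z] by (intro lin_infty) auto
next
  case y: (2 \<alpha> \<beta>)
  from z show ?thesis
  proof (cases rule: linE)
    case 1 then show ?thesis using y by (intro lin_infty) auto
  next
    case (2 \<alpha>' \<beta>')
    then show ?thesis using y Cl_plus[OF y(1) 2(1)] Cl_plus[OF y(3) 2(3)]
      by (intro linI[of "\<lambda>i. \<alpha> i \<oplus> \<alpha>' i" k "\<beta> \<oplus> \<beta>'"]) (auto simp: ag)
  qed
qed

text \<open>Comparing \<open>\<alpha> i \<oplus> \<beta>\<close> with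
  \<open>\<alpha>' i \<oplus> \<beta>'\<close> amounts to comparing the \<open>b\<close>-free
  sequence \<open>\<alpha> i \<ominus> \<alpha>' i\<close> with the constant
  \<open>\<beta>' \<ominus> \<beta>\<close>. Only the index \<open>0\<close> is not covered by
  indiscernibility over \<open>b\<close>.\<close>

lemma lin_compare_one:
  assumes k: "0 \<le> k" "k + 1 \<le> N" and y: "lin k y" and z: "lin k z" and i: "i \<in> J k"
  shows "(y i = z i \<longleftrightarrow> y 1 = z 1) \<and> (y i \<prec> z i \<longleftrightarrow> y 1 \<prec> z 1)"
proof -
  have J: "0 \<in> J k" "1 \<in> J k" "- 1 \<in> J k" using k by auto
  have k': "0 \<le> k" "k \<le> N" using k by auto
  from y show ?thesis
  proof (cases rule: linE)
    case y: 1
    from z show ?thesis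
    proof (cases rule: linE)
      case 1 then show ?thesis using y i J by simp
    next
      case (2 \<alpha> \<beta>)
      have "z i \<in> \<Gamma>" "z 1 \<in> \<Gamma>" using 2(2,4,5) i J by auto
      moreover have "y i = \<infinity>" "y 1 = \<infinity>" using y i J by auto
      ultimately show ?thesis using not_infty[of "z i"] not_infty[of "z 1"] by (metis Gam_carrier infty_rules(2))
    qed
  next
    case y: (2 \<alpha> \<beta>)
    have yG: "y i \<in> \<Gamma>" "y 1 \<in> \<Gamma>" using y(2,4,5) i J by auto
    from z show ?thesis
    proof (cases rule: linE)
      case 1
      then have "z i = \<infinity>" "z 1 = \<infinity>" using i J by auto
      then show ?thesis using yG by simp
    next
      case z: (2 \<alpha>' \<beta>')
      define \<gamma> where "\<gamma> = (\<lambda>i. \<alpha> i \<ominus> \<alpha>' i)"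
      define d where "d = \<beta>' \<ominus> \<beta>"
      have g: "\<gamma> \<in> A k" "(\<lambda>_. d) \<in> C k" unfolding \<gamma>_def d_def
        using Cl_plus[OF y(1) Cl_unary[OF z(1), of FNeg]] Cl_plus[OF z(3) Cl_unary[OF y(3), of FNeg]] by simp_all
      have G: "\<gamma> j \<in> \<Gamma>" if "j \<in> J k" for j using y z that by (simp add: \<gamma>_def)
      have dG: "d \<in> \<Gamma>" using y z by (simp add: d_def)
      have eq: "y j = z j \<longleftrightarrow> \<gamma> j = d" "y j \<prec> z j \<longleftrightarrow> \<gamma> j \<prec> d" if j: "j \<in> J k" for j
      proof -
        have m: "\<alpha> j \<in> \<Gamma>" "\<alpha>' j \<in> \<Gamma>" "\<beta> \<in> \<Gamma>" "\<beta>' \<in> \<Gamma>" using y z j by auto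
        have "y j = \<gamma> j \<oplus> (\<alpha>' j \<oplus> \<beta>)" "z j = d \<oplus> (\<alpha>' j \<oplus> \<beta>)" using m y(5)[OF j] z(5)[OF j] by (simp_all add: \<gamma>_def d_def ag)
        then show "y j = z j \<longleftrightarrow> \<gamma> j = d" "y j \<prec> z j \<longleftrightarrow> \<gamma> j \<prec> d" using m G[OF j] dG by simp_all
      qed
      have C: "\<gamma> j = d \<longleftrightarrow> \<gamma> 1 = d" "\<gamma> j \<prec> d \<longleftrightarrow> \<gamma> 1 \<prec> d" if "j \<in> J k" "j \<noteq> 0" for j
        using indisc2[OF indisc_C[OF k'] AC[OF g(1)] g(2), of j j 1 1] that J by auto
      show ?thesis
      proof (cases "i = 0")
        case False then show ?thesis using C[OF i] eq[OF i] eq[OF J(2)] by simp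
      next
        case True
        \<comment> \<open>The sequence \<gamma> does not involve \<open>b\<close>, so it may be
          compared at \<open>0\<close> as well: it is constant or strictly monotone on
          \<open>-1\<close>, \<open>0\<close>, \<open>1\<close>.\<close>
        have o: "\<gamma> (-1) = \<gamma> 0 \<longleftrightarrow> \<gamma> 0 = \<gamma> 1" "\<gamma> (-1) \<prec> \<gamma> 0 \<longleftrightarrow> \<gamma> 0 \<prec> \<gamma> 1"
          using indisc2[OF indisc_A[OF k'] g(1) g(1), of "-1" 0 0 1] J by auto
        have c: "\<gamma> (-1) \<in> carrier M" "\<gamma> 0 \<in> carrier M" "\<gamma> 1 \<in> carrier M" "d \<in> carrier M" using G J dG by auto
        have "(\<gamma> 0 = d \<longleftrightarrow> \<gamma> 1 = d) \<and> (\<gamma> 0 \<prec> d \<longleftrightarrow> \<gamma> 1 \<prec> d)"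
        proof (cases "\<gamma> 0 = \<gamma> 1")
          case False
          then have "\<gamma> (-1) \<prec> \<gamma> 0 \<and> \<gamma> 0 \<prec> \<gamma> 1 \<or> \<gamma> 1 \<prec> \<gamma> 0 \<and> \<gamma> 0 \<prec> \<gamma> (-1)"
            using o less_linear[OF c(1,2)] less_linear[OF c(2,3)] by blast
          from between_compare[OF c this] show ?thesis using C[of "-1"] J by simp
        qed simp
        then show ?thesis using True eq[OF J(1)] eq[OF J(2)] by simp
      qed
    qed
  qed
qed

text \<open>For \<open>f = \<psi>\<close> (with \<open>g = \<zero>\<close>) and \<open>f = \<s>\<close> (with \<open>g = \<s>\<close>). If the values of \<open>f\<close> agree away from \<open>0\<close>, then they agree
  at \<open>0\<close> because the level sets of \<open>f\<close> are convex on either side. Otherwise they are strictly monotone, and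
  \<open>fg\<close> writes them as \<open>\<psi> (\<alpha> i \<ominus> \<alpha> r)\<close> for an outer index \<open>r\<close>, where \<open>\<beta>\<close> has cancelled.\<close>

lemma psi_succ_step:
  assumes f: "log_fun_arity f = 1" "fn M f [\<infinity>] = \<infinity>" "\<And>x. x \<in> \<Gamma> \<Longrightarrow> fn M f [x] \<in> carrier M"
    and g: "wf_tm L_log g" "vars_tm g \<subseteq> {0}"
    and fg: "\<And>x y. x \<in> \<Gamma> \<Longrightarrow> y \<in> \<Gamma> \<Longrightarrow> fn M f [y] \<prec> fn M f [x] \<Longrightarrow>
      \<psi> (x \<ominus> y) = fn M f [y] \<and> (y \<prec> x \<longleftrightarrow> y \<prec> eval M (\<lambda>_. y) g)"
    and k: "0 \<le> k" "k + 2 \<le> N" and y: "lin k y"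
  shows "pure (k + 1) (\<lambda>i. fn M f [y i])"
  using y
proof (cases rule: linE)
  case 1
  then have "fn M f [y i] = \<infinity>" if "i \<in> J (k + 1)" for i using that f(2) by simp
  then show ?thesis unfolding pure_def using Cl_const[of FInf M _ N "k + 1"] by (intro disjI1 exI[of _ \<infinity>]) auto
next
  case (2 \<alpha> \<beta>)
  define m where "m = N - k"
  \<comment> \<open>The bound ensures that \<open>1\<close> and \<open>m\<close> are different
    indices, so that comparing \<open>F 1\<close> with \<open>F m\<close> decides how
    \<open>F\<close> behaves away from \<open>0\<close>.\<close>
  have m: "m \<ge> 2" "J k = {-m..m}" "J (k + 1) = {-(m-1)..m-1}" using k by (auto simp: m_def)
  have k': "0 \<le> k" "k \<le> N" using k by auto
  define z where "z = (\<lambda>i. \<alpha> i \<oplus> \<beta>)"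
  define F where "F = (\<lambda>i. fn M f [z i])"
  have aG: "\<alpha> i \<in> \<Gamma>" if "-m \<le> i" "i \<le> m" for i using 2(4)[of i] that unfolding m(2) by simp
  have zG: "z i \<in> \<Gamma>" if "-m \<le> i" "i \<le> m" for i using aG[OF that] 2(2) by (simp add: z_def)
  have Fc: "F i \<in> carrier M" if "-m \<le> i" "i \<le> m" for i using f(3)[OF zG[OF that]] by (simp add: F_def)
  have yz: "fn M f [y i] = F i" if "i \<in> J (k + 1)" for i using 2(5)[of i] that m by (auto simp: F_def z_def)
  have zC: "z \<in> C k" using Cl_plus[OF AC[OF 2(1)] 2(3)] by (simp add: z_def)
  have FC: "F \<in> C k" using Cl_unary[OF zC f(1)] by (simp add: F_def)
  have gC: "(\<lambda>i. eval M (\<lambda>_. z i) g) \<in> C k" using Cl_op[OF g(1), of "\<lambda>_. z"] zC by simp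
  note iC = indisc2[OF indisc_C[OF k'], unfolded m(2)]
  note iA = indisc2[OF indisc_A[OF k'] 2(1) 2(1), unfolded m(2)]
  have sub: "z i \<ominus> z j = \<alpha> i \<ominus> \<alpha> j" if "-m \<le> i" "i \<le> m" "-m \<le> j" "j \<le> m" for i j
    using aG that 2(2) by (simp add: z_def ag)
  have "pure (k + 1) F"
  proof (cases "F 1 = F m")
    case True
    have e: "F i = F m" if "-m \<le> i" "i \<le> m" "i \<noteq> 0" for i
      using iC(1)[OF FC FC, of 1 m i m] True that m by (cases "i = m") auto
    \<comment> \<open>Otherwise \<open>z\<close> would be strictly monotone at \<open>-1\<close>,
      \<open>0\<close>, \<open>1\<close>, while \<open>fg\<close> forces \<open>z (-1)\<close> and
      \<open>z 1\<close> to lie on the same side of \<open>z 0\<close>.\<close>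
    have "F 0 = F m"
    proof (rule ccontr)
      assume n: "F 0 \<noteq> F m"
      have zc: "z (-1) \<in> carrier M" "z 0 \<in> carrier M" "z 1 \<in> carrier M" using zG m by auto
      \<comment> \<open>At the indices \<open>1\<close> and \<open>-1\<close>, both different from
        \<open>0\<close>, indiscernibility over \<open>b\<close> makes the side of \<open>z\<close>
        relative to \<open>g\<close> the same.\<close>
      have gz: "z 1 \<prec> eval M (\<lambda>_. z 1) g \<longleftrightarrow> z (-1) \<prec> eval M (\<lambda>_. z (-1)) g"
        using iC(2)[OF zC gC, of 1 1 "-1" "-1"] m by auto
      have a: "\<alpha> (-1) = \<alpha> 0 \<longleftrightarrow> \<alpha> 0 = \<alpha> 1" "\<alpha> (-1) \<prec> \<alpha> 0 \<longleftrightarrow> \<alpha> 0 \<prec> \<alpha> 1"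
        using iA[of "-1" 0 0 1] m by auto
      have "\<alpha> 0 \<noteq> \<alpha> 1" using e[of 1] n m by (auto simp: F_def z_def)
      then have za: "z (-1) \<noteq> z 0" "z 0 \<noteq> z 1" "z (-1) \<prec> z 0 \<longleftrightarrow> z 0 \<prec> z 1"
        using a aG[of "-1"] aG[of 0] aG[of 1] m 2(2) by (auto simp: z_def)
      have zo: "z (-1) \<prec> z 0 \<and> \<not> z 0 \<prec> z (-1) \<and> z 0 \<prec> z 1 \<and> \<not> z 1 \<prec> z 0 \<or> z 0 \<prec> z (-1) \<and> \<not> z (-1) \<prec> z 0 \<and> z 1 \<prec> z 0 \<and> \<not> z 0 \<prec> z 1"
        using za less_linear[OF zc(1,2)] less_linear[OF zc(2,3)] less_asym[of "z (-1)" "z 0"] less_asym[of "z 0" "z (-1)"]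
          less_asym[of "z 0" "z 1"] less_asym[of "z 1" "z 0"] zc by blast
      have e1: "F 1 = F m" "F (-1) = F m" using e[of 1] e[of "-1"] m by auto
      consider "F m \<prec> F 0" | "F 0 \<prec> F m" using less_linear[OF Fc[of 0] Fc[of m]] n m by auto
      then show False
      proof cases
        case 1
        \<comment> \<open>The values at \<open>1\<close> and \<open>-1\<close> are the smaller ones,
          so the sides are read off from \<open>g\<close> there, and \<open>gz\<close> compares
          them.\<close>
        have "z 1 \<prec> z 0 \<longleftrightarrow> z 1 \<prec> eval M (\<lambda>_. z 1) g" "z (-1) \<prec> z 0 \<longleftrightarrow> z (-1) \<prec> eval M (\<lambda>_. z (-1)) g"
          using fg[OF zG[of 0] zG[of 1]] fg[OF zG[of 0] zG[of "-1"]] 1 e1 m by (auto simp: F_def)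
        then show False using gz zo by blast
      next
        case 2
        \<comment> \<open>The value at \<open>0\<close> is the smaller one, so both sides are read
          off from the same condition on \<open>z 0\<close>.\<close>
        have "z 0 \<prec> z 1 \<longleftrightarrow> z 0 \<prec> eval M (\<lambda>_. z 0) g" "z 0 \<prec> z (-1) \<longleftrightarrow> z 0 \<prec> eval M (\<lambda>_. z 0) g"
          using fg[OF zG[of 1] zG[of 0]] fg[OF zG[of "-1"] zG[of 0]] 2 e1 m by (auto simp: F_def)
        then show False using zo by blast
      qed
    qed
    then have "F i = F m" if "i \<in> J (k + 1)" for i using e[of i] that m by (cases "i = 0") auto
    moreover have "(\<lambda>_. F m) \<in> C (k + 1)" using Cl_fix[OF FC, of "k + 1" m] m k by (simp add: m_def)
    ultimately show ?thesis unfolding pure_def by blast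
  next
    case False
    \<comment> \<open>The sign \<open>d\<close> records the direction in which \<open>F\<close>
      increases away from \<open>0\<close>; the end \<open>d * m\<close> is then the index with the
      largest value among these.\<close>
    have "\<exists>d. (d = 1 \<or> d = -1) \<and> (\<forall>i j. -m \<le> i \<longrightarrow> i \<le> m \<longrightarrow> i \<noteq> 0 \<longrightarrow> -m \<le> j \<longrightarrow> j \<le> m \<longrightarrow> j \<noteq> 0 \<longrightarrow> d * i < d * j \<longrightarrow> F i \<prec> F j)"
    proof -
      consider "F 1 \<prec> F m" | "F m \<prec> F 1" using False less_linear[OF Fc[of 1] Fc[of m]] m by auto
      then show ?thesis
      proof cases
        case 1
        have "F i \<prec> F j" if "-m \<le> i" "i \<le> m" "i \<noteq> 0" "-m \<le> j" "j \<le> m" "j \<noteq> 0" "i < j" for i j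
          using iC(2)[OF FC FC, of 1 m i j] that 1 m by auto
        then show ?thesis by (intro exI[of _ 1]) auto
      next
        case 2
        have "F i \<prec> F j" if "-m \<le> i" "i \<le> m" "i \<noteq> 0" "-m \<le> j" "j \<le> m" "j \<noteq> 0" "j < i" for i j
          using iC(2)[OF FC FC, of m 1 i j] that 2 m by auto
        then show ?thesis by (intro exI[of _ "-1"]) auto
      qed
    qed
    then obtain d :: int where d: "d = 1 \<or> d = -1"
      and mono: "\<And>i j. -m \<le> i \<Longrightarrow> i \<le> m \<Longrightarrow> i \<noteq> 0 \<Longrightarrow> -m \<le> j \<Longrightarrow> j \<le> m \<Longrightarrow> j \<noteq> 0 \<Longrightarrow> d * i < d * j \<Longrightarrow> F i \<prec> F j" by blast
    have val: "\<psi> (\<alpha> j \<ominus> \<alpha> i) = F i" if "-m \<le> i" "i \<le> m" "-m \<le> j" "j \<le> m" "F i \<prec> F j" for i j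
      using fg[OF zG[of j] zG[of i]] sub[of j i] that by (auto simp: F_def)
    \<comment> \<open>By \<open>val\<close> this equals \<open>F i\<close> whenever
      \<open>F i\<close> is below \<open>F (d * m)\<close>; the constant \<beta> cancels in the
      difference, so no \<open>b\<close> is left.\<close>
    define \<epsilon> where "\<epsilon> = (\<lambda>i. \<psi> (\<alpha> (d * m) \<ominus> \<alpha> i))"
    have dm: "- m \<le> d * m" "d * m \<le> m" "d * m \<noteq> 0" "\<bar>d * m\<bar> = m" "d * (d * m) = m" "-m \<le> d" "d \<le> m" "d \<noteq> 0" "d * d = 1" "-m \<le> -d" "-d \<le> m"
      using d m by auto
    have "\<epsilon> \<in> A (k + 1)"
    proof -
      have "(\<lambda>_. \<alpha> (d * m)) \<in> A (k + 1)" using Cl_fix[OF 2(1), of "k + 1" "d * m"] dm m k by (simp add: m_def)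
      moreover have "\<alpha> \<in> A (k + 1)" using Cl_mono[of k "k + 1"] 2(1) by auto
      ultimately show ?thesis unfolding \<epsilon>_def using Cl_plus Cl_unary[of _ M S N "k + 1" FNeg] Cl_unary[of _ M S N "k + 1" FPsi] by force
    qed
    moreover have "F i = \<epsilon> i" if i: "i \<in> J (k + 1)" for i
    proof -
      have i': "-m \<le> i" "i \<le> m" "-m < i" "i < m" using i m by auto
      have "F i \<prec> F (d * m)"
      proof (cases "i = 0")
        case False
        have "d * i < d * (d * m)" using d i' dm(5) by auto
        then show ?thesis using mono[of i "d * m"] i' dm False by blast
      next
        case True
        show ?thesis
        proof (rule ccontr)
          \<comment> \<open>If \<open>F 0\<close> were too large, then
            \<open>\<psi> (\<alpha> 0 \<ominus> \<alpha> d)\<close> and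
            \<open>\<psi> (\<alpha> (d * m) \<ominus> \<alpha> d)\<close> would both be
            \<open>F d\<close>. But at \<open>-d\<close>, \<open>d\<close>, \<open>d * m\<close> the
            first of the two differences has a strictly smaller value, and \<alpha> cannot
            distinguish this triple from \<open>0\<close>, \<open>d\<close>,
            \<open>d * m\<close>.\<close>
          assume "\<not> F i \<prec> F (d * m)"
          then have "\<not> F 0 \<prec> F (d * m)" using True by simp
          moreover have "F 0 \<in> carrier M" "F (d * m) \<in> carrier M" using Fc dm m by simp_all
          ultimately have le: "F (d * m) \<preceq> F 0" using less_linear[of "F 0" "F (d * m)"] by auto
          have dl: "d * d < d * (d * m)" unfolding dm(5) dm(9) using m by simp
          have l1: "F d \<prec> F (d * m)" using mono[of d "d * m"] dm dl by blast
          then have l2: "F d \<prec> F 0" using le less_le_trans[of "F d" "F (d * m)" "F 0"] Fc dm m by simp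
          have l3: "F (-d) \<prec> F d" using mono[of "-d" d] dm by simp
          have "\<psi> (\<alpha> d \<ominus> \<alpha> (-d)) \<prec> \<psi> (\<alpha> (d * m) \<ominus> \<alpha> d)"
            using val[of "-d" d] val[of d "d * m"] l3 l1 dm by simp
          moreover have "\<psi> (\<alpha> d \<ominus> \<alpha> (-d)) \<prec> \<psi> (\<alpha> (d * m) \<ominus> \<alpha> d) \<longleftrightarrow> \<psi> (\<alpha> d \<ominus> \<alpha> 0) \<prec> \<psi> (\<alpha> (d * m) \<ominus> \<alpha> d)"
            by (rule indisc_psi_triple[OF indisc_A[OF k'] 2(1)]) (use d m in auto)
          moreover have "\<psi> (\<alpha> (d * m) \<ominus> \<alpha> d) = F d" "\<psi> (\<alpha> 0 \<ominus> \<alpha> d) = F d"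
            using val[of d "d * m"] val[of d 0] l1 l2 dm m by simp_all
          ultimately show False using psi_sub_swap[of "\<alpha> d" "\<alpha> 0"] aG dm m Fc[of d] by simp
        qed
      qed
      then show ?thesis using val[of i "d * m"] i' dm by (simp add: \<epsilon>_def)
    qed
    ultimately show ?thesis unfolding pure_def by blast
  qed
  then show ?thesis using yz unfolding pure_def by auto
qed

lemma psi_step: "0 \<le> k \<Longrightarrow> k + 2 \<le> N \<Longrightarrow> lin k y \<Longrightarrow> pure (k + 1) (\<lambda>i. \<psi> (y i))"
  by (rule psi_succ_step[where g = tZero]) (auto simp: psi_less_psi)

lemma succ_step: "0 \<le> k \<Longrightarrow> k + 2 \<le> N \<Longrightarrow> lin k y \<Longrightarrow> pure (k + 1) (\<lambda>i. \<s> (y i))"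
  by (rule psi_succ_step[where g = "tSucc (Var 0)"]) (auto simp: succ_less_psi)

text \<open>The term \<open>q = \<p> (\<s> y)\<close> is pure, and on the group \<open>y = q\<close>
  holds exactly on \<Psi>. By comparison this equation has the same truth value at all remaining
  indices: either \<open>\<p> y\<close> is \<open>\<p> q\<close> throughout, or it is
  \<open>\<infinity>\<close> throughout.\<close>

lemma pred_step:
  assumes k: "0 \<le> k" "k + 2 \<le> N" and y: "lin k y"
  shows "pure (k + 1) (\<lambda>i. \<p> (y i))"
proof -
  define q where "q = (\<lambda>i. \<p> (\<s> (y i)))"
  have q: "pure (k + 1) q" unfolding q_def by (rule pure_unary[OF succ_step[OF assms]]) simp
  have ql: "lin (k + 1) q" by (rule pure_lin[OF _ _ q]) (use k in auto)
  have yl: "lin (k + 1) y" using lin_mono[OF y] by simp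
  have cmp: "y i = q i \<longleftrightarrow> y 1 = q 1" if "i \<in> J (k + 1)" for i
    using lin_compare_one[OF _ _ yl ql that] k by simp
  show ?thesis
  proof (cases "y 1 = q 1")
    case True
    then have "\<p> (y i) = \<p> (q i)" if "i \<in> J (k + 1)" for i using cmp[OF that] by simp
    then show ?thesis using pure_unary[OF q, of FPred] unfolding pure_def by simp
  next
    case False
    have "\<p> (y i) = \<infinity>" if i: "i \<in> J (k + 1)" for i
    proof (rule pred_infty)
      have c: "y i \<in> carrier M" using lin_carrier[OF yl i] .
      then show "y i \<in> carrier M" .
      show "\<not> (y i \<in> \<Psi> \<and> y i \<noteq> \<s> \<zero>)" using cmp[OF i] False by (auto simp: q_def)
    qed
    then show ?thesis unfolding pure_def using Cl_const[of FInf M _ N "k + 1"] by (intro disjI1 exI[of _ \<infinity>]) auto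
  qed
qed

end

text \<open>The loss \<open>h\<close> grows by one for each nested \<psi>, \<open>\<s>\<close> or
  \<open>\<p>\<close> and depends on the term alone. It is fixed before the model, the sequences and
  \<open>N\<close>, because \<open>N\<close> will be chosen after it.\<close>

lemma linearize_term:
  assumes "wf_tm L_log t"
  shows "\<exists>h\<ge>0. \<forall>(M :: (log_fun, log_rel, 'm) fo_struct) S b N s. linearization M S b N \<longrightarrow> h + 2 \<le> N \<longrightarrow>
    (\<forall>v\<in>vars_tm t. s v \<in> insert (\<lambda>_. b) S) \<longrightarrow> linearization.lin M S b N h (\<lambda>i. eval M (\<lambda>v. s v i) t)"
  (is "\<exists>h\<ge>0. ?P h t")
  using assms
proof (induction t rule: log_tm_induct)
  case (Var v)
  show ?case
  proof (intro exI[of _ 0] conjI allI impI)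
    fix M :: "(log_fun, log_rel, 'm) fo_struct" and S b N and s :: "nat \<Rightarrow> int \<Rightarrow> 'm"
    assume l: "linearization M S b N" and N: "0 + 2 \<le> N" and s: "\<forall>v\<in>vars_tm (Var v :: log_tm). s v \<in> insert (\<lambda>_. b) S"
    interpret linearization M S b N by fact
    have "pure 0 (s v)"
    proof (cases "s v \<in> S")
      case True then show ?thesis using Cl_base[of "s v" S M N 0] unfolding pure_def by blast
    next
      case False
      then have "s v = (\<lambda>_. b)" using s by simp
      then show ?thesis using Cl_base[of "\<lambda>_. b" "insert (\<lambda>_. b) S" M N 0] unfolding pure_def by (intro disjI1 exI[of _ b]) simp
    qed
    then show "lin 0 (\<lambda>i. eval M (\<lambda>v. s v i) (Var v))" using pure_lin[of 0 "s v"] N by simp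
  qed simp
next
  case Zero
  show ?case
  proof (intro exI[of _ 0] conjI allI impI)
    fix M :: "(log_fun, log_rel, 'm) fo_struct" and S b N and s :: "nat \<Rightarrow> int \<Rightarrow> 'm"
    assume l: "linearization M S b N" and N: "0 + 2 \<le> N"
    interpret linearization M S b N by fact
    have "pure 0 (\<lambda>_. \<zero>\<^bsub>M\<^esub>)" using Cl_const[of FZero M _ N 0] unfolding pure_def by auto
    then show "lin 0 (\<lambda>i. eval M (\<lambda>v. s v i) tZero)" using pure_lin[of 0] N by simp
  qed simp
next
  case Inf
  show ?case
  proof (intro exI[of _ 0] conjI allI impI)
    fix M :: "(log_fun, log_rel, 'm) fo_struct" and S b N and s :: "nat \<Rightarrow> int \<Rightarrow> 'm"
    assume l: "linearization M S b N"
    interpret linearization M S b N by fact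
    show "lin 0 (\<lambda>i. eval M (\<lambda>v. s v i) tInf)" by (rule lin_infty) simp
  qed simp
next
  case (Plus t u)
  obtain h where h1: "h \<ge> 0 \<and> ?P h t" using Plus.IH(1) by (rule exE)
  obtain h' where h2: "h' \<ge> 0 \<and> ?P h' u" using Plus.IH(2) by (rule exE)
  note h = h1[THEN conjunct1] h1[THEN conjunct2, rule_format] h2[THEN conjunct1] h2[THEN conjunct2, rule_format]
  show ?case
  proof (intro exI[of _ "max h h'"] conjI allI impI)
    fix M :: "(log_fun, log_rel, 'm) fo_struct" and S b N and s :: "nat \<Rightarrow> int \<Rightarrow> 'm"
    assume l: "linearization M S b N" and N: "max h h' + 2 \<le> N" and s: "\<forall>v\<in>vars_tm (t [+] u). s v \<in> insert (\<lambda>_. b) S"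
    interpret linearization M S b N by fact
    have "lin h (\<lambda>i. eval M (\<lambda>v. s v i) t)" "lin h' (\<lambda>i. eval M (\<lambda>v. s v i) u)" using h l N s by auto
    then show "lin (max h h') (\<lambda>i. eval M (\<lambda>v. s v i) (t [+] u))" using lin_plus lin_mono by simp
  qed (use h in simp)
next
  case (Neg t)
  obtain h where h1: "h \<ge> 0 \<and> ?P h t" using Neg.IH by (rule exE)
  note h = h1[THEN conjunct1] h1[THEN conjunct2, rule_format]
  show ?case
  proof (intro exI[of _ h] conjI allI impI)
    fix M :: "(log_fun, log_rel, 'm) fo_struct" and S b N and s :: "nat \<Rightarrow> int \<Rightarrow> 'm"
    assume l: "linearization M S b N" and N: "h + 2 \<le> N" and s: "\<forall>v\<in>vars_tm (tNeg t). s v \<in> insert (\<lambda>_. b) S"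
    interpret linearization M S b N by fact
    show "lin h (\<lambda>i. eval M (\<lambda>v. s v i) (tNeg t))" using lin_neg[of h] h l N s by simp
  qed (use h in simp)
next
  case (Delta n t)
  obtain h where h1: "h \<ge> 0 \<and> ?P h t" using Delta.IH by (rule exE)
  note h = h1[THEN conjunct1] h1[THEN conjunct2, rule_format]
  show ?case
  proof (intro exI[of _ h] conjI allI impI)
    fix M :: "(log_fun, log_rel, 'm) fo_struct" and S b N and s :: "nat \<Rightarrow> int \<Rightarrow> 'm"
    assume l: "linearization M S b N" and N: "h + 2 \<le> N" and s: "\<forall>v\<in>vars_tm (tDelta n t). s v \<in> insert (\<lambda>_. b) S"
    interpret linearization M S b N by fact
    show "lin h (\<lambda>i. eval M (\<lambda>v. s v i) (tDelta n t))" using lin_delta[of h] h l N s by simp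
  qed (use h in simp)
next
  case (Psi t)
  obtain h where h1: "h \<ge> 0 \<and> ?P h t" using Psi.IH by (rule exE)
  note h = h1[THEN conjunct1] h1[THEN conjunct2, rule_format]
  show ?case
  proof (intro exI[of _ "h + 1"] conjI allI impI)
    fix M :: "(log_fun, log_rel, 'm) fo_struct" and S b N and s :: "nat \<Rightarrow> int \<Rightarrow> 'm"
    assume l: "linearization M S b N" and N: "h + 1 + 2 \<le> N" and s: "\<forall>v\<in>vars_tm (tPsi t). s v \<in> insert (\<lambda>_. b) S"
    interpret linearization M S b N by fact
    show "lin (h + 1) (\<lambda>i. eval M (\<lambda>v. s v i) (tPsi t))" using pure_lin[OF _ _ psi_step[of h]] h l N s by simp
  qed (use h in simp)
next
  case (Succ t)
  obtain h where h1: "h \<ge> 0 \<and> ?P h t" using Succ.IH by (rule exE)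
  note h = h1[THEN conjunct1] h1[THEN conjunct2, rule_format]
  show ?case
  proof (intro exI[of _ "h + 1"] conjI allI impI)
    fix M :: "(log_fun, log_rel, 'm) fo_struct" and S b N and s :: "nat \<Rightarrow> int \<Rightarrow> 'm"
    assume l: "linearization M S b N" and N: "h + 1 + 2 \<le> N" and s: "\<forall>v\<in>vars_tm (tSucc t). s v \<in> insert (\<lambda>_. b) S"
    interpret linearization M S b N by fact
    show "lin (h + 1) (\<lambda>i. eval M (\<lambda>v. s v i) (tSucc t))" using pure_lin[OF _ _ succ_step[of h]] h l N s by simp
  qed (use h in simp)
next
  case (Pred t)
  obtain h where h1: "h \<ge> 0 \<and> ?P h t" using Pred.IH by (rule exE)
  note h = h1[THEN conjunct1] h1[THEN conjunct2, rule_format]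
  show ?case
  proof (intro exI[of _ "h + 1"] conjI allI impI)
    fix M :: "(log_fun, log_rel, 'm) fo_struct" and S b N and s :: "nat \<Rightarrow> int \<Rightarrow> 'm"
    assume l: "linearization M S b N" and N: "h + 1 + 2 \<le> N" and s: "\<forall>v\<in>vars_tm (tPred t). s v \<in> insert (\<lambda>_. b) S"
    interpret linearization M S b N by fact
    show "lin (h + 1) (\<lambda>i. eval M (\<lambda>v. s v i) (tPred t))" using pure_lin[OF _ _ pred_step[of h]] h l N s by simp
  qed (use h in simp)
qed

lemma linearization_compare:
  assumes "wf_tm L_log t" "wf_tm L_log u"
  shows "\<exists>n. \<forall>(M :: (log_fun, log_rel, 'm) fo_struct) S b N s. linearization M S b N \<longrightarrow> n \<le> N \<longrightarrow>
    (\<forall>v\<in>vars_tm t \<union> vars_tm u. s v \<in> insert (\<lambda>_. b) S) \<longrightarrow>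
    (eval M (\<lambda>v. s v 0) t = eval M (\<lambda>v. s v 0) u \<longleftrightarrow> eval M (\<lambda>v. s v 1) t = eval M (\<lambda>v. s v 1) u) \<and>
    (eval M (\<lambda>v. s v 0) t \<prec>\<^bsub>M\<^esub> eval M (\<lambda>v. s v 0) u \<longleftrightarrow> eval M (\<lambda>v. s v 1) t \<prec>\<^bsub>M\<^esub> eval M (\<lambda>v. s v 1) u)"
proof -
  obtain h where h: "h \<ge> 0 \<and> (\<forall>(M :: (log_fun, log_rel, 'm) fo_struct) S b N s. linearization M S b N \<longrightarrow> h + 2 \<le> N \<longrightarrow>
    (\<forall>v\<in>vars_tm t. s v \<in> insert (\<lambda>_. b) S) \<longrightarrow> linearization.lin M S b N h (\<lambda>i. eval M (\<lambda>v. s v i) t))"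
    using linearize_term[OF assms(1)] by (rule exE)
  obtain h' where h': "h' \<ge> 0 \<and> (\<forall>(M :: (log_fun, log_rel, 'm) fo_struct) S b N s. linearization M S b N \<longrightarrow> h' + 2 \<le> N \<longrightarrow>
    (\<forall>v\<in>vars_tm u. s v \<in> insert (\<lambda>_. b) S) \<longrightarrow> linearization.lin M S b N h' (\<lambda>i. eval M (\<lambda>v. s v i) u))"
    using linearize_term[OF assms(2)] by (rule exE)
  show ?thesis
  proof (intro exI[of _ "max h h' + 2"] allI impI)
    fix M :: "(log_fun, log_rel, 'm) fo_struct" and S b N and s :: "nat \<Rightarrow> int \<Rightarrow> 'm"
    assume l: "linearization M S b N" and N: "max h h' + 2 \<le> N" and s: "\<forall>v\<in>vars_tm t \<union> vars_tm u. s v \<in> insert (\<lambda>_. b) S"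
    interpret linearization M S b N by fact
    have mx: "0 \<le> max h h'" "max h h' + 1 \<le> N" using h h' N by auto
    have "lin h (\<lambda>i. eval M (\<lambda>v. s v i) t)" "lin h' (\<lambda>i. eval M (\<lambda>v. s v i) u)" using h h' l N s by auto
    then have "lin (max h h') (\<lambda>i. eval M (\<lambda>v. s v i) t)" "lin (max h h') (\<lambda>i. eval M (\<lambda>v. s v i) u)"
      using lin_mono by auto
    moreover have "0 \<in> J (max h h')" using mx by auto
    ultimately show "(eval M (\<lambda>v. s v 0) t = eval M (\<lambda>v. s v 0) u \<longleftrightarrow> eval M (\<lambda>v. s v 1) t = eval M (\<lambda>v. s v 1) u) \<and>
    (eval M (\<lambda>v. s v 0) t \<prec>\<^bsub>M\<^esub> eval M (\<lambda>v. s v 0) u \<longleftrightarrow> eval M (\<lambda>v. s v 1) t \<prec>\<^bsub>M\<^esub> eval M (\<lambda>v. s v 1) u)"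
      by (rule lin_compare_one[OF mx])
  qed
qed

text \<open>Each variable may carry its own index map from \<open>E\<close>. Indiscernibility is
  inherited because the order of two transported indices depends only on the order of the original
  ones.\<close>

lemma indisc_reindex:
  fixes J :: "('j::linorder) set" and Q :: "('i::linorder) set"
  assumes S: "indisc M Q S" and E: "\<And>e k. e \<in> E \<Longrightarrow> k \<in> J \<Longrightarrow> e k \<in> Q"
    and o: "\<And>e e' i j i' j'. e \<in> E \<Longrightarrow> e' \<in> E \<Longrightarrow> {i, j, i', j'} \<subseteq> J \<Longrightarrow> (i < j \<longleftrightarrow> i' < j') \<Longrightarrow> (j < i \<longleftrightarrow> j' < i') \<Longrightarrow>
      e i < e' j \<longleftrightarrow> e i' < e' j'"
  shows "indisc M J {\<lambda>k. s (e k) | s e. s \<in> S \<and> e \<in> E}"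
proof (rule indiscI)
  fix t u :: log_tm and s' :: "nat \<Rightarrow> 'j \<Rightarrow> 'a" and \<iota> \<kappa> :: "nat \<Rightarrow> 'j"
  let ?V = "vars_tm t \<union> vars_tm u"
  assume wf: "wf_tm L_log t" "wf_tm L_log u"
    and a: "\<And>v. v \<in> ?V \<Longrightarrow> s' v \<in> {\<lambda>k. s (e k) | s e. s \<in> S \<and> e \<in> E} \<and> \<iota> v \<in> J \<and> \<kappa> v \<in> J"
    and b: "\<And>v w. v \<in> ?V \<Longrightarrow> w \<in> ?V \<Longrightarrow> \<iota> v < \<iota> w \<longleftrightarrow> \<kappa> v < \<kappa> w"
  have "\<forall>v\<in>?V. \<exists>q. fst q \<in> S \<and> snd q \<in> E \<and> s' v = (\<lambda>k. fst q (snd q k))"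
    using a by fastforce
  from bchoice[OF this] obtain q where q: "\<And>v. v \<in> ?V \<Longrightarrow> fst (q v) \<in> S \<and> snd (q v) \<in> E \<and> s' v = (\<lambda>k. fst (q v) (snd (q v) k))"
    by blast
  have ev: "eval M (\<lambda>v. s' v (\<nu> v)) r = eval M (\<lambda>v. fst (q v) (snd (q v) (\<nu> v))) r" if "vars_tm r \<subseteq> ?V" for \<nu> r
  proof (rule eval_cong)
    fix v assume "v \<in> vars_tm r"
    then have "v \<in> ?V" using that by blast
    from q[OF this] show "s' v (\<nu> v) = fst (q v) (snd (q v) (\<nu> v))" by metis
  qed
  have 1: "fst (q v) \<in> S \<and> snd (q v) (\<iota> v) \<in> Q \<and> snd (q v) (\<kappa> v) \<in> Q" if "v \<in> ?V" for v
    using q[OF that] E a[OF that] by blast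
  have 2: "snd (q v) (\<iota> v) < snd (q w) (\<iota> w) \<longleftrightarrow> snd (q v) (\<kappa> v) < snd (q w) (\<kappa> w)" if vw: "v \<in> ?V" "w \<in> ?V" for v w
    by (rule o) (use q[OF vw(1)] q[OF vw(2)] a[OF vw(1)] a[OF vw(2)] b[OF vw] b[OF vw(2,1)] in auto)
  have t: "vars_tm t \<subseteq> ?V" "vars_tm u \<subseteq> ?V" by auto
  show "(eval M (\<lambda>v. s' v (\<iota> v)) t = eval M (\<lambda>v. s' v (\<iota> v)) u \<longleftrightarrow> eval M (\<lambda>v. s' v (\<kappa> v)) t = eval M (\<lambda>v. s' v (\<kappa> v)) u) \<and>
     (eval M (\<lambda>v. s' v (\<iota> v)) t \<prec>\<^bsub>M\<^esub> eval M (\<lambda>v. s' v (\<iota> v)) u \<longleftrightarrow> eval M (\<lambda>v. s' v (\<kappa> v)) t \<prec>\<^bsub>M\<^esub> eval M (\<lambda>v. s' v (\<kappa> v)) u)"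
    unfolding ev[OF t(1)] ev[OF t(2)]
    using indiscD[OF S wf, of "\<lambda>v. fst (q v)" "\<lambda>v. snd (q v) (\<iota> v)" "\<lambda>v. snd (q v) (\<kappa> v)", OF 1 2] by blast
qed

text \<open>By the pigeonhole principle infinitely many elements of \<open>A\<close> have the same
  elements of \<open>F\<close> below them; these form an infinite set inside one gap of
  \<open>F\<close>.\<close>

lemma infinite_gap_below:
  fixes A :: "('i::linorder) set"
  assumes "infinite A" "finite F"
  shows "\<exists>B P. B \<subseteq> A - F \<and> infinite B \<and> P \<subseteq> F \<and> (\<forall>x\<in>B. (\<forall>f\<in>P. f < x) \<and> (\<forall>f\<in>F - P. x < f))"
proof -
  let ?g = "\<lambda>x. {f \<in> F. f < x}"
  have "finite (?g ` (A - F))" by (rule finite_subset[of _ "Pow F"]) (blast, simp add: assms(2))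
  moreover have "infinite (A - F)" using assms by simp
  ultimately have "\<exists>a\<in>A - F. infinite {x \<in> A - F. ?g x = ?g a}" by (intro pigeonhole_infinite)
  then obtain a where a: "infinite {x \<in> A - F. ?g x = ?g a}" by (rule bexE)
  have "\<forall>x\<in>{x \<in> A - F. ?g x = ?g a}. (\<forall>f\<in>?g a. f < x) \<and> (\<forall>f\<in>F - ?g a. x < f)"
  proof (intro ballI conjI)
    fix x f assume x: "x \<in> {x \<in> A - F. ?g x = ?g a}"
    then have gx: "?g x = ?g a" by blast
    show "f < x" if "f \<in> ?g a" using that unfolding gx[symmetric] by blast
    show "x < f" if "f \<in> F - ?g a"
    proof -
      have "\<not> f < x" using that unfolding gx[symmetric] by blast
      moreover have "x \<noteq> f" using x that by blast
      ultimately show ?thesis by simp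
    qed
  qed
  moreover have "{x \<in> A - F. ?g x = ?g a} \<subseteq> A - F" "?g a \<subseteq> F" by blast+
  ultimately show ?thesis using a by (intro exI[of _ "{x \<in> A - F. ?g x = ?g a}"] exI[of _ "?g a"] conjI)
qed

lemma infinite_gap_above:
  fixes A :: "('i::linorder) set"
  assumes "infinite A" "finite F"
  shows "\<exists>B P. B \<subseteq> A - F \<and> infinite B \<and> P \<subseteq> F \<and> (\<forall>x\<in>B. (\<forall>f\<in>P. x < f) \<and> (\<forall>f\<in>F - P. f < x))"
proof -
  obtain B P where *: "B \<subseteq> A - F" "infinite B" "P \<subseteq> F" "\<forall>x\<in>B. (\<forall>f\<in>P. f < x) \<and> (\<forall>f\<in>F - P. x < f)"
    using infinite_gap_below[OF assms] by blast
  then have "F - (F - P) = P" by blast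
  then show ?thesis using * by (intro exI[of _ B] exI[of _ "F - P"]) auto
qed

lemma sorted_wrt_nth_iff:
  fixes xs :: "('i::linorder) list"
  assumes "sorted_wrt (<) xs" "i < length xs" "j < length xs"
  shows "xs ! i < xs ! j \<longleftrightarrow> i < j"
  using sorted_wrt_nth_less[OF assms(1), of i j] sorted_wrt_nth_less[OF assms(1), of j i] assms(2,3)
  by (cases i j rule: linorder_cases) auto

text \<open>A finite set of indices containing \<open>c\<close> is extended to a sequence of copies of it, the copy at
  \<open>0\<close> being the original one. Since \<open>I\<^sub>1\<close> may have a last element below \<open>c\<close>, only the indices between
  suitable infinite gaps are moved.\<close>

lemma block_family:
  fixes I\<^sub>1 :: "('i::linorder) set" and N :: int
  assumes I: "infinite I\<^sub>1" "infinite I\<^sub>2" "\<And>i. i \<in> I\<^sub>1 \<Longrightarrow> i < c" "\<And>i. i \<in> I\<^sub>2 \<Longrightarrow> c < i"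
    and F: "finite F" "F \<subseteq> I\<^sub>1 \<union> {c} \<union> I\<^sub>2" "c \<in> F" and N: "0 \<le> N"
  shows "\<exists>e. (\<forall>f\<in>F. e f 0 = f \<and> (\<forall>k. e f k \<in> I\<^sub>1 \<union> {c} \<union> I\<^sub>2) \<and> (\<forall>k\<in>{-N..N} - {0}. e f k \<in> I\<^sub>1 \<union> I\<^sub>2)) \<and>
    (\<forall>f\<in>F. \<forall>g\<in>F. \<forall>i j i' j'. {i, j, i', j'} \<subseteq> {-N..N} \<longrightarrow> (i < j \<longleftrightarrow> i' < j') \<longrightarrow> (j < i \<longleftrightarrow> j' < i') \<longrightarrow>
       (e f i < e g j \<longleftrightarrow> e f i' < e g j'))"
proof -
  define F1 where "F1 = {f \<in> F. f < c}"
  define F2 where "F2 = {f \<in> F. c < f}"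
  have FF: "F = F1 \<union> {c} \<union> F2" "finite F1" "finite F2" "F1 \<subseteq> I\<^sub>1" "F2 \<subseteq> I\<^sub>2"
    using F I(3,4) by (auto simp: F1_def F2_def dest: less_asym)
  \<comment> \<open>\<open>P1\<close> is the part of \<open>F1\<close> below the chosen gap. It
    stays fixed, as there may be no room to move it.\<close>
  obtain X1 P1 where X1': "X1 \<subseteq> I\<^sub>1 - F1" "infinite X1" "P1 \<subseteq> F1" "\<forall>x\<in>X1. (\<forall>f\<in>P1. f < x) \<and> (\<forall>f\<in>F1 - P1. x < f)"
    using infinite_gap_below[OF I(1) FF(2)] by blast
  then have X1: "X1 \<subseteq> I\<^sub>1 - F1" "infinite X1" "P1 \<subseteq> F1" "\<And>x f. x \<in> X1 \<Longrightarrow> f \<in> P1 \<Longrightarrow> f < x" "\<And>x f. x \<in> X1 \<Longrightarrow> f \<in> F1 - P1 \<Longrightarrow> x < f"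
    by blast+
  obtain X2 P2 where X2': "X2 \<subseteq> I\<^sub>2 - F2" "infinite X2" "P2 \<subseteq> F2" "\<forall>x\<in>X2. (\<forall>f\<in>P2. x < f) \<and> (\<forall>f\<in>F2 - P2. f < x)"
    using infinite_gap_above[OF I(2) FF(3)] by blast
  then have X2: "X2 \<subseteq> I\<^sub>2 - F2" "infinite X2" "P2 \<subseteq> F2" "\<And>x f. x \<in> X2 \<Longrightarrow> f \<in> P2 \<Longrightarrow> x < f" "\<And>x f. x \<in> X2 \<Longrightarrow> f \<in> F2 - P2 \<Longrightarrow> f < x"
    by blast+
  \<comment> \<open>The block to be copied: \<open>c\<close> and the elements of \<open>F\<close>
    between the two gaps.\<close>
  define B where "B = (F1 - P1) \<union> {c} \<union> (F2 - P2)"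
  have "c \<notin> P1" "c \<notin> P2" "P1 \<inter> F2 = {}" "P2 \<inter> F1 = {}" using X1(3) X2(3) by (auto simp: F1_def F2_def)
  then have B: "finite B" "B \<subseteq> F" "c \<in> B" "F - B = P1 \<union> P2" using FF(1-3) X1(3) X2(3) unfolding B_def by auto
  define K where "K = card B"
  have K: "K > 0" using B by (auto simp: K_def card_gt_0_iff)
  define n where "n = nat N"
  \<comment> \<open>Room for \<open>n\<close> copies of the block below it, and in the next line for
    \<open>n\<close> copies above it.\<close>
  obtain Y1 where Y1: "finite Y1" "card Y1 = n * K" "Y1 \<subseteq> X1" using infinite_arbitrarily_large[OF X1(2)] by blast
  obtain Y2 where Y2: "finite Y2" "card Y2 = n * K" "Y2 \<subseteq> X2" using infinite_arbitrarily_large[OF X2(2)] by blast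
  define l1 where "l1 = sorted_list_of_set Y1"
  define lb where "lb = sorted_list_of_set B"
  define l2 where "l2 = sorted_list_of_set Y2"
  have l: "set l1 = Y1" "set lb = B" "set l2 = Y2" "length l1 = n * K" "length lb = K" "length l2 = n * K"
    "sorted_wrt (<) l1" "sorted_wrt (<) lb" "sorted_wrt (<) l2"
    using Y1 Y2 B by (simp_all add: l1_def lb_def l2_def K_def)
  have Bc: "f < c \<longrightarrow> f \<in> F1 - P1" "c < f \<longrightarrow> f \<in> F2 - P2" if "f \<in> B" for f
    using that FF(4,5) I(3,4) by (auto simp: B_def F1_def F2_def)
  have lt1: "y < f" if "y \<in> Y1" "f \<in> B" for y f
  proof -
    have "y < c" "y \<in> X1" using that Y1(3) X1(1) I(3) by auto
    then show ?thesis using that X1(5)[of y f] Bc(1)[OF that(2)] by (cases "f < c") auto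
  qed
  have lt2: "f < y" if "y \<in> Y2" "f \<in> B" for y f
  proof -
    have "c < y" "y \<in> X2" using that Y2(3) X2(1) I(4) by auto
    then show ?thesis using that X2(5)[of y f] Bc(2)[OF that(2)] by (cases "c < f") auto
  qed
  have lt3: "x < y" if "x \<in> Y1" "y \<in> Y2" for x y using lt1[OF that(1) B(3)] lt2[OF that(2) B(3)] by simp
  define ys where "ys = l1 @ lb @ l2"
  have ys: "sorted_wrt (<) ys" "length ys = (2 * n + 1) * K" "set ys = Y1 \<union> B \<union> Y2"
    using l lt1 lt2 lt3 by (auto simp: ys_def sorted_wrt_append algebra_simps)
  \<comment> \<open>The number of the copy, counted from \<open>0\<close> to \<open>2 * n\<close>,
    with the original block at \<open>n\<close>. Integers outside \<open>{-N..N}\<close> are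
    clamped, so that every copy consists of admissible indices.\<close>
  define cl where "cl = (\<lambda>k. nat (max (-N) (min N k) + N))"
  have cl: "cl k \<le> 2 * n" "cl 0 = n" for k using N by (auto simp: cl_def n_def)
  have cl_less: "cl i < cl j \<longleftrightarrow> i < j" if "i \<in> {-N..N}" "j \<in> {-N..N}" for i j using that by (auto simp: cl_def)
  define blk where "blk = (\<lambda>k p. ys ! (cl k * K + p))"
  have idx: "cl k * K + p < length ys" if "p < K" for k p
  proof -
    have "cl k * K + p < cl k * K + K" using that by simp
    also have "\<dots> = (cl k + 1) * K" by simp
    also have "\<dots> \<le> (2 * n + 1) * K" using cl(1)[of k] by (intro mult_le_mono1) simp
    finally show ?thesis using ys by simp
  qed
  \<comment> \<open>Positions in the concatenated list are ordered lexicographically by copy and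
    place in the block.\<close>
  have pos_less: "a * K + p < a' * K + p' \<longleftrightarrow> a < a' \<or> a = a' \<and> p < p'" if "p < K" "p' < K" for a a' p p' :: nat
  proof -
    have *: "a * K + p < a' * K + p'" if "a < a'" "p < K" for a a' p p'
    proof -
      have "a * K + p < (a + 1) * K" using that by simp
      also have "\<dots> \<le> a' * K" using that by (intro mult_le_mono1) simp
      finally show ?thesis by simp
    qed
    show ?thesis using *[of a a' p p'] *[of a' a p' p] that by (cases a a' rule: linorder_cases) auto
  qed
  have blk_less: "blk k p < blk k' p' \<longleftrightarrow> cl k < cl k' \<or> cl k = cl k' \<and> p < p'" if "p < K" "p' < K" for k k' p p'
    unfolding blk_def sorted_wrt_nth_iff[OF ys(1) idx[OF that(1)] idx[OF that(2)]] using pos_less[OF that] .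
  have blk0: "blk 0 p = lb ! p" if "p < K" for p
    using that l(4,5) cl(2) by (simp add: blk_def ys_def nth_append)
  have blk_in: "blk k p \<in> Y1 \<union> B \<union> Y2" if "p < K" for k p using idx[OF that] ys(3) nth_mem unfolding blk_def by blast
  have blk_nB: "blk k p \<in> Y1 \<union> Y2" if "p < K" "k \<in> {-N..N} - {0}" for k p
  proof (cases "k < 0")
    case True
    then have "cl k < n" using cl_less[of k 0] that cl(2) N by auto
    then have "cl k * K + p < n * K" using pos_less[of p 0 "cl k" n] that K by simp
    then show ?thesis using l by (simp add: blk_def ys_def nth_append) (metis nth_mem)
  next
    case False
    then have "n < cl k" using cl_less[of 0 k] that cl(2) N by auto
    then have "(n + 1) * K \<le> cl k * K" by (intro mult_le_mono1) simp
    then have ge: "n * K + K \<le> cl k * K + p" by simp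
    have "ys ! (cl k * K + p) = l2 ! (cl k * K + p - (n * K + K))"
    proof -
      have "\<not> cl k * K + p < length (l1 @ lb)" using ge l(4,5) by simp
      then show ?thesis using l(4,5) nth_append[of "l1 @ lb" l2 "cl k * K + p"] by (simp add: ys_def)
    qed
    moreover have "cl k * K + p - (n * K + K) < length l2" using idx[OF that(1), of k] ge l ys(2) by (simp add: algebra_simps)
    ultimately show ?thesis using l(3) nth_mem[of _ l2] by (simp add: blk_def)
  qed
  have "\<forall>f\<in>B. \<exists>p<K. lb ! p = f" using l(2,5) by (metis in_set_conv_nth)
  from bchoice[OF this] obtain r where r: "\<And>f. f \<in> B \<Longrightarrow> r f < K \<and> lb ! r f = f" by blast
  define e where "e = (\<lambda>f k. if f \<in> B then blk k (r f) else f)"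
  have YI: "Y1 \<subseteq> I\<^sub>1" "Y2 \<subseteq> I\<^sub>2" using Y1 Y2 X1 X2 by auto
  have P: "f < y" if "f \<in> P1" "y \<in> Y1 \<union> B \<union> Y2" for f y
  proof -
    obtain z where z: "z \<in> X1" using X1(2) by (metis ex_in_conv finite.emptyI)
    have fc: "f < c" using that X1(3) F1_def by auto
    have "y \<in> Y2 \<Longrightarrow> c < y" using YI(2) I(4) by blast
    then have "y \<in> Y1 \<or> y \<in> F1 - P1 \<or> c \<le> y" using that(2) Bc(1)[of y] by fastforce
    then consider "y \<in> Y1" | "y \<in> F1 - P1" | "c \<le> y" by blast
    then show ?thesis
    proof cases
      case 1 then show ?thesis using X1(4) that Y1 by blast
    next
      case 2 then show ?thesis using X1(4)[OF z that(1)] X1(5)[OF z 2] by simp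
    next
      case 3 then show ?thesis using fc by simp
    qed
  qed
  have P': "y < f" if "f \<in> P2" "y \<in> Y1 \<union> B \<union> Y2" for f y
  proof -
    obtain z where z: "z \<in> X2" using X2(2) by (metis ex_in_conv finite.emptyI)
    have fc: "c < f" using that X2(3) F2_def by auto
    have "y \<in> Y1 \<Longrightarrow> y < c" using YI(1) I(3) by blast
    then have "y \<in> Y2 \<or> y \<in> F2 - P2 \<or> y \<le> c" using that(2) Bc(2)[of y] by fastforce
    then consider "y \<in> Y2" | "y \<in> F2 - P2" | "y \<le> c" by blast
    then show ?thesis
    proof cases
      case 1 then show ?thesis using X2(4) that Y2 by blast
    next
      case 2 then show ?thesis using X2(4)[OF z that(1)] X2(5)[OF z 2] by simp
    next
      case 3 then show ?thesis using fc by simp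
    qed
  qed
  have "e f 0 = f" if "f \<in> F" for f using r[of f] blk0 by (auto simp: e_def)
  moreover have "e f k \<in> I\<^sub>1 \<union> {c} \<union> I\<^sub>2" if "f \<in> F" for f k
    using that F(2) B(2) YI blk_in[of "r f" k] r[of f] by (auto simp: e_def)
  moreover have "e f k \<in> I\<^sub>1 \<union> I\<^sub>2" if "f \<in> F" "k \<in> {-N..N} - {0}" for f k
    using that F(2) B(3) YI blk_nB[of "r f" k] r[of f] by (auto simp: e_def)
  moreover have "e f i < e g j \<longleftrightarrow> e f i' < e g j'"
    if fg: "f \<in> F" "g \<in> F" and ij: "{i, j, i', j'} \<subseteq> {-N..N}" "i < j \<longleftrightarrow> i' < j'" "j < i \<longleftrightarrow> j' < i'" for f g i j i' j'
  proof -
    have cc: "cl i < cl j \<longleftrightarrow> cl i' < cl j'" "cl j < cl i \<longleftrightarrow> cl j' < cl i'" using ij cl_less by auto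
    have ce: "cl i = cl j \<longleftrightarrow> cl i' = cl j'" using cc by linarith
    show "e f i < e g j \<longleftrightarrow> e f i' < e g j'"
    proof (cases "f \<in> B"; cases "g \<in> B")
      assume "f \<in> B" "g \<in> B"
      then show ?thesis using blk_less r cc ce by (simp add: e_def)
    next
      assume fB: "f \<in> B" "g \<notin> B"
      then have g: "g \<in> P1 \<union> P2" using fg B by blast
      have "blk k (r f) \<in> Y1 \<union> B \<union> Y2" for k using blk_in r fB by blast
      then have "g \<in> P1 \<longrightarrow> g < blk k (r f)" "g \<in> P2 \<longrightarrow> blk k (r f) < g" for k using P P' by blast+
      then show ?thesis using fB g by (simp add: e_def) (metis less_asym)
    next
      assume fB: "f \<notin> B" "g \<in> B"
      then have f: "f \<in> P1 \<union> P2" using fg B by blast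
      have "blk k (r g) \<in> Y1 \<union> B \<union> Y2" for k using blk_in r fB by blast
      then have "f \<in> P1 \<longrightarrow> f < blk k (r g)" "f \<in> P2 \<longrightarrow> blk k (r g) < f" for k using P P' by blast+
      then show ?thesis using fB f by (simp add: e_def) (metis less_asym)
    next
      assume "f \<notin> B" "g \<notin> B"
      then show ?thesis by (simp add: e_def)
    qed
  qed
  ultimately show ?thesis by (intro exI[of _ e] conjI ballI allI impI) blast+
qed

lemma finite_vars_tm: "finite (vars_tm t)"
  by (induction t) auto

text \<open>\<open>block_family\<close> turns \<open>c\<close> into the index \<open>0\<close> of a sequence over \<open>{-N..N}\<close>; \<open>linearization_compare\<close> moves it to \<open>1\<close>,
  hence into \<open>I\<^sub>1 \<union> I\<^sub>2\<close>, where indiscernibility over \<open>b\<close> is given.\<close>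

lemma indisc_add_parameter:
  fixes I\<^sub>1 I\<^sub>2 :: "('i::linorder) set"
  assumes M: "log_structure M" and I: "infinite I\<^sub>1" "infinite I\<^sub>2" "\<And>i. i \<in> I\<^sub>1 \<Longrightarrow> i < c" "\<And>i. i \<in> I\<^sub>2 \<Longrightarrow> c < i"
    and S: "\<And>s i. s \<in> S \<Longrightarrow> i \<in> I\<^sub>1 \<union> {c} \<union> I\<^sub>2 \<Longrightarrow> s i \<in> carrier M" and b: "b \<in> carrier M"
    and ind: "indisc M (I\<^sub>1 \<union> {c} \<union> I\<^sub>2) S" and indb: "indisc M (I\<^sub>1 \<union> I\<^sub>2) (insert (\<lambda>_. b) S)"
  shows "indisc M (I\<^sub>1 \<union> {c} \<union> I\<^sub>2) (insert (\<lambda>_. b) S)"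
proof (rule indiscI)
  interpret log_model M using M by unfold_locales
  let ?I = "I\<^sub>1 \<union> {c} \<union> I\<^sub>2" and ?S = "insert (\<lambda>_. b) S"
  fix t u :: log_tm and s :: "nat \<Rightarrow> 'i \<Rightarrow> 'a" and \<iota> \<kappa> :: "nat \<Rightarrow> 'i"
  let ?V = "vars_tm t \<union> vars_tm u"
  \<comment> \<open>Both truth values to be preserved, as a function of the assignment of
    indices.\<close>
  define Q where "Q = (\<lambda>\<nu>. (eval M (\<lambda>v. s v (\<nu> v)) t = eval M (\<lambda>v. s v (\<nu> v)) u, eval M (\<lambda>v. s v (\<nu> v)) t \<prec>\<^bsub>M\<^esub> eval M (\<lambda>v. s v (\<nu> v)) u))"
  assume wf: "wf_tm L_log t" "wf_tm L_log u" and a: "\<And>v. v \<in> ?V \<Longrightarrow> s v \<in> ?S \<and> \<iota> v \<in> ?I \<and> \<kappa> v \<in> ?I"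
    and o: "\<And>v w. v \<in> ?V \<Longrightarrow> w \<in> ?V \<Longrightarrow> \<iota> v < \<iota> w \<longleftrightarrow> \<kappa> v < \<kappa> w"
  \<comment> \<open>Every assignment has the order type and truth values of one avoiding
    \<open>c\<close>; thus two assignments can be compared where indiscernibility over
    \<open>b\<close> is known.\<close>
  have avoid: "\<exists>\<nu>'. (\<forall>v\<in>?V. \<nu>' v \<in> I\<^sub>1 \<union> I\<^sub>2) \<and> (\<forall>v\<in>?V. \<forall>w\<in>?V. \<nu>' v < \<nu>' w \<longleftrightarrow> \<nu> v < \<nu> w) \<and> Q \<nu>' = Q \<nu>"
    if \<nu>: "\<forall>v\<in>?V. \<nu> v \<in> ?I" for \<nu>
  proof (cases "c \<in> \<nu> ` ?V")
    case False
    then show ?thesis using \<nu> by (intro exI[of _ \<nu>]) auto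
  next
    case True
    obtain n where n: "\<forall>(M :: (log_fun, log_rel, 'a) fo_struct) S b N s. linearization M S b N \<longrightarrow> n \<le> N \<longrightarrow>
      (\<forall>v\<in>vars_tm t \<union> vars_tm u. s v \<in> insert (\<lambda>_. b) S) \<longrightarrow>
      (eval M (\<lambda>v. s v 0) t = eval M (\<lambda>v. s v 0) u \<longleftrightarrow> eval M (\<lambda>v. s v 1) t = eval M (\<lambda>v. s v 1) u) \<and>
      (eval M (\<lambda>v. s v 0) t \<prec>\<^bsub>M\<^esub> eval M (\<lambda>v. s v 0) u \<longleftrightarrow> eval M (\<lambda>v. s v 1) t \<prec>\<^bsub>M\<^esub> eval M (\<lambda>v. s v 1) u)"
      using linearization_compare[OF wf] by (rule exE)
    \<comment> \<open>Besides reaching the bound of the comparison, the interval must contain the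
      index \<open>1\<close>.\<close>
    define N where "N = max n 1"
    have N: "0 \<le> N" "1 \<le> N" "n \<le> N" by (auto simp: N_def)
    let ?F = "\<nu> ` ?V"
    have F: "finite ?F" "?F \<subseteq> ?I" "c \<in> ?F" using finite_vars_tm \<nu> True by auto
    obtain e where e0: "(\<forall>f\<in>?F. e f 0 = f \<and> (\<forall>k. e f k \<in> ?I) \<and> (\<forall>k\<in>{-N..N} - {0}. e f k \<in> I\<^sub>1 \<union> I\<^sub>2)) \<and>
      (\<forall>f\<in>?F. \<forall>g\<in>?F. \<forall>i j i' j'. {i, j, i', j'} \<subseteq> {-N..N} \<longrightarrow> (i < j \<longleftrightarrow> i' < j') \<longrightarrow> (j < i \<longleftrightarrow> j' < i') \<longrightarrow>
         (e f i < e g j \<longleftrightarrow> e f i' < e g j'))"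
      using block_family[OF I F N(1)] by (rule exE)
    have e: "f \<in> ?F \<Longrightarrow> e f (0::int) = f" "f \<in> ?F \<Longrightarrow> e f k \<in> ?I"
      "f \<in> ?F \<Longrightarrow> k \<in> {-N..N} - {0} \<Longrightarrow> e f k \<in> I\<^sub>1 \<union> I\<^sub>2" for f k
      using e0[THEN conjunct1] by blast+
    have eo: "e f i < e g j \<longleftrightarrow> e f i' < e g j'"
      if "f \<in> ?F" "g \<in> ?F" "{i, j, i', j'} \<subseteq> {-N..N}" "i < j \<longleftrightarrow> i' < j'" "j < i \<longleftrightarrow> j' < i'" for f g i j i' j'
      by (rule e0[THEN conjunct2, rule_format]) (use that in auto)
    define E where "E = e ` ?F"
    define S' where "S' = {\<lambda>k. s (e k) | s e. s \<in> S \<and> e \<in> E}"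
    have i1: "indisc M {-N..N} S'" unfolding S'_def
    proof (rule indisc_reindex[OF ind])
      show "f k \<in> ?I" if "f \<in> E" "k \<in> {-N..N}" for f k using that e(2) unfolding E_def by blast
      fix f g i j i' j' assume fg: "f \<in> E" "g \<in> E" and ij: "{i, j, i', j'} \<subseteq> {-N..N}" "i < j \<longleftrightarrow> i' < j'" "j < i \<longleftrightarrow> j' < i'"
      obtain f' g' where "f' \<in> ?F" "g' \<in> ?F" "f = e f'" "g = e g'" using fg by (auto simp: E_def)
      then show "f i < g j \<longleftrightarrow> f i' < g j'" using eo[of f' g'] ij by blast
    qed
    have "indisc M ({-N..N} - {0}) {\<lambda>k. s (e k) | s e. s \<in> ?S \<and> e \<in> E}"
    proof (rule indisc_reindex[OF indb])
      show "f k \<in> I\<^sub>1 \<union> I\<^sub>2" if "f \<in> E" "k \<in> {-N..N} - {0}" for f k using that e(3) unfolding E_def by blast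
      fix f g i j i' j' assume fg: "f \<in> E" "g \<in> E" and ij: "{i, j, i', j'} \<subseteq> {-N..N} - {0}" "i < j \<longleftrightarrow> i' < j'" "j < i \<longleftrightarrow> j' < i'"
      obtain f' g' where "f' \<in> ?F" "g' \<in> ?F" "f = e f'" "g = e g'" using fg by (auto simp: E_def)
      then show "f i < g j \<longleftrightarrow> f i' < g j'" using eo[of f' g'] ij by blast
    qed
    \<comment> \<open>Reindexing leaves the constant sequence \<open>b\<close> unchanged; some index
      map is needed, and \<open>e c\<close> is one.\<close>
    moreover have "insert (\<lambda>_. b) S' \<subseteq> {\<lambda>k. s (e k) | s e. s \<in> ?S \<and> e \<in> E}"
    proof -
      have "e c \<in> E" using F(3) by (auto simp: E_def)
      then have "(\<lambda>_. b) \<in> {\<lambda>k. s (e k) | s e. s \<in> ?S \<and> e \<in> E}"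
        by (intro CollectI exI[of _ "\<lambda>_. b"] exI[of _ "e c"]) simp
      then show ?thesis unfolding S'_def by blast
    qed
    ultimately have i2: "indisc M ({-N..N} - {0}) (insert (\<lambda>_. b) S')" using indisc_mono by blast
    have "linearization M S' b N"
    proof
      show "s i \<in> carrier M" if "s \<in> S'" for s i using that S e(2) by (auto simp: S'_def E_def)
    qed (use b i1 i2 in auto)
    moreover have "(\<lambda>k. s v (e (\<nu> v) k)) \<in> insert (\<lambda>_. b) S'" if "v \<in> ?V" for v
      using a[OF that] that by (auto simp: S'_def E_def)
    ultimately have "(eval M (\<lambda>v. s v (e (\<nu> v) 0)) t = eval M (\<lambda>v. s v (e (\<nu> v) 0)) u \<longleftrightarrow> eval M (\<lambda>v. s v (e (\<nu> v) 1)) t = eval M (\<lambda>v. s v (e (\<nu> v) 1)) u) \<and>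
      (eval M (\<lambda>v. s v (e (\<nu> v) 0)) t \<prec>\<^bsub>M\<^esub> eval M (\<lambda>v. s v (e (\<nu> v) 0)) u \<longleftrightarrow> eval M (\<lambda>v. s v (e (\<nu> v) 1)) t \<prec>\<^bsub>M\<^esub> eval M (\<lambda>v. s v (e (\<nu> v) 1)) u)"
      using n[rule_format, of M S' b N "\<lambda>v k. s v (e (\<nu> v) k)"] N(3) by blast
    moreover have "eval M (\<lambda>v. s v (e (\<nu> v) 0)) q = eval M (\<lambda>v. s v (\<nu> v)) q" if "vars_tm q \<subseteq> ?V" for q
      using that e(1) by (intro eval_cong) auto
    ultimately have "Q (\<lambda>v. e (\<nu> v) 1) = Q \<nu>" by (simp add: Q_def)
    moreover have "e (\<nu> v) 1 \<in> I\<^sub>1 \<union> I\<^sub>2" if "v \<in> ?V" for v using e(3)[of "\<nu> v" 1] that N by simp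
    moreover have "e (\<nu> v) 1 < e (\<nu> w) 1 \<longleftrightarrow> \<nu> v < \<nu> w" if "v \<in> ?V" "w \<in> ?V" for v w
      using eo[of "\<nu> v" "\<nu> w" 1 1 0 0] e(1)[of "\<nu> v"] e(1)[of "\<nu> w"] that N by simp
    ultimately show ?thesis by (intro exI[of _ "\<lambda>v. e (\<nu> v) 1"]) blast
  qed
  have iotaI: "\<forall>v\<in>?V. \<iota> v \<in> ?I" and kappaI: "\<forall>v\<in>?V. \<kappa> v \<in> ?I" using a by blast+
  obtain \<iota>' where \<iota>': "\<forall>v\<in>?V. \<iota>' v \<in> I\<^sub>1 \<union> I\<^sub>2" "\<forall>v\<in>?V. \<forall>w\<in>?V. \<iota>' v < \<iota>' w \<longleftrightarrow> \<iota> v < \<iota> w" "Q \<iota>' = Q \<iota>"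
    using avoid[of \<iota>, OF iotaI] by (elim exE conjE) blast
  obtain \<kappa>' where \<kappa>': "\<forall>v\<in>?V. \<kappa>' v \<in> I\<^sub>1 \<union> I\<^sub>2" "\<forall>v\<in>?V. \<forall>w\<in>?V. \<kappa>' v < \<kappa>' w \<longleftrightarrow> \<kappa> v < \<kappa> w" "Q \<kappa>' = Q \<kappa>"
    using avoid[of \<kappa>, OF kappaI] by (elim exE conjE) blast
  have 1: "s v \<in> ?S \<and> \<iota>' v \<in> I\<^sub>1 \<union> I\<^sub>2 \<and> \<kappa>' v \<in> I\<^sub>1 \<union> I\<^sub>2" if "v \<in> ?V" for v using a[OF that] \<iota>'(1) \<kappa>'(1) that by blast
  have 2: "\<iota>' v < \<iota>' w \<longleftrightarrow> \<kappa>' v < \<kappa>' w" if "v \<in> ?V" "w \<in> ?V" for v w using o[OF that] \<iota>'(2) \<kappa>'(2) that by blast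
  have "Q \<iota>' = Q \<kappa>'" using indiscD[OF indb wf, of s \<iota>' \<kappa>', OF 1 2] by (simp add: Q_def)
  then have "Q \<iota> = Q \<kappa>" using \<iota>'(3) \<kappa>'(3) by simp
  then show "(eval M (\<lambda>v. s v (\<iota> v)) t = eval M (\<lambda>v. s v (\<iota> v)) u \<longleftrightarrow> eval M (\<lambda>v. s v (\<kappa> v)) t = eval M (\<lambda>v. s v (\<kappa> v)) u) \<and>
     (eval M (\<lambda>v. s v (\<iota> v)) t \<prec>\<^bsub>M\<^esub> eval M (\<lambda>v. s v (\<iota> v)) u \<longleftrightarrow> eval M (\<lambda>v. s v (\<kappa> v)) t \<prec>\<^bsub>M\<^esub> eval M (\<lambda>v. s v (\<kappa> v)) u)"
    by (simp add: Q_def)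
qed

text \<open>Two terms mention finitely many parameters, and these are added successively: after each
  step the new constant sequence counts as one of the given sequences.\<close>

lemma indisc_add_parameters:
  fixes I\<^sub>1 I\<^sub>2 :: "('i::linorder) set"
  assumes M: "log_structure M" and I: "infinite I\<^sub>1" "infinite I\<^sub>2" "\<And>i. i \<in> I\<^sub>1 \<Longrightarrow> i < c" "\<And>i. i \<in> I\<^sub>2 \<Longrightarrow> c < i"
    and S: "\<And>s i. s \<in> S \<Longrightarrow> i \<in> I\<^sub>1 \<union> {c} \<union> I\<^sub>2 \<Longrightarrow> s i \<in> carrier M" and A: "A \<subseteq> carrier M"
    and ind: "indisc M (I\<^sub>1 \<union> {c} \<union> I\<^sub>2) S" and indA: "indisc M (I\<^sub>1 \<union> I\<^sub>2) (S \<union> (\<lambda>b _. b) ` A)"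
  shows "indisc M (I\<^sub>1 \<union> {c} \<union> I\<^sub>2) (S \<union> (\<lambda>b _. b) ` A)"
proof -
  let ?I = "I\<^sub>1 \<union> {c} \<union> I\<^sub>2"
  have fin: "indisc M ?I (S \<union> (\<lambda>b _. b) ` B)" if "finite B" "B \<subseteq> A" for B
    using that
  proof (induction B rule: finite_induct)
    case empty then show ?case using ind by simp
  next
    case (insert b B)
    have eq: "S \<union> (\<lambda>b _. b) ` insert b B = insert (\<lambda>_. b) (S \<union> (\<lambda>b _. b) ` B)" by simp
    show ?case unfolding eq
    proof (rule indisc_add_parameter[OF M I])
      show "s i \<in> carrier M" if "s \<in> S \<union> (\<lambda>b _. b) ` B" "i \<in> ?I" for s i using that S insert.prems A by auto
      show "indisc M ?I (S \<union> (\<lambda>b _. b) ` B)" using insert by simp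
      show "indisc M (I\<^sub>1 \<union> I\<^sub>2) (insert (\<lambda>_. b) (S \<union> (\<lambda>b _. b) ` B))"
        by (rule indisc_mono[OF indA]) (use insert.prems in auto)
    qed (use insert.prems A in auto)
  qed
  show ?thesis
  proof (rule indiscI)
    fix t u :: log_tm and s :: "nat \<Rightarrow> 'i \<Rightarrow> 'a" and \<iota> \<kappa> :: "nat \<Rightarrow> 'i"
    let ?V = "vars_tm t \<union> vars_tm u"
    assume wf: "wf_tm L_log t" "wf_tm L_log u" and a: "\<And>v. v \<in> ?V \<Longrightarrow> s v \<in> S \<union> (\<lambda>b _. b) ` A \<and> \<iota> v \<in> ?I \<and> \<kappa> v \<in> ?I"
      and o: "\<And>v w. v \<in> ?V \<Longrightarrow> w \<in> ?V \<Longrightarrow> \<iota> v < \<iota> w \<longleftrightarrow> \<kappa> v < \<kappa> w"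
    \<comment> \<open>Evaluating a constant sequence anywhere returns its parameter, so this set
      catches all parameters that occur.\<close>
    define B where "B = A \<inter> (\<lambda>v. s v undefined) ` ?V"
    have B: "finite B" "B \<subseteq> A" using finite_vars_tm by (auto simp: B_def)
    have 1: "s v \<in> S \<union> (\<lambda>b _. b) ` B \<and> \<iota> v \<in> ?I \<and> \<kappa> v \<in> ?I" if v: "v \<in> ?V" for v
    proof (cases "s v \<in> S")
      case True then show ?thesis using a[OF v] by blast
    next
      case False
      then obtain b where b: "b \<in> A" "s v = (\<lambda>_. b)" using a[OF v] by blast
      then have "b \<in> B" using v by (auto simp: B_def intro!: image_eqI[of _ _ v])
      then show ?thesis using b a[OF v] by blast
    qed
    show "(eval M (\<lambda>v. s v (\<iota> v)) t = eval M (\<lambda>v. s v (\<iota> v)) u \<longleftrightarrow> eval M (\<lambda>v. s v (\<kappa> v)) t = eval M (\<lambda>v. s v (\<kappa> v)) u) \<and>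
       (eval M (\<lambda>v. s v (\<iota> v)) t \<prec>\<^bsub>M\<^esub> eval M (\<lambda>v. s v (\<iota> v)) u \<longleftrightarrow> eval M (\<lambda>v. s v (\<kappa> v)) t \<prec>\<^bsub>M\<^esub> eval M (\<lambda>v. s v (\<kappa> v)) u)"
      using indiscD[OF fin[OF B] wf, of s \<iota> \<kappa>, OF 1 o] by blast
  qed
qed

section \<open>Distality\<close>

lemma concat_nth_mult:
  assumes "\<And>x. x \<in> set xs \<Longrightarrow> length x = n" "i < length xs" "q < n"
  shows "concat xs ! (i * n + q) = xs ! i ! q"
  using assms
proof (induction xs arbitrary: i)
  case (Cons x xs)
  show ?case
  proof (cases i)
    case 0 then show ?thesis using Cons.prems by (simp add: nth_append)
  next
    case (Suc k)
    then have "concat xs ! (k * n + q) = xs ! k ! q" by (intro Cons.IH) (use Cons.prems in auto)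
    then show ?thesis using Suc Cons.prems(1)[of x] by (simp add: nth_append add.assoc)
  qed
qed simp

lemma length_concat_mult:
  "(\<And>x. x \<in> set xs \<Longrightarrow> length x = n) \<Longrightarrow> length (concat xs) = length xs * n"
  by (induction xs) auto

lemma index_bound: "p < (m::nat) \<Longrightarrow> q < n \<Longrightarrow> p * n + q < m * n"
proof -
  assume "p < m" "q < n"
  then have "p * n + q < (p + 1) * n" by simp
  also have "\<dots> \<le> m * n" using \<open>p < m\<close> by (intro mult_le_mono1) simp
  finally show ?thesis .
qed

text \<open>The variables carry indices in arbitrary order and with repetitions. Listing the indices
  increasingly and renumbering the variables turns an atomic comparison into a formula about
  increasing tuples.\<close>

lemma indiscernible_imp_indisc:
  assumes len: "\<And>i. i \<in> I \<Longrightarrow> length (a i) = n"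
    and ind: "indiscernible_over L_log M A n I a"
  shows "indisc M I ((\<lambda>q i. a i ! q) ` {..<n} \<union> (\<lambda>b _. b) ` A)" (is "indisc M I (?Sa \<union> ?Sb)")
proof (rule indiscI)
  fix t u :: log_tm and s and \<iota> \<kappa> :: "nat \<Rightarrow> 'a"
  let ?V = "vars_tm t \<union> vars_tm u"
  assume wf: "wf_tm L_log t" "wf_tm L_log u"
    and s: "\<And>v. v \<in> ?V \<Longrightarrow> s v \<in> ?Sa \<union> ?Sb \<and> \<iota> v \<in> I \<and> \<kappa> v \<in> I"
    and o: "\<And>v w. v \<in> ?V \<Longrightarrow> w \<in> ?V \<Longrightarrow> \<iota> v < \<iota> w \<longleftrightarrow> \<kappa> v < \<kappa> w"
  have fin: "finite ?V" using finite_vars_tm by blast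
  \<comment> \<open>The order condition makes equal \<iota>-indices have equal \<kappa>-indices, so
    \<kappa> is an increasing function of \<iota>.\<close>
  define h where "h = (\<lambda>x. \<kappa> (SOME v. v \<in> ?V \<and> \<iota> v = x))"
  have h: "h (\<iota> v) = \<kappa> v" if v: "v \<in> ?V" for v
  proof -
    have "\<exists>w. w \<in> ?V \<and> \<iota> w = \<iota> v" using v by blast
    then have "(SOME w. w \<in> ?V \<and> \<iota> w = \<iota> v) \<in> ?V \<and> \<iota> (SOME w. w \<in> ?V \<and> \<iota> w = \<iota> v) = \<iota> v" by (rule someI_ex)
    then show ?thesis using o[of _ v] o[of v] v unfolding h_def by (metis linorder_less_linear less_irrefl)
  qed
  define "is" where "is = sorted_list_of_set (\<iota> ` ?V)"
  have si: "set is = \<iota> ` ?V" "sorted_wrt (<) is" using fin by (simp_all add: is_def)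
  define js where "js = map h is"
  have hmono: "h x < h y" if "x \<in> \<iota> ` ?V" "y \<in> \<iota> ` ?V" "x < y" for x y using that h o by auto
  have sj: "sorted_wrt (<) js"
    unfolding js_def sorted_wrt_map by (rule sorted_wrt_mono_rel[OF _ si(2)]) (use si(1) hmono in auto)
  have setj: "set js \<subseteq> I" using h s by (auto simp: js_def si(1))
  have seti: "set is \<subseteq> I" using s by (auto simp: si(1))
  have "\<forall>v\<in>?V. \<exists>p<length is. is ! p = \<iota> v" using si(1) by (metis imageI in_set_conv_nth)
  from bchoice[OF this] obtain pos where pos: "\<And>v. v \<in> ?V \<Longrightarrow> pos v < length is \<and> is ! pos v = \<iota> v" by blast
  have posj: "js ! pos v = \<kappa> v" if "v \<in> ?V" for v using pos[OF that] h[OF that] by (simp add: js_def)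
  define Vc where "Vc = {v \<in> ?V. s v \<in> ?Sb}"
  have "\<forall>v\<in>Vc. \<exists>b. b \<in> A \<and> s v = (\<lambda>_. b)" by (auto simp: Vc_def)
  from bchoice[OF this] obtain b where b: "\<And>v. v \<in> Vc \<Longrightarrow> b v \<in> A \<and> s v = (\<lambda>_. b v)" by blast
  have "\<forall>v\<in>?V - Vc. \<exists>q<n. s v = (\<lambda>i. a i ! q)" using s by (fastforce simp: Vc_def)
  from bchoice[OF this] obtain q where q: "\<And>v. v \<in> ?V - Vc \<Longrightarrow> q v < n \<and> s v = (\<lambda>i. a i ! q v)" by blast
  define vs where "vs = sorted_list_of_set Vc"
  have "finite Vc" using fin by (simp add: Vc_def)
  then have vs: "set vs = Vc" by (simp add: vs_def)
  then have "\<forall>v\<in>Vc. \<exists>p<length vs. vs ! p = v" by (metis in_set_conv_nth)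
  from bchoice[OF this] obtain ix where ix: "\<And>v. v \<in> Vc \<Longrightarrow> ix v < length vs \<and> vs ! ix v = v" by blast
  define bs where "bs = map b vs"
  have bs: "set bs \<subseteq> A" using b vs by (auto simp: bs_def)
  \<comment> \<open>Entries of the sequence come in groups of \<open>n\<close>, in the order of the
    indices; parameters follow after them.\<close>
  define \<sigma> :: "nat \<Rightarrow> log_tm" where "\<sigma> v = Var (if v \<in> Vc then length is * n + ix v else pos v * n + q v)" for v
  have ev: "eval M (\<lambda>v. (concat (map a ks) @ bs) ! v) (tsubst \<sigma> r) = eval M (\<lambda>v. s v (\<nu> v)) r"
    if ks: "set ks \<subseteq> I" "length ks = length is" and \<nu>: "\<forall>v\<in>?V. ks ! pos v = \<nu> v" and r: "vars_tm r \<subseteq> ?V" for ks \<nu> r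
    unfolding eval_tsubst
  proof (rule eval_cong)
    fix v assume "v \<in> vars_tm r"
    then have v: "v \<in> ?V" using r by blast
    have l: "\<And>x. x \<in> set (map a ks) \<Longrightarrow> length x = n" using ks len by auto
    note lc = length_concat_mult[of "map a ks", OF l, simplified]
    show "eval M (\<lambda>v. (concat (map a ks) @ bs) ! v) (\<sigma> v) = s v (\<nu> v)"
    proof (cases "v \<in> Vc")
      case True
      then show ?thesis using ix[OF True] b[OF True] lc ks(2) by (simp add: \<sigma>_def nth_append bs_def)
    next
      case False
      then have qv: "q v < n" "s v = (\<lambda>i. a i ! q v)" using q v by auto
      have pv: "pos v < length ks" using pos[OF v] ks(2) by simp
      have "pos v * n + q v < length ks * n" by (rule index_bound[OF pv qv(1)])
      then show ?thesis using False qv pv bspec[OF \<nu> v] lc concat_nth_mult[of "map a ks", OF l, of "pos v" "q v"]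
        by (simp add: \<sigma>_def nth_append)
    qed
  qed
  have vars: "vars_tm (tsubst \<sigma> r) \<subseteq> {..<length is * n + length bs}" if "vars_tm r \<subseteq> ?V" for r
  proof -
    have "v \<in> ?V \<Longrightarrow> vars_tm (\<sigma> v) \<subseteq> {..<length is * n + length bs}" for v
      using ix[of v] q[of v] pos[of v] index_bound[of "pos v" "length is" "q v" n]
      by (auto simp: \<sigma>_def bs_def trans_less_add1)
    then show ?thesis using that unfolding vars_tsubst by blast
  qed
  have key: "holds M \<phi> (concat (map a is) @ bs) \<longleftrightarrow> holds M \<phi> (concat (map a js) @ bs)"
    if "formula_in L_log (length is * n + length bs) \<phi>" for \<phi>
    using ind[unfolded indiscernible_over_def, rule_format, of bs "is" js \<phi>] bs seti setj si(2) sj that by (simp add: js_def)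
  have wfs: "wf_tm L_log (tsubst \<sigma> t)" "wf_tm L_log (tsubst \<sigma> u)" by (rule wf_tsubst; use wf in \<open>simp add: \<sigma>_def\<close>)+
  have lj: "length js = length is" by (simp add: js_def)
  have t: "vars_tm t \<subseteq> ?V" "vars_tm u \<subseteq> ?V" by auto
  have "\<forall>v\<in>?V. is ! pos v = \<iota> v" "\<forall>v\<in>?V. js ! pos v = \<kappa> v" using pos posj by blast+
  note evi = ev[OF seti refl this(1)] and evj = ev[OF setj lj this(2)]
  show "(eval M (\<lambda>v. s v (\<iota> v)) t = eval M (\<lambda>v. s v (\<iota> v)) u \<longleftrightarrow> eval M (\<lambda>v. s v (\<kappa> v)) t = eval M (\<lambda>v. s v (\<kappa> v)) u) \<and>
     (eval M (\<lambda>v. s v (\<iota> v)) t \<prec>\<^bsub>M\<^esub> eval M (\<lambda>v. s v (\<iota> v)) u \<longleftrightarrow> eval M (\<lambda>v. s v (\<kappa> v)) t \<prec>\<^bsub>M\<^esub> eval M (\<lambda>v. s v (\<kappa> v)) u)"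
  proof
    show "eval M (\<lambda>v. s v (\<iota> v)) t = eval M (\<lambda>v. s v (\<iota> v)) u \<longleftrightarrow> eval M (\<lambda>v. s v (\<kappa> v)) t = eval M (\<lambda>v. s v (\<kappa> v)) u"
      using key[of "tsubst \<sigma> t [=] tsubst \<sigma> u"] vars[OF t(1)] vars[OF t(2)] wfs
      by (simp add: formula_in_def holds_def evi[OF t(1)] evi[OF t(2)] evj[OF t(1)] evj[OF t(2)])
    show "eval M (\<lambda>v. s v (\<iota> v)) t \<prec>\<^bsub>M\<^esub> eval M (\<lambda>v. s v (\<iota> v)) u \<longleftrightarrow> eval M (\<lambda>v. s v (\<kappa> v)) t \<prec>\<^bsub>M\<^esub> eval M (\<lambda>v. s v (\<kappa> v)) u"
      using key[of "tsubst \<sigma> t [<] tsubst \<sigma> u"] vars[OF t(1)] vars[OF t(2)] wfs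
      by (simp add: formula_in_def holds_def evi[OF t(1)] evi[OF t(2)] evj[OF t(1)] evj[OF t(2)])
  qed
qed

text \<open>Indiscernibility for atomic formulas says that the two tuples give atomically equivalent
  assignments; quantifier elimination does the rest.\<close>

lemma indisc_imp_indiscernible:
  assumes M: "log_structure M" "countably_saturated L_log M" and A: "A \<subseteq> carrier M"
    and len: "\<And>i. i \<in> I \<Longrightarrow> length (a i) = n \<and> set (a i) \<subseteq> carrier M"
    and ind: "indisc M I ((\<lambda>q i. a i ! q) ` {..<n} \<union> (\<lambda>b _. b) ` A)" (is "indisc M I ?S")
  shows "indiscernible_over L_log M A n I a"
  unfolding indiscernible_over_def
proof (intro allI impI, elim conjE)
  interpret log_model M using M(1) by unfold_locales
  fix \<phi> :: log_fm and bs "is" js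
  assume bs: "set bs \<subseteq> A" and i: "set is \<subseteq> I" "sorted_wrt (<) is" and j: "set js \<subseteq> I" "sorted_wrt (<) js"
    and eq: "length is = length js" and \<phi>: "formula_in L_log (length is * n + length bs) \<phi>"
  let ?m = "length is" and ?k = "length is * n + length bs"
  \<comment> \<open>Quantifier elimination needs assignments with values in the carrier at all
    variables, hence the padding by \<open>\<zero>\<close>.\<close>
  define e where "e = (\<lambda>ks v. if v < ?k then (concat (map a ks) @ bs) ! v else \<zero>\<^bsub>M\<^esub>)"
  define s where "s = (\<lambda>v. if v < ?m * n then (\<lambda>i. a i ! (v mod n)) else (\<lambda>_. bs ! (v - ?m * n)))"
  define pos where "pos = (\<lambda>v. if v < ?m * n then v div n else 0)"
  have es: "e ks v = s v (ks ! pos v) \<and> e ks v \<in> carrier M" if ks: "set ks \<subseteq> I" "length ks = ?m" and v: "v < ?k" for ks v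
  proof -
    have l: "\<And>x. x \<in> set (map a ks) \<Longrightarrow> length x = n" using ks len by auto
    note lc = length_concat_mult[of "map a ks", OF l, simplified]
    show ?thesis
    proof (cases "v < ?m * n")
      case True
      then have n: "0 < n" by (cases n) auto
      have p: "v div n < length ks" "v mod n < n" using True n ks(2) by (simp_all add: less_mult_imp_div_less)
      have "a (ks ! (v div n)) ! (v mod n) \<in> carrier M" using p ks len[of "ks ! (v div n)"] nth_mem by (metis subsetD)
      then show ?thesis using True lc ks(2) p concat_nth_mult[of "map a ks", OF l, of "v div n" "v mod n"] v
        by (simp add: e_def s_def pos_def nth_append)
    next
      case False
      then have "v - ?m * n < length bs" using v by linarith
      then have "bs ! (v - ?m * n) \<in> carrier M" using bs A nth_mem[of "v - ?m * n" bs] by blast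
      then show ?thesis using False lc ks(2) v by (simp add: e_def s_def pos_def nth_append)
    qed
  qed
  have ec: "e ks v \<in> carrier M" if "set ks \<subseteq> I" "length ks = ?m" for ks v
  proof (cases "v < ?k")
    case True then show ?thesis using es[OF that True] by blast
  qed (simp add: e_def)
  have h: "holds M \<phi> (concat (map a ks) @ bs) \<longleftrightarrow> sat M (e ks) \<phi>" for ks
    unfolding holds_def by (rule sat_cong) (use \<phi> in \<open>auto simp: formula_in_def e_def\<close>)
  show "holds M \<phi> (concat (map a is) @ bs) \<longleftrightarrow> holds M \<phi> (concat (map a js) @ bs)"
  \<comment> \<open>Parameters are treated as constant sequences evaluated at the first index, which
    requires that there is an index.\<close>
  proof (cases "?m = 0")
    case True then show ?thesis using eq by simp
  next
    case False
    \<comment> \<open>The padded variables are replaced by the term for zero, because they belong to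
      no sequence of \<open>?S\<close>.\<close>
    define \<sigma> :: "nat \<Rightarrow> log_tm" where "\<sigma> v = (if v < ?k then Var v else tZero)" for v
    have \<sigma>: "vars_tm (tsubst \<sigma> t) \<subseteq> {..<?k}" "wf_tm L_log t \<Longrightarrow> wf_tm L_log (tsubst \<sigma> t)" for t
      by (auto simp: vars_tsubst \<sigma>_def split: if_splits intro!: wf_tsubst)
    have ev: "eval M (e ks) t = eval M (\<lambda>v. s v (ks ! pos v)) (tsubst \<sigma> t)" if "set ks \<subseteq> I" "length ks = ?m" for ks t
      unfolding eval_tsubst
    proof (rule eval_cong)
      show "e ks v = eval M (\<lambda>v. s v (ks ! pos v)) (\<sigma> v)" for v
        using es[OF that, of v] by (cases "v < ?k") (simp_all add: \<sigma>_def e_def)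
    qed
    have posm: "pos v < ?m" for v using False less_mult_imp_div_less by (simp add: pos_def)
    have sS: "s v \<in> ?S" if "v < ?k" for v
    proof (cases "v < ?m * n")
      case True
      then have "v mod n < n" by (cases n) auto
      then show ?thesis using True by (simp add: s_def)
    next
      case False
      then have "v - ?m * n < length bs" using that by linarith
      then have "bs ! (v - ?m * n) \<in> A" using that bs nth_mem[of "v - ?m * n" bs] by auto
      then show ?thesis using False by (simp add: s_def)
    qed
    have "atomic_equiv M M (e is) (e js)" unfolding atomic_equiv_def
    proof (intro allI impI)
      fix t u assume wf: "wf_tm L_log t" "wf_tm L_log u"
      have 1: "s v \<in> ?S \<and> is ! pos v \<in> I \<and> js ! pos v \<in> I" if "v \<in> vars_tm (tsubst \<sigma> t) \<union> vars_tm (tsubst \<sigma> u)" for v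
      proof -
        have "v < ?k" using that \<sigma>(1)[of t] \<sigma>(1)[of u] by blast
        then show ?thesis using sS[of v] posm[of v] i(1) j(1) eq nth_mem[of "pos v" "is"] nth_mem[of "pos v" js] by auto
      qed
      have 2: "is ! pos v < is ! pos w \<longleftrightarrow> js ! pos v < js ! pos w" for v w
        using sorted_wrt_nth_iff[OF i(2) posm posm] sorted_wrt_nth_iff[OF j(2), folded eq, OF posm posm] by blast
      show "(eval M (e is) t = eval M (e is) u \<longleftrightarrow> eval M (e js) t = eval M (e js) u) \<and>
          (eval M (e is) t \<prec>\<^bsub>M\<^esub> eval M (e is) u \<longleftrightarrow> eval M (e js) t \<prec>\<^bsub>M\<^esub> eval M (e js) u)"
        unfolding ev[OF i(1) refl] ev[OF j(1) eq[symmetric]]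
        using indiscD[OF ind \<sigma>(2)[OF wf(1)] \<sigma>(2)[OF wf(2)], of s "\<lambda>v. is ! pos v" "\<lambda>v. js ! pos v", OF 1 2] by blast
    qed
    then have "sat M (e is) \<phi> \<longleftrightarrow> sat M (e js) \<phi>"
      by (rule quantifier_elimination[OF M M]) (use ec[OF i(1) refl] ec[OF j(1) eq[symmetric]] \<phi> in \<open>auto simp: formula_in_def\<close>)
    then show ?thesis using h by blast
  qed
qed

text \<open>A countable set of formulas involves countably many parameters, which inject into the
  type of formulas through equations between variables; so their number is below \<kappa>.\<close>

lemma saturated_countably_saturated:
  assumes "saturated L \<kappa> M" and \<kappa>: "|UNIV :: ('f, 'r) fm set| <o \<kappa>"
  shows "countably_saturated (L :: ('f, 'r) language) M"
  unfolding countably_saturated_def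
proof (intro allI impI, elim conjE)
  fix \<Phi> assume \<Phi>: "countable \<Phi>" "\<Phi> \<subseteq> {(\<phi>, bs). set bs \<subseteq> carrier M \<and> formula_in L (Suc (length bs)) \<phi>}"
    and fin: "\<forall>F\<subseteq>\<Phi>. finite F \<longrightarrow> (\<exists>x\<in>carrier M. \<forall>(\<phi>, bs)\<in>F. holds M \<phi> (x # bs))"
  define A where "A = (\<Union>p\<in>\<Phi>. set (snd p))"
  have "countable A" unfolding A_def by (intro countable_UN \<Phi>(1)) (simp add: countable_finite)
  then obtain g :: "_ \<Rightarrow> nat" where g: "inj_on g A" by (rule countableE)
  have "inj_on (\<lambda>x. Eq (Var (g x)) (Var 0) :: ('f, 'r) fm) A" using g by (auto simp: inj_on_def)
  then have "|A| \<le>o |UNIV :: ('f, 'r) fm set|" by (meson card_of_ordLeq subset_UNIV)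
  then have A1: "|A| <o \<kappa>" using \<kappa> by (rule ordLeq_ordLess_trans)
  have A2: "A \<subseteq> carrier M" using \<Phi>(2) by (fastforce simp: A_def)
  have A3: "\<Phi> \<subseteq> {(\<phi>, bs). set bs \<subseteq> A \<and> formula_in L (Suc (length bs)) \<phi>}"
  proof
    fix p assume p: "p \<in> \<Phi>"
    then have "set (snd p) \<subseteq> A" by (auto simp: A_def)
    then show "p \<in> {(\<phi>, bs). set bs \<subseteq> A \<and> formula_in L (Suc (length bs)) \<phi>}" using p \<Phi>(2) by auto
  qed
  show "\<exists>x\<in>carrier M. \<forall>(\<phi>, bs)\<in>\<Phi>. holds M \<phi> (x # bs)"
    using assms(1)[unfolded saturated_def, rule_format, OF A2 A1 A3] fin by blast
qed

theorem distal_T_log: "distal L_log T_log TYPE('m) TYPE('i::linorder)"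
  unfolding distal_def
proof (intro allI impI, elim conjE)
  fix M :: "(log_fun, log_rel, 'm) fo_struct" and I\<^sub>1 I\<^sub>2 :: "'i set" and c :: 'i and A n a
  assume "monster_model L_log T_log M" and I: "infinite I\<^sub>1" "infinite I\<^sub>2" "\<forall>i\<in>I\<^sub>1. i < c" "\<forall>i\<in>I\<^sub>2. c < i"
    and A: "A \<subseteq> carrier M" and a: "\<forall>i\<in>I\<^sub>1 \<union> {c} \<union> I\<^sub>2. length (a i) = n \<and> set (a i) \<subseteq> carrier M"
    and ind: "indiscernible_over L_log M {} n (I\<^sub>1 \<union> {c} \<union> I\<^sub>2) a" "indiscernible_over L_log M A n (I\<^sub>1 \<union> I\<^sub>2) a"
  then have "model_of L_log M T_log" and s: "countably_saturated L_log M"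
    using saturated_countably_saturated unfolding monster_model_def by blast+
  then have M: "log_structure M" "countably_saturated L_log M"
    using model_of_T_log_iff unfolding model_of_def by blast+
  let ?S = "(\<lambda>q i. a i ! q) ` {..<n}"
  show "indiscernible_over L_log M A n (I\<^sub>1 \<union> {c} \<union> I\<^sub>2) a"
  proof (rule indisc_imp_indiscernible[OF M A])
    show "indisc M (I\<^sub>1 \<union> {c} \<union> I\<^sub>2) (?S \<union> (\<lambda>b _. b) ` A)"
    proof (rule indisc_add_parameters[OF M(1) I(1,2) _ _ _ A])
      show "indisc M (I\<^sub>1 \<union> {c} \<union> I\<^sub>2) ?S" using indiscernible_imp_indisc[OF _ ind(1)] a by simp
      show "indisc M (I\<^sub>1 \<union> I\<^sub>2) (?S \<union> (\<lambda>b _. b) ` A)" using indiscernible_imp_indisc[OF _ ind(2)] a by simp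
      show "s i \<in> carrier M" if "s \<in> ?S" "i \<in> I\<^sub>1 \<union> {c} \<union> I\<^sub>2" for s i
      proof -
        obtain q where "q < n" "s = (\<lambda>i. a i ! q)" using \<open>s \<in> ?S\<close> by blast
        moreover have "length (a i) = n" "set (a i) \<subseteq> carrier M" using a that(2) by blast+
        ultimately show ?thesis by (metis nth_mem subsetD)
      qed
    qed (use I in auto)
  qed (use a in blast)
qed

section \<open>Ultrapowers and completeness\<close>

text \<open>Zorn's lemma among the filters containing all tails. The tails are what makes the
  ultrapower countably saturated.\<close>

lemma ultrafilter_exists:
  "\<exists>U. (\<forall>n. eventually (\<lambda>i. n \<le> i) U) \<and> U \<noteq> bot \<and>
     (\<forall>P. eventually P U \<or> eventually (\<lambda>i::nat. \<not> P i) U)"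
proof -
  define filt :: "nat set set \<Rightarrow> bool" where "filt = (\<lambda>F. (\<forall>n. {n..} \<in> F) \<and> {} \<notin> F \<and>
    (\<forall>A\<in>F. \<forall>B\<in>F. A \<inter> B \<in> F) \<and> (\<forall>A\<in>F. \<forall>B. A \<subseteq> B \<longrightarrow> B \<in> F))"
  have "\<exists>F\<in>Collect filt. \<forall>G\<in>Collect filt. F \<subseteq> G \<longrightarrow> G = F"
  proof (rule subset_Zorn_nonempty)
    have "filt {A. \<exists>n. {n..} \<subseteq> A}" unfolding filt_def
    proof (intro conjI ballI)
      fix A B :: "nat set" assume "A \<in> {A. \<exists>n. {n..} \<subseteq> A}" "B \<in> {A. \<exists>n. {n..} \<subseteq> A}"
      then obtain m n where "{m..} \<subseteq> A" "{n..} \<subseteq> B" by blast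
      then have "{max m n..} \<subseteq> A \<inter> B" by auto
      then show "A \<inter> B \<in> {A. \<exists>n. {n..} \<subseteq> A}" by blast
    qed auto
    then show "Collect filt \<noteq> {}" by blast
    fix C assume C: "C \<noteq> {}" "subset.chain (Collect filt) C"
    then have f: "F \<in> C \<Longrightarrow> filt F" and ch: "F \<in> C \<Longrightarrow> G \<in> C \<Longrightarrow> F \<subseteq> G \<or> G \<subseteq> F" for F G
      by (auto simp: subset_chain_def)
    have "filt (\<Union>C)" unfolding filt_def
    proof (intro conjI ballI allI impI)
      obtain F0 where F0: "F0 \<in> C" using C(1) by blast
      show "{n..} \<in> \<Union>C" for n
        by (rule UnionI[OF F0]) (rule f[OF F0, unfolded filt_def, THEN conjunct1, rule_format])
      show "{} \<notin> \<Union>C"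
      proof
        assume "{} \<in> \<Union>C"
        then obtain F where "F \<in> C" "{} \<in> F" by blast
        then show False using f[of F] unfolding filt_def by blast
      qed
      fix A assume A: "A \<in> \<Union>C"
      show "B \<in> \<Union>C" if "A \<subseteq> B" for B
      proof -
        obtain F where F: "F \<in> C" "A \<in> F" using A by blast
        then have "B \<in> F" using f[OF F(1)] that unfolding filt_def by blast
        then show ?thesis using F(1) by blast
      qed
      fix B assume "B \<in> \<Union>C"
      then obtain F G where FG: "F \<in> C" "A \<in> F" "G \<in> C" "B \<in> G" using A by blast
      then obtain H where H: "H \<in> C" "A \<in> H" "B \<in> H" using ch[of F G] by blast
      then have "A \<inter> B \<in> H" using f[OF H(1)] unfolding filt_def by blast
      then show "A \<inter> B \<in> \<Union>C" using H(1) by blast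
    qed
    then show "\<Union>C \<in> Collect filt" by blast
  qed
  then obtain F where F: "filt F" and max: "\<And>G. filt G \<Longrightarrow> F \<subseteq> G \<Longrightarrow> G = F" by blast
  note Fd = F[unfolded filt_def]
  have F1: "{n..} \<in> F" for n using Fd by (elim conjE) (rule spec)
  have F2: "{} \<notin> F" using Fd by (elim conjE)
  have F3: "A \<in> F \<Longrightarrow> B \<in> F \<Longrightarrow> A \<inter> B \<in> F" for A B
    using Fd[THEN conjunct2, THEN conjunct2, THEN conjunct1] by blast
  have F4: "A \<in> F \<Longrightarrow> A \<subseteq> B \<Longrightarrow> B \<in> F" for A B
    using Fd[THEN conjunct2, THEN conjunct2, THEN conjunct2] by blast
  have ultra: "A \<in> F \<or> - A \<in> F" for A
  proof (rule ccontr)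
    assume n: "\<not> (A \<in> F \<or> - A \<in> F)"
    \<comment> \<open>The filter generated by \<open>F\<close> and \<open>A\<close>; it is proper
      since the complement of \<open>A\<close> is not in \<open>F\<close>.\<close>
    define G where "G = {B. \<exists>C\<in>F. C \<inter> A \<subseteq> B}"
    have "filt G" unfolding filt_def
    proof (intro conjI ballI allI impI)
      show "{n..} \<in> G" for n using F1[of n] by (auto simp: G_def)
      show "{} \<notin> G"
      proof
        assume "{} \<in> G"
        then obtain C where "C \<in> F" "C \<subseteq> - A" by (auto simp: G_def)
        then show False using F4 n by blast
      qed
      fix B assume B: "B \<in> G"
      show "D \<in> G" if "B \<subseteq> D" for D using B that by (auto simp: G_def)
      fix D assume "D \<in> G"
      then obtain B' D' where *: "B' \<in> F" "B' \<inter> A \<subseteq> B" "D' \<in> F" "D' \<inter> A \<subseteq> D" using B by (auto simp: G_def)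
      then have "B' \<inter> D' \<in> F" "(B' \<inter> D') \<inter> A \<subseteq> B \<inter> D" using F3 by auto
      then show "B \<inter> D \<in> G" unfolding G_def by blast
    qed
    moreover have "F \<subseteq> G" by (auto simp: G_def)
    ultimately have "G = F" by (rule max)
    moreover have "A \<in> G" using F1[of 0] by (auto simp: G_def)
    ultimately show False using n by blast
  qed
  define U where "U = Abs_filter (\<lambda>P. Collect P \<in> F)"
  have "is_filter (\<lambda>P. Collect P \<in> F)"
  proof
    show "Collect (\<lambda>x. True) \<in> F" using F4[OF F1[of 0]] by simp
    show "Collect P \<in> F \<Longrightarrow> Collect Q \<in> F \<Longrightarrow> {x. P x \<and> Q x} \<in> F" for P Q using F3[of "Collect P" "Collect Q"] by (simp add: Collect_conj_eq)
    show "\<forall>x. P x \<longrightarrow> Q x \<Longrightarrow> Collect P \<in> F \<Longrightarrow> Collect Q \<in> F" for P Q by (rule F4[of "Collect P"]) auto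
  qed
  then have ev: "eventually P U \<longleftrightarrow> Collect P \<in> F" for P unfolding U_def by (rule eventually_Abs_filter)
  have "U \<noteq> bot" using ev[of "\<lambda>_. False"] F2 by auto
  moreover have "\<forall>n. eventually (\<lambda>i. n \<le> i) U" using F1 by (simp add: ev atLeast_def)
  moreover have "eventually P U \<or> eventually (\<lambda>i. \<not> P i) U" for P
    using ultra[of "Collect P"] by (simp add: ev Collect_neg_eq)
  ultimately show ?thesis by blast
qed

locale ultrapower =
  fixes U :: "nat filter" and L :: "('f, 'r) language" and M :: "('f, 'r, 'm) fo_struct"
  assumes U_large: "eventually (\<lambda>i. n \<le> i) U" and U_bot: "U \<noteq> bot"
    and U_ultra: "eventually P U \<or> eventually (\<lambda>i. \<not> P i) U" and M: "is_structure L M"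
begin

lemma eventually_not: "eventually (\<lambda>i. \<not> P i) U \<longleftrightarrow> \<not> eventually P U"
proof
  assume n: "eventually (\<lambda>i. \<not> P i) U"
  show "\<not> eventually P U"
  proof
    assume "eventually P U"
    with n have "eventually (\<lambda>_. False) U" by eventually_elim simp
    then show False using U_bot by simp
  qed
qed (use U_ultra in blast)

text \<open>The classes of the ultrapower are represented by chosen members.\<close>

definition rep :: "(nat \<Rightarrow> 'm) \<Rightarrow> nat \<Rightarrow> 'm" where
  "rep f = (SOME g. (\<forall>i. g i \<in> carrier M) \<and> eventually (\<lambda>i. g i = f i) U)"

lemma rep:
  assumes "\<And>i. f i \<in> carrier M"
  shows "rep f i \<in> carrier M" "eventually (\<lambda>i. rep f i = f i) U"
proof -
  have "(\<forall>i. rep f i \<in> carrier M) \<and> eventually (\<lambda>i. rep f i = f i) U"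
    unfolding rep_def by (rule someI[of _ f]) (use assms in simp)
  then show "rep f i \<in> carrier M" "eventually (\<lambda>i. rep f i = f i) U" by blast+
qed

lemma rep_eq: assumes "eventually (\<lambda>i. f i = g i) U" shows "rep f = rep g"
proof -
  have "eventually (\<lambda>i. h i = f i) U \<longleftrightarrow> eventually (\<lambda>i. h i = g i) U" for h
    by (rule eventually_subst) (use assms in eventually_elim, simp)
  then show ?thesis by (simp add: rep_def)
qed

definition Ult :: "('f, 'r, nat \<Rightarrow> 'm) fo_struct" where
  "Ult = \<lparr>carrier = rep ` {f. \<forall>i. f i \<in> carrier M}, fn = (\<lambda>f xs. rep (\<lambda>i. fn M f (map (\<lambda>x. x i) xs))),
     rel = (\<lambda>r xs. eventually (\<lambda>i. rel M r (map (\<lambda>x. x i) xs)) U)\<rparr>"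

lemma Ult_carrier: "x \<in> carrier Ult \<Longrightarrow> x i \<in> carrier M"
  using rep(1) by (auto simp: Ult_def)

lemma rep_carrier: "(\<And>i. f i \<in> carrier M) \<Longrightarrow> rep f \<in> carrier Ult"
  by (auto simp: Ult_def)

lemma Ult_eq_iff:
  assumes "x \<in> carrier Ult" "y \<in> carrier Ult"
  shows "x = y \<longleftrightarrow> eventually (\<lambda>i. x i = y i) U"
proof
  assume xy: "eventually (\<lambda>i. x i = y i) U"
  obtain f g where f: "x = rep f" "\<And>i. f i \<in> carrier M" and g: "y = rep g" "\<And>i. g i \<in> carrier M" using assms by (auto simp: Ult_def)
  have "eventually (\<lambda>i. f i = g i) U" using xy rep(2)[of f, OF f(2)] rep(2)[of g, OF g(2)] unfolding f(1) g(1) by eventually_elim simp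
  then show "x = y" unfolding f(1) g(1) by (rule rep_eq)
qed simp

lemma fn_closed: "length xs = fun_arity L f \<Longrightarrow> set xs \<subseteq> carrier M \<Longrightarrow> fn M f xs \<in> carrier M"
  using M by (auto simp: is_structure_def)

lemma fn_Ult_closed:
  assumes "length xs = fun_arity L f" "set xs \<subseteq> carrier Ult"
  shows "fn M f (map (\<lambda>x. x i) xs) \<in> carrier M"
  by (rule fn_closed) (use assms Ult_carrier in auto)

lemma is_structure_Ult: "is_structure L Ult"
  unfolding is_structure_def
proof (rule conjI)
  obtain a where "a \<in> carrier M" using M by (auto simp: is_structure_def)
  then show "carrier Ult \<noteq> {}" using rep_carrier[of "\<lambda>_. a"] by blast
next
  show "\<forall>f xs. length xs = fun_arity L f \<and> set xs \<subseteq> carrier Ult \<longrightarrow> fn Ult f xs \<in> carrier Ult"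
  proof (intro allI impI)
  fix f xs assume xs: "length xs = fun_arity L f \<and> set xs \<subseteq> carrier Ult"
  have "rep (\<lambda>i. fn M f (map (\<lambda>x. x i) xs)) \<in> carrier Ult"
    by (rule rep_carrier[OF fn_Ult_closed]) (use xs in auto)
  then show "fn Ult f xs \<in> carrier Ult" by (simp add: Ult_def)
  qed
qed

lemma eval_Ult:
  assumes e: "\<And>v. e v \<in> carrier Ult"
  shows "wf_tm L t \<Longrightarrow> eval Ult e t \<in> carrier Ult \<and> eventually (\<lambda>i. eval Ult e t i = eval M (\<lambda>v. e v i) t) U"
proof (induction t)
  case (Var v)
  then show ?case using e by simp
next
  case (Fn f ts)
  let ?xs = "map (eval Ult e) ts"
  have xs: "length ?xs = fun_arity L f" "set ?xs \<subseteq> carrier Ult" using Fn by auto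
  have "eval Ult e (Fn f ts) \<in> carrier Ult" using is_structure_Ult xs unfolding is_structure_def by simp
  moreover have "eventually (\<lambda>i. \<forall>t\<in>set ts. eval Ult e t i = eval M (\<lambda>v. e v i) t) U"
    using Fn by (intro eventually_ball_finite) auto
  then have "eventually (\<lambda>i. eval Ult e (Fn f ts) i = eval M (\<lambda>v. e v i) (Fn f ts)) U"
    using rep(2)[of "\<lambda>i. fn M f (map (\<lambda>x. x i) ?xs)", OF fn_Ult_closed[OF xs]]
  proof eventually_elim
    case (elim i)
    then have "map (\<lambda>t. eval Ult e t i) ts = map (eval M (\<lambda>v. e v i)) ts" by simp
    moreover have "fn Ult f ?xs = rep (\<lambda>i. fn M f (map (\<lambda>x. x i) ?xs))" by (simp add: Ult_def)
    ultimately show ?case using elim(2) by (simp add: comp_def del: map_eq_conv)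
  qed
  ultimately show ?case by blast
qed

theorem Los:
  assumes "\<And>v. e v \<in> carrier Ult" "wf_fm L \<phi>"
  shows "sat Ult e \<phi> \<longleftrightarrow> eventually (\<lambda>i. sat M (\<lambda>v. e v i) \<phi>) U"
  using assms
proof (induction \<phi> arbitrary: e)
  case Falsum
  then show ?case using U_bot by simp
next
  case (Eq t u)
  then have t: "eval Ult e t \<in> carrier Ult" "eventually (\<lambda>i. eval Ult e t i = eval M (\<lambda>v. e v i) t) U"
    "eval Ult e u \<in> carrier Ult" "eventually (\<lambda>i. eval Ult e u i = eval M (\<lambda>v. e v i) u) U"
    using eval_Ult[of e t] eval_Ult[of e u] by auto
  have "eventually (\<lambda>i. eval Ult e t i = eval Ult e u i) U \<longleftrightarrow> eventually (\<lambda>i. eval M (\<lambda>v. e v i) t = eval M (\<lambda>v. e v i) u) U"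
    by (rule eventually_subst) (use t(2,4) in \<open>eventually_elim, simp\<close>)
  then show ?case using Ult_eq_iff[OF t(1,3)] by simp
next
  case (Rel r ts)
  have "eventually (\<lambda>i. \<forall>t\<in>set ts. eval Ult e t i = eval M (\<lambda>v. e v i) t) U"
    using Rel eval_Ult[of e] by (intro eventually_ball_finite) auto
  then have "eventually (\<lambda>i. map (\<lambda>t. eval Ult e t i) ts = map (eval M (\<lambda>v. e v i)) ts) U" by eventually_elim simp
  then have "eventually (\<lambda>i. rel M r (map (\<lambda>t. eval Ult e t i) ts) = rel M r (map (eval M (\<lambda>v. e v i)) ts)) U" by eventually_elim (simp only:)
  note eventually_subst[OF this]
  moreover have "rel Ult r xs \<longleftrightarrow> eventually (\<lambda>i. rel M r (map (\<lambda>x. x i) xs)) U" for xs by (simp add: Ult_def)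
  ultimately show ?case by (simp add: comp_def)
next
  case (Imp \<phi> \<chi>)
  have "sat Ult e \<phi> \<longleftrightarrow> eventually (\<lambda>i. sat M (\<lambda>v. e v i) \<phi>) U" "sat Ult e \<chi> \<longleftrightarrow> eventually (\<lambda>i. sat M (\<lambda>v. e v i) \<chi>) U"
    using Imp by simp_all
  moreover have "eventually (\<lambda>i. P i \<longrightarrow> Q i) U \<longleftrightarrow> (eventually P U \<longrightarrow> eventually Q U)" for P Q
  proof (cases "eventually P U")
    case True
    then have "eventually (\<lambda>i. (P i \<longrightarrow> Q i) = Q i) U" by eventually_elim simp
    from eventually_subst[OF this] show ?thesis using True by simp
  next
    case False
    then have "eventually (\<lambda>i. \<not> P i) U" using eventually_not by blast
    then have "eventually (\<lambda>i. P i \<longrightarrow> Q i) U" by eventually_elim simp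
    then show ?thesis using False by blast
  qed
  ultimately show ?case by simp
next
  case (Forall v \<phi>)
  have upd: "(\<lambda>w. (e(v := x)) w i) = (\<lambda>w. e w i)(v := x i)" for x i by auto
  have IH: "sat Ult (e(v := x)) \<phi> \<longleftrightarrow> eventually (\<lambda>i. sat M ((\<lambda>w. e w i)(v := x i)) \<phi>) U" if "x \<in> carrier Ult" for x
  proof -
    have "(e(v := x)) w \<in> carrier Ult" for w using Forall.prems that by simp
    moreover have "wf_fm L \<phi>" using Forall.prems by simp
    ultimately show ?thesis using Forall.IH[of "e(v := x)"] unfolding upd by blast
  qed
  show ?case
  proof
    assume l: "sat Ult e (Forall v \<phi>)"
    show "eventually (\<lambda>i. sat M (\<lambda>v. e v i) (Forall v \<phi>)) U"
    proof (rule ccontr)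
      assume "\<not> eventually (\<lambda>i. sat M (\<lambda>v. e v i) (Forall v \<phi>)) U"
      then have n: "eventually (\<lambda>i. \<not> sat M (\<lambda>v. e v i) (Forall v \<phi>)) U" using eventually_not by blast
      obtain a0 where a0: "a0 \<in> carrier M" using M by (auto simp: is_structure_def)
      \<comment> \<open>A counterexample is chosen in every coordinate that has one; together they
        form one in the ultrapower.\<close>
      have "\<exists>a. a \<in> carrier M \<and> (\<not> sat M (\<lambda>v. e v i) (Forall v \<phi>) \<longrightarrow> \<not> sat M ((\<lambda>w. e w i)(v := a)) \<phi>)" for i
        using a0 by auto
      then obtain f where f: "\<And>i. f i \<in> carrier M"
        "\<And>i. \<not> sat M (\<lambda>v. e v i) (Forall v \<phi>) \<Longrightarrow> \<not> sat M ((\<lambda>w. e w i)(v := f i)) \<phi>" by metis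
      have "eventually (\<lambda>i. sat M ((\<lambda>w. e w i)(v := rep f i)) \<phi>) U" using IH[OF rep_carrier[of f]] f(1) l rep_carrier[of f] by simp
      then have "eventually (\<lambda>_. False) U" using n rep(2)[of f, OF f(1)]
      proof eventually_elim
        case (elim i)
        then show ?case using f(2)[of i] by simp
      qed
      then show False using U_bot by simp
    qed
  next
    assume r: "eventually (\<lambda>i. sat M (\<lambda>v. e v i) (Forall v \<phi>)) U"
    have "sat Ult (e(v := x)) \<phi>" if x: "x \<in> carrier Ult" for x
    proof -
      have "eventually (\<lambda>i. sat M ((\<lambda>w. e w i)(v := x i)) \<phi>) U" using r
        by eventually_elim (use Ult_carrier[OF x] in simp)
      then show ?thesis using IH[OF x] by blast
    qed
    then show "sat Ult e (Forall v \<phi>)" by simp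
  qed
qed

lemma holds_Ult:
  assumes "formula_in L (length xs) \<phi>" "set xs \<subseteq> carrier Ult"
  shows "holds Ult \<phi> xs \<longleftrightarrow> eventually (\<lambda>i. holds M \<phi> (map (\<lambda>x. x i) xs)) U"
proof -
  obtain x0 where x0: "x0 \<in> carrier Ult" using is_structure_Ult by (auto simp: is_structure_def)
  define e where "e = (\<lambda>v. if v < length xs then xs ! v else x0)"
  have e: "e v \<in> carrier Ult" for v using assms(2) x0 nth_mem by (auto simp: e_def)
  have "holds Ult \<phi> xs \<longleftrightarrow> sat Ult e \<phi>"
    unfolding holds_def by (rule sat_cong) (use assms(1) in \<open>auto simp: formula_in_def e_def\<close>)
  moreover have "holds M \<phi> (map (\<lambda>x. x i) xs) \<longleftrightarrow> sat M (\<lambda>v. e v i) \<phi>" for i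
    unfolding holds_def by (rule sat_cong) (use assms(1) in \<open>auto simp: formula_in_def e_def\<close>)
  ultimately show ?thesis using Los[of e \<phi>] e assms(1) by (simp add: formula_in_def)
qed

lemma holds_Ult_sentence: "sentence L \<phi> \<Longrightarrow> holds Ult \<phi> [] \<longleftrightarrow> holds M \<phi> []"
  using holds_Ult[of "[]" \<phi>] U_bot by (simp add: formula_in_def sentence_def)

text \<open>A diagonal argument: coordinate \<open>i\<close> satisfies as long an initial segment of
  the type as it can, among those ending at \<open>i\<close> or before. Each formula is then
  satisfied at almost all coordinates.\<close>

lemma countably_saturated_Ult: "countably_saturated L Ult"
  unfolding countably_saturated_def
proof (intro allI impI, elim conjE)
  fix \<Phi> assume \<Phi>: "countable \<Phi>" "\<Phi> \<subseteq> {(\<phi>, bs). set bs \<subseteq> carrier Ult \<and> formula_in L (Suc (length bs)) \<phi>}"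
    and fin: "\<forall>F\<subseteq>\<Phi>. finite F \<longrightarrow> (\<exists>x\<in>carrier Ult. \<forall>(\<phi>, bs)\<in>F. holds Ult \<phi> (x # bs))"
  obtain x0 where x0: "x0 \<in> carrier Ult" using is_structure_Ult by (auto simp: is_structure_def)
  show "\<exists>x\<in>carrier Ult. \<forall>(\<phi>, bs)\<in>\<Phi>. holds Ult \<phi> (x # bs)"
  proof (cases "\<Phi> = {}")
    case True
    then show ?thesis using x0 by blast
  next
    case False
    define p where "p = from_nat_into \<Phi>"
    have p: "range p = \<Phi>" using \<Phi>(1) False by (simp add: p_def range_from_nat_into)
    have pk: "set (snd (p k)) \<subseteq> carrier Ult" "formula_in L (Suc (length (snd (p k)))) (fst (p k))" for k
      using \<Phi>(2) p by (metis (mono_tags, lifting) case_prodD mem_Collect_eq prod.collapse rangeI subsetD)+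
    define H where "H k i a \<longleftrightarrow> holds M (fst (p k)) (a # map (\<lambda>x. x i) (snd (p k)))" for k i a
    have H: "holds Ult (fst (p k)) (x # snd (p k)) \<longleftrightarrow> eventually (\<lambda>i. H k i (x i)) U" if "x \<in> carrier Ult" for k x
      using holds_Ult[of "x # snd (p k)" "fst (p k)"] pk[of k] that by (simp add: H_def)
    define S where "S n i \<longleftrightarrow> (\<exists>a\<in>carrier M. \<forall>k\<le>n. H k i a)" for n i
    have S: "eventually (S n) U" for n
    proof -
      have "p ` {..n} \<subseteq> \<Phi>" "finite (p ` {..n})" using p by auto
      then obtain x where x: "x \<in> carrier Ult" "\<forall>(\<phi>, bs)\<in>p ` {..n}. holds Ult \<phi> (x # bs)" using fin by blast
      have "eventually (\<lambda>i. \<forall>k\<in>{..n}. H k i (x i)) U"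
      proof (intro eventually_ball_finite ballI)
        fix k assume "k \<in> {..n}"
        then have "p k \<in> p ` {..n}" by blast
        then have "holds Ult (fst (p k)) (x # snd (p k))" using x(2) by (metis case_prodD prod.collapse)
        then show "eventually (\<lambda>i. H k i (x i)) U" using H[OF x(1)] by blast
      qed simp
      then show ?thesis
      proof eventually_elim
        case (elim i)
        then show ?case unfolding S_def using Ult_carrier[OF x(1), of i] by blast
      qed
    qed
    \<comment> \<open>The condition \<open>S n i\<close> becomes stronger as \<open>n\<close> grows,
      so a witness for the largest possible \<open>n\<close> satisfies all smaller ones.\<close>
    have "\<exists>a. a \<in> carrier M \<and> (\<forall>n\<le>i. S n i \<longrightarrow> H n i a)" for i
    proof (cases "{n. n \<le> i \<and> S n i} = {}")
      case True
      then show ?thesis using Ult_carrier[OF x0, of i] by blast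
    next
      case False
      define m where "m = Max {n. n \<le> i \<and> S n i}"
      have f: "finite {n. n \<le> i \<and> S n i}" by simp
      have "S m i" using Max_in[OF f False] by (simp add: m_def)
      then obtain a where "a \<in> carrier M" "\<forall>k\<le>m. H k i a" unfolding S_def by blast
      moreover have "n \<le> i \<Longrightarrow> S n i \<Longrightarrow> n \<le> m" for n using Max_ge[OF f] by (simp add: m_def)
      ultimately show ?thesis by blast
    qed
    then obtain f where f: "\<And>i. f i \<in> carrier M" "\<And>i n. n \<le> i \<Longrightarrow> S n i \<Longrightarrow> H n i (f i)" by metis
    have "holds Ult (fst (p k)) (rep f # snd (p k))" for k
    proof -
      have "eventually (\<lambda>i. H k i (rep f i)) U" using S[of k] U_large[of k] rep(2)[of f, OF f(1)]
        by eventually_elim (use f(2) in simp)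
      then show ?thesis using H[OF rep_carrier[of f]] f(1) by blast
    qed
    then have "\<forall>(\<phi>, bs)\<in>\<Phi>. holds Ult \<phi> (rep f # bs)" using p by (metis (mono_tags, lifting) case_prodI2 fst_conv rangeE snd_conv)
    then show ?thesis using rep_carrier[of f] f(1) by blast
  qed
qed

end

lemma log_structure_ultrapower:
  assumes mod: "model_of L_log M T_log"
  shows "\<exists>N :: (log_fun, log_rel, nat \<Rightarrow> 'm) fo_struct. log_structure N \<and> countably_saturated L_log N \<and>
    (\<forall>\<phi>. sentence L_log \<phi> \<longrightarrow> (holds N \<phi> [] \<longleftrightarrow> holds (M :: (log_fun, log_rel, 'm) fo_struct) \<phi> []))"
proof -
  obtain U :: "nat filter" where U: "\<forall>n. eventually (\<lambda>i. n \<le> i) U" "U \<noteq> bot" "\<forall>P. eventually P U \<or> eventually (\<lambda>i. \<not> P i) U"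
    using ultrafilter_exists by (elim exE conjE) blast
  interpret ultrapower U L_log M
    by unfold_locales (use U mod[unfolded model_of_def] in \<open>blast+\<close>)
  have "model_of L_log Ult T_log"
    unfolding model_of_def
  proof (intro conjI ballI)
    show "holds Ult \<phi> []" if "\<phi> \<in> T_log" for \<phi>
      using holds_Ult_sentence[OF sentence_T_log[OF that]] bspec[OF mod[unfolded model_of_def, THEN conjunct2] that] by blast
  qed (rule is_structure_Ult)
  then have "log_structure Ult" using model_of_T_log_iff[OF is_structure_Ult] by blast
  then show ?thesis using countably_saturated_Ult holds_Ult_sentence by (intro exI[of _ Ult]) blast
qed

section \<open>Elementary equivalence of any two models and completeness\<close>

context log_model
begin

definition succs :: "nat \<Rightarrow> 'm" where
  "succs n = ((\<lambda>x. \<s> x) ^^ Suc n) \<zero>"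

lemma succs: "succs 0 = \<s> \<zero>" "succs (Suc n) = \<s> (succs n)" "succs n \<in> \<Psi>"
proof -
  show s: "succs 0 = \<s> \<zero>" "succs (Suc n) = \<s> (succs n)" for n by (simp_all add: succs_def)
  show "succs n \<in> \<Psi>" by (induction n) (use s Psi_min(2) Psi_Gam in auto)
qed

lemma succs_less_iff: "succs m \<prec> succs n \<longleftrightarrow> m < n"
proof -
  have C: "succs n \<in> carrier M" for n using succs(3) Psi_carrier by blast
  have l: "succs m \<prec> succs (m + Suc k)" for m k
  proof (induction k)
    case 0
    then show ?case using Psi_succ_less[OF succs(3)[of m]] succs(2)[of m] by simp
  next
    case (Suc k)
    have "succs (m + Suc k) \<prec> succs (m + Suc (Suc k))" using Psi_succ_less[OF succs(3)[of "m + Suc k"]] succs(2)[of "m + Suc k"] by simp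
    then show ?case using less_trans[of "succs m" "succs (m + Suc k)" "succs (m + Suc (Suc k))"] Suc C by blast
  qed
  have l': "succs m \<prec> succs n" if "m < n" for m n using l[of m "n - Suc m"] that by simp
  show ?thesis
    using l'[of m n] l'[of n m] less_asym[of "succs m" "succs n"] C less_irrefl[OF C[of n]] by (cases m n rule: linorder_cases) auto
qed

end

text \<open>The substructure generated by \<open>\<zero>\<close> need not be computed. It suffices
  to start from the pair of zeros and the iterated successors of zero, and to extend to all values
  of closed terms.\<close>

lemma (in two_models) atomic_equiv_zero:
  assumes "countably_saturated L_log M" "countably_saturated L_log N"
  shows "atomic_equiv M N (\<lambda>_. \<zero>) (\<lambda>_. \<zero>\<^bsub>N\<^esub>)"
proof -
  define E where "E = {x \<in> \<Gamma>. \<exists>t. wf_tm L_log t \<and> x = eval M (\<lambda>_. \<zero>) t}"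
  have E: "closed_set E" unfolding E_def by (rule closed_set_terms) simp
  have "E \<subseteq> range (eval M (\<lambda>_. \<zero>))" by (auto simp: E_def)
  then have cE: "countable E" by (rule countable_subset) simp
  define T0 where "T0 = range (\<lambda>n. (succs n, N.succs n))"
  have T0: "Psi_iso T0" unfolding Psi_iso_def
  proof (intro conjI allI impI)
    show "T0 \<subseteq> \<Psi> \<times> \<Psi>\<^bsub>N\<^esub>" using succs(3) N.succs(3) by (auto simp: T0_def)
    show "(\<s> \<zero>, \<s>\<^bsub>N\<^esub> \<zero>\<^bsub>N\<^esub>) \<in> T0" unfolding T0_def by (rule range_eqI[of _ _ 0]) (simp add: succs(1) N.succs(1))
    fix x x' assume "(x, x') \<in> T0"
    then obtain m where m: "x = succs m" "x' = N.succs m" by (auto simp: T0_def)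
    show "(\<s> x, \<s>\<^bsub>N\<^esub> x') \<in> T0" unfolding m T0_def by (rule range_eqI[of _ _ "Suc m"]) (simp add: succs(2) N.succs(2))
    show "(\<p> x, \<p>\<^bsub>N\<^esub> x') \<in> T0" if nz: "x \<noteq> \<s> \<zero>"
    proof -
      obtain k where k: "m = Suc k" using nz m succs(1) by (cases m) auto
      show ?thesis unfolding m k T0_def by (rule range_eqI[of _ _ k]) (simp add: succs N.succs)
    qed
    fix y y' assume "(y, y') \<in> T0"
    then obtain n where "y = succs n" "y' = N.succs n" by (auto simp: T0_def)
    then show "x \<prec> y \<longleftrightarrow> x' \<prec>\<^bsub>N\<^esub> y'" using m succs_less_iff N.succs_less_iff by simp
  qed
  have T0E: "Domain T0 \<subseteq> E"
  proof -
    have "succs n \<in> E" for n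
      by (induction n) (use succs closed_setD(2,5)[OF E] in auto)
    then show ?thesis by (auto simp: T0_def)
  qed
  have good: "good T0 {(\<zero>, \<zero>\<^bsub>N\<^esub>)}" unfolding good_def by auto
  have "\<exists>R. {(\<zero>, \<zero>\<^bsub>N\<^esub>)} \<subseteq> R \<and> Domain R = E \<and> log_iso R"
  proof (rule extension[OF assms E cE T0 T0E good])
    show "Domain {(\<zero>, \<zero>\<^bsub>N\<^esub>)} \<subseteq> E" using closed_setD(2)[OF E] by simp
    show "(\<s> x, \<s>\<^bsub>N\<^esub> x') \<in> T0 \<and> (x \<prec> \<s> x \<longleftrightarrow> x' \<prec>\<^bsub>N\<^esub> \<s>\<^bsub>N\<^esub> x')" if "(x, x') \<in> {(\<zero>, \<zero>\<^bsub>N\<^esub>)}" for x x'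
      using that Psi_min(3) N.Psi_min(3) T0 unfolding Psi_iso_def by auto
    \<comment> \<open>The condition is vacuous: \<open>x\<close> is zero, and the successor of an
      element of \<Psi> is never the least element \<open>\<s> \<zero>\<close>.\<close>
    show "(w, w') \<in> {(\<zero>, \<zero>\<^bsub>N\<^esub>)}" if "(x, x') \<in> {(\<zero>, \<zero>\<^bsub>N\<^esub>)}" "(w, w') \<in> T0" "x \<noteq> \<zero> \<and> \<psi> x = \<s> w \<or> \<s> x = \<s> w" for x x' w w'
      using that succ_notmin[of w] Psi_isoD(1)[OF T0 that(2)] by auto
  qed
  then obtain R where R: "(\<zero>, \<zero>\<^bsub>N\<^esub>) \<in> R" "log_iso R" by blast
  show ?thesis by (rule log_iso_atomic_equiv[OF R(2)]) (use R(1) in simp)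
qed

text \<open>Saturated ultrapowers have the same sentences as the given models. There the assignments
  constantly zero are atomically equivalent, and a sentence does not depend on the
  assignment.\<close>

theorem elementarily_equivalent:
  fixes M :: "(log_fun, log_rel, 'm) fo_struct" and N :: "(log_fun, log_rel, 'n) fo_struct"
  assumes "model_of L_log M T_log" "model_of L_log N T_log" "sentence L_log \<phi>"
  shows "holds M \<phi> [] \<longleftrightarrow> holds N \<phi> []"
proof -
  obtain M' :: "(log_fun, log_rel, nat \<Rightarrow> 'm) fo_struct" where M': "log_structure M'" "countably_saturated L_log M'" "\<forall>\<phi>. sentence L_log \<phi> \<longrightarrow> (holds M' \<phi> [] \<longleftrightarrow> holds M \<phi> [])"
    using log_structure_ultrapower[OF assms(1)] by (elim exE conjE) (rule that)
  obtain N' :: "(log_fun, log_rel, nat \<Rightarrow> 'n) fo_struct" where N': "log_structure N'" "countably_saturated L_log N'" "\<forall>\<phi>. sentence L_log \<phi> \<longrightarrow> (holds N' \<phi> [] \<longleftrightarrow> holds N \<phi> [])"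
    using log_structure_ultrapower[OF assms(2)] by (elim exE conjE) (rule that)
  interpret two_models M' N' using M'(1) N'(1) by unfold_locales
  have "sat M' (\<lambda>_. fn M' FZero []) \<phi> \<longleftrightarrow> sat N' (\<lambda>_. fn N' FZero []) \<phi>"
    by (rule quantifier_elimination[OF M'(1,2) N'(1,2) atomic_equiv_zero[OF M'(2) N'(2)]])
      (use assms(3) in \<open>auto simp: sentence_def\<close>)
  moreover have "holds M' \<phi> [] \<longleftrightarrow> sat M' (\<lambda>_. fn M' FZero []) \<phi>" "holds N' \<phi> [] \<longleftrightarrow> sat N' (\<lambda>_. fn N' FZero []) \<phi>"
    unfolding holds_def by (rule sat_cong; use assms(3) in \<open>simp add: sentence_def\<close>)+
  ultimately show ?thesis using M'(3) N'(3) assms(3) by blast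
qed

lemma holds_Neg: "holds M (Neg \<phi>) xs \<longleftrightarrow> \<not> holds M \<phi> xs"
  by (simp add: holds_def)

lemma complete_T_log_if_consistent:
  assumes "consistent L_log T_log"
  shows "complete_theory L_log T_log"
  unfolding complete_theory_def
proof (intro conjI ballI allI impI)
  fix \<phi> assume s: "sentence L_log \<phi>"
  obtain M0 :: "(log_fun, log_rel, log_fm) fo_struct" where M0: "model_of L_log M0 T_log"
    using assms unfolding consistent_def by blast
  have "holds M \<phi> [] \<longleftrightarrow> holds M0 \<phi> []" if "model_of L_log M T_log" for M :: "(log_fun, log_rel, log_fm) fo_struct"
    by (rule elementarily_equivalent[OF that M0 s])
  then show "entails L_log T_log \<phi> \<or> entails L_log T_log (Neg \<phi>)" unfolding entails_def holds_Neg by blast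
qed (use sentence_T_log assms in blast)+

section \<open>A model\<close>

text \<open>The polynomials over the rationals, with \<open>monom 1 n\<close> in the role of \<open>e\<^sub>n\<close>, form the subgroup of
  \<open>\<Gamma>_log\<close> with rational coordinates; \<open>None\<close> is \<open>\<infinity>\<close>.\<close>

definition pos :: "rat poly \<Rightarrow> bool" where
  "pos p \<longleftrightarrow> (\<exists>i. 0 < coeff p i \<and> (\<forall>j<i. coeff p j = 0))"

definition low :: "rat poly \<Rightarrow> nat" where
  "low p = (LEAST i. coeff p i \<noteq> 0)"

text \<open>The vector \<open>(1, ..., 1, 0, ...)\<close> with \<open>k + 1\<close> ones, which is
  the value under \<psi> of any element with first nonzero coordinate \<open>k\<close>.\<close>

definition ones :: "nat \<Rightarrow> rat poly" where
  "ones k = (\<Sum>i\<le>k. monom 1 i)"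

lemma coeff_ones [simp]: "coeff (ones k) i = (if i \<le> k then 1 else 0)"
  by (simp add: ones_def coeff_sum)

lemma low: assumes "p \<noteq> 0" shows "coeff p (low p) \<noteq> 0" "j < low p \<Longrightarrow> coeff p j = 0"
proof -
  have "\<exists>i. coeff p i \<noteq> 0" using assms by (simp add: poly_eq_iff)
  then show "coeff p (low p) \<noteq> 0" unfolding low_def by (rule LeastI_ex)
  show "j < low p \<Longrightarrow> coeff p j = 0" using not_less_Least unfolding low_def by blast
qed

lemma low_eqI: assumes "coeff p i \<noteq> 0" "\<And>j. j < i \<Longrightarrow> coeff p j = 0" shows "low p = i"
  unfolding low_def by (rule Least_equality) (use assms not_le in blast)+

lemma pos_iff: "pos p \<longleftrightarrow> p \<noteq> 0 \<and> 0 < coeff p (low p)"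
proof
  assume "pos p"
  then obtain i where i: "0 < coeff p i" "\<forall>j<i. coeff p j = 0" unfolding pos_def by blast
  then have "low p = i" by (intro low_eqI) auto
  then show "p \<noteq> 0 \<and> 0 < coeff p (low p)" using i by auto
qed (use low in \<open>auto simp: pos_def\<close>)

lemma pos_not_neg: "pos p \<Longrightarrow> \<not> pos (- p)"
proof -
  have "low (- p) = low p" by (simp add: low_def)
  then show "pos p \<Longrightarrow> \<not> pos (- p)" by (simp add: pos_iff)
qed

lemma pos_cases: "p = 0 \<or> pos p \<or> pos (- p)"
proof -
  have "low (- p) = low p" by (simp add: low_def)
  then show ?thesis using low(1)[of p] by (auto simp: pos_iff not_less_iff_gr_or_eq linorder_neq_iff)
qed

lemma pos_add: assumes "pos p" "pos q" shows "pos (p + q)"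
proof -
  obtain i k where i: "0 < coeff p i" "\<forall>j<i. coeff p j = 0" and k: "0 < coeff q k" "\<forall>j<k. coeff q j = 0"
    using assms unfolding pos_def by blast
  have "0 < coeff (p + q) (min i k)" using i k by (cases i k rule: linorder_cases) (auto simp: min_def)
  moreover have "\<forall>j<min i k. coeff (p + q) j = 0" using i k by auto
  ultimately show ?thesis unfolding pos_def by blast
qed

lemma not_pos_zero [simp]: "\<not> pos 0" by (simp add: pos_def)

lemma pos_ones_diff: "pos (ones l - ones k) \<longleftrightarrow> k < l"
proof -
  have *: "pos (ones l - ones k)" if "k < l" for k l
    unfolding pos_def by (rule exI[of _ "Suc k"]) (use that in auto)
  show ?thesis using *[of k l] *[of l k] pos_not_neg[of "ones k - ones l"] by (cases k l rule: linorder_cases) auto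
qed

lemma ones_eq [simp]: "ones k = ones l \<longleftrightarrow> k = l"
  using pos_ones_diff[of k l] pos_ones_diff[of l k] by (cases k l rule: linorder_cases) auto

lemma low_monom [simp]: "low (monom 1 k) = k"
  by (rule low_eqI) auto

lemma low_smult: "c \<noteq> 0 \<Longrightarrow> low (smult c p) = low p"
  by (simp add: low_def)

definition oadd :: "rat poly option \<Rightarrow> rat poly option \<Rightarrow> rat poly option" where
  "oadd x y = (case x of None \<Rightarrow> None | Some p \<Rightarrow> map_option (\<lambda>q. p + q) y)"

definition oless :: "rat poly option \<Rightarrow> rat poly option \<Rightarrow> bool" where
  "oless x y = (case x of None \<Rightarrow> False | Some p \<Rightarrow> (case y of None \<Rightarrow> True | Some q \<Rightarrow> pos (q - p)))"

definition opsi :: "rat poly option \<Rightarrow> rat poly option" where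
  "opsi x = (case x of None \<Rightarrow> None | Some p \<Rightarrow> if p = 0 then None else Some (ones (low p)))"

abbreviation "osucc \<equiv> asymptotic_couple.succ (range Some) oadd (Some 0) opsi"

abbreviation "oPsi_above \<equiv> asymptotic_couple.Psi_above (range Some) oadd (Some 0) oless opsi"

abbreviation "opred \<equiv> asymptotic_couple.pred (range Some) oadd (Some 0) opsi"

lemma o_simps [simp]: "oadd (Some p) (Some q) = Some (p + q)" "oadd x None = None" "oadd None y = None"
  "oless (Some p) (Some q) = pos (q - p)" "oless (Some p) None" "\<not> oless None y"
  "p \<noteq> 0 \<Longrightarrow> opsi (Some p) = Some (ones (low p))" "opsi (Some 0) = None" "opsi None = None"
  by (simp_all add: oadd_def oless_def opsi_def split: option.split)

lemma ordered_abelian_group_poly: "ordered_abelian_group (range Some) oadd (Some 0) (map_option uminus) oless"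
proof
  show "oless x z" if "x \<in> range Some" "y \<in> range Some" "z \<in> range Some" "oless x y" "oless y z" for x y z
    using that pos_add by (fastforce simp: algebra_simps)
  show "oless x y \<or> x = y \<or> oless y x" if xy: "x \<in> range Some" "y \<in> range Some" for x y
  proof -
    obtain p q where "x = Some p" "y = Some q" using xy by auto
    then show ?thesis using pos_cases[of "p - q"] by auto
  qed
qed (auto simp: algebra_simps)

lemma nat_mult_poly: "ordered_abelian_group.nat_mult oadd (Some 0) n (Some p) = Some (smult (of_nat n) p)"
proof -
  interpret ordered_abelian_group "range Some" oadd "Some 0" "map_option uminus" oless
    by (rule ordered_abelian_group_poly)
  show ?thesis by (induction n) (simp_all add: smult_add_left)
qed

lemma asymptotic_couple_poly: "asymptotic_couple (range Some) oadd (Some 0) (map_option uminus) oless opsi"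
proof -
  interpret ordered_abelian_group "range Some" oadd "Some 0" "map_option uminus" oless
    by (rule ordered_abelian_group_poly)
  have nz: "x \<in> nonzero \<longleftrightarrow> (\<exists>p. p \<noteq> 0 \<and> x = Some p)" for x by (auto simp: nonzero_def)
  have le: "le (Some (ones k)) (Some (ones l)) \<longleftrightarrow> k \<le> l" for k l by (auto simp: le_def pos_ones_diff)
  show ?thesis
  proof
    show "opsi \<alpha> \<in> range Some" if "\<alpha> \<in> nonzero" for \<alpha> using that nz by auto
    show "le (opsi \<alpha>) (opsi (oadd \<alpha> \<beta>)) \<or> le (opsi \<beta>) (opsi (oadd \<alpha> \<beta>))"
      if ab: "\<alpha> \<in> nonzero" "\<beta> \<in> nonzero" "oadd \<alpha> \<beta> \<noteq> Some 0" for \<alpha> \<beta>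
    proof -
      obtain p q where pq: "\<alpha> = Some p" "\<beta> = Some q" "p \<noteq> 0" "q \<noteq> 0" using ab nz by auto
      then have n: "p + q \<noteq> 0" using ab(3) by simp
      have "low p \<le> low (p + q) \<or> low q \<le> low (p + q)"
        using low(1)[OF n] low(2)[OF pq(3), of "low (p + q)"] low(2)[OF pq(4), of "low (p + q)"] by (auto simp: not_less[symmetric])
      then show ?thesis using pq n le by simp
    qed
    show "opsi (int_mult k \<alpha>) = opsi \<alpha>" if k: "\<alpha> \<in> nonzero" "k \<noteq> 0" for \<alpha> k
    proof -
      obtain p where p: "\<alpha> = Some p" "p \<noteq> 0" using k(1) nz by auto
      then have "int_mult k \<alpha> = Some (smult (of_int k) p)" by (simp add: int_mult_def nat_mult_poly)
      then show ?thesis using p k(2) by (simp add: low_smult)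
    qed
    show "oless (opsi \<beta>) (oadd \<alpha> (opsi \<alpha>))" if ab: "\<alpha> \<in> nonzero" "\<beta> \<in> nonzero" "oless (Some 0) \<alpha>" for \<alpha> \<beta>
    proof -
      obtain p q where pq: "\<alpha> = Some p" "\<beta> = Some q" "p \<noteq> 0" "q \<noteq> 0" using ab nz by auto
      have p: "0 < coeff p (low p)" using ab(3) pq by (simp add: pos_iff)
      have "pos (p + ones (low p) - ones (low q))"
        unfolding pos_def
      \<comment> \<open>Up to the smaller of the two lowest degrees the sums of ones agree. If
        \<open>q\<close> starts earlier, the first difference is the next coordinate of
        \<open>ones (low p)\<close>; otherwise it is the positive leading coefficient of
        \<open>p\<close>.\<close>
      proof (rule exI[of _ "if low q < low p then Suc (low q) else low p"])
        show "0 < coeff (p + ones (low p) - ones (low q)) (if low q < low p then Suc (low q) else low p) \<and>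
          (\<forall>j<if low q < low p then Suc (low q) else low p. coeff (p + ones (low p) - ones (low q)) j = 0)"
          using p low(2)[OF pq(3)] by (cases "Suc (low q) = low p") auto
      qed
      then show ?thesis using pq by simp
    qed
  qed
qed

text \<open>Let \<open>k\<close> be the first coordinate of \<open>q\<close> different from 1.
  Subtracting \<open>ones k\<close> clears exactly the coordinates before \<open>k\<close>, so the
  difference is the integral of \<open>q\<close>, of lowest degree \<open>k\<close>.\<close>

lemma integral_poly: "\<exists>p k. p \<noteq> 0 \<and> k = low p \<and> q = p + ones k \<and> coeff q k \<noteq> 1 \<and> (\<forall>i<k. coeff q i = 1)"
proof -
  define k where "k = (LEAST i. coeff q i \<noteq> 1)"
  \<comment> \<open>Coefficients beyond the degree vanish, so such a coordinate exists.\<close>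
  have "coeff q (Suc (degree q)) \<noteq> 1" by (simp add: coeff_eq_0)
  then have k: "coeff q k \<noteq> 1" unfolding k_def by (rule LeastI)
  have k': "coeff q i = 1" if "i < k" for i using not_less_Least[of i] that unfolding k_def by blast
  have "low (q - ones k) = k" by (rule low_eqI) (use k k' in auto)
  moreover have "q - ones k \<noteq> 0" using k by (metis coeff_diff coeff_ones diff_self eq_iff_diff_eq_0 order_refl coeff_0)
  ultimately show ?thesis using k k' by (intro exI[of _ "q - ones k"] exI[of _ k]) auto
qed

lemma log_couple_poly: "log_couple (range Some) oadd (Some 0) (map_option uminus) oless opsi"
proof -
  interpret asymptotic_couple "range Some" oadd "Some 0" "map_option uminus" oless opsi
    by (rule asymptotic_couple_poly)
  have nz: "x \<in> nonzero \<longleftrightarrow> (\<exists>p. p \<noteq> 0 \<and> x = Some p)" for x by (auto simp: nonzero_def)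
  have le: "le (Some (ones k)) (Some (ones l)) \<longleftrightarrow> k \<le> l" for k l by (auto simp: le_def pos_ones_diff)
  have int: "\<exists>\<alpha> k. \<alpha> \<in> nonzero \<and> deriv \<alpha> = Some q \<and> opsi \<alpha> = Some (ones k) \<and> coeff q k \<noteq> 1 \<and> (\<forall>i<k. coeff q i = 1)" for q
  proof -
    obtain p k where "p \<noteq> 0" "k = low p" "q = p + ones k" "coeff q k \<noteq> 1" "\<forall>i<k. coeff q i = 1"
      using integral_poly[of q] by blast
    then show ?thesis by (intro exI[of _ "Some p"] exI[of _ k]) (auto simp: nz deriv_def)
  qed
  have succ: "succ (Some q) = Some (ones k)" if q: "coeff q k \<noteq> 1" "\<forall>i<k. coeff q i = 1" for q k
  proof -
    obtain \<alpha> l where l: "\<alpha> \<in> nonzero" "deriv \<alpha> = Some q" "opsi \<alpha> = Some (ones l)" "coeff q l \<noteq> 1" "\<forall>i<l. coeff q i = 1"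
      using int[of q] by blast
    have "l = k" using q l by (cases l k rule: linorder_cases) auto
    then show ?thesis using succ_deriv[OF l(1)] l by simp
  qed
  have s0: "succ (Some 0) = Some (ones 0)" by (rule succ) auto
  have ss: "succ (Some (ones k)) = Some (ones (Suc k))" for k by (rule succ) auto
  have Psi: "Psi = range (\<lambda>k. Some (ones k))"
  proof
    show "Psi \<subseteq> range (\<lambda>k. Some (ones k))" using nz by (auto simp: Psi_def)
    show "range (\<lambda>k. Some (ones k)) \<subseteq> Psi"
    proof
      fix x assume "x \<in> range (\<lambda>k. Some (ones k))"
      then obtain k where "x = Some (ones k)" by blast
      then have "x = opsi (Some (monom 1 k))" "Some (monom 1 k) \<in> nonzero" using nz by auto
      then show "x \<in> Psi" unfolding Psi_def by blast
    qed
  qed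
  have above: "Psi_above = range (\<lambda>k. Some (ones (Suc k)))"
    unfolding Psi_above_def Psi s0 by (auto simp: pos_ones_diff image_iff gr0_conv_Suc)
  show ?thesis
  proof
    show divisible unfolding divisible_def
    proof (intro ballI allI impI)
      fix x :: "rat poly option" and n assume x: "x \<in> range Some" "1 \<le> (n :: nat)"
      then obtain p where "x = Some p" by blast
      then show "\<exists>y\<in>range Some. nat_mult n y = x"
        using x(2) by (intro bexI[of _ "Some (smult (1 / of_nat n) p)"]) (auto simp: nat_mult_poly)
    qed
    show H_type unfolding H_type_def
    proof (intro ballI impI, elim conjE)
      fix \<alpha> \<beta> assume a: "\<alpha> \<in> range Some" "\<beta> \<in> range Some" "oless (Some 0) \<alpha>" "le \<alpha> \<beta>"
      then obtain p q where pq: "\<alpha> = Some p" "\<beta> = Some q" by blast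
      have p: "pos p" using a pq by simp
      have qp: "q = p \<or> pos (q - p)" using a pq by (auto simp: le_def)
      then have "pos q" using p pos_add[of p "q - p"] by auto
      then have n: "p \<noteq> 0" "q \<noteq> 0" using p by auto
      have "\<not> low p < low q"
      proof
        assume l: "low p < low q"
        then have "pos (p - q)" unfolding pos_def
          using p n low(2)[of q] low(2)[of p] by (intro exI[of _ "low p"]) (auto simp: pos_iff)
        then show False using qp pos_not_neg[of "p - q"] l by auto
      qed
      then show "le (opsi \<beta>) (opsi \<alpha>)" using pq n le by simp
    qed
    show asymptotic_integration unfolding asymptotic_integration_def using int by blast
    show "succ (Some 0) \<in> Psi" unfolding s0 Psi by blast
    show "le (succ (Some 0)) \<beta>" if "\<beta> \<in> Psi" for \<beta> using that le[of 0] unfolding s0 Psi by auto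
    show "oless (Some 0) (succ (Some 0))" unfolding s0 by (simp add: pos_def)
    show "succ \<alpha> \<in> Psi" "oless \<alpha> (succ \<alpha>)" if "\<alpha> \<in> Psi" for \<alpha>
      using that ss unfolding Psi by (auto simp: pos_ones_diff)
    show "\<not> (oless \<alpha> \<beta> \<and> oless \<beta> (succ \<alpha>))" if "\<alpha> \<in> Psi" "\<beta> \<in> Psi" for \<alpha> \<beta>
      using that ss unfolding Psi by (auto simp: pos_ones_diff)
    have "inj_on succ Psi" unfolding Psi by (auto simp: inj_on_def ss)
    moreover have "succ ` Psi = Psi_above" unfolding Psi above by (simp add: image_image ss)
    ultimately show "bij_betw succ Psi Psi_above" by (simp add: bij_betw_def)
  qed
qed

fun poly_fn :: "log_fun \<Rightarrow> rat poly option list \<Rightarrow> rat poly option" where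
  "poly_fn FZero _ = Some 0"
| "poly_fn FInf _ = None"
| "poly_fn FPlus xs = oadd (xs ! 0) (xs ! 1)"
| "poly_fn FNeg xs = map_option uminus (xs ! 0)"
| "poly_fn FPsi xs = opsi (xs ! 0)"
| "poly_fn FSucc xs = (if xs ! 0 = None then None else osucc (xs ! 0))"
| "poly_fn FPred xs = (if xs ! 0 \<in> oPsi_above then opred (xs ! 0) else None)"
| "poly_fn (FDelta n) xs = map_option (smult (1 / of_nat (Suc n))) (xs ! 0)"

definition poly_model :: "(log_fun, log_rel, rat poly option) fo_struct" where
  "poly_model = \<lparr>carrier = UNIV, fn = poly_fn, rel = (\<lambda>_ xs. oless (xs ! 0) (xs ! 1))\<rparr>"

lemma log_structure_poly: "log_structure poly_model"
proof -
  have G: "UNIV - {None :: rat poly option} = range Some" by (auto simp: image_iff)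
  show ?thesis
    unfolding log_structure_def Let_def
    using log_couple_poly
    by (auto simp: poly_model_def G nat_mult_poly simp del: ordered_abelian_group.nat_mult.simps of_nat_Suc)
qed

text \<open>\<open>consistent\<close> asks for a model made of formulas; a model on any type with an
  injection into the formulas can be copied there.\<close>

lemma model_image:
  assumes h: "inj h" and M: "carrier M = UNIV" and mod: "model_of L M T" and T: "\<And>\<phi>. \<phi> \<in> T \<Longrightarrow> sentence L \<phi>"
  shows "model_of L \<lparr>carrier = range h, fn = (\<lambda>f xs. h (fn M f (map (inv h) xs))), rel = (\<lambda>r xs. rel M r (map (inv h) xs))\<rparr> T"
    (is "model_of L ?N T")
proof -
  have ev: "eval ?N (\<lambda>v. h (e v)) t = h (eval M e t)" for e t
  proof (induction t)
    case (Fn f ts)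
    then have "map (\<lambda>t. inv h (eval ?N (\<lambda>v. h (e v)) t)) ts = map (eval M e) ts" using h by simp
    then show ?case by (simp add: comp_def del: map_eq_conv)
  qed simp
  have sat: "sat ?N (\<lambda>v. h (e v)) \<phi> \<longleftrightarrow> sat M e \<phi>" for e \<phi>
  proof (induction \<phi> arbitrary: e)
    case (Eq t u) then show ?case using h by (simp add: ev inj_eq)
  next
    case (Rel r ts) then show ?case using h by (simp add: comp_def ev)
  next
    case (Forall v \<phi>)
    have upd: "(\<lambda>w. h (e w))(v := h a) = (\<lambda>w. h ((e(v := a)) w))" for a by auto
    have "sat ?N ((\<lambda>w. h (e w))(v := h a)) \<phi> \<longleftrightarrow> sat M (e(v := a)) \<phi>" for a
      unfolding upd by (rule Forall.IH)
    then show ?case using M by simp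
  qed simp_all
  have "holds ?N \<phi> []" if "\<phi> \<in> T" for \<phi>
  proof -
    have "free_vars \<phi> = {}" using T[OF that] by (simp add: sentence_def)
    \<comment> \<open>Evaluating the empty list gives unspecified elements, perhaps outside the
      carrier; for a sentence they may be replaced by images under \<open>h\<close>.\<close>
    then have "sat ?N (\<lambda>v. [] ! v) \<phi> \<longleftrightarrow> sat ?N (\<lambda>v. h ([] ! v)) \<phi>" by (intro sat_cong) simp
    then show ?thesis using sat[of "\<lambda>v. [] ! v" \<phi>] mod that by (simp add: holds_def model_of_def)
  qed
  moreover have "is_structure L ?N" by (simp add: is_structure_def)
  ultimately show ?thesis by (simp add: model_of_def)
qed

lemma consistent_T_log: "consistent L_log T_log"
proof -
  have "is_structure L_log poly_model" by (simp add: is_structure_def poly_model_def)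
  then have m: "model_of L_log poly_model T_log" using model_of_T_log_iff log_structure_poly by blast
  \<comment> \<open>A polynomial is coded by its coefficient list as a natural number, and that
    number becomes a variable in an equation.\<close>
  define h :: "rat poly option \<Rightarrow> log_fm" where "h x = Eq (Var (to_nat (map_option coeffs x))) (Var 0)" for x
  have "inj (map_option coeffs :: rat poly option \<Rightarrow> _)" by (intro option.inj_map) (simp add: inj_def coeffs_eq_iff)
  then have "inj h" by (simp add: h_def inj_def)
  moreover have "carrier poly_model = UNIV" by (simp add: poly_model_def)
  ultimately show ?thesis unfolding consistent_def by (intro exI) (rule model_image[OF _ _ m sentence_T_log])
qed

theorem theorem1p1:
  shows "complete_theory L_log T_log \<and> distal L_log T_log TYPE('m) TYPE('i::linorder)"
  using complete_T_log_if_consistent[OF consistent_T_log] distal_T_log by blast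

end
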